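(* Let $a,b\ge0$ be fixed real numbers, not both zero, and consider the two-community stochastic block model with parameters $a,b$ and side information generated according to any non-trivial symmetric distribution $\mu_s\neq\delta_0$ on $(-\infty,+\infty]$. For $t\in\mathbb{N}_+$ let $\hat X^{(t)}_{\mathrm{BP}}$ be any estimator that runs $t$-local belief propagation with parameter $\delta=\frac{b}{a+b}$. Then $$\lim_{t\to\infty}\lim_{n\to\infty}p_n\big(\hat X^{(t)}_{\mathrm{BP}}\big)=\lim_{n\to\infty}p_n^*,$$ where $p_n^*=\sup_{\hat X}p_n(\hat X)$ is the optimal estimation accuracy over all estimators based on the graph and the side information.
   Context: Stochastic block model: vertices $\mathcal{V}=\{v_1,\dots,v_n\}$ ($n$ large enough that $a/n,b/n\le1$), labels $(X_v)_{v\in\mathcal V}$ i.i.d. $\mathrm{Ber}(1/2)$. Given the labels, the random simple graph $G$ has independent edges; the pair $v_i\ne v_j$ is joined with probability $a/n$ if $X_{v_i}=X_{v_j}$ and with probability $b/n$ otherwise. A probability distribution $\mu$ on $(-\infty,+\infty]$ is symmetric if $\mu[E]=\int e^{-r}\mathbf{1}\{-r\in E\}\,d\mu(r)$ for every measurable $E\subseteq(-\infty,+\infty)$; $\delta_0$ is the unit mass at $0$ (trivial distribution). Side information: each label $X_v$ is observed through an identical binary memoryless symmetric channel with LLR distribution $\mu_s$; equivalently, for each $v$ one observes a variable $S_v\in[-\infty,+\infty]$ such that, given the labels, the $S_v$ are independent of each other and of $G$, and $(-1)^{X_v}S_v\sim\mu_s$. Accuracy of an estimator $\hat X=(\hat X_v)_{v}\in\{0,1\}^{\mathcal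 V}$ (a function of $G$ and the side information): $p_n(\hat X)=\frac1n\sum_{v\in\mathcal V}\mathbb{P}[X_v=\hat X_v]$. $t$-local belief propagation with parameter $\delta$: for each $v$ consider the subgraph $N_t(v)$ induced by the vertices at distance less than $t$ from $v$, together with the side information on it. If $N_t(v)$ is a tree, root it at $v$ and recursively set $\lambda_u=S_u+\sum_{w\text{ child of }u}F_\delta(\lambda_w)$ with $F_\delta(x)=\ln\frac{(1-\delta)e^x+\delta}{\delta e^x+1-\delta}$; output $\hat X_v=0$ if $\lambda_v>0$ and $\hat X_v=1$ if $\lambda_v<0$. Ties, and the case where $N_t(v)$ is not a tree, are handled by an arbitrary rule based only on this local information (and possibly independent randomness). *)

theory Defs
  imports "HOL-Probability.Probability"
begin

section \<open>The block model with side information\<close>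

text \<open>
  The vertices are \<open>0, \<dots>, n - 1\<close>, and a label is \<open>True\<close> (for 1) or \<open>False\<close> (for 0). A simple
  graph on the vertices is given by the indicators \<open>g (i, j)\<close>, \<open>i < j < n\<close>, of its edges. An
  observation consists of a graph and of the side information of the vertices.
\<close>

type_synonym labelling = "nat \<Rightarrow> bool"
type_synonym observation = "(nat \<times> nat \<Rightarrow> bool) \<times> (nat \<Rightarrow> ereal)"

definition vertex_pairs :: "nat \<Rightarrow> (nat \<times> nat) set" where
  "vertex_pairs n = {(i, j). i < j \<and> j < n}"

definition label_measure :: "nat \<Rightarrow> labelling measure" where
  "label_measure n = (\<Pi>\<^sub>M v\<in>{..<n}. measure_pmf (bernoulli_pmf (1 / 2)))"

text \<open>
  Note that \<open>bernoulli_pmf p\<close> truncates \<open>p\<close> to the unit interval, which only affects the finitely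
  many \<open>n\<close> with \<open>n < max a b\<close>.
\<close>

definition graph_measure :: "nat \<Rightarrow> real \<Rightarrow> real \<Rightarrow> labelling \<Rightarrow> (nat \<times> nat \<Rightarrow> bool) measure" where
  "graph_measure n a b x =
     (\<Pi>\<^sub>M e\<in>vertex_pairs n. measure_pmf (bernoulli_pmf (if x (fst e) = x (snd e) then a / n else b / n)))"

text \<open>The law of \<open>S\<close> given that the label is \<open>y\<close>, that is, the law for which \<open>(- 1)\<^sup>y * S\<close> has law \<open>\<mu>\<close>.\<close>

definition channel :: "ereal measure \<Rightarrow> bool \<Rightarrow> ereal measure" where
  "channel \<mu> y = (if y then distr \<mu> borel uminus else \<mu>)"

definition side_measure :: "nat \<Rightarrow> ereal measure \<Rightarrow> labelling \<Rightarrow> (nat \<Rightarrow> ereal) measure" where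
  "side_measure n \<mu> x = (\<Pi>\<^sub>M v\<in>{..<n}. channel \<mu> (x v))"

definition observation_space :: "nat \<Rightarrow> observation measure" where
  "observation_space n =
     (\<Pi>\<^sub>M e\<in>vertex_pairs n. count_space UNIV) \<Otimes>\<^sub>M (\<Pi>\<^sub>M v\<in>{..<n}. borel)"

definition sbm_kernel ::
    "nat \<Rightarrow> real \<Rightarrow> real \<Rightarrow> ereal measure \<Rightarrow> labelling \<Rightarrow> (labelling \<times> observation) measure" where
  "sbm_kernel n a b \<mu> x = distr (graph_measure n a b x \<Otimes>\<^sub>M side_measure n \<mu> x)
     (label_measure n \<Otimes>\<^sub>M observation_space n) (\<lambda>obs. (x, obs))"

definition sbm :: "nat \<Rightarrow> real \<Rightarrow> real \<Rightarrow> ereal measure \<Rightarrow> (labelling \<times> observation) measure" where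
  "sbm n a b \<mu> = label_measure n \<bind> sbm_kernel n a b \<mu>"

lemma prob_space_channel: "prob_space \<mu> \<Longrightarrow> sets \<mu> = sets borel \<Longrightarrow> prob_space (channel \<mu> y)"
  unfolding channel_def by (auto intro!: prob_space.prob_space_distr)

lemma finite_vertex_pairs: "finite (vertex_pairs n)"
  by (rule finite_subset[of _ "{..<n} \<times> {..<n}"]) (auto simp: vertex_pairs_def)

lemma sets_labels: "sets (label_measure n) = Pow ({..<n} \<rightarrow>\<^sub>E UNIV)"
proof -
  have "sets (label_measure n) = sets (\<Pi>\<^sub>M v\<in>{..<n}. count_space (UNIV::bool set))"
    unfolding label_measure_def by (intro sets_PiM_cong) auto
  also have "\<dots> = sets (count_space ({..<n} \<rightarrow>\<^sub>E UNIV))"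
    by (subst count_space_PiM_finite) auto
  finally show ?thesis by simp
qed

lemma sets_obs:
  assumes "sets \<mu> = sets borel"
  shows "sets (graph_measure n a b x \<Otimes>\<^sub>M side_measure n \<mu> x) = sets (observation_space n)"
  unfolding observation_space_def graph_measure_def side_measure_def
  using assms by (intro sets_pair_measure_cong sets_PiM_cong) (auto simp: channel_def)

lemma prob_space_label_measure: "prob_space (label_measure n)"
  unfolding label_measure_def by (intro prob_space_PiM prob_space_measure_pmf)

lemma space_label_measure: "space (label_measure n) = {..<n} \<rightarrow>\<^sub>E UNIV"
  by (simp add: label_measure_def space_PiM)

lemma Pair_measurable_label:
  assumes "x \<in> space (label_measure n)" and "sets \<mu> = sets borel"
  shows "(\<lambda>obs. (x, obs)) \<in> graph_measure n a b x \<Otimes>\<^sub>M side_measure n \<mu> x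
           \<rightarrow>\<^sub>M label_measure n \<Otimes>\<^sub>M observation_space n"
  unfolding measurable_cong_sets[OF sets_obs[OF assms(2)] refl] using assms(1) by simp

lemma prob_space_sbm_kernel:
  assumes "prob_space \<mu>" and "sets \<mu> = sets borel" and "x \<in> space (label_measure n)"
  shows "prob_space (sbm_kernel n a b \<mu> x)"
proof -
  interpret G: prob_space "graph_measure n a b x"
    unfolding graph_measure_def by (intro prob_space_PiM prob_space_measure_pmf)
  interpret S: prob_space "side_measure n \<mu> x"
    unfolding side_measure_def by (intro prob_space_PiM prob_space_channel assms)
  interpret P: pair_prob_space "graph_measure n a b x" "side_measure n \<mu> x" ..
  show ?thesis
    unfolding sbm_kernel_def by (rule P.prob_space_distr[OF Pair_measurable_label[OF assms(3,2)]])
qed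

lemma measurable_sbm_kernel:
  assumes "prob_space \<mu>" and "sets \<mu> = sets borel"
  shows "sbm_kernel n a b \<mu> \<in> measurable (label_measure n)
           (subprob_algebra (label_measure n \<Otimes>\<^sub>M observation_space n))"
proof -
  have "sbm_kernel n a b \<mu> \<in> measurable (count_space (space (label_measure n)))
          (subprob_algebra (label_measure n \<Otimes>\<^sub>M observation_space n))"
    using prob_space_sbm_kernel[OF assms, of _ n a b]
    by (auto simp: space_subprob_algebra sbm_kernel_def intro: prob_space_imp_subprob_space)
  moreover have "sets (label_measure n) = sets (count_space (space (label_measure n)))"
    by (simp add: sets_labels space_label_measure)
  ultimately show ?thesis
    using measurable_cong_sets by blast
qed

lemma sets_sbm:
  "sets (sbm n a b \<mu>) = sets (label_measure n \<Otimes>\<^sub>M observation_space n)"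
  unfolding sbm_def
  by (rule sets_bind[OF _ prob_space.not_empty[OF prob_space_label_measure]]) (simp add: sbm_kernel_def)

lemma prob_space_sbm:
  assumes "prob_space \<mu>" and "sets \<mu> = sets borel"
  shows "prob_space (sbm n a b \<mu>)"
  unfolding sbm_def
  by (rule prob_space.prob_space_bind[OF prob_space_label_measure _ measurable_sbm_kernel[OF assms]])
     (simp add: prob_space_sbm_kernel[OF assms])

lemma emeasure_sbm:
  assumes "prob_space \<mu>" and "sets \<mu> = sets borel"
    and x: "x \<in> {..<n} \<rightarrow>\<^sub>E UNIV" and B: "B \<in> sets (observation_space n)"
  shows "emeasure (sbm n a b \<mu>) ({x} \<times> B) =
    ennreal (1 / 2 ^ n) * emeasure (graph_measure n a b x \<Otimes>\<^sub>M side_measure n \<mu> x) B"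
proof -
  let ?P = "graph_measure n a b x \<Otimes>\<^sub>M side_measure n \<mu> x"
  have xs: "x \<in> space (label_measure n)" and sx: "{x} \<in> sets (label_measure n)"
    using x by (auto simp: space_label_measure sets_labels)
  have XB: "{x} \<times> B \<in> sets (label_measure n \<Otimes>\<^sub>M observation_space n)"
    using sx B by simp
  have sp: "B \<subseteq> space ?P"
    using sets.sets_into_space[OF B] sets_eq_imp_space_eq[OF sets_obs[OF assms(2), of n a b x]] by simp
  have *: "emeasure (sbm_kernel n a b \<mu> y) ({x} \<times> B) = emeasure ?P B * indicator {x} y"
    if y: "y \<in> space (label_measure n)" for y
  proof -
    have "(\<lambda>obs. (y, obs)) -` ({x} \<times> B) \<inter> space (graph_measure n a b y \<Otimes>\<^sub>M side_measure n \<mu> y) =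
        (if y = x then B else {})"
      using sp by auto
    then show ?thesis
      unfolding sbm_kernel_def
      by (subst emeasure_distr[OF Pair_measurable_label[OF y assms(2)] XB]) auto
  qed
  have "emeasure (sbm n a b \<mu>) ({x} \<times> B) =
      (\<integral>\<^sup>+ y. emeasure (sbm_kernel n a b \<mu> y) ({x} \<times> B) \<partial>label_measure n)"
    unfolding sbm_def
    by (rule emeasure_bind[OF prob_space.not_empty[OF prob_space_label_measure]
          measurable_sbm_kernel[OF assms(1,2)] XB])
  also have "\<dots> = (\<integral>\<^sup>+ y. emeasure ?P B * indicator {x} y \<partial>label_measure n)"
    by (intro nn_integral_cong *)
  also have "\<dots> = emeasure ?P B * emeasure (label_measure n) {x}"
    using sx by (simp add: nn_integral_cmult_indicator)
  also have "emeasure (label_measure n) {x} = ennreal (1 / 2 ^ n)"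
  proof -
    interpret product_prob_space "\<lambda>_. measure_pmf (bernoulli_pmf (1 / 2))" "{..<n}"
      by unfold_locales
    have "{x} = (\<Pi>\<^sub>E v\<in>{..<n}. {x v})"
      using x PiE_singleton[of x "{..<n}"] unfolding PiE_def by blast
    then have "emeasure (label_measure n) {x} =
        (\<Prod>v<n. emeasure (measure_pmf (bernoulli_pmf (1 / 2))) {x v})"
      unfolding label_measure_def using emeasure_PiM[of "{..<n}" "\<lambda>v. {x v}"] by simp
    also have "\<dots> = (\<Prod>v<n. ennreal (1 / 2))"
    proof (rule prod.cong[OF refl])
      fix v
      show "emeasure (measure_pmf (bernoulli_pmf (1 / 2))) {x v} = ennreal (1 / 2)"
        by (cases "x v") (simp_all add: emeasure_pmf_single)
    qed
    also have "\<dots> = ennreal ((1 / 2) ^ n)"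
      by (simp only: prod_constant card_lessThan) (simp only: ennreal_power)
    finally show ?thesis by (simp add: power_one_over)
  qed
  finally show ?thesis by (simp add: mult.commute)
qed

text \<open>
  In the third condition \<open>- r \<in> E\<close> forces \<open>r\<close> to be finite, so that \<open>real_of_ereal\<close> is harmless.
\<close>

definition symmetric_distribution :: "ereal measure \<Rightarrow> bool" where
  "symmetric_distribution \<mu> \<longleftrightarrow>
     prob_space \<mu> \<and> sets \<mu> = sets borel \<and> emeasure \<mu> {-\<infinity>} = 0 \<and>
     (\<forall>E\<in>sets borel. E \<subseteq> UNIV - {-\<infinity>, \<infinity>} \<longrightarrow>
        emeasure \<mu> E = (\<integral>\<^sup>+ r. ennreal (exp (- real_of_ereal r)) * indicator E (- r) \<partial>\<mu>))"


section \<open>Estimators and their accuracy\<close>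

definition accuracy :: "nat \<Rightarrow> 'w measure \<Rightarrow> ('w \<Rightarrow> labelling) \<Rightarrow> ('w \<Rightarrow> labelling) \<Rightarrow> real" where
  "accuracy n P X Xhat = (\<Sum>v<n. \<P>(\<omega> in P. X \<omega> v = Xhat \<omega> v)) / n"

definition estimators :: "nat \<Rightarrow> (observation \<Rightarrow> labelling) set" where
  "estimators n = {h. \<forall>v<n. (\<lambda>obs. h obs v) \<in> measurable (observation_space n) (count_space UNIV)}"

definition optimal_accuracy :: "nat \<Rightarrow> real \<Rightarrow> real \<Rightarrow> ereal measure \<Rightarrow> real" where
  "optimal_accuracy n a b \<mu> =
     (\<Squnion>h\<in>estimators n. accuracy n (sbm n a b \<mu>) fst (\<lambda>\<omega>. h (snd \<omega>)))"

text \<open>A randomised estimator also uses an independent random element with law \<open>R\<close>.\<close>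

definition randomised_accuracy ::
    "nat \<Rightarrow> real \<Rightarrow> real \<Rightarrow> ereal measure \<Rightarrow> 'r measure \<Rightarrow> ('r \<Rightarrow> observation \<Rightarrow> labelling) \<Rightarrow> real" where
  "randomised_accuracy n a b \<mu> R h =
     accuracy n (sbm n a b \<mu> \<Otimes>\<^sub>M R) (\<lambda>\<omega>. fst (fst \<omega>)) (\<lambda>\<omega>. h (snd \<omega>) (snd (fst \<omega>)))"

definition randomised_estimator ::
    "nat \<Rightarrow> 'r measure \<Rightarrow> ('r \<Rightarrow> observation \<Rightarrow> labelling) \<Rightarrow> bool" where
  "randomised_estimator n R h \<longleftrightarrow> prob_space R \<and>
     (\<forall>v<n. (\<lambda>(r, obs). h r obs v) \<in> measurable (R \<Otimes>\<^sub>M observation_space n) (count_space UNIV))"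


section \<open>Neighbourhoods and trees\<close>

definition edges :: "nat \<Rightarrow> (nat \<times> nat \<Rightarrow> bool) \<Rightarrow> nat set set" where
  "edges n g = {{i, j} | i j. (i, j) \<in> vertex_pairs n \<and> g (i, j)}"

definition adj :: "nat set set \<Rightarrow> (nat \<times> nat) set" where
  "adj E = {(u, w). {u, w} \<in> E}"

text \<open>The value of \<open>graph_dist\<close> is only meaningful for vertices in the same component.\<close>

definition graph_dist :: "nat set set \<Rightarrow> nat \<Rightarrow> nat \<Rightarrow> nat" where
  "graph_dist E u w = (LEAST k. (u, w) \<in> adj E ^^ k)"

definition nbhd :: "nat \<Rightarrow> nat set set \<Rightarrow> nat \<Rightarrow> nat set" where
  "nbhd t E v = {u. (v, u) \<in> (adj E)\<^sup>* \<and> graph_dist E v u < t}"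

lemma finite_nbhd: "finite (nbhd t (edges n g) v)"
proof (rule finite_subset)
  have "u \<in> insert v {..<n}" if "(v, u) \<in> (adj (edges n g))\<^sup>*" for u
    using that
  proof (cases rule: rtranclE)
    case (step y)
    then have "{y, u} \<in> edges n g" by (simp add: adj_def)
    then show ?thesis by (auto simp: edges_def vertex_pairs_def doubleton_eq_iff)
  qed simp
  then show "nbhd t (edges n g) v \<subseteq> insert v {..<n}"
    by (auto simp: nbhd_def)
qed simp

definition induced_edges :: "nat set \<Rightarrow> nat set set \<Rightarrow> nat set set" where
  "induced_edges V E = {e \<in> E. e \<subseteq> V}"

definition is_cycle :: "nat set set \<Rightarrow> nat list \<Rightarrow> bool" where
  "is_cycle E p \<longleftrightarrow> 3 \<le> length p \<and> distinct p \<and>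
     successively (\<lambda>u w. {u, w} \<in> E) p \<and> {last p, hd p} \<in> E"

definition is_tree :: "nat set \<Rightarrow> nat set set \<Rightarrow> bool" where
  "is_tree V E \<longleftrightarrow>
     V \<noteq> {} \<and> (\<forall>u\<in>V. \<forall>w\<in>V. (u, w) \<in> (adj E)\<^sup>*) \<and> \<not> (\<exists>p. is_cycle E p)"

text \<open>The children of \<open>u\<close> in the tree with edge set \<open>E\<close> and root \<open>v\<close>.\<close>

definition children :: "nat set set \<Rightarrow> nat \<Rightarrow> nat \<Rightarrow> nat set" where
  "children E v u = {w. {u, w} \<in> E \<and> graph_dist E v w = Suc (graph_dist E v u)}"


section \<open>Local belief propagation\<close>

text \<open>The values at \<open>\<plusminus>\<infinity>\<close> are the limits of the finite values.\<close>

definition bp_fun :: "real \<Rightarrow> ereal \<Rightarrow> ereal" where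
  "bp_fun \<delta> x = (case x of
       ereal r \<Rightarrow> ereal (ln (((1 - \<delta>) * exp r + \<delta>) / (\<delta> * exp r + 1 - \<delta>)))
     | PInfty \<Rightarrow> (if \<delta> = 0 then \<infinity> else if \<delta> = 1 then -\<infinity> else ereal (ln ((1 - \<delta>) / \<delta>)))
     | MInfty \<Rightarrow> (if \<delta> = 0 then -\<infinity> else if \<delta> = 1 then \<infinity> else ereal (ln (\<delta> / (1 - \<delta>)))))"

text \<open>
  The sum may contain both \<open>\<infinity>\<close> and \<open>-\<infinity>\<close> only if \<open>\<delta>\<close> is 0 or 1, and then only with probability 0,
  because the labels of the vertices of a tree determine each other if \<open>a = 0\<close> or \<open>b = 0\<close>.
\<close>

definition bp_recursion ::
    "real \<Rightarrow> nat set \<Rightarrow> nat set set \<Rightarrow> (nat \<Rightarrow> ereal) \<Rightarrow> nat \<Rightarrow> (nat \<Rightarrow> ereal) \<Rightarrow> bool" where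
  "bp_recursion \<delta> V E s v l \<longleftrightarrow>
     (\<forall>u\<in>V. l u = s u + (\<Sum>w\<in>children E v u. bp_fun \<delta> (l w)))"

primrec bp_iterate ::
    "nat \<Rightarrow> real \<Rightarrow> nat set set \<Rightarrow> (nat \<Rightarrow> ereal) \<Rightarrow> nat \<Rightarrow> nat \<Rightarrow> ereal" where
  "bp_iterate 0 \<delta> E s v = s"
| "bp_iterate (Suc k) \<delta> E s v = (\<lambda>u. s u + (\<Sum>w\<in>children E v u. bp_fun \<delta> (bp_iterate k \<delta> E s v w)))"

lemma bp_recursion_determined:
  assumes "finite V" and "\<Union>E \<subseteq> V"
  shows bp_recursion_exists: "\<exists>l. bp_recursion \<delta> V E s v l"
    and bp_recursion_unique: "bp_recursion \<delta> V E s v l \<Longrightarrow> bp_recursion \<delta> V E s v l' \<Longrightarrow> u \<in> V \<Longrightarrow> l u = l' u"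
proof -
  define N where "N = Max (insert 0 (graph_dist E v ` V))"
  have N: "graph_dist E v u \<le> N" if "u \<in> V" for u
    unfolding N_def using that assms(1) by (intro Max_ge) auto
  have ch: "w \<in> V" "graph_dist E v w = Suc (graph_dist E v u)" if "w \<in> children E v u" for u w
    using that assms(2) by (auto simp: children_def)
  have stable: "bp_iterate k \<delta> E s v u = bp_iterate k' \<delta> E s v u"
    if "u \<in> V" "N < k + graph_dist E v u" "N < k' + graph_dist E v u" for k k' u
    using that
  proof (induction k arbitrary: k' u)
    case 0
    then show ?case using N[of u] by simp
  next
    case (Suc k)
    then obtain j where j: "k' = Suc j"
      using N[of u] by (cases k') auto
    have "bp_iterate k \<delta> E s v w = bp_iterate j \<delta> E s v w" if "w \<in> children E v u" for w
      using Suc.IH[of w j] ch[OF that] Suc.prems j by simp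
    then show ?case
      by (simp add: j)
  qed
  have "bp_recursion \<delta> V E s v (bp_iterate (Suc N) \<delta> E s v)"
    unfolding bp_recursion_def
  proof
    fix u assume u: "u \<in> V"
    have "bp_iterate N \<delta> E s v w = bp_iterate (Suc N) \<delta> E s v w" if "w \<in> children E v u" for w
      using stable[of w N "Suc N"] ch[OF that] by simp
    then show "bp_iterate (Suc N) \<delta> E s v u =
        s u + (\<Sum>w\<in>children E v u. bp_fun \<delta> (bp_iterate (Suc N) \<delta> E s v w))"
      by (simp cong: sum.cong)
  qed
  then show "\<exists>l. bp_recursion \<delta> V E s v l" by blast
  assume l: "bp_recursion \<delta> V E s v l" and l': "bp_recursion \<delta> V E s v l'"
  show "l u = l' u" if "u \<in> V" for u
    using that
  proof (induction "N - graph_dist E v u" arbitrary: u rule: less_induct)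
    case less
    have "l w = l' w" if "w \<in> children E v u" for w
      using less(1)[of w] ch[OF that] N[of w] by simp
    then show ?case
      using l l' less(2) by (simp add: bp_recursion_def)
  qed
qed

definition local_at :: "nat \<Rightarrow> nat \<Rightarrow> nat \<Rightarrow> (observation \<Rightarrow> bool) \<Rightarrow> bool" where
  "local_at n t v f \<longleftrightarrow>
     (\<forall>(g, s)\<in>space (observation_space n). \<forall>(g', s')\<in>space (observation_space n).
        let E = edges n g; E' = edges n g'; V = nbhd t E v; V' = nbhd t E' v in
        V = V' \<and> induced_edges V E = induced_edges V' E' \<and> (\<forall>u\<in>V. s u = s' u) \<longrightarrow>
        f (g, s) = f (g', s'))"

text \<open>
  Ties and the case that the neighbourhood is not a tree are only constrained by locality. The
  quantifier over \<open>l\<close> ranges over exactly one function on the neighbourhood, see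
  \<open>bp_recursion_exists\<close>, \<open>bp_recursion_unique\<close> and \<open>finite_nbhd\<close>.
\<close>

definition bp_estimator ::
    "nat \<Rightarrow> nat \<Rightarrow> real \<Rightarrow> 'r measure \<Rightarrow> ('r \<Rightarrow> observation \<Rightarrow> labelling) \<Rightarrow> bool" where
  "bp_estimator n t \<delta> R h \<longleftrightarrow> randomised_estimator n R h \<and>
     (\<forall>v<n. \<forall>r\<in>space R. local_at n t v (\<lambda>obs. h r obs v) \<and>
        (\<forall>(g, s)\<in>space (observation_space n).
           let V = nbhd t (edges n g) v; E = induced_edges V (edges n g) in
           is_tree V E \<longrightarrow>
           (\<forall>l. bp_recursion \<delta> V E s v l \<longrightarrow>
              (l v > 0 \<longrightarrow> h r (g, s) v = False) \<and> (l v < 0 \<longrightarrow> h r (g, s) v = True))))"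

end

(*
  A symmetric channel is described by the law of the posterior mean x of (-1)^X, and one channel is
  degraded with respect to another if all its integrals of max 0 (|x| - c) are smaller. Let P k be
  the law of the posterior mean of the root label of a Poisson tree of depth k given all side
  information, and Q k the same law if the labels at depth k are revealed as well. Then P k
  improves and Q k deteriorates with k, and P k is degraded with respect to Q k. If Q k, observed
  through an additional noise of strength u, is degraded with respect to P k, then one more step of
  the recursion increases u by a fixed amount as long as u is bounded away from 1: the root may
  have many children, in which case even noisy messages determine its label. Hence u gets
  arbitrarily close to 1, and P k and Q k have the same limiting accuracy.

  For the graph, lower bounds suffice. Summing over the trees of bounded degree that can occur as
  a neighbourhood bounds both the success and the error probability of local belief propagation
  from below by the values on the Poisson tree, up to an arbitrarily small loss, and the two bounds
  add up to almost 1. In the same way Q k bounds the error probability of every estimator from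
  below, because revealing all labels outside the interior of the neighbourhood makes the rest of
  the graph irrelevant.
*)
theory Submission
  imports Defs
begin

text \<open>Likelihoods are kept unnormalised throughout: a pair of likelihoods is tested only by
  functions that are homogeneous of degree 1, so normalising constants factor out, independent
  observations multiply, and \<open>max\<close>, \<open>min\<close> and a single likelihood are
  covered by one induction. The obstacle in comparing the two recursions is to gain a fixed amount
  in each step for all u up to a prescribed u1 < 1. Pushing noise from the root to the children is
  free because independent noise is better than common noise, and dropping it from the side
  information can only help; the strict gain then comes from one large degree, whose probability and
  advantage are uniform in the depth. The nontrivial side information starts this process: it makes
  some u > 0 admissible at depth 0 and keeps every later message informative. On the graph, a lower
  bound for each outcome replaces a coupling with the Poisson tree; the balls that can occur define
  disjoint events, so atypical graphs are simply dropped.\<close>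

section \<open>Laws of posterior means\<close>

text \<open>Laws of posterior means when the bit itself is not known. Exchanging the two values of
  the bit reflects the posterior mean, hence the invariance; given the bit, the law has density
  \<open>1 + x\<close> or \<open>1 - x\<close> with respect to this one.\<close>

definition mlaw :: "real measure \<Rightarrow> bool" where
  "mlaw \<rho> \<longleftrightarrow> prob_space \<rho> \<and> sets \<rho> = sets borel \<and> (AE x in \<rho>. \<bar>x\<bar> \<le> 1) \<and> distr \<rho> borel uminus = \<rho>"

lemma mlaw_prob: "mlaw \<rho> \<Longrightarrow> prob_space \<rho>"
  and mlaw_sets: "mlaw \<rho> \<Longrightarrow> sets \<rho> = sets borel"
  and mlaw_AE: "mlaw \<rho> \<Longrightarrow> AE x in \<rho>. \<bar>x\<bar> \<le> 1"
  by (auto simp: mlaw_def)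

lemma mlaw_measurable: "mlaw \<rho> \<Longrightarrow> f \<in> borel_measurable borel \<Longrightarrow> f \<in> borel_measurable \<rho>"
  using measurable_cong_sets[OF mlaw_sets refl] by blast

lemma mlaw_nn_integral_uminus:
  assumes "mlaw \<rho>" and [measurable]: "f \<in> borel_measurable borel"
  shows "(\<integral>\<^sup>+x. f (- x) \<partial>\<rho>) = (\<integral>\<^sup>+x. f x \<partial>\<rho>)"
proof -
  note [measurable_cong] = mlaw_sets[OF assms(1)]
  have "(\<integral>\<^sup>+x. f x \<partial>\<rho>) = (\<integral>\<^sup>+x. f x \<partial>(distr \<rho> borel uminus))"
    using assms by (simp add: mlaw_def)
  also have "\<dots> = (\<integral>\<^sup>+x. f (- x) \<partial>\<rho>)"
    by (rule nn_integral_distr) measurable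
  finally show ?thesis ..
qed

text \<open>Pairs \<open>x\<close> with \<open>- x\<close>. The factor 2 takes the place of a
  division in \<open>ennreal\<close> and is cancelled by
  \<open>ennreal_2_mult_le_iff\<close>.\<close>

lemma mlaw_nn_integral_symmetrize:
  assumes "mlaw \<rho>" and [measurable]: "f \<in> borel_measurable borel"
  shows "2 * (\<integral>\<^sup>+x. f x \<partial>\<rho>) = (\<integral>\<^sup>+x. f x + f (- x) \<partial>\<rho>)"
proof -
  note [measurable_cong] = mlaw_sets[OF assms(1)]
  have "(\<integral>\<^sup>+x. f x + f (- x) \<partial>\<rho>) = (\<integral>\<^sup>+x. f x \<partial>\<rho>) + (\<integral>\<^sup>+x. f (- x) \<partial>\<rho>)"
    by (rule nn_integral_add) measurable
  then show ?thesis
    by (simp add: mlaw_nn_integral_uminus[OF assms] mult_2)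
qed

lemma ennreal_2_mult_le_iff: "2 * a \<le> 2 * b \<longleftrightarrow> a \<le> (b::ennreal)"
  by (rule ennreal_mult_le_mult_iff) auto

text \<open>
  For symmetric laws the functions \<open>\<bar>x\<bar> - c\<close>, truncated at 0 by \<open>ennreal\<close>, generate the convex order,
  so that \<open>degraded\<close> is the degradation order of channels.
\<close>

definition excess :: "real measure \<Rightarrow> real \<Rightarrow> ennreal" where
  "excess \<rho> c = (\<integral>\<^sup>+x. ennreal (\<bar>x\<bar> - c) \<partial>\<rho>)"

definition degraded :: "real measure \<Rightarrow> real measure \<Rightarrow> bool" where
  "degraded \<rho> \<sigma> \<longleftrightarrow> (\<forall>c\<ge>0. excess \<rho> c \<le> excess \<sigma> c)"

lemma degraded_refl: "degraded \<rho> \<rho>"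
  and degraded_trans: "degraded \<rho> \<sigma> \<Longrightarrow> degraded \<sigma> \<tau> \<Longrightarrow> degraded \<rho> \<tau>"
  unfolding degraded_def by (auto intro: order_trans)

text \<open>With y = q x, averaging over the sign of x gives (p + y)^+ + (p - y)^+ = 2 p^+ + (|y| -
  |p|)^+ for positive parts. So truncated affine functions see a symmetric law only through its
  excess. For \<open>q = 0\<close> the threshold is a placeholder multiplied by 0.\<close>

lemma nn_integral_affine:
  assumes r: "mlaw \<rho>"
  shows "2 * (\<integral>\<^sup>+x. ennreal (p + q * x) \<partial>\<rho>) =
    2 * ennreal p + ennreal \<bar>q\<bar> * excess \<rho> (if q = 0 then 0 else \<bar>p\<bar> / \<bar>q\<bar>)"
proof -
  note [measurable_cong] = mlaw_sets[OF r]
  interpret prob_space \<rho> by (rule mlaw_prob[OF r])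
  have *: "ennreal (p + q * x) + ennreal (p + q * (- x)) =
     2 * ennreal p + ennreal \<bar>q\<bar> * ennreal (\<bar>x\<bar> - (if q = 0 then 0 else \<bar>p\<bar> / \<bar>q\<bar>))" for x
  proof (cases "q = 0")
    case True
    then show ?thesis by (simp add: mult_2)
  next
    case False
    have e: "ennreal \<bar>q\<bar> * ennreal (\<bar>x\<bar> - \<bar>p\<bar> / \<bar>q\<bar>) = ennreal (\<bar>q * x\<bar> - \<bar>p\<bar>)"
      using False by (subst ennreal_mult'[symmetric]) (auto simp: right_diff_distrib abs_mult)
    have "ennreal (p + y) + ennreal (p - y) = 2 * ennreal p + ennreal (\<bar>y\<bar> - \<bar>p\<bar>)" for y
    proof -
      have m: "ennreal z = ennreal (max 0 z)" for z
        by (metis ennreal_eq_0_iff ennreal_max_0 )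
      have "max 0 (p + y) + max 0 (p - y) = 2 * max 0 p + max 0 (\<bar>y\<bar> - \<bar>p\<bar>)"
        by (auto simp: max_def abs_if)
      then have "ennreal (max 0 (p + y) + max 0 (p - y)) = ennreal (2 * max 0 p + max 0 (\<bar>y\<bar> - \<bar>p\<bar>))"
        by simp
      then show ?thesis
        by (subst (asm) (1 2) ennreal_plus) (auto simp: ennreal_mult ennreal_max_0)
    qed
    from this[of "q * x"] show ?thesis using False e by simp
  qed
  have "2 * (\<integral>\<^sup>+x. ennreal (p + q * x) \<partial>\<rho>) =
      (\<integral>\<^sup>+x. 2 * ennreal p + ennreal \<bar>q\<bar> * ennreal (\<bar>x\<bar> - (if q = 0 then 0 else \<bar>p\<bar> / \<bar>q\<bar>)) \<partial>\<rho>)"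
    by (subst mlaw_nn_integral_symmetrize[OF r]) (simp_all only: *, measurable)
  also have "\<dots> = (\<integral>\<^sup>+x. 2 * ennreal p \<partial>\<rho>) +
      (\<integral>\<^sup>+x. ennreal \<bar>q\<bar> * ennreal (\<bar>x\<bar> - (if q = 0 then 0 else \<bar>p\<bar> / \<bar>q\<bar>)) \<partial>\<rho>)"
    by (rule nn_integral_add) measurable
  also have "\<dots> = 2 * ennreal p + ennreal \<bar>q\<bar> * excess \<rho> (if q = 0 then 0 else \<bar>p\<bar> / \<bar>q\<bar>)"
    unfolding excess_def by (subst nn_integral_cmult) (measurable, simp add: emeasure_space_1)
  finally show ?thesis .
qed

lemma nn_integral_affine_mono:
  assumes r: "mlaw \<rho>" and s: "mlaw \<sigma>" and d: "degraded \<rho> \<sigma>"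
  shows "(\<integral>\<^sup>+x. ennreal (p + q * x) \<partial>\<rho>) \<le> (\<integral>\<^sup>+x. ennreal (p + q * x) \<partial>\<sigma>)"
proof -
  have "2 * (\<integral>\<^sup>+x. ennreal (p + q * x) \<partial>\<rho>) \<le> 2 * (\<integral>\<^sup>+x. ennreal (p + q * x) \<partial>\<sigma>)"
    unfolding nn_integral_affine[OF r] nn_integral_affine[OF s]
    using d by (intro add_left_mono mult_left_mono) (auto simp: degraded_def)
  then show ?thesis by (simp only: ennreal_2_mult_le_iff)
qed

section \<open>Combining independent observations\<close>

text \<open>
  The posterior mean of a fair bit that is observed through two independent channels.
\<close>

definition star :: "real measure \<Rightarrow> real measure \<Rightarrow> real measure" where
  "star \<rho> \<sigma> = distr (density (\<rho> \<Otimes>\<^sub>M \<sigma>) (\<lambda>(x, y). ennreal (1 + x * y))) borel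
     (\<lambda>(x, y). (x + y) / (1 + x * y))"

lemma sets_star [simp, measurable_cong]: "sets (star \<rho> \<sigma>) = sets borel"
  by (simp add: star_def)

lemma nn_integral_star:
  assumes r: "mlaw \<rho>" and s: "mlaw \<sigma>" and [measurable]: "f \<in> borel_measurable borel"
  shows "(\<integral>\<^sup>+z. f z \<partial>star \<rho> \<sigma>) =
    (\<integral>\<^sup>+x. (\<integral>\<^sup>+y. ennreal (1 + x * y) * f ((x + y) / (1 + x * y)) \<partial>\<sigma>) \<partial>\<rho>)"
proof -
  note [measurable_cong] = mlaw_sets[OF r] mlaw_sets[OF s]
  interpret s: prob_space \<sigma> by (rule mlaw_prob[OF s])
  have "(\<integral>\<^sup>+z. f z \<partial>star \<rho> \<sigma>) =
      (\<integral>\<^sup>+p. (case p of (x, y) \<Rightarrow> ennreal (1 + x * y) * f ((x + y) / (1 + x * y))) \<partial>(\<rho> \<Otimes>\<^sub>M \<sigma>))"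
    unfolding star_def
    by (subst nn_integral_distr, measurable, subst nn_integral_density, measurable)
      (auto simp: case_prod_unfold intro!: nn_integral_cong)
  also have "\<dots> = (\<integral>\<^sup>+x. (\<integral>\<^sup>+y. ennreal (1 + x * y) * f ((x + y) / (1 + x * y)) \<partial>\<sigma>) \<partial>\<rho>)"
    by (subst s.nn_integral_fst[symmetric]) auto
  finally show ?thesis .
qed

text \<open>The density \<open>1 + x * y\<close> is absorbed by homogeneity and the quotient
  disappears. This also covers the points where the density vanishes: there \<open>x + y = 0\<close>
  as well, and \<open>\<phi> 0 0 = 0\<close>.\<close>

lemma nn_integral_star_homogeneous:
  fixes \<phi> :: "real \<Rightarrow> real \<Rightarrow> ennreal"
  assumes r: "mlaw \<rho>" and s: "mlaw \<sigma>" and [measurable]: "(\<lambda>z. \<phi> 1 z) \<in> borel_measurable borel"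
    and hom: "\<And>c x y. 0 \<le> c \<Longrightarrow> \<phi> (c * x) (c * y) = ennreal c * \<phi> x y"
  shows "(\<integral>\<^sup>+z. \<phi> 1 z \<partial>star \<rho> \<sigma>) = (\<integral>\<^sup>+x. (\<integral>\<^sup>+y. \<phi> (1 + x * y) (x + y) \<partial>\<sigma>) \<partial>\<rho>)"
proof -
  note [measurable_cong] = mlaw_sets[OF r] mlaw_sets[OF s]
  have z: "\<phi> 0 0 = 0"
    using hom[of 0 0 0] by simp
  have *: "ennreal (1 + x * y) * \<phi> 1 ((x + y) / (1 + x * y)) = \<phi> (1 + x * y) (x + y)"
    if "\<bar>x\<bar> \<le> 1" "\<bar>y\<bar> \<le> 1" for x y :: real
  proof -
    have xy: "\<bar>x * y\<bar> \<le> 1"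
      using that by (simp add: abs_mult mult_le_one)
    show ?thesis
    proof (cases "1 + x * y = 0")
      \<comment> \<open>On the square this happens only at the corners (1, -1) and (-1, 1), where
        two certain observations contradict each other.\<close>
      case True
      have "x + y = 0"
      proof -
        have "x * y = -1" using True by simp
        then have "\<bar>x\<bar> * \<bar>y\<bar> = 1" by (metis abs_minus abs_mult abs_one)
        moreover have "\<bar>x\<bar> * \<bar>y\<bar> \<le> \<bar>x\<bar> * 1" "\<bar>x\<bar> * \<bar>y\<bar> \<le> 1 * \<bar>y\<bar>"
          using that by (intro mult_left_mono mult_right_mono; simp)+
        ultimately have "\<bar>x\<bar> = 1" "\<bar>y\<bar> = 1" using that by auto
        with \<open>x * y = -1\<close> show ?thesis by (auto simp: abs_if split: if_splits)
      qed
      then show ?thesis using True z by simp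
    next
      case False
      with xy have "1 + x * y > 0" by (simp add: abs_if split: if_splits)
      then show ?thesis
        using hom[of "1 + x * y" 1 "(x + y) / (1 + x * y)"] by simp
    qed
  qed
  show ?thesis
    unfolding nn_integral_star[OF r s assms(3)]
  proof (rule nn_integral_cong_AE, use mlaw_AE[OF r] in eventually_elim)
    case (elim x)
    show ?case
      by (rule nn_integral_cong_AE, use mlaw_AE[OF s] in eventually_elim) (use elim in \<open>simp add: *\<close>)
  qed
qed

lemma mlaw_nn_integral_mono:
  assumes r: "mlaw \<rho>" and "\<And>x. \<bar>x\<bar> \<le> 1 \<Longrightarrow> f x \<le> g x"
  shows "(\<integral>\<^sup>+x. f x \<partial>\<rho>) \<le> (\<integral>\<^sup>+x. g x \<partial>\<rho>)"
  by (rule nn_integral_mono_AE, use mlaw_AE[OF r] in eventually_elim) (use assms(2) in auto)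

lemma mlaw_nn_integral_cong:
  assumes r: "mlaw \<rho>" and "\<And>x. \<bar>x\<bar> \<le> 1 \<Longrightarrow> f x = g x"
  shows "(\<integral>\<^sup>+x. f x \<partial>\<rho>) = (\<integral>\<^sup>+x. g x \<partial>\<rho>)"
  by (rule nn_integral_cong_AE, use mlaw_AE[OF r] in eventually_elim) (use assms(2) in auto)

lemma mlaw_swap:
  assumes r: "mlaw \<rho>" and s: "mlaw \<sigma>" and [measurable]: "case_prod f \<in> borel_measurable (borel \<Otimes>\<^sub>M borel)"
  shows "(\<integral>\<^sup>+x. (\<integral>\<^sup>+y. f x y \<partial>\<sigma>) \<partial>\<rho>) = (\<integral>\<^sup>+y. (\<integral>\<^sup>+x. f x y \<partial>\<rho>) \<partial>\<sigma>)"
proof -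
  note [measurable_cong] = mlaw_sets[OF r] mlaw_sets[OF s]
  interpret r: prob_space \<rho> by (rule mlaw_prob[OF r])
  interpret s: prob_space \<sigma> by (rule mlaw_prob[OF s])
  interpret pair_sigma_finite \<rho> \<sigma> ..
  show ?thesis by (rule Fubini'[symmetric]) measurable
qed

lemma excess_eq_0:
  assumes "mlaw \<rho>" "c \<ge> 1"
  shows "excess \<rho> c = 0"
proof -
  have "excess \<rho> c = (\<integral>\<^sup>+x. 0 \<partial>\<rho>)"
    unfolding excess_def by (rule mlaw_nn_integral_cong[OF assms(1)]) (use assms(2) in \<open>simp add: ennreal_neg\<close>)
  then show ?thesis by simp
qed

lemma abs_mult_le_1: "\<bar>x\<bar> \<le> 1 \<Longrightarrow> \<bar>y\<bar> \<le> 1 \<Longrightarrow> \<bar>x * y\<bar> \<le> (1::real)"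
  by (simp add: abs_mult mult_le_one)

lemma one_plus_mult_nonneg: "\<bar>x\<bar> \<le> 1 \<Longrightarrow> \<bar>y\<bar> \<le> 1 \<Longrightarrow> 0 \<le> 1 + x * (y::real)"
  using abs_mult_le_1[of x y] by linarith

text \<open>The two bounds say that (1 - x) (1 - y) and (1 + x) (1 + y) are nonnegative. They keep
  the combined posterior mean in [-1, 1].\<close>

lemma abs_add_le_one_plus_mult: "\<bar>x\<bar> \<le> 1 \<Longrightarrow> \<bar>y\<bar> \<le> 1 \<Longrightarrow> \<bar>x + y\<bar> \<le> 1 + x * (y::real)"
proof -
  assume "\<bar>x\<bar> \<le> 1" "\<bar>y\<bar> \<le> 1"
  then have "0 \<le> (1 - x) * (1 - y)" "0 \<le> (1 + x) * (1 + y)"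
    by (intro mult_nonneg_nonneg; simp)+
  then show ?thesis by (simp add: algebra_simps abs_le_iff)
qed

text \<open>A symmetric law has mean 0. In the affine formula the threshold is at least 1 unless
  \<open>x = 0\<close>, where its factor is 0; so the excess term vanishes in both cases.\<close>

lemma nn_integral_one_plus:
  assumes "mlaw \<rho>" "\<bar>x\<bar> \<le> 1"
  shows "(\<integral>\<^sup>+y. ennreal (1 + x * y) \<partial>\<rho>) = 1"
proof -
  have "2 * (\<integral>\<^sup>+y. ennreal (1 + x * y) \<partial>\<rho>) = 2 * 1"
    unfolding nn_integral_affine[OF assms(1)] using assms(2)
    by (auto simp: excess_eq_0[OF assms(1)] divide_le_eq le_divide_eq)
  then show ?thesis by (metis ennreal_2_mult_le_iff antisym order_refl)
qed

text \<open>The total mass is 1 because \<open>\<sigma>\<close> has mean 0. For the symmetry both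
  arguments are reflected: the weight \<open>1 + x * y\<close> is unchanged and the combined
  posterior mean changes its sign.\<close>

lemma mlaw_star:
  assumes r: "mlaw \<rho>" and s: "mlaw \<sigma>"
  shows "mlaw (star \<rho> \<sigma>)"
proof -
  note [measurable_cong] = mlaw_sets[OF r] mlaw_sets[OF s]
  have sp: "space (star \<rho> \<sigma>) = UNIV" by (simp add: star_def)
  interpret r: prob_space \<rho> by (rule mlaw_prob[OF r])
  interpret s: prob_space \<sigma> by (rule mlaw_prob[OF s])
  have "emeasure (star \<rho> \<sigma>) (space (star \<rho> \<sigma>)) = (\<integral>\<^sup>+z. 1 \<partial>star \<rho> \<sigma>)"
    by simp
  also have "\<dots> = (\<integral>\<^sup>+x. (\<integral>\<^sup>+y. ennreal (1 + x * y) \<partial>\<sigma>) \<partial>\<rho>)"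
    by (subst nn_integral_star[OF r s]) auto
  also have "\<dots> = (\<integral>\<^sup>+x. 1 \<partial>\<rho>)"
    by (rule mlaw_nn_integral_cong[OF r]) (rule nn_integral_one_plus[OF s])
  also have "\<dots> = 1" by (simp add: r.emeasure_space_1)
  finally have p: "prob_space (star \<rho> \<sigma>)" by (rule prob_spaceI)
  have "(\<integral>\<^sup>+z. indicator {z. 1 < \<bar>z\<bar>} z \<partial>star \<rho> \<sigma>) = (\<integral>\<^sup>+x. (\<integral>\<^sup>+y. 0 \<partial>\<sigma>) \<partial>\<rho>)"
    by (subst nn_integral_star[OF r s], measurable, intro mlaw_nn_integral_cong[OF r] mlaw_nn_integral_cong[OF s])
      (use abs_add_le_one_plus_mult one_plus_mult_nonneg in
        \<open>auto simp: indicator_def less_divide_eq ennreal_eq_0_iff not_less split: if_splits\<close>)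
  then have "emeasure (star \<rho> \<sigma>) {z. 1 < \<bar>z\<bar>} = 0"
    by simp
  then have a: "AE z in star \<rho> \<sigma>. \<bar>z\<bar> \<le> 1"
    by (intro AE_I[where N = "{z. 1 < \<bar>z\<bar>}"]) auto
  have "distr (star \<rho> \<sigma>) borel uminus = star \<rho> \<sigma>"
  proof (rule measure_eqI)
    fix A assume "A \<in> sets (distr (star \<rho> \<sigma>) borel uminus)"
    then have [measurable]: "A \<in> sets borel" by simp
    define h where "h x y = ennreal (1 + x * y) * indicator A (- ((x + y) / (1 + x * y)))" for x y :: real
    have [measurable]: "case_prod h \<in> borel_measurable (borel \<Otimes>\<^sub>M borel)"
      unfolding h_def by measurable
    have "emeasure (distr (star \<rho> \<sigma>) borel uminus) A = (\<integral>\<^sup>+z. indicator A (- z) \<partial>star \<rho> \<sigma>)"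
      by (subst nn_integral_indicator[symmetric], simp, subst nn_integral_distr) auto
    also have "\<dots> = (\<integral>\<^sup>+x. (\<integral>\<^sup>+y. h x y \<partial>\<sigma>) \<partial>\<rho>)"
      unfolding h_def by (rule nn_integral_star[OF r s]) measurable
    also have "\<dots> = (\<integral>\<^sup>+x. (\<integral>\<^sup>+y. h (- x) y \<partial>\<sigma>) \<partial>\<rho>)"
      by (rule mlaw_nn_integral_uminus[OF r, symmetric]) measurable
    also have "\<dots> = (\<integral>\<^sup>+x. (\<integral>\<^sup>+y. h (- x) (- y) \<partial>\<sigma>) \<partial>\<rho>)"
      by (intro nn_integral_cong mlaw_nn_integral_uminus[OF s, symmetric]) measurable
    also have "\<dots> = (\<integral>\<^sup>+x. (\<integral>\<^sup>+y. ennreal (1 + x * y) * indicator A ((x + y) / (1 + x * y)) \<partial>\<sigma>) \<partial>\<rho>)"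
    proof -
      have "- (- x - y) / (1 + x * y) = (x + y) / (1 + x * y)" for x y :: real by simp
      then show ?thesis unfolding h_def by (intro nn_integral_cong) (simp add: minus_divide_left add.commute)
    qed
    also have "\<dots> = (\<integral>\<^sup>+z. indicator A z \<partial>star \<rho> \<sigma>)"
      by (rule nn_integral_star[OF r s, symmetric]) measurable
    also have "\<dots> = emeasure (star \<rho> \<sigma>) A"
      by simp
    finally show "emeasure (distr (star \<rho> \<sigma>) borel uminus) A = emeasure (star \<rho> \<sigma>) A" .
  qed simp
  with p a show ?thesis by (simp add: mlaw_def)
qed

lemma excess_star:
  assumes r: "mlaw \<rho>" and s: "mlaw \<sigma>"
  shows "excess (star \<rho> \<sigma>) c = (\<integral>\<^sup>+x. (\<integral>\<^sup>+y. ennreal (\<bar>x + y\<bar> - c * (1 + x * y)) \<partial>\<sigma>) \<partial>\<rho>)"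
  using nn_integral_star_homogeneous[OF r s, of "\<lambda>a b. ennreal (\<bar>b\<bar> - c * a)"]
  by (simp add: excess_def ennreal_mult'[symmetric] abs_mult right_diff_distrib mult_ac)

text \<open>For fixed \<open>x\<close> the truncated integrand of \<open>excess_star\<close> is a
  sum of two truncated affine functions of \<open>y\<close>, at most one of which is positive; their
  integrals are monotone by \<open>nn_integral_affine_mono\<close>.\<close>

lemma degraded_star_right:
  assumes r: "mlaw \<rho>" and s: "mlaw \<sigma>" and s': "mlaw \<sigma>'" and d: "degraded \<sigma> \<sigma>'"
  shows "degraded (star \<rho> \<sigma>) (star \<rho> \<sigma>')"
  unfolding degraded_def
proof (intro allI impI)
  fix c :: real assume c: "0 \<le> c"
  have split: "ennreal (\<bar>x + y\<bar> - c * (1 + x * y)) =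
      ennreal ((x - c) + (1 - c * x) * y) + ennreal ((- x - c) + (- 1 - c * x) * y)"
    if "\<bar>x\<bar> \<le> 1" "\<bar>y\<bar> \<le> 1" for x y
  proof -
    have "0 \<le> c * (1 + x * y)" using c one_plus_mult_nonneg[OF that] by simp
    then show ?thesis
      by (cases "x + y \<ge> 0") (auto simp: algebra_simps ennreal_neg)
  qed
  have eq: "(\<integral>\<^sup>+y. ennreal (\<bar>x + y\<bar> - c * (1 + x * y)) \<partial>\<tau>) =
      (\<integral>\<^sup>+y. ennreal ((x - c) + (1 - c * x) * y) \<partial>\<tau>) + (\<integral>\<^sup>+y. ennreal ((- x - c) + (- 1 - c * x) * y) \<partial>\<tau>)"
    if "\<bar>x\<bar> \<le> 1" "mlaw \<tau>" for x \<tau>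
  proof -
    note [measurable_cong] = mlaw_sets[OF that(2)]
    have "(\<integral>\<^sup>+y. ennreal (\<bar>x + y\<bar> - c * (1 + x * y)) \<partial>\<tau>) =
      (\<integral>\<^sup>+y. ennreal ((x - c) + (1 - c * x) * y) + ennreal ((- x - c) + (- 1 - c * x) * y) \<partial>\<tau>)"
      by (rule mlaw_nn_integral_cong[OF that(2)]) (rule split[OF that(1)])
    also have "\<dots> = (\<integral>\<^sup>+y. ennreal ((x - c) + (1 - c * x) * y) \<partial>\<tau>) + (\<integral>\<^sup>+y. ennreal ((- x - c) + (- 1 - c * x) * y) \<partial>\<tau>)"
      by (rule nn_integral_add) measurable
    finally show ?thesis .
  qed
  show "excess (star \<rho> \<sigma>) c \<le> excess (star \<rho> \<sigma>') c"
    unfolding excess_star[OF r s] excess_star[OF r s']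
    by (rule mlaw_nn_integral_mono[OF r])
      (auto simp only: eq[OF _ s] eq[OF _ s'] intro!: add_mono nn_integral_affine_mono[OF s s' d])
qed

text \<open>Commutativity is only claimed for the excess, which is all that the degradation order
  sees.\<close>

lemma excess_star_commute:
  assumes r: "mlaw \<rho>" and s: "mlaw \<sigma>"
  shows "excess (star \<rho> \<sigma>) c = excess (star \<sigma> \<rho>) c"
  unfolding excess_star[OF r s] excess_star[OF s r]
  by (subst mlaw_swap[OF r s]) (simp_all add: add.commute mult.commute)

lemma degraded_star:
  assumes "mlaw \<rho>" "mlaw \<rho>'" "mlaw \<sigma>" "mlaw \<sigma>'" and d: "degraded \<rho> \<rho>'" "degraded \<sigma> \<sigma>'"
  shows "degraded (star \<rho> \<sigma>) (star \<rho>' \<sigma>')"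
proof -
  have "degraded (star \<rho> \<sigma>) (star \<rho> \<sigma>')"
    by (intro degraded_star_right assms)
  moreover have "degraded (star \<sigma>' \<rho>) (star \<sigma>' \<rho>')"
    by (intro degraded_star_right assms)
  ultimately show ?thesis
    using assms(1-4) by (auto simp: degraded_def excess_star_commute[of \<sigma>'] intro: order_trans)
qed

section \<open>Noise before and after combining observations\<close>

text \<open>
  For \<open>\<bar>t\<bar> \<le> 1\<close>: the bit passes through a binary symmetric channel with crossover probability
  \<open>(1 - t) / 2\<close> before it is observed.
\<close>

definition scale :: "real \<Rightarrow> real measure \<Rightarrow> real measure" where
  "scale t \<rho> = distr \<rho> borel ((*) t)"

lemma sets_scale [simp, measurable_cong]: "sets (scale t \<rho>) = sets borel"
  by (simp add: scale_def)

lemma nn_integral_scale: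
  assumes r: "mlaw \<rho>" and [measurable]: "f \<in> borel_measurable borel"
  shows "(\<integral>\<^sup>+x. f x \<partial>scale t \<rho>) = (\<integral>\<^sup>+x. f (t * x) \<partial>\<rho>)"
proof -
  note [measurable_cong] = mlaw_sets[OF r]
  show ?thesis unfolding scale_def by (rule nn_integral_distr) measurable
qed

lemma mlaw_scale:
  assumes r: "mlaw \<rho>" and t: "\<bar>t\<bar> \<le> 1"
  shows "mlaw (scale t \<rho>)"
proof -
  note [measurable_cong] = mlaw_sets[OF r]
  interpret r: prob_space \<rho> by (rule mlaw_prob[OF r])
  have "prob_space (scale t \<rho>)"
    unfolding scale_def by (rule r.prob_space_distr) measurable
  moreover have "AE x in scale t \<rho>. \<bar>x\<bar> \<le> 1"
    unfolding scale_def
    by (subst AE_distr_iff, measurable, use mlaw_AE[OF r] in eventually_elim) (use t in \<open>simp add: abs_mult_le_1\<close>)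
  moreover have "distr (scale t \<rho>) borel uminus = scale t \<rho>"
  proof -
    have "scale t \<rho> = scale t (distr \<rho> borel uminus)" using r by (simp add: mlaw_def)
    also have "\<dots> = distr (scale t \<rho>) borel uminus"
      unfolding scale_def by (subst (1 2) distr_distr) (measurable, simp add: comp_def)
    finally show ?thesis ..
  qed
  ultimately show ?thesis by (simp add: mlaw_def)
qed

lemma excess_scale:
  assumes "mlaw \<rho>"
  shows "excess (scale t \<rho>) c = (\<integral>\<^sup>+x. ennreal (\<bar>t\<bar> * \<bar>x\<bar> - c) \<partial>\<rho>)"
  unfolding excess_def by (subst nn_integral_scale[OF assms]) (auto simp: abs_mult)

lemma degraded_scale_mono:
  assumes "mlaw \<rho>" "\<bar>t\<bar> \<le> \<bar>u\<bar>"
  shows "degraded (scale t \<rho>) (scale u \<rho>)"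
  unfolding degraded_def excess_scale[OF assms(1)] using assms(2)
  by (auto intro!: nn_integral_mono ennreal_leI mult_right_mono)

lemma degraded_scale:
  assumes r: "mlaw \<rho>" and s: "mlaw \<sigma>" and d: "degraded \<rho> \<sigma>"
  shows "degraded (scale t \<rho>) (scale t \<sigma>)"
  unfolding degraded_def
proof (intro allI impI)
  fix c :: real assume c: "c \<ge> 0"
  show "excess (scale t \<rho>) c \<le> excess (scale t \<sigma>) c"
  proof (cases "t = 0")
    case True
    then show ?thesis using c by (simp add: excess_scale[OF r] excess_scale[OF s] ennreal_neg)
  next
    case False
    have "excess (scale t \<tau>) c = ennreal \<bar>t\<bar> * excess \<tau> (c / \<bar>t\<bar>)" if "mlaw \<tau>" for \<tau>
    proof -
      note [measurable_cong] = mlaw_sets[OF that]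
      have "ennreal (\<bar>t\<bar> * \<bar>x\<bar> - c) = ennreal \<bar>t\<bar> * ennreal (\<bar>x\<bar> - c / \<bar>t\<bar>)" for x
        using False by (subst ennreal_mult'[symmetric]) (auto simp: right_diff_distrib)
      then show ?thesis
        unfolding excess_scale[OF that] by (simp add: nn_integral_cmult excess_def)
    qed
    then show ?thesis
      using d c r s by (auto simp: degraded_def intro!: mult_left_mono)
  qed
qed

text \<open>The terms are the integrands for common noise (left) and independent noise (right) at
  \<open>y\<close> and \<open>- y\<close>. Both sides subtract \<open>2 * c\<close> in total, but on
  the right the two thresholds are closer together. This loses nothing: agreeing observations have
  the larger posterior mean, so if the conflicting pair exceeds its threshold, the agreeing pair
  does so as well.\<close>

lemma positive_part_rearrange:
  fixes t x y c :: real
  assumes t: "0 \<le> t" "t \<le> 1" and x: "\<bar>x\<bar> \<le> 1" and y: "\<bar>y\<bar> \<le> 1" and c: "0 \<le> c"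
  shows "max 0 (t * \<bar>x + y\<bar> - c * (1 + x * y)) + max 0 (t * \<bar>x - y\<bar> - c * (1 - x * y)) \<le>
    max 0 (t * \<bar>x + y\<bar> - c * (1 + t * t * (x * y))) + max 0 (t * \<bar>x - y\<bar> - c * (1 - t * t * (x * y)))"
proof -
  \<comment> \<open>Here \<open>A\<close> belongs to the signs that agree, and the hypothesis
    relating \<open>A\<close> and \<open>B\<close> compares the two posterior means without
    division.\<close>
  have key: "max 0 (t * A - c * (1 + p)) + max 0 (t * B - c * (1 - p)) \<le>
     max 0 (t * A - c * (1 + t * t * p)) + max 0 (t * B - c * (1 - t * t * p))"
    if p: "0 \<le> p" "p \<le> 1" and AB: "B * (1 + p) \<le> A * (1 - p)" and nn: "0 \<le> A" "0 \<le> B" for A B p :: real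
  proof -
    have tt: "t * t \<le> 1" "0 \<le> t * t" using t by (auto simp: mult_le_one)
    have tp: "t * t * p \<le> p" using tt p by (simp add: mult_left_le_one_le)
    have ctp: "c * (t * t * p) \<le> c * p" by (rule mult_left_mono[OF tp c])
    show ?thesis
    proof (cases "t * B - c * (1 - p) \<le> 0")
      case True
      then show ?thesis using ctp by (auto simp: max_def algebra_simps)
    next
      case False
      have "c * (1 - p) * (1 + p) \<le> t * B * (1 + p)"
        using False p by (intro mult_right_mono) auto
      also have "\<dots> \<le> t * A * (1 - p)"
        using mult_left_mono[OF AB t(1)] by (simp add: mult_ac)
      finally have le: "c * (1 + p) * (1 - p) \<le> t * A * (1 - p)" by (simp add: mult_ac)
      have "c * (1 + p) \<le> t * A"
      proof (cases "p = 1")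
        case True
        with AB nn have "B = 0" by simp
        with False True show ?thesis by simp
      next
        case False
        with p have "0 < 1 - p" by simp
        with le show ?thesis by (metis mult_le_cancel_right_pos)
      qed
      then show ?thesis using False by (auto simp: max_def algebra_simps)
    qed
  qed
  have sq: "(x + y) * (1 - x * y) - (x - y) * (1 + x * y) = 2 * y * (1 - x * x)"
           "(x + y) * (1 - x * y) + (x - y) * (1 + x * y) = 2 * x * (1 - y * y)" by (auto simp: algebra_simps)
  have xx: "0 \<le> 1 - x * x" "0 \<le> 1 - y * y"
    using abs_mult_le_1[OF x x] abs_mult_le_1[OF y y] by auto
  have xy: "\<bar>x * y\<bar> \<le> 1" by (rule abs_mult_le_1[OF x y])
  consider "x * y \<ge> 0" | "x * y \<le> 0" by linarith
  then show ?thesis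
  proof cases
    case 1
    then consider "x \<ge> 0" "y \<ge> 0" | "x \<le> 0" "y \<le> 0" by (auto simp: zero_le_mult_iff)
    then have "\<bar>x - y\<bar> * (1 + x * y) \<le> \<bar>x + y\<bar> * (1 - x * y)"
    proof cases
      case 1
      then have "0 \<le> 2 * y * (1 - x * x)" "0 \<le> 2 * x * (1 - y * y)" using xx by auto
      with sq have "(x - y) * (1 + x * y) \<le> (x + y) * (1 - x * y)" "(y - x) * (1 + x * y) \<le> (x + y) * (1 - x * y)"
        by (auto simp: algebra_simps)
      with 1 show ?thesis by (simp add: abs_if)
    next
      case 2
      then have "2 * y * (1 - x * x) \<le> 0" "2 * x * (1 - y * y) \<le> 0" using xx by (auto simp: mult_nonpos_nonneg)
      with sq 2 show ?thesis by (auto simp: abs_if algebra_simps)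
    qed
    from key[OF 1 _ this] xy show ?thesis by simp
  next
    case 2
    then consider "x \<ge> 0" "y \<le> 0" | "x \<le> 0" "y \<ge> 0" by (auto simp: mult_le_0_iff)
    then have "\<bar>x + y\<bar> * (1 + - (x * y)) \<le> \<bar>x - y\<bar> * (1 - - (x * y))"
    proof cases
      case 1
      then have "2 * y * (1 - x * x) \<le> 0" "0 \<le> 2 * x * (1 - y * y)" using xx by (auto simp: mult_nonpos_nonneg)
      with sq 1 show ?thesis by (auto simp: abs_if algebra_simps)
    next
      case 2
      then have "0 \<le> 2 * y * (1 - x * x)" "2 * x * (1 - y * y) \<le> 0" using xx by (auto simp: mult_nonpos_nonneg)
      with sq 2 show ?thesis by (auto simp: abs_if algebra_simps)
    qed
    from key[OF _ _ this] 2 xy show ?thesis by (simp add: add.commute)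
  qed
qed

lemma ennreal_add_le_iff_max:
  "ennreal a + ennreal b \<le> ennreal c + ennreal d \<longleftrightarrow> max 0 a + max 0 b \<le> max 0 c + max 0 d"
proof -
  have e: "ennreal a + ennreal b = ennreal (max 0 a + max 0 b)" for a b :: real
    by (subst ennreal_plus) (auto simp: ennreal_max_0)
  show ?thesis
    unfolding e by (rule ennreal_le_iff) simp
qed

text \<open>
  Independent noise in the two observations is better than common noise.
\<close>

lemma degraded_scale_star:
  assumes r: "mlaw \<rho>" and s: "mlaw \<sigma>" and t: "0 \<le> t" "t \<le> 1"
  shows "degraded (scale t (star \<rho> \<sigma>)) (star (scale t \<rho>) (scale t \<sigma>))"
  unfolding degraded_def
proof (intro allI impI)
  fix c :: real assume c: "0 \<le> c"
  note [measurable_cong] = mlaw_sets[OF r] mlaw_sets[OF s]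
  interpret s: prob_space \<sigma> by (rule mlaw_prob[OF s])
  have at: "\<bar>t\<bar> \<le> 1" using t by simp
  have L: "excess (scale t (star \<rho> \<sigma>)) c =
     (\<integral>\<^sup>+x. (\<integral>\<^sup>+y. ennreal (t * \<bar>x + y\<bar> - c * (1 + x * y)) \<partial>\<sigma>) \<partial>\<rho>)"
    using nn_integral_star_homogeneous[OF r s, of "\<lambda>a b. ennreal (t * \<bar>b\<bar> - c * a)"] t
    by (simp add: excess_scale[OF mlaw_star[OF r s]] ennreal_mult'[symmetric] abs_mult right_diff_distrib mult_ac)
  interpret ts: prob_space "scale t \<sigma>" by (rule mlaw_prob[OF mlaw_scale[OF s at]])
  have R: "excess (star (scale t \<rho>) (scale t \<sigma>)) c =
     (\<integral>\<^sup>+x. (\<integral>\<^sup>+y. ennreal (t * \<bar>x + y\<bar> - c * (1 + t * t * (x * y))) \<partial>\<sigma>) \<partial>\<rho>)"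
  proof -
    have "t * \<bar>x + y\<bar> = \<bar>t * x + t * y\<bar>" for x y :: real
      using t by (simp add: abs_mult distrib_left[symmetric])
    then show ?thesis
      unfolding excess_star[OF mlaw_scale[OF r at] mlaw_scale[OF s at]]
      by (subst nn_integral_scale[OF r], measurable, intro nn_integral_cong, subst nn_integral_scale[OF s], measurable)
        (simp add: mult_ac)
  qed
  show "excess (scale t (star \<rho> \<sigma>)) c \<le> excess (star (scale t \<rho>) (scale t \<sigma>)) c"
    unfolding L R
  proof (rule mlaw_nn_integral_mono[OF r])
    fix x :: real assume x: "\<bar>x\<bar> \<le> 1"
    \<comment> \<open>The inequality may fail pointwise where \<open>x * y < 0\<close>; only the sum
      over \<open>y\<close> and \<open>- y\<close> is monotone, hence the symmetrisation.\<close>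
    have "2 * (\<integral>\<^sup>+y. ennreal (t * \<bar>x + y\<bar> - c * (1 + x * y)) \<partial>\<sigma>) \<le>
      2 * (\<integral>\<^sup>+y. ennreal (t * \<bar>x + y\<bar> - c * (1 + t * t * (x * y))) \<partial>\<sigma>)"
      by (subst (1 2) mlaw_nn_integral_symmetrize[OF s]; measurable?; intro mlaw_nn_integral_mono[OF s])
        (use positive_part_rearrange[OF t x _ c] in \<open>simp add: ennreal_add_le_iff_max\<close>)
    then show "(\<integral>\<^sup>+y. ennreal (t * \<bar>x + y\<bar> - c * (1 + x * y)) \<partial>\<sigma>) \<le>
      (\<integral>\<^sup>+y. ennreal (t * \<bar>x + y\<bar> - c * (1 + t * t * (x * y))) \<partial>\<sigma>)"
      by (simp only: ennreal_2_mult_le_iff)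
  qed
qed

section \<open>The Bhattacharyya coefficient\<close>

text \<open>
  The Bhattacharyya coefficient, which is multiplicative for independent observations.
\<close>

definition hellinger :: "real measure \<Rightarrow> ennreal" where
  "hellinger \<rho> = (\<integral>\<^sup>+x. ennreal (sqrt (1 - x\<^sup>2)) \<partial>\<rho>)"

text \<open>Tested with the homogeneous function sqrt (a^2 - b^2): at a = 1 + x y and b = x + y the
  difference of squares factors as (1 - x^2) (1 - y^2).\<close>

lemma hellinger_star:
  assumes r: "mlaw \<rho>" and s: "mlaw \<sigma>"
  shows "hellinger (star \<rho> \<sigma>) = hellinger \<rho> * hellinger \<sigma>"
proof -
  note [measurable_cong] = mlaw_sets[OF r] mlaw_sets[OF s]
  have "hellinger (star \<rho> \<sigma>) = (\<integral>\<^sup>+x. (\<integral>\<^sup>+y. ennreal (sqrt ((1 + x * y)\<^sup>2 - (x + y)\<^sup>2)) \<partial>\<sigma>) \<partial>\<rho>)"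
    unfolding hellinger_def
    using nn_integral_star_homogeneous[OF r s, of "\<lambda>a b. ennreal (sqrt (a\<^sup>2 - b\<^sup>2))"]
    by (simp add: ennreal_mult'[symmetric] power_mult_distrib right_diff_distrib[symmetric] real_sqrt_mult)
  also have "\<dots> = (\<integral>\<^sup>+x. (\<integral>\<^sup>+y. ennreal (sqrt (1 - x\<^sup>2)) * ennreal (sqrt (1 - y\<^sup>2)) \<partial>\<sigma>) \<partial>\<rho>)"
  proof (intro mlaw_nn_integral_cong[OF r] mlaw_nn_integral_cong[OF s])
    fix x y :: real assume "\<bar>x\<bar> \<le> 1" "\<bar>y\<bar> \<le> 1"
    then have "0 \<le> 1 - x\<^sup>2" "0 \<le> 1 - y\<^sup>2" by (auto simp: abs_square_le_1)
    moreover have "(1 + x * y)\<^sup>2 - (x + y)\<^sup>2 = (1 - x\<^sup>2) * (1 - y\<^sup>2)"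
      by (simp add: algebra_simps power2_eq_square)
    ultimately show "ennreal (sqrt ((1 + x * y)\<^sup>2 - (x + y)\<^sup>2)) = ennreal (sqrt (1 - x\<^sup>2)) * ennreal (sqrt (1 - y\<^sup>2))"
      by (simp add: real_sqrt_mult ennreal_mult)
  qed
  also have "\<dots> = hellinger \<rho> * hellinger \<sigma>"
    unfolding hellinger_def by (simp add: nn_integral_cmult nn_integral_multc)
  finally show ?thesis .
qed

lemma hellinger_le_1: "mlaw \<rho> \<Longrightarrow> hellinger \<rho> \<le> 1"
proof -
  assume r: "mlaw \<rho>"
  interpret prob_space \<rho> by (rule mlaw_prob[OF r])
  have "hellinger \<rho> \<le> (\<integral>\<^sup>+x. 1 \<partial>\<rho>)"
    unfolding hellinger_def by (intro nn_integral_mono) auto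
  then show ?thesis by (simp add: emeasure_space_1)
qed

text \<open>Pointwise \<open>1 - \<bar>x\<bar> \<le> sqrt (1 - x\<^sup>2)\<close>. So a small
  Bhattacharyya coefficient forces an excess of almost \<open>1 - c\<close>, the value of the
  perfect channel for \<open>c \<le> 1\<close>.\<close>

lemma excess_plus_hellinger:
  assumes r: "mlaw \<rho>" and c: "0 \<le> c"
  shows "1 \<le> excess \<rho> c + ennreal c + hellinger \<rho>"
proof -
  note [measurable_cong] = mlaw_sets[OF r]
  interpret prob_space \<rho> by (rule mlaw_prob[OF r])
  have "(\<integral>\<^sup>+x. 1 \<partial>\<rho>) \<le> (\<integral>\<^sup>+x. (ennreal (\<bar>x\<bar> - c) + ennreal c) + ennreal (sqrt (1 - x\<^sup>2)) \<partial>\<rho>)"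
  proof (rule mlaw_nn_integral_mono[OF r])
    fix x :: real assume x: "\<bar>x\<bar> \<le> 1"
    then have x2: "x\<^sup>2 \<le> 1" by (simp add: abs_square_le_1)
    have "(1 - \<bar>x\<bar>)\<^sup>2 \<le> 1 - x\<^sup>2"
      using x mult_right_mono[of "\<bar>x\<bar>" 1 "\<bar>x\<bar>"] by (simp add: power2_eq_square algebra_simps)
    then have "1 - \<bar>x\<bar> \<le> sqrt (1 - x\<^sup>2)" using real_le_rsqrt by blast
    then have "1 \<le> max 0 (\<bar>x\<bar> - c) + c + sqrt (1 - x\<^sup>2)" by simp
    then have "ennreal 1 \<le> ennreal (max 0 (\<bar>x\<bar> - c) + c + sqrt (1 - x\<^sup>2))" by (rule ennreal_leI)
    also have "\<dots> = ennreal (max 0 (\<bar>x\<bar> - c)) + ennreal c + ennreal (sqrt (1 - x\<^sup>2))"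
      using c x2 by (simp add: ennreal_plus)
    finally show "1 \<le> ennreal (\<bar>x\<bar> - c) + ennreal c + ennreal (sqrt (1 - x\<^sup>2))"
      by (simp add: ennreal_max_0)
  qed
  also have "\<dots> = excess \<rho> c + ennreal c + hellinger \<rho>"
    unfolding excess_def hellinger_def
    by (simp add: nn_integral_add emeasure_space_1)
  finally show ?thesis by (simp add: emeasure_space_1)
qed

text \<open>From sqrt (1 - s) \<le> 1 - s / 2 and from the fact that the second moment is at least
  the square of the first absolute moment. The sum on the left avoids truncated subtraction.\<close>

lemma hellinger_scale_le:
  assumes r: "mlaw \<rho>" and t: "\<bar>t\<bar> \<le> 1"
  shows "hellinger (scale t \<rho>) + ennreal (t\<^sup>2 / 2) * (excess \<rho> 0)\<^sup>2 \<le> 1"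
proof -
  note [measurable_cong] = mlaw_sets[OF r]
  interpret prob_space \<rho> by (rule mlaw_prob[OF r])
  have i: "integrable \<rho> (\<lambda>x. \<bar>x\<bar>)" "integrable \<rho> (\<lambda>x. x\<^sup>2)"
    by (intro integrable_const_bound[where B = 1]; use mlaw_AE[OF r] in \<open>simp add: abs_square_le_1\<close>)+
  have ex: "excess \<rho> 0 = ennreal (expectation abs)"
    unfolding excess_def using i by (simp add: nn_integral_eq_integral)
  have sq: "(expectation abs)\<^sup>2 \<le> expectation (\<lambda>x. x\<^sup>2)"
  proof -
    have "0 \<le> variance abs" by (rule variance_positive)
    also have "\<dots> = expectation (\<lambda>x. x\<^sup>2) - (expectation abs)\<^sup>2"
      using variance_eq[of abs] i by simp
    finally show ?thesis by simp
  qed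
  have "hellinger (scale t \<rho>) \<le> (\<integral>\<^sup>+x. ennreal (1 - t\<^sup>2 / 2 * x\<^sup>2) \<partial>\<rho>)"
    unfolding hellinger_def
  proof (subst nn_integral_scale[OF r], measurable, rule mlaw_nn_integral_mono[OF r])
    fix x :: real assume x: "\<bar>x\<bar> \<le> 1"
    have u: "0 \<le> t\<^sup>2 * x\<^sup>2" "t\<^sup>2 * x\<^sup>2 \<le> 1"
      using x t by (auto simp: abs_square_le_1 mult_le_one)
    have "1 - t\<^sup>2 * x\<^sup>2 \<le> (1 - t\<^sup>2 / 2 * x\<^sup>2)\<^sup>2"
    proof -
      have "(1 - t\<^sup>2 / 2 * x\<^sup>2)\<^sup>2 = 1 - t\<^sup>2 * x\<^sup>2 + (t\<^sup>2 * x\<^sup>2)\<^sup>2 / 4"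
        by (simp add: power2_eq_square algebra_simps)
      then show ?thesis by simp
    qed
    then have "sqrt (1 - (t * x)\<^sup>2) \<le> 1 - t\<^sup>2 / 2 * x\<^sup>2"
      using u by (intro real_le_lsqrt) (auto simp: power_mult_distrib)
    then show "ennreal (sqrt (1 - (t * x)\<^sup>2)) \<le> ennreal (1 - t\<^sup>2 / 2 * x\<^sup>2)"
      by (rule ennreal_leI)
  qed
  also have "\<dots> = ennreal (expectation (\<lambda>x. 1 - t\<^sup>2 / 2 * x\<^sup>2))"
  proof (rule nn_integral_eq_integral)
    show "AE x in \<rho>. 0 \<le> 1 - t\<^sup>2 / 2 * x\<^sup>2"
      using mlaw_AE[OF r]
    proof eventually_elim
      case (elim x)
      then have "t\<^sup>2 * x\<^sup>2 \<le> 1" using t by (simp add: abs_square_le_1 mult_le_one)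
      then show ?case by simp
    qed
  qed (use i in simp)
  also have "expectation (\<lambda>x. 1 - t\<^sup>2 / 2 * x\<^sup>2) = 1 - t\<^sup>2 / 2 * expectation (\<lambda>x. x\<^sup>2)"
    using i by (simp add: prob_space)
  finally have *: "hellinger (scale t \<rho>) \<le> ennreal (1 - t\<^sup>2 / 2 * expectation (\<lambda>x. x\<^sup>2))" .
  have "ennreal (t\<^sup>2 / 2) * (excess \<rho> 0)\<^sup>2 = ennreal (t\<^sup>2 / 2 * (expectation abs)\<^sup>2)"
    unfolding ex by (subst ennreal_mult) (simp_all add: ennreal_power)
  also have "\<dots> \<le> ennreal (t\<^sup>2 / 2 * expectation (\<lambda>x. x\<^sup>2))"
    using sq by (intro ennreal_leI mult_left_mono) auto
  finally have "hellinger (scale t \<rho>) + ennreal (t\<^sup>2 / 2) * (excess \<rho> 0)\<^sup>2 \<le>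
     ennreal (1 - t\<^sup>2 / 2 * expectation (\<lambda>x. x\<^sup>2)) + ennreal (t\<^sup>2 / 2 * expectation (\<lambda>x. x\<^sup>2))"
    using * by (intro add_mono)
  also have "\<dots> = 1"
  proof -
    have "expectation (\<lambda>x. x\<^sup>2) \<le> 1"
      using mlaw_AE[OF r] i by (intro integral_le_const) (auto simp: abs_square_le_1)
    moreover have "t\<^sup>2 \<le> 1" using t by (simp add: abs_square_le_1)
    moreover have e: "0 \<le> expectation (\<lambda>x. x\<^sup>2)" by simp
    ultimately have "t\<^sup>2 * expectation (\<lambda>x. x\<^sup>2) \<le> 1" by (intro mult_le_one) auto
    then show ?thesis using e by (subst ennreal_plus[symmetric]) auto
  qed
  finally show ?thesis .
qed

lemma mlawI:
  assumes [measurable_cong]: "sets \<rho> = sets borel" and "prob_space \<rho>" "AE x in \<rho>. \<bar>x\<bar> \<le> 1"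
    and sym: "\<And>A. A \<in> sets borel \<Longrightarrow> (\<integral>\<^sup>+x. indicator A (- x) \<partial>\<rho>) = (\<integral>\<^sup>+x. indicator A x \<partial>\<rho>)"
  shows "mlaw \<rho>"
proof -
  have "distr \<rho> borel uminus = \<rho>"
  proof (rule measure_eqI)
    fix A assume "A \<in> sets (distr \<rho> borel uminus)"
    then have [measurable]: "A \<in> sets borel" by simp
    have "emeasure (distr \<rho> borel (\<lambda>x. - x)) A = (\<integral>\<^sup>+z. indicator A z \<partial>distr \<rho> borel (\<lambda>x. - x))"
      by simp
    also have "\<dots> = (\<integral>\<^sup>+z. indicator A (- z) \<partial>\<rho>)"
      by (rule nn_integral_distr) measurable
    also have "\<dots> = emeasure \<rho> A"
      using assms(1) by (simp add: sym)
    finally show "emeasure (distr \<rho> borel uminus) A = emeasure \<rho> A" by simp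
  qed (simp add: assms)
  with assms show ?thesis by (simp add: mlaw_def)
qed

section \<open>The recursion for Poisson trees\<close>

primrec pow_law :: "real measure \<Rightarrow> nat \<Rightarrow> real measure" where
  "pow_law \<rho> 0 = return borel 0"
| "pow_law \<rho> (Suc j) = star \<rho> (pow_law \<rho> j)"

text \<open>The point mass at 0 is the law of the posterior mean without any observation; it starts
  the products of messages.\<close>

lemma mlaw_return_0: "mlaw (return borel 0)"
  unfolding mlaw_def
  by (auto intro!: prob_space_return simp: AE_return distr_return)

lemma mlaw_pow_law: "mlaw \<rho> \<Longrightarrow> mlaw (pow_law \<rho> j)"
  by (induction j) (auto intro: mlaw_star mlaw_return_0)

text \<open>Mixtures model an index that is itself observed, here the number of children: integrals
  average over it and no information is lost. Any kernel from a \<open>measure_pmf\<close> is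
  measurable, so only its values matter.\<close>

lemma mlaw_bind:
  assumes K: "\<And>j. mlaw (K j)"
  shows "mlaw (measure_pmf p \<bind> K)" (is "mlaw ?B")
    and nn_integral_mlaw_bind:
      "f \<in> borel_measurable borel \<Longrightarrow> (\<integral>\<^sup>+x. f x \<partial>(measure_pmf p \<bind> K)) = (\<integral>\<^sup>+j. (\<integral>\<^sup>+x. f x \<partial>K j) \<partial>measure_pmf p)"
proof -
  have ms: "K \<in> measurable (measure_pmf p) (subprob_algebra borel)"
    using K by (auto simp: space_subprob_algebra mlaw_sets intro: prob_space_imp_subprob_space mlaw_prob)
  show nn: "(\<integral>\<^sup>+x. f x \<partial>?B) = (\<integral>\<^sup>+j. (\<integral>\<^sup>+x. f x \<partial>K j) \<partial>measure_pmf p)"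
    if "f \<in> borel_measurable borel" for f
    by (rule nn_integral_bind[OF that ms])
  have sets[measurable_cong]: "sets ?B = sets borel"
    by (rule sets_bind) (auto simp: K mlaw_sets)
  have "prob_space ?B"
    by (rule prob_space.prob_space_bind[OF prob_space_measure_pmf _ ms]) (simp add: K mlaw_prob)
  moreover have "AE x in ?B. \<bar>x\<bar> \<le> 1"
    by (subst AE_bind[OF ms]) (auto simp: K mlaw_AE)
  moreover have "(\<integral>\<^sup>+z. indicator A (- z) \<partial>?B) = (\<integral>\<^sup>+z. indicator A z \<partial>?B)"
    if [measurable]: "A \<in> sets borel" for A
  proof -
    have "(\<integral>\<^sup>+z. indicator A (- z) \<partial>?B) = (\<integral>\<^sup>+j. (\<integral>\<^sup>+x. indicator A (- x) \<partial>K j) \<partial>measure_pmf p)"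
      by (rule nn) measurable
    also have "\<dots> = (\<integral>\<^sup>+j. (\<integral>\<^sup>+x. indicator A x \<partial>K j) \<partial>measure_pmf p)"
      by (intro nn_integral_cong mlaw_nn_integral_uminus[OF K]) measurable
    also have "\<dots> = (\<integral>\<^sup>+z. indicator A z \<partial>?B)"
      by (rule nn[symmetric]) measurable
    finally show ?thesis .
  qed
  ultimately show "mlaw ?B" using sets by (intro mlawI)
qed

text \<open>
  The law at the root of a Poisson tree if \<open>W\<close> is the law of its side information and \<open>\<rho>\<close> is the law
  at its children.
\<close>

definition bp_step :: "real measure \<Rightarrow> real \<Rightarrow> real \<Rightarrow> real measure \<Rightarrow> real measure" where
  "bp_step W d t \<rho> = measure_pmf (poisson_pmf d) \<bind> (\<lambda>j. star W (pow_law (scale t \<rho>) j))"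

definition perfect_law :: "real measure" where
  "perfect_law = distr (measure_pmf (bernoulli_pmf (1 / 2))) borel (\<lambda>y. if y then - 1 else 1)"

lemma nn_integral_perfect_law:
  assumes [measurable]: "f \<in> borel_measurable borel"
  shows "(\<integral>\<^sup>+x. f x \<partial>perfect_law) = (f 1 + f (- 1)) / 2"
  unfolding perfect_law_def
  by (subst nn_integral_distr, measurable, subst nn_integral_measure_pmf, subst nn_integral_count_space_finite)
    (auto simp: UNIV_bool ennreal_divide_numeral divide_ennreal_def distrib_left distrib_right mult.commute add.commute
      inverse_ennreal[symmetric])

lemma mlaw_perfect: "mlaw perfect_law"
proof (rule mlawI)
  show "prob_space perfect_law"
    unfolding perfect_law_def by (rule prob_space.prob_space_distr[OF prob_space_measure_pmf]) simp
  show "AE x in perfect_law. \<bar>x\<bar> \<le> 1"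
    unfolding perfect_law_def by (subst AE_distr_iff) auto
  show "(\<integral>\<^sup>+z. indicator A (- z) \<partial>perfect_law) = (\<integral>\<^sup>+z. indicator A z \<partial>perfect_law)"
    if [measurable]: "A \<in> sets borel" for A
    by (subst (1 2) nn_integral_perfect_law) (measurable, simp add: add.commute)
qed (simp add: perfect_law_def)

lemma mlaw_bp_step:
  assumes "mlaw W" "\<bar>t\<bar> \<le> 1" "mlaw \<rho>"
  shows "mlaw (bp_step W d t \<rho>)"
  unfolding bp_step_def by (intro mlaw_bind mlaw_star mlaw_pow_law mlaw_scale assms)

lemma nn_integral_bp_step:
  assumes "mlaw W" "\<bar>t\<bar> \<le> 1" "mlaw \<rho>" "f \<in> borel_measurable borel"
  shows "(\<integral>\<^sup>+x. f x \<partial>bp_step W d t \<rho>) =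
    (\<integral>\<^sup>+j. (\<integral>\<^sup>+x. f x \<partial>star W (pow_law (scale t \<rho>) j)) \<partial>measure_pmf (poisson_pmf d))"
  unfolding bp_step_def by (intro nn_integral_mlaw_bind mlaw_star mlaw_pow_law mlaw_scale assms)

lemma excess_bp_step:
  assumes "mlaw W" "\<bar>t\<bar> \<le> 1" "mlaw \<rho>"
  shows "excess (bp_step W d t \<rho>) c =
    (\<integral>\<^sup>+j. excess (star W (pow_law (scale t \<rho>) j)) c \<partial>measure_pmf (poisson_pmf d))"
  unfolding excess_def by (intro nn_integral_bp_step assms) simp

lemma excess_scale_bp_step:
  assumes "mlaw W" "\<bar>t\<bar> \<le> 1" "mlaw \<rho>"
  shows "excess (scale u (bp_step W d t \<rho>)) c =
    (\<integral>\<^sup>+j. excess (scale u (star W (pow_law (scale t \<rho>) j))) c \<partial>measure_pmf (poisson_pmf d))"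
proof -
  have "mlaw (star W (pow_law (scale t \<rho>) j))" for j
    by (intro mlaw_star mlaw_pow_law mlaw_scale assms)
  then show ?thesis
    by (simp add: excess_scale mlaw_bp_step assms nn_integral_bp_step)
qed

lemma degraded_return_0: "degraded (return borel 0) \<sigma>"
  by (simp add: degraded_def excess_def nn_integral_return ennreal_neg)

lemma degraded_perfect:
  assumes r: "mlaw \<rho>"
  shows "degraded \<rho> perfect_law"
  unfolding degraded_def
proof (intro allI impI)
  fix c :: real
  interpret prob_space \<rho> by (rule mlaw_prob[OF r])
  have "excess \<rho> c \<le> (\<integral>\<^sup>+x. ennreal (1 - c) \<partial>\<rho>)"
    unfolding excess_def by (rule mlaw_nn_integral_mono[OF r]) (simp add: ennreal_leI)
  also have "\<dots> = ennreal (1 - c)" by (simp add: emeasure_space_1)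
  also have "\<dots> = excess perfect_law c"
    by (simp add: excess_def nn_integral_perfect_law mult_2_right[symmetric] ennreal_mult_divide_eq)
  finally show "excess \<rho> c \<le> excess perfect_law c" .
qed

lemma degraded_pow_law:
  assumes "mlaw \<rho>" "mlaw \<sigma>" "degraded \<rho> \<sigma>"
  shows "degraded (pow_law \<rho> j) (pow_law \<sigma> j)"
  by (induction j) (auto intro!: degraded_star mlaw_pow_law degraded_refl assms)

lemma degraded_bp_step:
  assumes W: "mlaw W" and t: "\<bar>t\<bar> \<le> 1" and r: "mlaw \<rho>" and s: "mlaw \<sigma>" and d: "degraded \<rho> \<sigma>"
  shows "degraded (bp_step W d' t \<rho>) (bp_step W d' t \<sigma>)"
proof -
  have "degraded (star W (pow_law (scale t \<rho>) j)) (star W (pow_law (scale t \<sigma>) j))" for j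
    by (intro degraded_star_right degraded_pow_law degraded_scale mlaw_pow_law mlaw_scale assms)
  then show ?thesis
    unfolding degraded_def excess_bp_step[OF W t r] excess_bp_step[OF W t s]
    by (auto intro!: nn_integral_mono)
qed

lemma scale_scale:
  assumes r: "mlaw \<rho>"
  shows "scale t (scale u \<rho>) = scale (t * u) \<rho>"
proof -
  note [measurable_cong] = mlaw_sets[OF r]
  show ?thesis unfolding scale_def
    by (subst distr_distr) (measurable, simp add: comp_def mult.assoc[symmetric] fun_eq_iff)
qed

text \<open>Peels off one observation at a time by \<open>degraded_scale_star\<close>: noise common
  to all observations is exchanged for separate noise on each.\<close>

lemma degraded_scale_pow_law:
  assumes r: "mlaw \<rho>" and u: "0 \<le> u" "u \<le> 1"
  shows "degraded (scale u (pow_law \<rho> j)) (pow_law (scale u \<rho>) j)"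
proof (induction j)
  case 0
  then show ?case by (simp add: scale_def distr_return degraded_refl)
next
  case (Suc j)
  have "\<bar>u\<bar> \<le> 1" using u by simp
  then have "degraded (star (scale u \<rho>) (scale u (pow_law \<rho> j))) (star (scale u \<rho>) (pow_law (scale u \<rho>) j))"
    by (intro degraded_star_right mlaw_scale mlaw_pow_law r Suc)
  with degraded_scale_star[OF r mlaw_pow_law[OF r] u] show ?case
    by (auto intro: degraded_trans)
qed

text \<open>Moves noise at a vertex to its children: first to the side information and to each
  message separately, then away from the side information, which can only help. In this way noise at
  the root is compared with a recursion that starts from noisy laws.\<close>

lemma degraded_scale_node:
  assumes W: "mlaw W" and r: "mlaw \<rho>" and t: "\<bar>t\<bar> \<le> 1" and u: "0 \<le> u" "u \<le> 1"
  shows "degraded (scale u (star W (pow_law (scale t \<rho>) j))) (star W (pow_law (scale t (scale u \<rho>)) j))"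
proof -
  have au: "\<bar>u\<bar> \<le> 1" using u by simp
  have "degraded (scale u (star W (pow_law (scale t \<rho>) j))) (star (scale u W) (scale u (pow_law (scale t \<rho>) j)))"
    by (intro degraded_scale_star W mlaw_pow_law mlaw_scale r t u)
  moreover have "degraded (star (scale u W) (scale u (pow_law (scale t \<rho>) j))) (star W (pow_law (scale t (scale u \<rho>)) j))"
  proof (intro degraded_star mlaw_scale W mlaw_pow_law r t au)
    show "degraded (scale u W) W"
      using degraded_scale_mono[OF W, of u 1] au unfolding degraded_def excess_scale[OF W, of 1]
      by (simp add: excess_def)
    have "scale t (scale u \<rho>) = scale u (scale t \<rho>)" by (simp add: scale_scale r mult.commute)
    then show "degraded (scale u (pow_law (scale t \<rho>) j)) (pow_law (scale t (scale u \<rho>)) j)"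
      by (simp add: degraded_scale_pow_law mlaw_scale r t u)
  qed
  ultimately show ?thesis by (rule degraded_trans)
qed

lemma hellinger_pow_law: "mlaw \<rho> \<Longrightarrow> hellinger (pow_law \<rho> j) = hellinger \<rho> ^ j"
proof (induction j)
  case 0
  then show ?case by (simp add: hellinger_def nn_integral_return)
next
  case (Suc j)
  then show ?case by (simp add: hellinger_star mlaw_pow_law)
qed

lemma excess_star_return_0: "mlaw W \<Longrightarrow> excess (star W (return borel 0)) c = excess W c"
  unfolding excess_star[OF _ mlaw_return_0] by (simp add: nn_integral_return excess_def)

lemma degraded_star_left_factor:
  assumes "mlaw W" "mlaw \<sigma>"
  shows "degraded W (star W \<sigma>)"
  using degraded_star_right[OF assms(1) mlaw_return_0 assms(2) degraded_return_0]
  by (simp add: degraded_def excess_star_return_0 assms)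

lemma degraded_into_bp_step:
  assumes W: "mlaw W" and t: "\<bar>t\<bar> \<le> 1" and r: "mlaw \<rho>"
  shows "degraded W (bp_step W d t \<rho>)"
  unfolding degraded_def
proof (intro allI impI)
  fix c :: real assume c: "0 \<le> c"
  have "excess W c = (\<integral>\<^sup>+j. excess W c \<partial>measure_pmf (poisson_pmf d))" by simp
  also have "\<dots> \<le> excess (bp_step W d t \<rho>) c"
    unfolding excess_bp_step[OF assms]
    using degraded_star_left_factor[OF W mlaw_pow_law[OF mlaw_scale[OF r t]]] c
    by (intro nn_integral_mono) (auto simp: degraded_def)
  finally show "excess W c \<le> excess (bp_step W d t \<rho>) c" .
qed

lemma excess_scale_le:
  assumes r: "mlaw \<rho>" and u: "0 \<le> u"
  shows "excess (scale u \<rho>) c \<le> ennreal (u - c)"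
proof -
  interpret prob_space \<rho> by (rule mlaw_prob[OF r])
  have "excess (scale u \<rho>) c \<le> (\<integral>\<^sup>+x. ennreal (u - c) \<partial>\<rho>)"
    unfolding excess_scale[OF r] using u
    by (intro mlaw_nn_integral_mono[OF r] ennreal_leI) (simp add: mult_left_le)
  then show ?thesis by (simp add: emeasure_space_1)
qed

text \<open>The excess is Lipschitz with constant 1 in the noise parameter. In the contraction step
  this converts a gain in the excess into a gain of the same size in the noise parameter.\<close>

lemma excess_scale_add_le:
  assumes r: "mlaw \<rho>" and u: "0 \<le> u" "0 \<le> g"
  shows "excess (scale (u + g) \<rho>) c \<le> excess (scale u \<rho>) c + ennreal g"
proof -
  note [measurable_cong] = mlaw_sets[OF r]
  interpret prob_space \<rho> by (rule mlaw_prob[OF r])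
  have "excess (scale (u + g) \<rho>) c \<le> (\<integral>\<^sup>+x. ennreal (\<bar>u\<bar> * \<bar>x\<bar> - c) + ennreal g \<partial>\<rho>)"
    unfolding excess_scale[OF r]
  proof (rule mlaw_nn_integral_mono[OF r])
    fix x :: real assume "\<bar>x\<bar> \<le> 1"
    then have "(u + g) * \<bar>x\<bar> - c \<le> max 0 (u * \<bar>x\<bar> - c) + g"
      using u mult_left_le[of "\<bar>x\<bar>" g] by (simp add: algebra_simps max_def)
    then have "ennreal ((u + g) * \<bar>x\<bar> - c) \<le> ennreal (max 0 (u * \<bar>x\<bar> - c) + g)"
      by (rule ennreal_leI)
    also have "\<dots> = ennreal (u * \<bar>x\<bar> - c) + ennreal g"
      using u by (subst ennreal_plus) (auto simp: ennreal_max_0)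
    finally show "ennreal (\<bar>u + g\<bar> * \<bar>x\<bar> - c) \<le> ennreal (\<bar>u\<bar> * \<bar>x\<bar> - c) + ennreal g"
      using u by simp
  qed
  also have "\<dots> = excess (scale u \<rho>) c + ennreal g"
    unfolding excess_scale[OF r] by (subst nn_integral_add) (measurable, simp add: emeasure_space_1)
  finally show ?thesis .
qed

lemma excess_le_1: "mlaw \<rho> \<Longrightarrow> 0 \<le> c \<Longrightarrow> excess \<rho> c \<le> 1"
proof -
  assume r: "mlaw \<rho>" and c: "0 \<le> c"
  interpret prob_space \<rho> by (rule mlaw_prob[OF r])
  have "excess \<rho> c \<le> (\<integral>\<^sup>+x. 1 \<partial>\<rho>)"
    unfolding excess_def using c by (intro mlaw_nn_integral_mono[OF r]) simp
  then show ?thesis by (simp add: emeasure_space_1)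
qed

text \<open>
  A vertex with many children knows its label almost surely, even if the messages of the children
  are noisy, whereas a noisy copy of an arbitrary channel has a posterior mean of at most \<open>u\<close>. The
  law of the number of children charges all natural numbers, hence the gap.
\<close>

lemma bp_step_contraction:
  assumes W: "mlaw W" "excess W 0 \<noteq> 0" and d: "0 < d" and t: "t \<noteq> 0" "\<bar>t\<bar> \<le> 1"
    and u: "0 < u0" "u0 \<le> u1" "u1 < 1"
  obtains g where "0 < g"
    and "\<And>Q u. mlaw Q \<Longrightarrow> degraded W Q \<Longrightarrow> u0 \<le> u \<Longrightarrow> u \<le> u1 \<Longrightarrow>
       degraded (scale (min (u + g) u1) (bp_step W d t Q)) (bp_step W d t (scale u Q))"
proof -
  define w where "w = enn2real (excess W 0)"
  have "excess W 0 \<noteq> top" using excess_le_1[OF W(1), of 0] by (auto simp: top_unique)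
  then have w: "excess W 0 = ennreal w" "0 < w" "w \<le> 1"
    using W(2) excess_le_1[OF W(1), of 0]
    by (auto simp: w_def enn2real_positive_iff less_top zero_less_iff_neq_zero intro: enn2real_leI)
  \<comment> \<open>By \<open>hellinger_scale_le\<close> this bounds the Bhattacharyya coefficient
    of the message of one child, uniformly in \<open>u \<ge> u0\<close> and in \<open>Q\<close>,
    because \<open>Q\<close> is at least as informative as \<open>W\<close>.\<close>
  define z where "z = 1 - (t * u0)\<^sup>2 / 2 * w\<^sup>2"
  have tu: "0 < (t * u0)\<^sup>2" "(t * u0)\<^sup>2 \<le> 1" "0 < w\<^sup>2" "w\<^sup>2 \<le> 1"
    using t u w by (auto simp: abs_square_le_1 abs_mult mult_le_one)
  then have "(t * u0)\<^sup>2 * w\<^sup>2 \<le> 1" "0 < (t * u0)\<^sup>2 * w\<^sup>2" by (auto intro: mult_le_one)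
  then have z: "0 \<le> z" "z < 1" by (auto simp: z_def)
  \<comment> \<open>Thresholds above \<open>c1\<close> are trivial, since the law on the left then
    has no excess. Below \<open>c1\<close> the perfect channel still has excess at least
    \<open>1 - c1\<close>.\<close>
  define c1 where "c1 = (1 + u1) / 2"
  have c1: "u1 < c1" "c1 < 1" using u by (auto simp: c1_def)
  have "(\<lambda>j. z ^ j) \<longlonglongrightarrow> 0" using z by (intro LIMSEQ_realpow_zero) auto
  then have "eventually (\<lambda>j. z ^ j < 1 - c1) sequentially"
    using c1 by (intro order_tendstoD) auto
  then obtain j where j: "z ^ j < 1 - c1" by (auto simp: eventually_sequentially)
  \<comment> \<open>At degree \<open>j\<close> the excess on the right is at least
    \<open>1 - c - z ^ j\<close>, against at most \<open>max 0 (u - c)\<close> on the left. The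
    difference is at least \<open>h\<close> for all \<open>c \<le> c1\<close>.\<close>
  define h where "h = 1 - c1 - z ^ j"
  define p where "p = pmf (poisson_pmf d) j"
  have p: "0 < p" using d by (simp add: p_def)
  have h: "0 < h" using j by (simp add: h_def)
  show thesis
  proof (rule that[of "p * h"])
    show "0 < p * h" using p h by simp
    fix Q u assume Q: "mlaw Q" and WQ: "degraded W Q" and uu: "u0 \<le> u" "u \<le> u1"
    have u01: "0 \<le> u" "u \<le> 1" "\<bar>u\<bar> \<le> 1" using uu u by auto
    note mQ = mlaw_scale[OF Q u01(3)]
    \<comment> \<open>The cap keeps the left-hand law below the threshold \<open>c1\<close> and
      keeps \<open>u\<close> in its range when the step is iterated.\<close>
    define v where "v = min (u + p * h) u1"
    have v: "0 \<le> v" "v \<le> u1" "v \<le> u + p * h" using u uu p h by (auto simp: v_def)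
    show "degraded (scale (min (u + p * h) u1) (bp_step W d t Q)) (bp_step W d t (scale u Q))"
      unfolding degraded_def v_def[symmetric]
    proof (intro allI impI)
      fix c :: real assume c: "0 \<le> c"
      let ?A = "\<lambda>i. excess (scale u (star W (pow_law (scale t Q) i))) c"
      let ?B = "\<lambda>i. excess (star W (pow_law (scale t (scale u Q)) i)) c"
      show "excess (scale v (bp_step W d t Q)) c \<le> excess (bp_step W d t (scale u Q)) c"
      proof (cases "c \<le> c1")
        case False
        have "excess (scale v (bp_step W d t Q)) c \<le> ennreal (v - c)"
          by (intro excess_scale_le mlaw_bp_step W t Q v)
        also have "\<dots> = 0" using False v c1 by (simp add: ennreal_neg)
        finally show ?thesis by simp
      next
        case True
        have AB: "?A i \<le> ?B i" for i
          using degraded_scale_node[OF W(1) Q t(2) u01(1,2)] c by (auto simp: degraded_def)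
        have Aj: "?A j + ennreal h \<le> ?B j"
        proof -
          let ?N = "star W (pow_law (scale t (scale u Q)) j)"
          have mt: "mlaw (scale t (scale u Q))" by (intro mlaw_scale t mQ)
          have tu1: "\<bar>t * u\<bar> \<le> 1" using t u01 by (simp add: abs_mult mult_le_one)
          have "ennreal ((t * u0)\<^sup>2 / 2 * w\<^sup>2) \<le> ennreal ((t * u)\<^sup>2 / 2) * (excess Q 0)\<^sup>2"
          proof -
            have "excess W 0 \<le> excess Q 0" using WQ by (simp add: degraded_def)
            then have "(ennreal w)\<^sup>2 \<le> (excess Q 0)\<^sup>2" unfolding w by (intro power_mono) auto
            moreover have "(t * u0)\<^sup>2 \<le> (t * u)\<^sup>2"
              using uu u by (simp add: power_mult_distrib power_mono mult_left_mono)
            ultimately show ?thesis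
              using w by (subst ennreal_mult) (auto simp: ennreal_power[symmetric] intro!: mult_mono ennreal_leI)
          qed
          then have "hellinger (scale (t * u) Q) + ennreal ((t * u0)\<^sup>2 / 2 * w\<^sup>2) \<le> 1"
            using hellinger_scale_le[OF Q tu1] by (meson add_left_mono order_trans)
          also have "1 = ennreal z + ennreal ((t * u0)\<^sup>2 / 2 * w\<^sup>2)"
            using z tu by (subst ennreal_plus[symmetric]) (auto simp: z_def)
          finally have hz: "hellinger (scale t (scale u Q)) \<le> ennreal z"
            by (simp add: scale_scale[OF Q] add.commute[of _ "ennreal ((t * u0)\<^sup>2 / 2 * w\<^sup>2)"]
              ennreal_add_left_cancel_le del: ennreal_plus)
          have "hellinger ?N = hellinger W * hellinger (scale t (scale u Q)) ^ j"
            by (simp add: hellinger_star W mlaw_pow_law mt hellinger_pow_law)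
          also have "\<dots> \<le> 1 * ennreal z ^ j"
            by (intro mult_mono power_mono hellinger_le_1 W hz) auto
          finally have hN: "hellinger ?N \<le> ennreal (z ^ j)" using z by (simp add: ennreal_power)
          have mN: "mlaw ?N" by (intro mlaw_star W mlaw_pow_law mt)
          have "1 \<le> excess ?N c + ennreal c + ennreal (z ^ j)"
            using excess_plus_hellinger[OF mN c] hN by (meson add_left_mono order_trans)
          also have "\<dots> = excess ?N c + ennreal (c + z ^ j)"
            using c z by (simp add: add.assoc ennreal_plus)
          finally have "1 - ennreal (c + z ^ j) \<le> excess ?N c"
            by (subst ennreal_minus_le_iff) (auto simp: add.commute)
          then have lower: "ennreal (1 - c - z ^ j) \<le> excess ?N c"
            using c z by (subst (asm) ennreal_1[symmetric], subst (asm) ennreal_minus) (auto simp: diff_diff_eq)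
          have "?A j + ennreal h \<le> ennreal (u - c) + ennreal h"
            by (intro add_right_mono excess_scale_le mlaw_star W mlaw_pow_law mlaw_scale t Q u01)
          also have "\<dots> = ennreal (max 0 (u - c) + h)"
            using h by (subst ennreal_plus) (auto simp: ennreal_max_0)
          also have "\<dots> \<le> ennreal (1 - c - z ^ j)"
            using True uu c1 by (intro ennreal_leI) (auto simp: h_def max_def)
          finally show ?thesis using lower by simp
        qed
        have "excess (scale v (bp_step W d t Q)) c \<le> excess (scale (u + p * h) (bp_step W d t Q)) c"
          using degraded_scale_mono[OF mlaw_bp_step[OF W(1) t(2) Q], of v "u + p * h" d] v u01 c
          by (auto simp: degraded_def)
        also have "\<dots> \<le> excess (scale u (bp_step W d t Q)) c + ennreal (p * h)"
          using p h by (intro excess_scale_add_le mlaw_bp_step W t Q u01) auto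
        \<comment> \<open>The extra \<open>p * h\<close> is a gain of \<open>h\<close> at the single
          degree \<open>j\<close>, which has probability \<open>p\<close>; at all other degrees
          \<open>AB\<close> suffices.\<close>
        also have "\<dots> = (\<integral>\<^sup>+i. ?A i + ennreal h * indicator {j} i \<partial>measure_pmf (poisson_pmf d))"
          using p h
          by (subst nn_integral_add) (auto simp: excess_scale_bp_step W t Q nn_integral_cmult_indicator
             emeasure_pmf_single p_def ennreal_mult'[symmetric] mult.commute)
        also have "\<dots> \<le> (\<integral>\<^sup>+i. ?B i \<partial>measure_pmf (poisson_pmf d))"
          using AB Aj by (intro nn_integral_mono) (auto simp: indicator_def)
        also have "\<dots> = excess (bp_step W d t (scale u Q)) c"
          by (simp add: excess_bp_step W t mQ)
        finally show ?thesis .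
      qed
    qed
  qed
qed

section \<open>Hidden and revealed boundaries have the same limit\<close>

definition bp_law :: "real measure \<Rightarrow> real \<Rightarrow> real \<Rightarrow> real measure \<Rightarrow> nat \<Rightarrow> real measure" where
  "bp_law W d t \<rho> k = (bp_step W d t ^^ k) \<rho>"

lemma bp_law_0: "bp_law W d t \<rho> 0 = \<rho>"
  and bp_law_Suc: "bp_law W d t \<rho> (Suc k) = bp_step W d t (bp_law W d t \<rho> k)"
  by (simp_all add: bp_law_def)

lemma mlaw_bp_law: "mlaw W \<Longrightarrow> \<bar>t\<bar> \<le> 1 \<Longrightarrow> mlaw \<rho> \<Longrightarrow> mlaw (bp_law W d t \<rho> k)"
  by (induction k) (auto simp: bp_law_0 bp_law_Suc intro: mlaw_bp_step)

locale bp_recursion_laws =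
  fixes W :: "real measure" and d t :: real
  assumes W: "mlaw W" and W_nontrivial: "excess W 0 \<noteq> 0" and d: "0 < d" and t: "\<bar>t\<bar> \<le> 1"
begin

abbreviation "P \<equiv> bp_law W d t W"
abbreviation "Q \<equiv> bp_law W d t perfect_law"

lemma mlaw_P: "mlaw (P k)" and mlaw_Q: "mlaw (Q k)"
  by (auto intro: mlaw_bp_law W t mlaw_perfect)

lemma degraded_P_Suc: "degraded (P k) (P (Suc k))"
proof (induction k)
  case 0
  then show ?case by (simp add: bp_law_0 bp_law_Suc degraded_into_bp_step W t)
next
  case (Suc k)
  then show ?case by (subst (1 2) bp_law_Suc) (intro degraded_bp_step W t mlaw_P)
qed

lemma degraded_Q_Suc: "degraded (Q (Suc k)) (Q k)"
proof (induction k)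
  case 0
  then show ?case by (simp add: bp_law_0 degraded_perfect mlaw_Q)
next
  case (Suc k)
  then show ?case by (subst (1 2) bp_law_Suc) (intro degraded_bp_step W t mlaw_Q)
qed

lemma degraded_P_Q: "degraded (P k) (Q k)"
proof (induction k)
  case 0
  then show ?case by (simp add: bp_law_0 degraded_perfect W)
next
  case (Suc k)
  then show ?case by (subst (1 2) bp_law_Suc) (intro degraded_bp_step W t mlaw_Q mlaw_P)
qed

lemma degraded_W_Q: "degraded W (Q k)"
  by (cases k) (auto simp: bp_law_0 bp_law_Suc intro: degraded_perfect degraded_into_bp_step W t mlaw_Q)

text \<open>Induction on the depth with a noise parameter that grows by \<open>g\<close> in each
  step up to the cap \<open>u1\<close>; the Archimedean property gives a depth at which the cap is
  reached.\<close>

lemma degraded_scale_Q_P: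
  assumes t0: "t \<noteq> 0" and u1: "0 < u1" "u1 < 1"
  shows "\<exists>k. degraded (scale u1 (Q k)) (P k)"
proof -
  define w where "w = enn2real (excess W 0)"
  have "excess W 0 \<noteq> top" using excess_le_1[OF W, of 0] by (auto simp: top_unique)
  then have w: "excess W 0 = ennreal w" "0 < w"
    using W_nontrivial by (auto simp: w_def enn2real_positive_iff less_top zero_less_iff_neq_zero)
  \<comment> \<open>At depth 0 a revealed label seen through noise \<open>u0\<close> has excess at
    most \<open>u0 - c\<close>, while \<open>W\<close> has at least \<open>w - c\<close>; so any
    value up to \<open>w\<close> can start the induction.\<close>
  define u0 where "u0 = min u1 (w / 2)"
  have u0: "0 < u0" "u0 \<le> u1" "2 * u0 \<le> w" using u1 w by (auto simp: u0_def)
  obtain g where g: "0 < g"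
    and step: "\<And>Q u. mlaw Q \<Longrightarrow> degraded W Q \<Longrightarrow> u0 \<le> u \<Longrightarrow> u \<le> u1 \<Longrightarrow>
       degraded (scale (min (u + g) u1) (bp_step W d t Q)) (bp_step W d t (scale u Q))"
    using bp_step_contraction[OF W W_nontrivial d t0 t u0(1,2) u1(2)] by metis
  have init: "degraded (scale u0 perfect_law) W"
    unfolding degraded_def
  proof (intro allI impI)
    fix c :: real assume c: "0 \<le> c"
    have "ennreal w \<le> excess W c + ennreal c"
    proof -
      interpret prob_space W by (rule mlaw_prob[OF W])
      note [measurable_cong] = mlaw_sets[OF W]
      have "excess W 0 \<le> (\<integral>\<^sup>+x. ennreal (\<bar>x\<bar> - c) + ennreal c \<partial>W)"
        unfolding excess_def
      proof (rule nn_integral_mono)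
        fix x
        have "ennreal (\<bar>x\<bar> - 0) \<le> ennreal (max 0 (\<bar>x\<bar> - c) + c)" by (intro ennreal_leI) auto
        also have "\<dots> = ennreal (\<bar>x\<bar> - c) + ennreal c" using c by (subst ennreal_plus) (auto simp: ennreal_max_0)
        finally show "ennreal (\<bar>x\<bar> - 0) \<le> ennreal (\<bar>x\<bar> - c) + ennreal c" .
      qed
      also have "\<dots> = excess W c + ennreal c"
        unfolding excess_def by (subst nn_integral_add) (measurable, simp add: emeasure_space_1)
      finally show ?thesis by (simp add: w)
    qed
    then have "ennreal w - ennreal c \<le> excess W c"
      by (subst ennreal_minus_le_iff) (auto simp: add.commute)
    then have lower: "ennreal (w - c) \<le> excess W c" using c by (simp add: ennreal_minus)
    have "excess (scale u0 perfect_law) c \<le> ennreal (u0 - c)"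
      using u0 by (intro excess_scale_le mlaw_perfect) auto
    also have "\<dots> \<le> ennreal (w - c)" using u0 by (intro ennreal_leI) auto
    finally show "excess (scale u0 perfect_law) c \<le> excess W c" using lower by simp
  qed
  have "degraded (scale (min (u0 + k * g) u1) (Q k)) (P k)" for k
  proof (induction k)
    case 0
    then show ?case using init u0 by (simp add: bp_law_0)
  next
    case (Suc k)
    define u where "u = min (u0 + k * g) u1"
    have u: "u0 \<le> u" "u \<le> u1" using g u0 by (auto simp: u_def)
    have au: "\<bar>u\<bar> \<le> 1" using u u0 u1 by auto
    have "degraded (scale (min (u + g) u1) (Q (Suc k))) (bp_step W d t (scale u (Q k)))"
      unfolding bp_law_Suc by (intro step mlaw_Q degraded_W_Q u)
    moreover have "degraded (bp_step W d t (scale u (Q k))) (P (Suc k))"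
      unfolding bp_law_Suc using Suc by (intro degraded_bp_step W t mlaw_scale mlaw_Q mlaw_P au) (simp add: u_def)
    moreover have "min (u + g) u1 = min (u0 + Suc k * g) u1"
      using g by (auto simp: u_def min_def algebra_simps)
    ultimately show ?case by (auto intro: degraded_trans)
  qed
  moreover obtain k :: nat where "u1 - u0 \<le> k * g"
    using reals_Archimedean3[OF g] by (metis less_imp_le)
  then have "min (u0 + k * g) u1 = u1" by simp
  ultimately show ?thesis by metis
qed

text \<open>The mean absolute posterior mean: guessing the more likely label succeeds with
  probability (1 + p k) / 2, and likewise for \<open>q\<close>.\<close>

definition "p k = enn2real (excess (P k) 0)"
definition "q k = enn2real (excess (Q k) 0)"

lemma excess_P: "excess (P k) 0 = ennreal (p k)" and excess_Q: "excess (Q k) 0 = ennreal (q k)"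
  and pq_bounds: "0 \<le> p k" "0 \<le> q k" "p k \<le> 1" "q k \<le> 1"
proof -
  have *: "excess (P k) 0 \<le> 1" "excess (Q k) 0 \<le> 1" by (auto intro: excess_le_1 mlaw_P mlaw_Q)
  then have "excess (P k) 0 \<noteq> top" "excess (Q k) 0 \<noteq> top" by (auto simp: top_unique)
  then show "excess (P k) 0 = ennreal (p k)" "excess (Q k) 0 = ennreal (q k)"
    by (auto simp: p_def q_def less_top[symmetric])
  show "0 \<le> p k" "0 \<le> q k" "p k \<le> 1" "q k \<le> 1" using * by (auto simp: p_def q_def intro: enn2real_leI)
qed

text \<open>For each \<open>u1 < 1\<close> a single depth with \<open>u1 * q k \<le> p k\<close>
  suffices, since \<open>p\<close> increases and \<open>q\<close> decreases. The case
  \<open>t = 0\<close> is separate because the contraction needs informative edges; there the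
  children say nothing and both laws agree from depth 1 on.\<close>

lemma boundary_irrelevance: "\<exists>L. p \<longlonglongrightarrow> L \<and> q \<longlonglongrightarrow> L"
proof (cases "t = 0")
  case True
  have sc: "scale t \<rho> = return borel 0" if "mlaw \<rho>" for \<rho>
  proof -
    interpret prob_space \<rho> by (rule mlaw_prob[OF that])
    have "(*) 0 = (\<lambda>_. 0 :: real)" by auto
    then show ?thesis unfolding scale_def using True by (simp add: distr_const)
  qed
  have PQ: "P (Suc k) = Q (Suc k)" for k
    by (simp add: bp_law_Suc bp_step_def sc mlaw_P mlaw_Q)
  have "Q (Suc (Suc k)) = Q (Suc k)" for k
    by (subst (1 2) bp_law_Suc) (simp add: bp_step_def sc mlaw_Q)
  then have QQ: "Q (Suc k) = Q (Suc 0)" for k by (induction k) auto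
  have "p (Suc k) = q 1" "q (Suc k) = q 1" for k
    using PQ[of k] QQ[of k] by (simp_all add: p_def q_def)
  then have "(\<lambda>k. p (Suc k)) = (\<lambda>_. q 1)" "(\<lambda>k. q (Suc k)) = (\<lambda>_. q 1)" by blast+
  then have "(\<lambda>k. p (Suc k)) \<longlonglongrightarrow> q 1" "(\<lambda>k. q (Suc k)) \<longlonglongrightarrow> q 1" by (metis tendsto_const)+
  then show ?thesis by (auto simp: filterlim_sequentially_Suc)
next
  case False
  have mono: "excess \<rho> 0 \<le> excess \<sigma> 0" if "degraded \<rho> \<sigma>" for \<rho> \<sigma> using that by (simp add: degraded_def)
  have incp: "p k \<le> p (Suc k)" for k using mono[OF degraded_P_Suc[of k]] by (simp add: excess_P pq_bounds)
  have decq: "q (Suc k) \<le> q k" for k using mono[OF degraded_Q_Suc[of k]] by (simp add: excess_Q pq_bounds)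
  have pq: "p k \<le> q k" for k using mono[OF degraded_P_Q[of k]] by (simp add: excess_Q excess_P pq_bounds)
  obtain Lp where Lp: "p \<longlonglongrightarrow> Lp" "\<And>k. p k \<le> Lp"
    using incseq_convergent[OF incseq_SucI, of p 1] incp pq_bounds by auto
  obtain Lq where Lq: "q \<longlonglongrightarrow> Lq" "\<And>k. Lq \<le> q k"
    using decseq_convergent[OF decseq_SucI, of q 0] decq pq_bounds by auto
  have "Lp \<le> Lq" using LIMSEQ_le[OF Lp(1) Lq(1)] pq by auto
  moreover have "u1 * Lq \<le> Lp" if u1: "0 < u1" "u1 < 1" for u1
  proof -
    obtain k where "degraded (scale u1 (Q k)) (P k)" using degraded_scale_Q_P[OF False u1] by auto
    from mono[OF this] have "excess (scale u1 (Q k)) 0 \<le> ennreal (p k)" by (simp add: excess_P)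
    moreover have "excess (scale u1 (Q k)) 0 = ennreal (u1 * q k)"
    proof -
      note [measurable_cong] = mlaw_sets[OF mlaw_Q]
      have "excess (scale u1 (Q k)) 0 = ennreal u1 * excess (Q k) 0"
        unfolding excess_scale[OF mlaw_Q] using u1 unfolding excess_def
        by (simp add: ennreal_mult' nn_integral_cmult mlaw_measurable[OF mlaw_Q])
      then show ?thesis using u1 by (simp add: excess_Q ennreal_mult pq_bounds)
    qed
    ultimately have "u1 * q k \<le> p k" by (simp add: pq_bounds)
    moreover have "u1 * Lq \<le> u1 * q k" using u1 Lq by (intro mult_left_mono) auto
    ultimately show ?thesis using Lp(2)[of k] by simp
  qed
  then have "Lq \<le> Lp"
  proof -
    assume *: "\<And>u1. 0 < u1 \<Longrightarrow> u1 < 1 \<Longrightarrow> u1 * Lq \<le> Lp"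
    have "((\<lambda>u. u * Lq) \<longlongrightarrow> 1 * Lq) (at_left 1)" by (intro tendsto_intros)
    moreover have "eventually (\<lambda>u. u * Lq \<le> Lp) (at_left 1)"
      using eventually_at_left_real[of 0 "1 :: real"] by (auto elim!: eventually_mono intro: *)
    ultimately show ?thesis using tendsto_upperbound[of "\<lambda>u. u * Lq" "1 * Lq" "at_left 1" Lp] by simp
  qed
  ultimately show ?thesis using Lp Lq by auto
qed

end

section \<open>Independence in finite product spaces\<close>

definition depends_on :: "'i set \<Rightarrow> (('i \<Rightarrow> 'x) \<Rightarrow> 'y) \<Rightarrow> bool" where
  "depends_on A f \<longleftrightarrow> (\<forall>x y. (\<forall>i\<in>A. x i = y i) \<longrightarrow> f x = f y)"

lemma depends_onI: "(\<And>x y. (\<And>i. i \<in> A \<Longrightarrow> x i = y i) \<Longrightarrow> f x = f y) \<Longrightarrow> depends_on A f"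
  and depends_onD: "depends_on A f \<Longrightarrow> (\<And>i. i \<in> A \<Longrightarrow> x i = y i) \<Longrightarrow> f x = f y"
  unfolding depends_on_def by blast+

text \<open>Independence is obtained by gluing two independent points rather than through
  sub-sigma-algebras: the glued point has the product law again, and functions of disjoint sets of
  coordinates can be read off separate copies.\<close>

definition splice_at :: "'i set \<Rightarrow> ('i \<Rightarrow> 'x) \<Rightarrow> ('i \<Rightarrow> 'x) \<Rightarrow> 'i \<Rightarrow> 'x" where
  "splice_at A x y = (\<lambda>i. if i \<in> A then x i else y i)"

lemma measurable_splice_at [measurable]:
  "(\<lambda>(x, y). splice_at A x y) \<in> PiM I M \<Otimes>\<^sub>M PiM I M \<rightarrow>\<^sub>M PiM I M"
proof (rule measurable_PiM_single')
  fix i assume i: "i \<in> I"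
  then show "(\<lambda>p. (case p of (x, y) \<Rightarrow> splice_at A x y) i) \<in> PiM I M \<Otimes>\<^sub>M PiM I M \<rightarrow>\<^sub>M M i"
    by (cases "i \<in> A") (simp_all add: splice_at_def case_prod_unfold)
qed (auto simp: space_pair_measure space_PiM splice_at_def PiE_iff extensional_def)

context
  fixes I :: "'i set" and M :: "'i \<Rightarrow> 'x measure"
  assumes I: "finite I" and M: "\<And>i. prob_space (M i)"
begin

lemma distr_splice_at:
  "distr (PiM I M \<Otimes>\<^sub>M PiM I M) (PiM I M) (\<lambda>(x, y). splice_at A x y) = PiM I M"
proof -
  interpret product_prob_space M I
    using M by (simp add: product_prob_space_def product_sigma_finite_def product_prob_space_axioms_def prob_space_imp_sigma_finite)
  interpret P: prob_space "PiM I M" by (rule prob_space_PiM) (rule M)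
  show ?thesis
  proof (rule PiM_eqI[OF I])
    fix E assume E: "\<And>i. i \<in> I \<Longrightarrow> E i \<in> sets (M i)"
    have "(\<lambda>(x, y). splice_at A x y) -` Pi\<^sub>E I E \<inter> space (PiM I M \<Otimes>\<^sub>M PiM I M) =
       (\<Pi>\<^sub>E i\<in>I. if i \<in> A then E i else space (M i)) \<times> (\<Pi>\<^sub>E i\<in>I. if i \<in> A then space (M i) else E i)"
      using E[THEN sets.sets_into_space]
      by (auto simp: space_pair_measure space_PiM splice_at_def PiE_iff extensional_def split: if_splits; fastforce)
    then have "emeasure (distr (PiM I M \<Otimes>\<^sub>M PiM I M) (PiM I M) (\<lambda>(x, y). splice_at A x y)) (Pi\<^sub>E I E) =
      emeasure (PiM I M \<Otimes>\<^sub>M PiM I M)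
        ((\<Pi>\<^sub>E i\<in>I. if i \<in> A then E i else space (M i)) \<times> (\<Pi>\<^sub>E i\<in>I. if i \<in> A then space (M i) else E i))"
      using E by (subst emeasure_distr) (auto intro!: sets_PiM_I_finite I)
    also have "\<dots> = (\<Prod>i\<in>I. emeasure (M i) (if i \<in> A then E i else space (M i))) *
         (\<Prod>i\<in>I. emeasure (M i) (if i \<in> A then space (M i) else E i))"
      using E I by (subst P.emeasure_pair_measure_Times) (auto intro!: sets_PiM_I_finite simp: emeasure_PiM)
    also have "\<dots> = (\<Prod>i\<in>I. emeasure (M i) (E i))"
      unfolding prod.distrib[symmetric]
      by (intro prod.cong refl) (simp add: prob_space.emeasure_space_1[OF M])
    finally show "emeasure (distr (PiM I M \<Otimes>\<^sub>M PiM I M) (PiM I M) (\<lambda>(x, y). splice_at A x y)) (Pi\<^sub>E I E) =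
      (\<Prod>i\<in>I. emeasure (M i) (E i))" .
  qed simp
qed

lemma nn_integral_PiM_splice:
  assumes [measurable]: "H \<in> borel_measurable (PiM I M)"
  shows "(\<integral>\<^sup>+x. H x \<partial>PiM I M) = (\<integral>\<^sup>+x. (\<integral>\<^sup>+y. H (splice_at A x y) \<partial>PiM I M) \<partial>PiM I M)"
proof -
  interpret P: prob_space "PiM I M" by (rule prob_space_PiM) (rule M)
  have "(\<integral>\<^sup>+x. H x \<partial>PiM I M) = (\<integral>\<^sup>+p. (case p of (x, y) \<Rightarrow> H (splice_at A x y)) \<partial>(PiM I M \<Otimes>\<^sub>M PiM I M))"
    by (subst (1) distr_splice_at[of A, symmetric], subst nn_integral_distr) (auto simp: case_prod_unfold)
  also have "\<dots> = (\<integral>\<^sup>+x. (\<integral>\<^sup>+y. H (splice_at A x y) \<partial>PiM I M) \<partial>PiM I M)"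
    by (subst P.nn_integral_fst[symmetric]) auto
  finally show ?thesis .
qed

text \<open>Gluing two copies along \<open>A\<close> turns the diagonal into a pair: the first
  argument sees only the copy used on \<open>A\<close>, the second only the other one.\<close>

lemma nn_integral_PiM_indep:
  assumes [measurable]: "case_prod H \<in> borel_measurable (PiM I M \<Otimes>\<^sub>M PiM I M)"
    and A: "\<And>y. depends_on A (\<lambda>x. H x y)" and B: "\<And>x. depends_on B (H x)" and AB: "A \<inter> B = {}"
  shows "(\<integral>\<^sup>+x. H x x \<partial>PiM I M) = (\<integral>\<^sup>+x. (\<integral>\<^sup>+y. H x y \<partial>PiM I M) \<partial>PiM I M)"
proof -
  have "H (splice_at A x y) (splice_at A x y) = H x y" for x y
  proof -
    have "H (splice_at A x y) (splice_at A x y) = H x (splice_at A x y)"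
      by (rule depends_onD[OF A]) (simp add: splice_at_def)
    also have "\<dots> = H x y"
      by (rule depends_onD[OF B]) (use AB in \<open>auto simp: splice_at_def\<close>)
    finally show ?thesis .
  qed
  then show ?thesis
    by (subst nn_integral_PiM_splice[of _ A]) auto
qed

lemma nn_integral_PiM_indep_mult:
  assumes [measurable]: "f \<in> borel_measurable (PiM I M)" "g \<in> borel_measurable (PiM I M)"
    and A: "depends_on A f" and B: "depends_on B g" and AB: "A \<inter> B = {}"
  shows "(\<integral>\<^sup>+x. f x * g x \<partial>PiM I M) = (\<integral>\<^sup>+x. f x \<partial>PiM I M) * (\<integral>\<^sup>+x. g x \<partial>PiM I M)"
proof -
  have "(\<integral>\<^sup>+x. f x * g x \<partial>PiM I M) = (\<integral>\<^sup>+x. (\<integral>\<^sup>+y. f x * g y \<partial>PiM I M) \<partial>PiM I M)"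
    by (rule nn_integral_PiM_indep[OF _ _ _ AB]) (auto intro!: depends_onI arg_cong2[where f = "(*)"] depends_onD[OF A] depends_onD[OF B])
  then show ?thesis by (simp add: nn_integral_cmult nn_integral_multc)
qed

lemma nn_integral_PiM_component:
  assumes "i \<in> I" and [measurable]: "f \<in> borel_measurable (M i)"
  shows "(\<integral>\<^sup>+x. f (x i) \<partial>PiM I M) = (\<integral>\<^sup>+z. f z \<partial>M i)"
proof -
  have "(\<integral>\<^sup>+z. f z \<partial>M i) = (\<integral>\<^sup>+z. f z \<partial>distr (PiM I M) (M i) (\<lambda>x. x i))"
    by (subst distr_PiM_component[OF M assms(1)]) simp
  also have "\<dots> = (\<integral>\<^sup>+x. f (x i) \<partial>PiM I M)"
    using assms(1) by (subst nn_integral_distr) auto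
  finally show ?thesis ..
qed

end

section \<open>Labelled trees and their likelihood\<close>

text \<open>The depth is passed separately as \<open>T\<close>. At depth 0 a vertex belongs to the
  boundary, and \<open>names\<close>, \<open>lik\<close>, \<open>inner\<close> and
  \<open>tedges\<close> do not look at its children.\<close>

datatype ntree = Node (root: nat) (kids: "ntree list")

primrec names :: "nat \<Rightarrow> ntree \<Rightarrow> nat set" where
  "names 0 \<tau> = {root \<tau>}"
| "names (Suc T) \<tau> = insert (root \<tau>) (\<Union>t\<in>set (kids \<tau>). names T t)"

text \<open>The subtrees are chosen from left to right, and each adds its names to the forbidden
  set. With the roots reserved in advance, disjointness is built in, and sums over forests unfold
  one tree at a time.\<close>

primrec forests :: "(nat set \<Rightarrow> nat \<Rightarrow> ntree set) \<Rightarrow> (ntree \<Rightarrow> nat set) \<Rightarrow> nat set \<Rightarrow> nat list \<Rightarrow> ntree list set" where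
  "forests F nm Z [] = {[]}"
| "forests F nm Z (w # ws) = (\<lambda>(t, ts). t # ts) ` (SIGMA t:F Z w. forests F nm (Z \<union> nm t) ws)"

definition kid_sets :: "nat \<Rightarrow> nat \<Rightarrow> nat set \<Rightarrow> nat \<Rightarrow> nat set set" where
  "kid_sets n k Z v = {C. C \<subseteq> {..<n} - insert v Z \<and> card C \<le> k}"

text \<open>
  Rooted trees of depth at most \<open>T\<close> with at most \<open>k\<close> children per vertex, whose other vertices avoid
  \<open>Z\<close>. Sorting the children makes the tree determined by its edges and root.
\<close>

primrec trees :: "nat \<Rightarrow> nat \<Rightarrow> nat \<Rightarrow> nat set \<Rightarrow> nat \<Rightarrow> ntree set" where
  "trees n k 0 Z v = {Node v []}"
| "trees n k (Suc T) Z v = (\<lambda>(C, ts). Node v ts) `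
     (SIGMA C:kid_sets n k Z v. forests (trees n k T) (names T) (insert v Z \<union> C) (sorted_list_of_set C))"

lemma finite_kid_sets: "finite (kid_sets n k Z v)"
  by (rule finite_subset[of _ "Pow {..<n}"]) (auto simp: kid_sets_def)

lemma kid_setsD: "C \<in> kid_sets n k Z v \<Longrightarrow> finite C" "C \<in> kid_sets n k Z v \<Longrightarrow> C \<subseteq> {..<n}"
  by (auto simp: kid_sets_def intro: finite_subset)

lemma root_tree: "\<tau> \<in> trees n k T Z v \<Longrightarrow> root \<tau> = v"
  by (cases T) auto

lemma root_in_names: "root \<tau> \<in> names T \<tau>"
  by (cases T) auto

lemma finite_names: "finite (names T \<tau>)"
  by (induction T arbitrary: \<tau>) auto

lemma finite_forests:
  assumes "\<And>Z w. finite (F Z w)"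
  shows "finite (forests F nm Z ws)"
  by (induction ws arbitrary: Z) (auto intro!: finite_imageI finite_SigmaI assms)

lemma finite_trees: "finite (trees n k T Z v)"
  by (induction T arbitrary: Z v) (auto intro!: finite_imageI finite_SigmaI finite_kid_sets finite_forests)

lemma roots_forest:
  assumes "ts \<in> forests (trees n k T) nm Z ws"
  shows "map root ts = ws"
  using assms by (induction ws arbitrary: Z ts) (auto simp: root_tree)

lemma sum_forests_Cons:
  assumes "\<And>Z w. finite (F Z w)"
  shows "(\<Sum>ts\<in>forests F nm Z (w # ws). f ts) = (\<Sum>t\<in>F Z w. \<Sum>ts\<in>forests F nm (Z \<union> nm t) ws. f (t # ts))"
proof -
  have "(\<Sum>ts\<in>forests F nm Z (w # ws). f ts) =
      (\<Sum>(t, ts)\<in>(SIGMA t:F Z w. forests F nm (Z \<union> nm t) ws). f (t # ts))"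
    unfolding forests.simps by (subst sum.reindex) (auto simp: inj_on_def case_prod_unfold)
  also have "\<dots> = (\<Sum>t\<in>F Z w. \<Sum>ts\<in>forests F nm (Z \<union> nm t) ws. f (t # ts))"
    by (rule sum.Sigma[symmetric]) (auto intro: assms finite_forests)
  finally show ?thesis .
qed

lemma sum_trees_Suc:
  "(\<Sum>\<tau>\<in>trees n k (Suc T) Z v. f \<tau>) = (\<Sum>C\<in>kid_sets n k Z v.
     \<Sum>ts\<in>forests (trees n k T) (names T) (insert v Z \<union> C) (sorted_list_of_set C). f (Node v ts))"
proof -
  have inj: "inj_on (\<lambda>(C, ts). Node v ts)
     (SIGMA C:kid_sets n k Z v. forests (trees n k T) (names T) (insert v Z \<union> C) (sorted_list_of_set C))"
  proof (rule inj_onI, clarsimp)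
    fix C C' ts
    assume C: "C \<in> kid_sets n k Z v" "C' \<in> kid_sets n k Z v"
      and "ts \<in> forests (trees n k T) (names T) (insert v (Z \<union> C)) (sorted_list_of_set C)"
        "ts \<in> forests (trees n k T) (names T) (insert v (Z \<union> C')) (sorted_list_of_set C')"
    then have "sorted_list_of_set C = sorted_list_of_set C'" by (metis roots_forest)
    then have "set (sorted_list_of_set C) = set (sorted_list_of_set C')" by simp
    then show "C = C'" using C[THEN kid_setsD(1)] by simp
  qed
  have "(\<Sum>\<tau>\<in>trees n k (Suc T) Z v. f \<tau>) =
    (\<Sum>(C, ts)\<in>(SIGMA C:kid_sets n k Z v. forests (trees n k T) (names T) (insert v Z \<union> C) (sorted_list_of_set C)). f (Node v ts))"
    unfolding trees.simps by (subst sum.reindex[OF inj]) (auto simp: case_prod_unfold)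
  also have "\<dots> = (\<Sum>C\<in>kid_sets n k Z v.
     \<Sum>ts\<in>forests (trees n k T) (names T) (insert v Z \<union> C) (sorted_list_of_set C). f (Node v ts))"
    by (rule sum.Sigma[symmetric]) (auto intro: finite_kid_sets finite_forests finite_trees)
  finally show ?thesis .
qed

text \<open>The given roots are listed apart from the other names: in \<open>trees\<close> all
  siblings are reserved in \<open>Z\<close> before the first subtree is chosen.\<close>

lemma names_forest:
  assumes IH: "\<And>Z v \<tau>. \<tau> \<in> trees n k T Z v \<Longrightarrow> names T \<tau> \<subseteq> insert v ({..<n} - Z)"
    and ts: "ts \<in> forests (trees n k T) (names T) Z ws"
  shows "(\<Union>t\<in>set ts. names T t) \<subseteq> set ws \<union> ({..<n} - Z)"
  using ts
proof (induction ws arbitrary: Z ts)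
  case (Cons w ws)
  then obtain t ts' where "ts = t # ts'" "t \<in> trees n k T Z w"
    "ts' \<in> forests (trees n k T) (names T) (Z \<union> names T t) ws" by auto
  with Cons.IH[OF this(3)] IH[OF this(2)] show ?case by auto
qed simp

lemma names_tree:
  "\<tau> \<in> trees n k T Z v \<Longrightarrow> names T \<tau> \<subseteq> insert v ({..<n} - Z)"
proof (induction T arbitrary: Z v \<tau>)
  case (Suc T)
  then obtain C ts where C: "C \<in> kid_sets n k Z v" and \<tau>: "\<tau> = Node v ts"
    and ts: "ts \<in> forests (trees n k T) (names T) (insert v Z \<union> C) (sorted_list_of_set C)" by auto
  have "(\<Union>t\<in>set ts. names T t) \<subseteq> set (sorted_list_of_set C) \<union> ({..<n} - (insert v Z \<union> C))"
    by (rule names_forest[OF _ ts]) (rule Suc.IH)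
  then show ?case using C kid_setsD(1)[OF C] by (auto simp: \<tau> kid_sets_def)
qed simp

lemma forest_ConsD:
  assumes "t # ts \<in> forests (trees n k T) (names T) Z (w # ws)" "distinct (w # ws)" "set (w # ws) \<subseteq> Z"
  shows "t \<in> trees n k T Z w" "ts \<in> forests (trees n k T) (names T) (Z \<union> names T t) ws"
    "names T t \<inter> (\<Union>t\<in>set ts. names T t) = {}"
proof -
  show t: "t \<in> trees n k T Z w" and ts: "ts \<in> forests (trees n k T) (names T) (Z \<union> names T t) ws"
    using assms(1) by auto
  have "(\<Union>t\<in>set ts. names T t) \<subseteq> set ws \<union> ({..<n} - (Z \<union> names T t))"
    by (rule names_forest[OF _ ts]) (rule names_tree)
  with names_tree[OF t] assms(2,3) show "names T t \<inter> (\<Union>t\<in>set ts. names T t) = {}" by auto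
qed

text \<open>Independent of the number of vertices, so the number of pairs inside a ball stays
  bounded while \<open>n\<close> grows.\<close>

primrec tree_size_bound :: "nat \<Rightarrow> nat \<Rightarrow> nat" where
  "tree_size_bound k 0 = 1"
| "tree_size_bound k (Suc T) = 1 + k * tree_size_bound k T"

lemma card_names_forest:
  assumes "\<And>Z v \<tau>. \<tau> \<in> trees n k T Z v \<Longrightarrow> card (names T \<tau>) \<le> B"
    and "ts \<in> forests (trees n k T) (names T) Z ws"
  shows "card (\<Union>t\<in>set ts. names T t) \<le> length ws * B"
  using assms(2)
proof (induction ws arbitrary: Z ts)
  case (Cons w ws)
  then obtain t ts' where *: "ts = t # ts'" "t \<in> trees n k T Z w"
    "ts' \<in> forests (trees n k T) (names T) (Z \<union> names T t) ws" by auto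
  have "card (\<Union>t\<in>set ts. names T t) \<le> card (names T t) + card (\<Union>t\<in>set ts'. names T t)"
    using *(1) by (simp add: card_Un_le)
  with Cons.IH[OF *(3)] assms(1)[OF *(2)] show ?case by simp
qed simp

lemma card_names_tree: "\<tau> \<in> trees n k T Z v \<Longrightarrow> card (names T \<tau>) \<le> tree_size_bound k T"
proof (induction T arbitrary: Z v \<tau>)
  case (Suc T)
  then obtain C ts where C: "C \<in> kid_sets n k Z v" and \<tau>: "\<tau> = Node v ts"
    and ts: "ts \<in> forests (trees n k T) (names T) (insert v Z \<union> C) (sorted_list_of_set C)" by auto
  have "card (names T' \<tau>) \<le> card {v} + card (\<Union>t\<in>set ts. names T t)" if "T' = Suc T" for T'
    unfolding that \<tau> using card_Un_le[of "{v}" "\<Union>t\<in>set ts. names T t"] by simp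
  also have "card (\<Union>t\<in>set ts. names T t) \<le> length (sorted_list_of_set C) * tree_size_bound k T"
    by (rule card_names_forest[OF _ ts]) (rule Suc.IH)
  also have "\<dots> \<le> k * tree_size_bound k T"
    using C by (simp add: kid_sets_def)
  finally show ?case by simp
qed simp

section \<open>Likelihoods of finite trees against the Poisson tree\<close>

definition sg :: "bool \<Rightarrow> real" where "sg y = (if y then - 1 else 1)"

lemma abs_sg [simp]: "\<bar>sg y\<bar> = 1" by (simp add: sg_def)

text \<open>Test functions of a pair of likelihoods, for the labels \<open>False\<close> and
  \<open>True\<close>. A common factor can be pulled out, so the pair never has to be normalised; on
  a normalised pair (1 + x, 1 - x) one gets back a function of the posterior mean x.\<close>

definition homogeneous :: "(real \<Rightarrow> real \<Rightarrow> ennreal) \<Rightarrow> bool" where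
  "homogeneous \<phi> \<longleftrightarrow> case_prod \<phi> \<in> borel_measurable (borel \<Otimes>\<^sub>M borel) \<and>
     (\<forall>c x y. 0 \<le> c \<longrightarrow> \<phi> (c * x) (c * y) = ennreal c * \<phi> x y)"

lemma homogeneous_measurable: "homogeneous \<phi> \<Longrightarrow> case_prod \<phi> \<in> borel_measurable (borel \<Otimes>\<^sub>M borel)"
  and homogeneousD: "homogeneous \<phi> \<Longrightarrow> 0 \<le> c \<Longrightarrow> \<phi> (c * x) (c * y) = ennreal c * \<phi> x y"
  by (auto simp: homogeneous_def)

lemma homogeneous_mult:
  assumes "homogeneous \<phi>"
  shows "homogeneous (\<lambda>x y. \<phi> (p * x) (q * y))"
proof -
  note [measurable] = homogeneous_measurable[OF assms]
  have "(\<lambda>(x, y). \<phi> (p * x) (q * y)) \<in> borel_measurable (borel \<Otimes>\<^sub>M borel)" by measurable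
  moreover have "\<phi> (p * (c * x)) (q * (c * y)) = ennreal c * \<phi> (p * x) (q * y)" if "0 \<le> c" for c x y
    using homogeneousD[OF assms that, of "p * x" "q * y"] by (simp add: mult_ac)
  ultimately show ?thesis by (simp add: homogeneous_def)
qed

text \<open>In terms of likelihoods \<open>star\<close> is componentwise multiplication: (1 + x) (1
  + y) is the sum, and (1 - x) (1 - y) the difference, of 1 + x y and x + y.\<close>

lemma nn_integral_star_likelihood:
  assumes r: "mlaw \<rho>" and s: "mlaw \<sigma>" and \<phi>: "homogeneous \<phi>"
  shows "(\<integral>\<^sup>+z. \<phi> (1 + z) (1 - z) \<partial>star \<rho> \<sigma>) =
    (\<integral>\<^sup>+x. (\<integral>\<^sup>+y. \<phi> ((1 + x) * (1 + y)) ((1 - x) * (1 - y)) \<partial>\<sigma>) \<partial>\<rho>)"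
proof -
  note [measurable] = homogeneous_measurable[OF \<phi>]
  have "(\<lambda>z. \<phi> (1 + z) (1 - z)) \<in> borel_measurable borel" by measurable
  then have "(\<integral>\<^sup>+z. \<phi> (1 + z) (1 - z) \<partial>star \<rho> \<sigma>) =
    (\<integral>\<^sup>+x. (\<integral>\<^sup>+y. \<phi> (1 + x * y + (x + y)) (1 + x * y - (x + y)) \<partial>\<sigma>) \<partial>\<rho>)"
    by (rule nn_integral_star_homogeneous[OF r s, of "\<lambda>a b. \<phi> (a + b) (a - b)"])
      (simp add: homogeneousD[OF \<phi>] distrib_left[symmetric] right_diff_distrib[symmetric])
  then show ?thesis by (simp add: algebra_simps)
qed

text \<open>One model for both kinds of boundary: \<open>N\<close> is the law of the observation at
  a vertex, with posterior mean \<open>mag\<close> in the interior and \<open>leaf\<close> at the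
  boundary. It is instantiated once with \<open>leaf\<close> equal to \<open>mag\<close> and once
  with \<open>leaf\<close> revealing the label.\<close>

locale tree_model =
  fixes n :: nat and a b :: real and N :: "'w measure" and mag leaf :: "'w \<Rightarrow> real"
  assumes n: "0 < n" and a: "0 \<le> a" and b: "0 \<le> b" and ab: "0 < a + b"
    and N: "prob_space N" and mag_measurable [measurable]: "mag \<in> borel_measurable N"
    and leaf_measurable [measurable]: "leaf \<in> borel_measurable N"
    and mag_le: "\<And>w. \<bar>mag w\<bar> \<le> 1" and leaf_le: "\<And>w. \<bar>leaf w\<bar> \<le> 1"
    and mlaw_mag: "mlaw (distr N borel mag)" and mlaw_leaf: "mlaw (distr N borel leaf)"
begin

text \<open>The mean degree and the correlation of the labels across an edge: a child agrees with
  its parent with probability (1 + th) / 2.\<close>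

definition "d = (a + b) / 2"
definition "th = (a - b) / (a + b)"
definition "conn x z = (if x = z then a / n else b / n)" for x z :: bool
abbreviation "\<Omega> \<equiv> PiM {..<n} (\<lambda>_. N)"

lemma d_pos: "0 < d" using ab by (simp add: d_def)
lemma th_le: "\<bar>th\<bar> \<le> 1" using a b ab by (simp add: th_def)

lemma prob_space_Omega: "prob_space \<Omega>"
  by (rule prob_space_PiM) (rule N)

text \<open>
  The likelihood of the label \<open>x\<close> of the root, where each edge contributes half its probability
  (so that summing over the label of the child averages over it) and the missing edges of a vertex
  contribute \<open>exp (- d)\<close>.
\<close>

primrec lik :: "nat \<Rightarrow> (nat \<Rightarrow> 'w) \<Rightarrow> ntree \<Rightarrow> bool \<Rightarrow> real" where
  "lik 0 \<omega> \<tau> x = 1 + sg x * leaf (\<omega> (root \<tau>))"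
| "lik (Suc T) \<omega> \<tau> x = (1 + sg x * mag (\<omega> (root \<tau>))) * exp (- d) *
     (\<Prod>t\<leftarrow>kids \<tau>. \<Sum>z\<in>UNIV. conn x z / 2 * lik T \<omega> t z)"

definition msg :: "nat \<Rightarrow> (nat \<Rightarrow> 'w) \<Rightarrow> ntree \<Rightarrow> bool \<Rightarrow> real" where
  "msg T \<omega> t x = (\<Sum>z\<in>UNIV. conn x z / 2 * lik T \<omega> t z)"

definition msgs :: "nat \<Rightarrow> (nat \<Rightarrow> 'w) \<Rightarrow> ntree list \<Rightarrow> bool \<Rightarrow> real" where
  "msgs T \<omega> ts x = (\<Prod>t\<leftarrow>ts. msg T \<omega> t x)"

lemma lik_Suc: "lik (Suc T) \<omega> (Node v ts) x = (1 + sg x * mag (\<omega> v)) * exp (- d) * msgs T \<omega> ts x"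
  by (simp add: msgs_def msg_def)

lemma msgs_Nil [simp]: "msgs T \<omega> [] x = 1"
  and msgs_Cons [simp]: "msgs T \<omega> (t # ts) x = msg T \<omega> t x * msgs T \<omega> ts x"
  by (simp_all add: msgs_def)

text \<open>An edge acts as the binary symmetric channel of \<open>scale th\<close>: the mixture
  maps the pair (1 + x, 1 - x) to (1 + th x, 1 - th x), and \<open>d / n\<close> factors
  out.\<close>

lemma msg_th:
  "msg T \<omega> t False = d / n * ((1 + th) / 2 * lik T \<omega> t False + (1 - th) / 2 * lik T \<omega> t True)"
  "msg T \<omega> t True = d / n * ((1 - th) / 2 * lik T \<omega> t False + (1 + th) / 2 * lik T \<omega> t True)"
proof -
  have 1: "d * ((1 + th) / 2) = a / 2" and 2: "d * ((1 - th) / 2) = b / 2"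
    using ab by (auto simp: d_def th_def field_simps)
  have *: "a / n / 2 = d / n * ((1 + th) / 2)" "b / n / 2 = d / n * ((1 - th) / 2)"
    using 1 2 by simp_all
  have "msg T \<omega> t False = a / n / 2 * lik T \<omega> t False + b / n / 2 * lik T \<omega> t True"
    "msg T \<omega> t True = b / n / 2 * lik T \<omega> t False + a / n / 2 * lik T \<omega> t True"
    by (auto simp: msg_def UNIV_bool conn_def)
  then show "msg T \<omega> t False = d / n * ((1 + th) / 2 * lik T \<omega> t False + (1 - th) / 2 * lik T \<omega> t True)"
    "msg T \<omega> t True = d / n * ((1 - th) / 2 * lik T \<omega> t False + (1 + th) / 2 * lik T \<omega> t True)"
    by (simp_all only: * distrib_left mult.assoc)
qed

lemma depends_on_lik: "names T \<tau> \<subseteq> A \<Longrightarrow> depends_on A (\<lambda>\<omega>. lik T \<omega> \<tau> x)"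
proof (induction T arbitrary: \<tau> x)
  case 0
  then show ?case by (auto intro!: depends_onI)
next
  case (Suc T)
  show ?case
  proof (rule depends_onI)
    fix \<omega> \<omega>' :: "nat \<Rightarrow> 'w" assume eq: "\<And>i. i \<in> A \<Longrightarrow> \<omega> i = \<omega>' i"
    have "map (\<lambda>t. \<Sum>z\<in>UNIV. conn x z / 2 * lik T \<omega> t z) (kids \<tau>) =
      map (\<lambda>t. \<Sum>z\<in>UNIV. conn x z / 2 * lik T \<omega>' t z) (kids \<tau>)"
    proof (rule map_cong[OF refl])
      fix t assume "t \<in> set (kids \<tau>)"
      then have "lik T \<omega> t z = lik T \<omega>' t z" for z
        using Suc.prems by (intro depends_onD[OF Suc.IH] eq) auto
      then show "(\<Sum>z\<in>UNIV. conn x z / 2 * lik T \<omega> t z) = (\<Sum>z\<in>UNIV. conn x z / 2 * lik T \<omega>' t z)" by simp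
    qed
    then show "lik (Suc T) \<omega> \<tau> x = lik (Suc T) \<omega>' \<tau> x"
      using eq Suc.prems by (simp only: lik.simps) auto
  qed
qed

lemma lik_cong: "(\<And>i. i \<in> names T \<tau> \<Longrightarrow> \<omega> i = \<omega>' i) \<Longrightarrow> lik T \<omega> \<tau> x = lik T \<omega>' \<tau> x"
  by (rule depends_onD[OF depends_on_lik[OF subset_refl]])

lemma msg_cong:
  assumes "\<And>i. i \<in> names T t \<Longrightarrow> \<omega> i = \<omega>' i"
  shows "msg T \<omega> t x = msg T \<omega>' t x"
  using lik_cong[of T t \<omega> \<omega>'] assms by (simp add: msg_def)

lemma msgs_cong:
  assumes "\<And>i. i \<in> (\<Union>t\<in>set ts. names T t) \<Longrightarrow> \<omega> i = \<omega>' i"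
  shows "msgs T \<omega> ts x = msgs T \<omega>' ts x"
  unfolding msgs_def
  by (rule arg_cong[where f = prod_list], rule map_cong[OF refl], rule msg_cong) (use assms in auto)

lemma measurable_lik: "names T \<tau> \<subseteq> {..<n} \<Longrightarrow> (\<lambda>\<omega>. lik T \<omega> \<tau> x) \<in> borel_measurable \<Omega>"
proof (induction T arbitrary: \<tau> x)
  case 0
  then have [measurable]: "root \<tau> \<in> {..<n}" by auto
  show ?case by simp
next
  case (Suc T)
  then have [measurable]: "root \<tau> \<in> {..<n}" by auto
  have "(\<lambda>\<omega>. \<Prod>t\<leftarrow>ts. \<Sum>z\<in>UNIV. conn x z / 2 * lik T \<omega> t z) \<in> borel_measurable \<Omega>"
    if "set ts \<subseteq> set (kids \<tau>)" for ts
    using that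
  proof (induction ts)
    case (Cons t ts)
    then have [measurable]: "(\<lambda>\<omega>. lik T \<omega> t z) \<in> borel_measurable \<Omega>" for z
      using Suc.prems by (intro Suc.IH) auto
    have [measurable]: "(\<lambda>\<omega>. \<Prod>t\<leftarrow>ts. \<Sum>z\<in>UNIV. conn x z / 2 * lik T \<omega> t z) \<in> borel_measurable \<Omega>"
      using Cons by auto
    show ?case by (simp only: list.map prod_list.Cons) measurable
  qed simp
  note [measurable] = this[OF subset_refl]
  show ?case unfolding lik.simps by measurable
qed

lemma measurable_msg: "names T t \<subseteq> {..<n} \<Longrightarrow> (\<lambda>\<omega>. msg T \<omega> t x) \<in> borel_measurable \<Omega>"
  unfolding msg_def by (intro borel_measurable_sum borel_measurable_times measurable_lik) auto

lemma measurable_msgs: "(\<Union>t\<in>set ts. names T t) \<subseteq> {..<n} \<Longrightarrow> (\<lambda>\<omega>. msgs T \<omega> ts x) \<in> borel_measurable \<Omega>"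
proof (induction ts)
  case (Cons t ts)
  then have [measurable]: "(\<lambda>\<omega>. msg T \<omega> t x) \<in> borel_measurable \<Omega>" "(\<lambda>\<omega>. msgs T \<omega> ts x) \<in> borel_measurable \<Omega>"
    by (auto intro: measurable_msg)
  show ?case by simp
qed simp

lemma nn_integral_msgs_Cons:
  assumes \<phi>: "homogeneous \<phi>"
    and t: "names T t \<subseteq> {..<n}" and ts: "(\<Union>t\<in>set ts. names T t) \<subseteq> {..<n}"
    and disj: "names T t \<inter> (\<Union>t\<in>set ts. names T t) = {}"
  shows "(\<integral>\<^sup>+\<omega>. \<phi> (msgs T \<omega> (t # ts) False) (msgs T \<omega> (t # ts) True) \<partial>\<Omega>) =
    (\<integral>\<^sup>+\<omega>'. (\<integral>\<^sup>+\<omega>. \<phi> (msg T \<omega>' t False * msgs T \<omega> ts False) (msg T \<omega>' t True * msgs T \<omega> ts True) \<partial>\<Omega>) \<partial>\<Omega>)"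
proof -
  note [measurable] = homogeneous_measurable[OF \<phi>] measurable_msg[OF t] measurable_msgs[OF ts]
  show ?thesis
    unfolding msgs_Cons
  proof (rule nn_integral_PiM_indep[OF _ _ _ _ _ disj])
    show "depends_on (names T t)
       (\<lambda>x. \<phi> (msg T x t False * msgs T y ts False) (msg T x t True * msgs T y ts True))" for y
      by (intro depends_onI arg_cong2[where f = \<phi>] arg_cong2[where f = "(*)"] refl msg_cong)
    show "depends_on (\<Union>t\<in>set ts. names T t)
       (\<lambda>y. \<phi> (msg T x t False * msgs T y ts False) (msg T x t True * msgs T y ts True))" for x
      by (intro depends_onI arg_cong2[where f = \<phi>] arg_cong2[where f = "(*)"] refl msgs_cong)
  qed (auto intro: N)
qed

text \<open>Integrating out the later siblings leaves a homogeneous test function of the first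
  message. This closes the induction over a forest.\<close>

lemma homogeneous_integral:
  assumes \<phi>: "homogeneous \<phi>" and r: "mlaw \<rho>"
  shows "homogeneous (\<lambda>p q. \<integral>\<^sup>+x. \<phi> (p * (1 + x)) (q * (1 - x)) \<partial>\<rho>)"
proof -
  note [measurable] = homogeneous_measurable[OF \<phi>]
  note [measurable_cong] = mlaw_sets[OF r]
  interpret prob_space \<rho> by (rule mlaw_prob[OF r])
  have "(\<lambda>(p, q). \<integral>\<^sup>+x. \<phi> (p * (1 + x)) (q * (1 - x)) \<partial>\<rho>) \<in> borel_measurable (borel \<Otimes>\<^sub>M borel)"
    by measurable
  moreover have "(\<integral>\<^sup>+x. \<phi> (c * p * (1 + x)) (c * q * (1 - x)) \<partial>\<rho>) =
    ennreal c * (\<integral>\<^sup>+x. \<phi> (p * (1 + x)) (q * (1 - x)) \<partial>\<rho>)" if "0 \<le> c" for c p q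
    by (simp add: mult.assoc homogeneousD[OF \<phi> that] nn_integral_cmult)
  ultimately show ?thesis by (simp add: homogeneous_def)
qed

text \<open>Induction over the siblings with an arbitrary test function. For a fixed first tree the
  sum over the remaining forest is bounded inside the integral, with the first message as a
  parameter of the test function; then the first tree itself is summed by \<open>IH\<close>. Each
  edge gives a factor \<open>d / n\<close>.\<close>

lemma forest_sum_le:
  assumes IH: "\<And>Z v \<psi>. v < n \<Longrightarrow> homogeneous \<psi> \<Longrightarrow>
      (\<Sum>\<tau>\<in>trees n k T Z v. \<integral>\<^sup>+\<omega>. \<psi> (lik T \<omega> \<tau> False) (lik T \<omega> \<tau> True) \<partial>\<Omega>) \<le> (\<integral>\<^sup>+x. \<psi> (1 + x) (1 - x) \<partial>\<rho>)"
    and r: "mlaw \<rho>" and ws: "distinct ws" "set ws \<subseteq> Z" "set ws \<subseteq> {..<n}" and \<phi>: "homogeneous \<phi>"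
  shows "(\<Sum>ts\<in>forests (trees n k T) (names T) Z ws. \<integral>\<^sup>+\<omega>. \<phi> (msgs T \<omega> ts False) (msgs T \<omega> ts True) \<partial>\<Omega>)
    \<le> ennreal ((d / n) ^ length ws) * (\<integral>\<^sup>+x. \<phi> (1 + x) (1 - x) \<partial>pow_law (scale th \<rho>) (length ws))"
  using ws \<phi>
proof (induction ws arbitrary: Z \<phi>)
  case Nil
  note [measurable] = homogeneous_measurable[OF Nil(4)]
  interpret prob_space \<Omega> by (rule prob_space_Omega)
  show ?case by (simp add: nn_integral_return emeasure_space_1)
next
  case (Cons w ws)
  note \<phi> = Cons.prems(4)
  note [measurable] = homogeneous_measurable[OF \<phi>]
  have mr: "mlaw (scale th \<rho>)" by (intro mlaw_scale r th_le)
  define \<sigma> where "\<sigma> = pow_law (scale th \<rho>) (length ws)"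
  have ms: "mlaw \<sigma>" unfolding \<sigma>_def by (intro mlaw_pow_law mr)
  note [measurable_cong] = mlaw_sets[OF ms]
  interpret s: prob_space \<sigma> by (rule mlaw_prob[OF ms])
  have dn: "0 \<le> d / n" using d_pos by simp
  \<comment> \<open>\<open>\<psi>\<close> averages over the later siblings; \<open>\<psi>'\<close>
    then composes it with the edge to the first child.\<close>
  define \<psi> where "\<psi> p q = (\<integral>\<^sup>+x. \<phi> (p * (1 + x)) (q * (1 - x)) \<partial>\<sigma>)" for p q
  have \<psi>: "homogeneous \<psi>" unfolding \<psi>_def by (rule homogeneous_integral[OF \<phi> ms])
  note [measurable] = homogeneous_measurable[OF \<psi>]
  define \<psi>' where "\<psi>' p q = \<psi> ((1 + th) / 2 * p + (1 - th) / 2 * q) ((1 - th) / 2 * p + (1 + th) / 2 * q)" for p q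
  have \<psi>': "homogeneous \<psi>'"
  proof -
    have "case_prod \<psi>' \<in> borel_measurable (borel \<Otimes>\<^sub>M borel)" unfolding \<psi>'_def by measurable
    moreover have "\<psi>' (c * x) (c * y) = ennreal c * \<psi>' x y" if "0 \<le> c" for c x y
      using homogeneousD[OF \<psi> that, of "(1 + th) / 2 * x + (1 - th) / 2 * y" "(1 - th) / 2 * x + (1 + th) / 2 * y"]
      unfolding \<psi>'_def by (simp add: distrib_left mult_ac)
    ultimately show ?thesis by (simp add: homogeneous_def)
  qed
  have tree: "(\<Sum>ts\<in>forests (trees n k T) (names T) (Z \<union> names T t) ws.
      \<integral>\<^sup>+\<omega>. \<phi> (msgs T \<omega> (t # ts) False) (msgs T \<omega> (t # ts) True) \<partial>\<Omega>) \<le>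
      ennreal ((d / n) ^ length (w # ws)) * (\<integral>\<^sup>+\<omega>. \<psi>' (lik T \<omega> t False) (lik T \<omega> t True) \<partial>\<Omega>)"
    if t: "t \<in> trees n k T Z w" for t
  proof -
    have nt: "names T t \<subseteq> {..<n}" using names_tree[OF t] Cons.prems by auto
    note [measurable] = measurable_msg[OF nt] measurable_lik[OF nt]
    interpret O: prob_space \<Omega> by (rule prob_space_Omega)
    have 1: "(\<integral>\<^sup>+\<omega>. \<phi> (msgs T \<omega> (t # ts) False) (msgs T \<omega> (t # ts) True) \<partial>\<Omega>) =
        (\<integral>\<^sup>+\<omega>'. (\<integral>\<^sup>+\<omega>. \<phi> (msg T \<omega>' t False * msgs T \<omega> ts False) (msg T \<omega>' t True * msgs T \<omega> ts True) \<partial>\<Omega>) \<partial>\<Omega>)"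
      and 2: "(\<Union>t\<in>set ts. names T t) \<subseteq> {..<n}"
      if ts: "ts \<in> forests (trees n k T) (names T) (Z \<union> names T t) ws" for ts
    proof -
      have *: "t # ts \<in> forests (trees n k T) (names T) Z (w # ws)" using t ts by auto
      note forest_ConsD(3)[OF * Cons.prems(1,2)]
      moreover have "(\<Union>t\<in>set ts. names T t) \<subseteq> set ws \<union> ({..<n} - (Z \<union> names T t))"
        by (rule names_forest[OF _ ts]) (rule names_tree)
      then show "(\<Union>t\<in>set ts. names T t) \<subseteq> {..<n}" using Cons.prems by auto
      ultimately show "(\<integral>\<^sup>+\<omega>. \<phi> (msgs T \<omega> (t # ts) False) (msgs T \<omega> (t # ts) True) \<partial>\<Omega>) =
        (\<integral>\<^sup>+\<omega>'. (\<integral>\<^sup>+\<omega>. \<phi> (msg T \<omega>' t False * msgs T \<omega> ts False) (msg T \<omega>' t True * msgs T \<omega> ts True) \<partial>\<Omega>) \<partial>\<Omega>)"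
        by (intro nn_integral_msgs_Cons \<phi> nt)
    qed
    have "(\<Sum>ts\<in>forests (trees n k T) (names T) (Z \<union> names T t) ws.
        \<integral>\<^sup>+\<omega>. \<phi> (msgs T \<omega> (t # ts) False) (msgs T \<omega> (t # ts) True) \<partial>\<Omega>) =
      (\<Sum>ts\<in>forests (trees n k T) (names T) (Z \<union> names T t) ws.
        (\<integral>\<^sup>+\<omega>'. (\<integral>\<^sup>+\<omega>. \<phi> (msg T \<omega>' t False * msgs T \<omega> ts False) (msg T \<omega>' t True * msgs T \<omega> ts True) \<partial>\<Omega>) \<partial>\<Omega>))"
      by (intro sum.cong refl 1)
    also have "\<dots> = (\<integral>\<^sup>+\<omega>'. (\<Sum>ts\<in>forests (trees n k T) (names T) (Z \<union> names T t) ws.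
        (\<integral>\<^sup>+\<omega>. \<phi> (msg T \<omega>' t False * msgs T \<omega> ts False) (msg T \<omega>' t True * msgs T \<omega> ts True) \<partial>\<Omega>)) \<partial>\<Omega>)"
    proof (rule nn_integral_sum[symmetric])
      fix ts assume "ts \<in> forests (trees n k T) (names T) (Z \<union> names T t) ws"
      note [measurable] = measurable_msgs[OF 2[OF this]]
      show "(\<lambda>\<omega>'. \<integral>\<^sup>+\<omega>. \<phi> (msg T \<omega>' t False * msgs T \<omega> ts False) (msg T \<omega>' t True * msgs T \<omega> ts True) \<partial>\<Omega>)
         \<in> borel_measurable \<Omega>" by measurable
    qed
    also have "\<dots> \<le> (\<integral>\<^sup>+\<omega>'. ennreal ((d / n) ^ length ws) * \<psi> (msg T \<omega>' t False) (msg T \<omega>' t True) \<partial>\<Omega>)"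
    proof (rule nn_integral_mono)
      fix \<omega>' :: "nat \<Rightarrow> 'w"
      show "(\<Sum>ts\<in>forests (trees n k T) (names T) (Z \<union> names T t) ws.
        (\<integral>\<^sup>+\<omega>. \<phi> (msg T \<omega>' t False * msgs T \<omega> ts False) (msg T \<omega>' t True * msgs T \<omega> ts True) \<partial>\<Omega>)) \<le>
        ennreal ((d / n) ^ length ws) * \<psi> (msg T \<omega>' t False) (msg T \<omega>' t True)"
        unfolding \<psi>_def \<sigma>_def
        by (rule Cons.IH[of "Z \<union> names T t" "\<lambda>p q. \<phi> (msg T \<omega>' t False * p) (msg T \<omega>' t True * q)"])
          (use Cons.prems in \<open>auto intro: homogeneous_mult \<phi>\<close>)
    qed
    also have "\<dots> = (\<integral>\<^sup>+\<omega>'. ennreal ((d / n) ^ length ws) * (ennreal (d / n) * \<psi>' (lik T \<omega>' t False) (lik T \<omega>' t True)) \<partial>\<Omega>)"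
      unfolding \<psi>'_def by (simp only: msg_th homogeneousD[OF \<psi> dn])
    also have "\<dots> = ennreal ((d / n) ^ length (w # ws)) * (\<integral>\<^sup>+\<omega>. \<psi>' (lik T \<omega> t False) (lik T \<omega> t True) \<partial>\<Omega>)"
    proof -
      note [measurable] = homogeneous_measurable[OF \<psi>']
      have "(\<lambda>\<omega>. \<psi>' (lik T \<omega> t False) (lik T \<omega> t True)) \<in> borel_measurable \<Omega>" by measurable
      moreover have "ennreal ((d / n) ^ length (w # ws)) = ennreal ((d / n) ^ length ws) * ennreal (d / n)"
        using dn by (simp add: ennreal_mult'[symmetric] mult.commute)
      ultimately show ?thesis by (simp add: nn_integral_cmult mult.assoc)
    qed
    finally show ?thesis .
  qed
  have "(\<Sum>ts\<in>forests (trees n k T) (names T) Z (w # ws). \<integral>\<^sup>+\<omega>. \<phi> (msgs T \<omega> ts False) (msgs T \<omega> ts True) \<partial>\<Omega>)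
     = (\<Sum>t\<in>trees n k T Z w. \<Sum>ts\<in>forests (trees n k T) (names T) (Z \<union> names T t) ws.
      \<integral>\<^sup>+\<omega>. \<phi> (msgs T \<omega> (t # ts) False) (msgs T \<omega> (t # ts) True) \<partial>\<Omega>)"
    by (rule sum_forests_Cons) (rule finite_trees)
  also have "\<dots> \<le> (\<Sum>t\<in>trees n k T Z w. ennreal ((d / n) ^ length (w # ws)) *
      (\<integral>\<^sup>+\<omega>. \<psi>' (lik T \<omega> t False) (lik T \<omega> t True) \<partial>\<Omega>))"
    by (intro sum_mono tree)
  also have "\<dots> = ennreal ((d / n) ^ length (w # ws)) *
      (\<Sum>t\<in>trees n k T Z w. \<integral>\<^sup>+\<omega>. \<psi>' (lik T \<omega> t False) (lik T \<omega> t True) \<partial>\<Omega>)"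
    by (rule sum_distrib_left[symmetric])
  also have "\<dots> \<le> ennreal ((d / n) ^ length (w # ws)) * (\<integral>\<^sup>+x. \<psi>' (1 + x) (1 - x) \<partial>\<rho>)"
    using Cons.prems by (intro mult_left_mono IH \<psi>') auto
  also have "(\<integral>\<^sup>+x. \<psi>' (1 + x) (1 - x) \<partial>\<rho>) = (\<integral>\<^sup>+x. \<psi> (1 + x) (1 - x) \<partial>scale th \<rho>)"
  proof -
    have "\<psi>' (1 + x) (1 - x) = \<psi> (1 + th * x) (1 - th * x)" for x
    proof -
      have "(1 + th) / 2 * (1 + x) + (1 - th) / 2 * (1 - x) = 1 + th * x"
        "(1 - th) / 2 * (1 + x) + (1 + th) / 2 * (1 - x) = 1 - th * x" by (simp_all add: field_simps)
      then show ?thesis by (simp only: \<psi>'_def)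
    qed
    then show ?thesis by (simp add: nn_integral_scale[OF r])
  qed
  also have "\<dots> = (\<integral>\<^sup>+x. \<phi> (1 + x) (1 - x) \<partial>pow_law (scale th \<rho>) (length (w # ws)))"
    by (simp add: nn_integral_star_likelihood[OF mr ms \<phi>, unfolded \<sigma>_def] \<psi>_def \<sigma>_def)
  finally show ?case .
qed

end

lemma sum_kid_sets_le:
  fixes g :: "nat \<Rightarrow> ennreal"
  shows "(\<Sum>C\<in>kid_sets n k Z v. g (card C)) \<le> (\<Sum>j\<le>k. of_nat (n choose j) * g j)"
proof -
  have "(\<Sum>C\<in>kid_sets n k Z v. g (card C)) = (\<Sum>j\<le>k. \<Sum>C\<in>{C \<in> kid_sets n k Z v. card C = j}. g (card C))"
    by (rule sum.group[symmetric]) (auto simp: finite_kid_sets kid_sets_def)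
  also have "\<dots> \<le> (\<Sum>j\<le>k. of_nat (n choose j) * g j)"
  proof (rule sum_mono)
    fix j
    have "(\<Sum>C\<in>{C \<in> kid_sets n k Z v. card C = j}. g (card C)) = of_nat (card {C \<in> kid_sets n k Z v. card C = j}) * g j"
      by simp
    also have "card {C \<in> kid_sets n k Z v. card C = j} \<le> card {C. C \<subseteq> {..<n} \<and> card C = j}"
      by (rule card_mono) (auto simp: kid_sets_def)
    then have "of_nat (card {C \<in> kid_sets n k Z v. card C = j}) * g j \<le> of_nat (n choose j) * g j"
      by (intro mult_right_mono) (auto simp: n_subsets)
    finally show "(\<Sum>C\<in>{C \<in> kid_sets n k Z v. card C = j}. g (card C)) \<le> of_nat (n choose j) * g j" .
  qed
  finally show ?thesis .
qed

lemma sum_le_nn_integral_pmf: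
  fixes S :: "nat \<Rightarrow> ennreal"
  shows "(\<Sum>j\<le>k. ennreal (pmf p j) * S j) \<le> (\<integral>\<^sup>+j. S j \<partial>measure_pmf p)"
  unfolding nn_integral_measure_pmf nn_integral_count_space_nat
  by (rule sum_le_suminf) auto

context tree_model
begin

abbreviation "W \<equiv> distr N borel mag"
abbreviation "L0 \<equiv> distr N borel leaf"

text \<open>Holds for every \<open>n\<close> and not only in the limit, because
  \<open>(n choose j) * (d / n) ^ j \<le> d ^ j / fact j\<close>: choosing distinct names only
  lowers the weight below that of a Poisson number of children. Truncating at \<open>k\<close> and
  avoiding \<open>Z\<close> lower it further.\<close>

lemma tree_sum_le:
  assumes "v < n" and "homogeneous \<phi>"
  shows "(\<Sum>\<tau>\<in>trees n k T Z v. \<integral>\<^sup>+\<omega>. \<phi> (lik T \<omega> \<tau> False) (lik T \<omega> \<tau> True) \<partial>\<Omega>) \<le>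
    (\<integral>\<^sup>+x. \<phi> (1 + x) (1 - x) \<partial>bp_law W d th L0 T)"
  using assms
proof (induction T arbitrary: Z v \<phi>)
  case 0
  note [measurable] = homogeneous_measurable[OF 0(2)]
  have "(\<integral>\<^sup>+\<omega>. \<phi> (1 + leaf (\<omega> v)) (1 - leaf (\<omega> v)) \<partial>\<Omega>) = (\<integral>\<^sup>+w. \<phi> (1 + leaf w) (1 - leaf w) \<partial>N)"
    using 0(1) by (intro nn_integral_PiM_component[where f = "\<lambda>w. \<phi> (1 + leaf w) (1 - leaf w)"]) (auto intro: N)
  also have "\<dots> = (\<integral>\<^sup>+x. \<phi> (1 + x) (1 - x) \<partial>L0)"
    by (rule nn_integral_distr[symmetric]) measurable
  finally show ?case by (simp add: bp_law_0 sg_def)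
next
  case (Suc T)
  note \<phi> = Suc.prems(2)
  note [measurable] = homogeneous_measurable[OF \<phi>]
  define \<rho> where "\<rho> = bp_law W d th L0 T"
  have r: "mlaw \<rho>" unfolding \<rho>_def by (intro mlaw_bp_law mlaw_mag mlaw_leaf th_le)
  define \<sigma> where "\<sigma> j = pow_law (scale th \<rho>) j" for j
  have ms: "mlaw (\<sigma> j)" for j unfolding \<sigma>_def by (intro mlaw_pow_law mlaw_scale r th_le)
  define S where "S j = (\<integral>\<^sup>+z. \<phi> (1 + z) (1 - z) \<partial>star W (\<sigma> j))" for j
  interpret O: prob_space \<Omega> by (rule prob_space_Omega)
  have kids: "(\<Sum>ts\<in>forests (trees n k T) (names T) (insert v Z \<union> C) (sorted_list_of_set C).
      \<integral>\<^sup>+\<omega>. \<phi> (lik (Suc T) \<omega> (Node v ts) False) (lik (Suc T) \<omega> (Node v ts) True) \<partial>\<Omega>) \<le>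
      ennreal (exp (- d)) * ennreal ((d / n) ^ card C) * S (card C)"
    (is "(\<Sum>ts\<in>?F. _) \<le> _") if C: "C \<in> kid_sets n k Z v" for C
  proof -
    have fC: "finite C" "C \<subseteq> {..<n}" "v \<notin> C" using C kid_setsD[OF C] by (auto simp: kid_sets_def)
    have 2: "(\<Union>t\<in>set ts. names T t) \<subseteq> {..<n} - {v}" if "ts \<in> ?F" for ts
    proof -
      have "(\<Union>t\<in>set ts. names T t) \<subseteq> set (sorted_list_of_set C) \<union> ({..<n} - (insert v Z \<union> C))"
        by (rule names_forest[OF _ that]) (rule names_tree)
      with fC show ?thesis by auto
    qed
    have 1: "(\<integral>\<^sup>+\<omega>. \<phi> (lik (Suc T) \<omega> (Node v ts) False) (lik (Suc T) \<omega> (Node v ts) True) \<partial>\<Omega>) =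
      ennreal (exp (- d)) * (\<integral>\<^sup>+\<omega>'. (\<integral>\<^sup>+\<omega>. \<phi> ((1 + mag (\<omega>' v)) * msgs T \<omega> ts False) ((1 - mag (\<omega>' v)) * msgs T \<omega> ts True) \<partial>\<Omega>) \<partial>\<Omega>)"
      if ts: "ts \<in> ?F" for ts
    proof -
      have nts: "(\<Union>t\<in>set ts. names T t) \<subseteq> {..<n}" using 2[OF ts] by auto
      note [measurable] = measurable_msgs[OF nts]
      have [measurable]: "v \<in> {..<n}" using Suc.prems by simp
      have "(\<integral>\<^sup>+\<omega>. \<phi> (lik (Suc T) \<omega> (Node v ts) False) (lik (Suc T) \<omega> (Node v ts) True) \<partial>\<Omega>) =
        (\<integral>\<^sup>+\<omega>. ennreal (exp (- d)) * \<phi> ((1 + mag (\<omega> v)) * msgs T \<omega> ts False) ((1 - mag (\<omega> v)) * msgs T \<omega> ts True) \<partial>\<Omega>)"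
        unfolding lik_Suc
        by (subst homogeneousD[OF \<phi>, symmetric]) (simp_all add: sg_def mult_ac)
      also have "\<dots> = ennreal (exp (- d)) *
         (\<integral>\<^sup>+\<omega>. \<phi> ((1 + mag (\<omega> v)) * msgs T \<omega> ts False) ((1 - mag (\<omega> v)) * msgs T \<omega> ts True) \<partial>\<Omega>)"
        by (rule nn_integral_cmult) measurable
      also have "(\<integral>\<^sup>+\<omega>. \<phi> ((1 + mag (\<omega> v)) * msgs T \<omega> ts False) ((1 - mag (\<omega> v)) * msgs T \<omega> ts True) \<partial>\<Omega>) =
         (\<integral>\<^sup>+\<omega>'. (\<integral>\<^sup>+\<omega>. \<phi> ((1 + mag (\<omega>' v)) * msgs T \<omega> ts False) ((1 - mag (\<omega>' v)) * msgs T \<omega> ts True) \<partial>\<Omega>) \<partial>\<Omega>)"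
      proof (rule nn_integral_PiM_indep[where A = "{v}" and B = "{..<n} - {v}"])
        show "depends_on {v} (\<lambda>x. \<phi> ((1 + mag (x v)) * msgs T y ts False) ((1 - mag (x v)) * msgs T y ts True))" for y
          by (auto intro!: depends_onI)
        show "depends_on ({..<n} - {v}) (\<lambda>y. \<phi> ((1 + mag (x v)) * msgs T y ts False) ((1 - mag (x v)) * msgs T y ts True))" for x
          using 2[OF ts] by (intro depends_onI arg_cong2[where f = \<phi>] arg_cong2[where f = "(*)"] refl msgs_cong) blast+
      qed (auto intro: N)
      finally show ?thesis .
    qed
    have "(\<Sum>ts\<in>?F. \<integral>\<^sup>+\<omega>. \<phi> (lik (Suc T) \<omega> (Node v ts) False) (lik (Suc T) \<omega> (Node v ts) True) \<partial>\<Omega>) =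
      (\<Sum>ts\<in>?F. ennreal (exp (- d)) * (\<integral>\<^sup>+\<omega>'. (\<integral>\<^sup>+\<omega>. \<phi> ((1 + mag (\<omega>' v)) * msgs T \<omega> ts False) ((1 - mag (\<omega>' v)) * msgs T \<omega> ts True) \<partial>\<Omega>) \<partial>\<Omega>))"
      by (intro sum.cong refl 1)
    also have "\<dots> = ennreal (exp (- d)) * (\<integral>\<^sup>+\<omega>'. (\<Sum>ts\<in>?F. \<integral>\<^sup>+\<omega>. \<phi> ((1 + mag (\<omega>' v)) * msgs T \<omega> ts False) ((1 - mag (\<omega>' v)) * msgs T \<omega> ts True) \<partial>\<Omega>) \<partial>\<Omega>)"
    proof (subst nn_integral_sum)
      fix ts assume ts: "ts \<in> ?F"
      have nts: "(\<Union>t\<in>set ts. names T t) \<subseteq> {..<n}" using 2[OF ts] by auto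
      note [measurable] = measurable_msgs[OF nts]
      have [measurable]: "v \<in> {..<n}" using Suc.prems by simp
      show "(\<lambda>\<omega>'. \<integral>\<^sup>+\<omega>. \<phi> ((1 + mag (\<omega>' v)) * msgs T \<omega> ts False) ((1 - mag (\<omega>' v)) * msgs T \<omega> ts True) \<partial>\<Omega>) \<in> borel_measurable \<Omega>"
        by measurable
    qed (simp add: sum_distrib_left)
    also have "\<dots> \<le> ennreal (exp (- d)) * (\<integral>\<^sup>+\<omega>'. ennreal ((d / n) ^ card C) *
       (\<integral>\<^sup>+x. \<phi> ((1 + mag (\<omega>' v)) * (1 + x)) ((1 - mag (\<omega>' v)) * (1 - x)) \<partial>\<sigma> (card C)) \<partial>\<Omega>)"
    proof (intro mult_left_mono nn_integral_mono)
      fix \<omega>' :: "nat \<Rightarrow> 'w"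
      show "(\<Sum>ts\<in>?F. \<integral>\<^sup>+\<omega>. \<phi> ((1 + mag (\<omega>' v)) * msgs T \<omega> ts False) ((1 - mag (\<omega>' v)) * msgs T \<omega> ts True) \<partial>\<Omega>) \<le>
         ennreal ((d / n) ^ card C) * (\<integral>\<^sup>+x. \<phi> ((1 + mag (\<omega>' v)) * (1 + x)) ((1 - mag (\<omega>' v)) * (1 - x)) \<partial>\<sigma> (card C))"
        using forest_sum_le[OF Suc.IH[folded \<rho>_def] r, of "sorted_list_of_set C" "insert v Z \<union> C"
          "\<lambda>p q. \<phi> ((1 + mag (\<omega>' v)) * p) ((1 - mag (\<omega>' v)) * q)"] fC
        by (auto simp: \<sigma>_def homogeneous_mult[OF \<phi>])
    qed simp
    also have "\<dots> = ennreal (exp (- d)) * ennreal ((d / n) ^ card C) * S (card C)"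
    proof -
      note [measurable_cong] = mlaw_sets[OF ms]
      interpret s: prob_space "\<sigma> j" for j by (rule mlaw_prob[OF ms])
      have [measurable]: "v \<in> {..<n}" using Suc.prems by simp
      let ?g = "\<lambda>m. \<integral>\<^sup>+x. \<phi> ((1 + m) * (1 + x)) ((1 - m) * (1 - x)) \<partial>\<sigma> (card C)"
      have [measurable]: "?g \<in> borel_measurable borel" by measurable
      have "(\<integral>\<^sup>+\<omega>'. ?g (mag (\<omega>' v)) \<partial>\<Omega>) = (\<integral>\<^sup>+w. ?g (mag w) \<partial>N)"
        using Suc.prems by (intro nn_integral_PiM_component[where f = "\<lambda>w. ?g (mag w)"]) (auto intro: N)
      also have "\<dots> = (\<integral>\<^sup>+m. ?g m \<partial>W)"
        by (rule nn_integral_distr[symmetric]) measurable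
      also have "\<dots> = S (card C)"
        unfolding S_def by (rule nn_integral_star_likelihood[OF mlaw_mag ms \<phi>, symmetric])
      finally show ?thesis by (subst nn_integral_cmult) (measurable, simp add: mult.assoc)
    qed
    finally show ?thesis .
  qed
  have "(\<Sum>\<tau>\<in>trees n k (Suc T) Z v. \<integral>\<^sup>+\<omega>. \<phi> (lik (Suc T) \<omega> \<tau> False) (lik (Suc T) \<omega> \<tau> True) \<partial>\<Omega>)
    \<le> (\<Sum>C\<in>kid_sets n k Z v. ennreal (exp (- d)) * ennreal ((d / n) ^ card C) * S (card C))"
    unfolding sum_trees_Suc by (intro sum_mono kids)
  also have "\<dots> \<le> (\<Sum>j\<le>k. of_nat (n choose j) * (ennreal (exp (- d)) * ennreal ((d / n) ^ j) * S j))"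
    by (rule sum_kid_sets_le)
  also have "\<dots> \<le> (\<Sum>j\<le>k. ennreal (pmf (poisson_pmf d) j) * S j)"
  proof (rule sum_mono)
    fix j
    have "real (n choose j) \<le> n ^ j / fact j"
      using binomial_fact_pow[of n j] by (simp add: le_divide_eq) (metis of_nat_fact of_nat_le_iff of_nat_mult of_nat_power)
    then have "real (n choose j) * (exp (- d) * (d / n) ^ j) \<le> n ^ j / fact j * (exp (- d) * (d / n) ^ j)"
      using d_pos by (intro mult_right_mono) auto
    also have "\<dots> = pmf (poisson_pmf d) j"
      using d_pos n by (simp add: power_divide)
    finally have "ennreal (real (n choose j) * (exp (- d) * (d / n) ^ j)) \<le> ennreal (pmf (poisson_pmf d) j)"
      by (rule ennreal_leI)
    then have "of_nat (n choose j) * (ennreal (exp (- d)) * ennreal ((d / n) ^ j)) \<le> ennreal (pmf (poisson_pmf d) j)"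
      using d_pos by (simp add: ennreal_mult ennreal_of_nat_eq_real_of_nat del: pmf_poisson)
    then show "of_nat (n choose j) * (ennreal (exp (- d)) * ennreal ((d / n) ^ j) * S j) \<le> ennreal (pmf (poisson_pmf d) j) * S j"
      by (subst mult.assoc[symmetric]) (rule mult_right_mono, simp_all add: mult.assoc)
  qed
  also have "\<dots> \<le> (\<integral>\<^sup>+j. S j \<partial>measure_pmf (poisson_pmf d))"
    by (rule sum_le_nn_integral_pmf)
  also have "\<dots> = (\<integral>\<^sup>+x. \<phi> (1 + x) (1 - x) \<partial>bp_law W d th L0 (Suc T))"
    unfolding bp_law_Suc \<rho>_def[symmetric] S_def \<sigma>_def
    by (rule nn_integral_bp_step[OF mlaw_mag th_le r, symmetric]) measurable
  finally show ?case .
qed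

end

section \<open>The trees of bounded degree carry almost all mass\<close>

primrec tree_weight :: "real \<Rightarrow> nat \<Rightarrow> nat \<Rightarrow> ntree \<Rightarrow> real" where
  "tree_weight d n 0 \<tau> = 1"
| "tree_weight d n (Suc T) \<tau> = exp (- d) * (\<Prod>t\<leftarrow>kids \<tau>. d / n * tree_weight d n T t)"

lemma tree_weight_nonneg: "0 \<le> d \<Longrightarrow> 0 \<le> tree_weight d n T \<tau>"
  by (induction T arbitrary: \<tau>) (auto intro!: mult_nonneg_nonneg prod_list_nonneg)

text \<open>Every earlier sibling adds at most \<open>tree_size_bound k T\<close> names, so the
  forbidden set keeps at most \<open>M\<close> elements and the bound \<open>r\<close> applies to
  each subtree.\<close>

lemma forest_weight_ge:
  assumes d: "0 \<le> d" and r: "0 \<le> r"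
    and tree: "\<And>Z w. finite Z \<Longrightarrow> card Z \<le> M \<Longrightarrow> r \<le> (\<Sum>\<tau>\<in>trees n k T Z w. tree_weight d n T \<tau>)"
    and Z: "finite Z" "card Z + length ws * tree_size_bound k T \<le> M"
  shows "(d / n * r) ^ length ws \<le> (\<Sum>ts\<in>forests (trees n k T) (names T) Z ws. \<Prod>t\<leftarrow>ts. d / n * tree_weight d n T t)"
  using Z
proof (induction ws arbitrary: Z)
  case (Cons w ws)
  have "(d / n * r) ^ length (w # ws) = d / n * r * (d / n * r) ^ length ws" by simp
  also have "\<dots> \<le> d / n * (\<Sum>t\<in>trees n k T Z w. tree_weight d n T t) * (d / n * r) ^ length ws"
    using Cons.prems d r by (intro mult_right_mono mult_left_mono tree) auto
  also have "\<dots> = (\<Sum>t\<in>trees n k T Z w. d / n * tree_weight d n T t * (d / n * r) ^ length ws)"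
    by (simp add: sum_distrib_left sum_distrib_right)
  also have "\<dots> \<le> (\<Sum>t\<in>trees n k T Z w. d / n * tree_weight d n T t *
      (\<Sum>ts\<in>forests (trees n k T) (names T) (Z \<union> names T t) ws. \<Prod>t\<leftarrow>ts. d / n * tree_weight d n T t))"
  proof (intro sum_mono mult_left_mono Cons.IH)
    fix t assume t: "t \<in> trees n k T Z w"
    show "finite (Z \<union> names T t)" using Cons.prems by (simp add: finite_names)
    have "card (Z \<union> names T t) \<le> card Z + tree_size_bound k T"
      using card_Un_le[of Z "names T t"] card_names_tree[OF t] by simp
    then show "card (Z \<union> names T t) + length ws * tree_size_bound k T \<le> M" using Cons.prems by simp
    show "0 \<le> d / n * tree_weight d n T t" using d by (intro mult_nonneg_nonneg tree_weight_nonneg) auto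
  qed
  also have "\<dots> = (\<Sum>ts\<in>forests (trees n k T) (names T) Z (w # ws). \<Prod>t\<leftarrow>ts. d / n * tree_weight d n T t)"
    by (subst sum_forests_Cons) (simp_all add: finite_trees sum_distrib_left)
  finally show ?case .
qed simp

text \<open>Each of the \<open>j\<close> factors of the falling factorial of \<open>m\<close> is at
  least \<open>m - j\<close>.\<close>

lemma binomial_ge_power_div_fact:
  assumes "j \<le> m"
  shows "real (m - j) ^ j / fact j \<le> real (m choose j)"
proof -
  have "(m - j) ^ i \<le> (m choose i) * fact i" if "i \<le> j" for i
    using that
  proof (induction i)
    case (Suc i)
    have "Suc i * (m choose Suc i) = (m choose i) * (m - i)"
    proof (cases m)
      case (Suc m')
      then show ?thesis using Suc_times_binomial[of i m'] binomial_absorb_comp[of m i] by (simp add: mult.commute)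
    qed simp
    moreover have "(m choose Suc i) * fact (Suc i) = (Suc i * (m choose Suc i)) * fact i"
      by (simp only: fact_Suc of_nat_id mult_ac)
    ultimately have "(m choose Suc i) * fact (Suc i) = (m choose i) * fact i * (m - i)"
      by (simp only: mult_ac)
    moreover have "(m - j) ^ i * (m - j) \<le> (m choose i) * fact i * (m - i)"
      using Suc by (intro mult_mono) auto
    ultimately show ?case by (simp add: mult.commute)
  qed simp
  then have "(m - j) ^ j \<le> (m choose j) * fact j" by simp
  then have "real ((m - j) ^ j) \<le> real ((m choose j) * fact j)" by (rule of_nat_mono)
  then show ?thesis by (simp add: divide_le_eq)
qed

lemma sum_kid_sets:
  fixes g :: "nat \<Rightarrow> real"
  shows "(\<Sum>C\<in>kid_sets n k Z v. g (card C)) = (\<Sum>j\<le>k. (card ({..<n} - insert v Z) choose j) * g j)"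
proof -
  have "(\<Sum>C\<in>kid_sets n k Z v. g (card C)) = (\<Sum>j\<le>k. \<Sum>C\<in>{C \<in> kid_sets n k Z v. card C = j}. g (card C))"
    by (rule sum.group[symmetric]) (auto simp: finite_kid_sets kid_sets_def)
  also have "\<dots> = (\<Sum>j\<le>k. (card ({..<n} - insert v Z) choose j) * g j)"
  proof (rule sum.cong[OF refl])
    fix j assume "j \<in> {..k}"
    then have "{C \<in> kid_sets n k Z v. card C = j} = {C. C \<subseteq> {..<n} - insert v Z \<and> card C = j}"
      by (auto simp: kid_sets_def)
    then have "card {C \<in> kid_sets n k Z v. card C = j} = card ({..<n} - insert v Z) choose j"
      by (simp add: n_subsets)
    then show "(\<Sum>C\<in>{C \<in> kid_sets n k Z v. card C = j}. g (card C)) = (card ({..<n} - insert v Z) choose j) * g j"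
      by simp
  qed
  finally show ?thesis .
qed

text \<open>The degree bound \<open>k\<close> is fixed before \<open>n\<close>. The forbidden set
  may have any bounded size, since the induction enlarges it by the names already used. Three losses
  are made small in turn: the tail of the Poisson series, a factor \<open>r\<close> per subtree, and
  the excluded names.\<close>

lemma tree_mass:
  assumes d: "0 < d" and \<epsilon>: "0 < \<epsilon>"
  shows "\<exists>k0. \<forall>k\<ge>k0. \<forall>M. \<exists>n0. \<forall>n\<ge>n0. \<forall>Z v. finite Z \<longrightarrow> card Z \<le> M \<longrightarrow>
    1 - \<epsilon> \<le> (\<Sum>\<tau>\<in>trees n k T Z v. tree_weight d n T \<tau>)"
  using \<epsilon>
proof (induction T arbitrary: \<epsilon>)
  case 0
  then show ?case by auto
next
  case (Suc T)
  have "(\<lambda>j. pmf (poisson_pmf d) j) sums 1"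
  proof -
    have "(\<lambda>j. inverse (fact j) * d ^ j) sums exp d" using exp_converges[of d] by (simp add: scaleR_conv_of_real)
    from sums_mult2[OF this, of "exp (- d)"] show ?thesis
      using d by (simp add: exp_minus field_simps)
  qed
  then have "(\<lambda>K. \<Sum>j<K. pmf (poisson_pmf d) j) \<longlonglongrightarrow> 1" by (simp add: sums_def)
  then have "eventually (\<lambda>K. 1 - \<epsilon> < (\<Sum>j<K. pmf (poisson_pmf d) j)) sequentially"
    using Suc.prems by (intro order_tendstoD) auto
  then obtain k1 where k1: "1 - \<epsilon> < (\<Sum>j<k1. pmf (poisson_pmf d) j)"
    by (auto simp: eventually_sequentially)
  have "((\<lambda>r. \<Sum>j<k1. pmf (poisson_pmf d) j * r ^ j) \<longlongrightarrow> (\<Sum>j<k1. pmf (poisson_pmf d) j * 1 ^ j)) (at_left 1)"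
    by (intro tendsto_intros)
  then have "eventually (\<lambda>r. 1 - \<epsilon> < (\<Sum>j<k1. pmf (poisson_pmf d) j * r ^ j)) (at_left 1)"
    using k1 by (intro order_tendstoD) (auto simp del: pmf_poisson)
  moreover have "eventually (\<lambda>r::real. r \<in> {0<..<1}) (at_left 1)" by (rule eventually_at_left_real) simp
  ultimately have "eventually (\<lambda>r. 1 - \<epsilon> < (\<Sum>j<k1. pmf (poisson_pmf d) j * r ^ j) \<and> r \<in> {0<..<1}) (at_left 1)"
    by (rule eventually_conj)
  then obtain r where r: "1 - \<epsilon> < (\<Sum>j<k1. pmf (poisson_pmf d) j * r ^ j)" "0 < r" "r < 1"
    using eventually_happens[of _ "at_left (1::real)"] by (auto simp: trivial_limit_at_left_real)
  obtain k0 where k0: "\<And>k M. k \<ge> k0 \<Longrightarrow> \<exists>n0. \<forall>n\<ge>n0. \<forall>Z v. finite Z \<longrightarrow> card Z \<le> M \<longrightarrow>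
    1 - (1 - r) \<le> (\<Sum>\<tau>\<in>trees n k T Z v. tree_weight d n T \<tau>)"
    using Suc.IH[of "1 - r"] r by auto
  show ?case
  proof (rule exI[of _ "max k0 k1"], intro allI impI)
    fix k M :: nat assume k: "k \<ge> max k0 k1"
    \<comment> \<open>A bound for the forbidden set at the last subtree: \<open>Z\<close>, the root,
      all siblings and the subtrees chosen before.\<close>
    define M' where "M' = M + 1 + k + k * tree_size_bound k T"
    from k have "k \<ge> k0" by simp
    from k0[OF this, of M'] obtain n1 where n1: "\<And>n Z v. n \<ge> n1 \<Longrightarrow> finite Z \<Longrightarrow> card Z \<le> M' \<Longrightarrow>
        r \<le> (\<Sum>\<tau>\<in>trees n k T Z v. tree_weight d n T \<tau>)" by auto
    \<comment> \<open>The last factor accounts for the at most \<open>M + 1\<close> excluded names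
      and for the falling factorial; it tends to 1.\<close>
    define f where "f n = (\<Sum>j<k1. pmf (poisson_pmf d) j * r ^ j * (1 - real (M + 1 + j) / real n) ^ j)" for n
    have "f \<longlonglongrightarrow> (\<Sum>j<k1. pmf (poisson_pmf d) j * r ^ j * (1 - 0) ^ j)"
      unfolding f_def by (intro tendsto_intros lim_const_over_n)
    then have "eventually (\<lambda>n. 1 - \<epsilon> < f n) sequentially"
      using r by (intro order_tendstoD) (auto simp del: pmf_poisson)
    then obtain n2 where n2: "\<And>n. n \<ge> n2 \<Longrightarrow> 1 - \<epsilon> < f n" by (auto simp: eventually_sequentially)
    show "\<exists>n0. \<forall>n\<ge>n0. \<forall>Z v. finite Z \<longrightarrow> card Z \<le> M \<longrightarrow>
       1 - \<epsilon> \<le> (\<Sum>\<tau>\<in>trees n k (Suc T) Z v. tree_weight d n (Suc T) \<tau>)"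
    proof (intro exI[of _ "max (max n1 n2) (M + 1 + k1)"] allI impI)
      fix n :: nat and Z :: "nat set" and v :: nat assume n: "n \<ge> max (max n1 n2) (M + 1 + k1)" and Z: "finite Z" "card Z \<le> M"
      define m where "m = card ({..<n} - insert v Z)"
      have "card {..<n} - card (insert v Z) \<le> m"
        unfolding m_def using Z by (intro diff_card_le_card_Diff) auto
      moreover have "card (insert v Z) \<le> M + 1" using Z by (simp add: card_insert_if)
      ultimately have m: "n - (M + 1) \<le> m" by simp
      have "1 - \<epsilon> \<le> f n" using n2[of n] n by simp
      also have "f n \<le> (\<Sum>j<k1. (m choose j) * (exp (- d) * (d / n * r) ^ j))"
        unfolding f_def
      proof (rule sum_mono)
        fix j assume "j \<in> {..<k1}"
        then have j: "M + 1 + j \<le> n" "j \<le> m" using n m by auto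
        have npos: "0 < n" using n by simp
        have "real (n - (M + 1 + j)) ^ j / fact j \<le> real (m - j) ^ j / fact j"
          using m by (intro divide_right_mono power_mono) auto
        also have "\<dots> \<le> real (m choose j)" by (rule binomial_ge_power_div_fact[OF j(2)])
        finally have le: "real (n - (M + 1 + j)) ^ j / fact j \<le> real (m choose j)" .
        have "pmf (poisson_pmf d) j * r ^ j * (1 - real (M + 1 + j) / real n) ^ j =
          real (n - (M + 1 + j)) ^ j / fact j * (exp (- d) * (d / n * r) ^ j)"
        proof -
          have "1 - real (M + 1 + j) / real n = real (n - (M + 1 + j)) / n"
            using npos j by (simp add: of_nat_diff field_simps)
          then show ?thesis using d npos by (simp add: power_divide power_mult_distrib)
        qed
        also have "\<dots> \<le> (m choose j) * (exp (- d) * (d / n * r) ^ j)"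
          using le d r by (intro mult_right_mono) auto
        finally show "pmf (poisson_pmf d) j * r ^ j * (1 - real (M + 1 + j) / real n) ^ j \<le>
          (m choose j) * (exp (- d) * (d / n * r) ^ j)" .
      qed
      also have "\<dots> \<le> (\<Sum>j\<le>k. (m choose j) * (exp (- d) * (d / n * r) ^ j))"
        using k d r by (intro sum_mono2) auto
      also have "\<dots> = (\<Sum>C\<in>kid_sets n k Z v. exp (- d) * (d / n * r) ^ card C)"
        unfolding m_def by (rule sum_kid_sets[symmetric])
      also have "\<dots> \<le> (\<Sum>C\<in>kid_sets n k Z v. exp (- d) *
        (\<Sum>ts\<in>forests (trees n k T) (names T) (insert v Z \<union> C) (sorted_list_of_set C). \<Prod>t\<leftarrow>ts. d / n * tree_weight d n T t))"
      proof (intro sum_mono mult_left_mono)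
        fix C assume C: "C \<in> kid_sets n k Z v"
        have fC: "finite C" "card C \<le> k" using kid_setsD[OF C] C by (auto simp: kid_sets_def)
        have "card (insert v Z \<union> C) + length (sorted_list_of_set C) * tree_size_bound k T \<le> M'"
        proof -
          have "card (insert v Z \<union> C) \<le> M + 1 + k"
            using card_Un_le[of "insert v Z" C] fC Z by (simp add: card_insert_if split: if_splits)
          moreover have "card C * tree_size_bound k T \<le> k * tree_size_bound k T" using fC by (intro mult_right_mono) auto
          ultimately show ?thesis unfolding M'_def length_sorted_list_of_set by linarith
        qed
        then show "(d / n * r) ^ card C \<le>
          (\<Sum>ts\<in>forests (trees n k T) (names T) (insert v Z \<union> C) (sorted_list_of_set C). \<Prod>t\<leftarrow>ts. d / n * tree_weight d n T t)"
          using forest_weight_ge[where d = d and r = r and M = M' and n = n and k = k and T = T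
            and Z = "insert v Z \<union> C" and ws = "sorted_list_of_set C"] n1[of n] n d r fC Z
          by simp
      qed simp
      also have "\<dots> = (\<Sum>\<tau>\<in>trees n k (Suc T) Z v. tree_weight d n (Suc T) \<tau>)"
        unfolding sum_trees_Suc by (simp add: sum_distrib_left)
      finally show "1 - \<epsilon> \<le> (\<Sum>\<tau>\<in>trees n k (Suc T) Z v. tree_weight d n (Suc T) \<tau>)" .
    qed
  qed
qed

context tree_model
begin

lemma lik_nonneg: "0 \<le> lik T \<omega> \<tau> x"
proof (induction T arbitrary: \<tau> x)
  case 0
  show ?case using leaf_le[of "\<omega> (root \<tau>)"] by (auto simp: sg_def)
next
  case (Suc T)
  have "0 \<le> (1 + sg x * mag (\<omega> (root \<tau>)))" using mag_le[of "\<omega> (root \<tau>)"] by (auto simp: sg_def)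
  then show ?case using a b Suc
    by (auto intro!: mult_nonneg_nonneg prod_list_nonneg sum_nonneg divide_nonneg_nonneg simp: conn_def)
qed

lemma msg_nonneg: "0 \<le> msg T \<omega> t x"
  unfolding msg_def using a b lik_nonneg by (auto intro!: sum_nonneg mult_nonneg_nonneg simp: conn_def)

lemma msgs_nonneg: "0 \<le> msgs T \<omega> ts x"
  by (induction ts) (auto intro!: mult_nonneg_nonneg msg_nonneg)

lemma homogeneous_proj: "homogeneous (\<lambda>p q. ennreal (if x then q else p))"
  by (cases x) (auto simp: homogeneous_def ennreal_mult')

lemma mlaw_integral_sign:
  assumes "mlaw (distr N borel f)" and [measurable]: "f \<in> borel_measurable N"
  shows "(\<integral>\<^sup>+w. ennreal (1 + sg x * f w) \<partial>N) = 1"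
proof -
  have "(\<integral>\<^sup>+y. ennreal (1 + sg x * y) \<partial>distr N borel f) = 1"
    by (rule nn_integral_one_plus[OF assms(1)]) simp
  then show ?thesis by (simp add: nn_integral_distr)
qed

text \<open>Averaged over the observations, the factors \<open>1 + sg x * mag\<close> and
  \<open>1 + sg x * leaf\<close> become 1 since posterior means are centred, and every edge gives (a
  / n + b / n) / 2 = d / n. So \<open>tree_weight\<close> is the mean likelihood, the same for both
  labels.\<close>

lemma nn_integral_lik:
  assumes "\<tau> \<in> trees n k T Z v" "v < n"
  shows "(\<integral>\<^sup>+\<omega>. ennreal (lik T \<omega> \<tau> x) \<partial>\<Omega>) = ennreal (tree_weight d n T \<tau>)"
  using assms
proof (induction T arbitrary: Z v \<tau> x)
  case 0
  then have "(\<integral>\<^sup>+\<omega>. ennreal (1 + sg x * leaf (\<omega> v)) \<partial>\<Omega>) = (\<integral>\<^sup>+w. ennreal (1 + sg x * leaf w) \<partial>N)"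
    by (intro nn_integral_PiM_component[where f = "\<lambda>w. ennreal (1 + sg x * leaf w)"]) (auto intro: N)
  then show ?case using 0 by (simp add: mlaw_integral_sign[OF mlaw_leaf])
next
  case (Suc T)
  interpret O: prob_space \<Omega> by (rule prob_space_Omega)
  have msg: "(\<integral>\<^sup>+\<omega>. ennreal (msg T \<omega> t x) \<partial>\<Omega>) = ennreal (d / n * tree_weight d n T t)"
    if t: "t \<in> trees n k T Z w" "w < n" for t Z w x
  proof -
    have nt: "names T t \<subseteq> {..<n}" using names_tree[OF t(1)] t(2) by auto
    note [measurable] = measurable_lik[OF nt]
    have "(\<integral>\<^sup>+\<omega>. ennreal (msg T \<omega> t x) \<partial>\<Omega>) =
      (\<integral>\<^sup>+\<omega>. ennreal (conn x False / 2) * ennreal (lik T \<omega> t False) + ennreal (conn x True / 2) * ennreal (lik T \<omega> t True) \<partial>\<Omega>)"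
    proof (rule nn_integral_cong)
      fix \<omega>
      have "msg T \<omega> t x = conn x False / 2 * lik T \<omega> t False + conn x True / 2 * lik T \<omega> t True"
        by (simp add: msg_def UNIV_bool)
      moreover have "0 \<le> conn x z / 2" for z using a b by (auto simp: conn_def)
      ultimately show "ennreal (msg T \<omega> t x) =
        ennreal (conn x False / 2) * ennreal (lik T \<omega> t False) + ennreal (conn x True / 2) * ennreal (lik T \<omega> t True)"
        using lik_nonneg by (simp only: ennreal_mult[symmetric] ennreal_plus[symmetric] mult_nonneg_nonneg)
    qed
    also have "\<dots> = ennreal (conn x False / 2) * ennreal (tree_weight d n T t) + ennreal (conn x True / 2) * ennreal (tree_weight d n T t)"
      by (subst nn_integral_add) (measurable, simp add: nn_integral_cmult Suc.IH[OF t])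
    also have "\<dots> = ennreal ((conn x False / 2 + conn x True / 2) * tree_weight d n T t)"
    proof -
      have "0 \<le> conn x z / 2 * tree_weight d n T t" for z
        using a b d_pos by (intro mult_nonneg_nonneg tree_weight_nonneg) (auto simp: conn_def)
      moreover have "0 \<le> conn x z / 2" for z using a b by (auto simp: conn_def)
      ultimately show ?thesis by (simp add: distrib_right ennreal_mult'[symmetric])
    qed
    also have "conn x False / 2 + conn x True / 2 = d / n"
      by (auto simp: conn_def d_def add_divide_distrib)
    finally show ?thesis .
  qed
  have forest: "(\<integral>\<^sup>+\<omega>. ennreal (msgs T \<omega> ts x) \<partial>\<Omega>) = ennreal (\<Prod>t\<leftarrow>ts. d / n * tree_weight d n T t)"
    if "ts \<in> forests (trees n k T) (names T) Z ws" "distinct ws" "set ws \<subseteq> Z" "set ws \<subseteq> {..<n}" for ts Z ws x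
    using that
  proof (induction ws arbitrary: ts Z)
    case Nil
    then show ?case by (simp add: O.emeasure_space_1)
  next
    case (Cons w ws)
    then obtain t ts' where ts: "ts = t # ts'" by auto
    note * = forest_ConsD[OF Cons.prems(1)[unfolded ts] Cons.prems(2,3)]
    have nt: "names T t \<subseteq> {..<n}" using names_tree[OF *(1)] Cons.prems by auto
    have "(\<Union>t\<in>set ts'. names T t) \<subseteq> set ws \<union> ({..<n} - (Z \<union> names T t))"
      by (rule names_forest[OF _ *(2)]) (rule names_tree)
    then have nts: "(\<Union>t\<in>set ts'. names T t) \<subseteq> {..<n}" using Cons.prems by auto
    note [measurable] = measurable_msg[OF nt] measurable_msgs[OF nts]
    have "(\<integral>\<^sup>+\<omega>. ennreal (msgs T \<omega> ts x) \<partial>\<Omega>) =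
      (\<integral>\<^sup>+\<omega>'. (\<integral>\<^sup>+\<omega>. ennreal (msg T \<omega>' t x * msgs T \<omega> ts' x) \<partial>\<Omega>) \<partial>\<Omega>)"
      using nn_integral_msgs_Cons[OF homogeneous_proj nt nts *(3), of x] unfolding ts by (cases x) simp_all
    also have "\<dots> = (\<integral>\<^sup>+\<omega>'. ennreal (msg T \<omega>' t x) * (\<integral>\<^sup>+\<omega>. ennreal (msgs T \<omega> ts' x) \<partial>\<Omega>) \<partial>\<Omega>)"
      by (simp add: ennreal_mult' msg_nonneg nn_integral_cmult)
    also have "\<dots> = ennreal (d / n * tree_weight d n T t) * (\<integral>\<^sup>+\<omega>. ennreal (msgs T \<omega> ts' x) \<partial>\<Omega>)"
      using Cons.prems by (subst nn_integral_multc) (measurable, simp add: msg[OF *(1)])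
    also have "(\<integral>\<^sup>+\<omega>. ennreal (msgs T \<omega> ts' x) \<partial>\<Omega>) = ennreal (\<Prod>t\<leftarrow>ts'. d / n * tree_weight d n T t)"
      using Cons.prems by (intro Cons.IH[OF *(2)]) auto
    also have "ennreal (d / n * tree_weight d n T t) * \<dots> = ennreal (\<Prod>t\<leftarrow>ts. d / n * tree_weight d n T t)"
    proof -
      have "0 \<le> d / n * tree_weight d n T t" using d_pos by (intro mult_nonneg_nonneg tree_weight_nonneg) auto
      then show ?thesis unfolding ts list.map prod_list.Cons by (rule ennreal_mult'[symmetric])
    qed
    finally show ?case .
  qed
  obtain C ts where C: "C \<in> kid_sets n k Z v" and \<tau>: "\<tau> = Node v ts"
    and ts: "ts \<in> forests (trees n k T) (names T) (insert v Z \<union> C) (sorted_list_of_set C)"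
    using Suc.prems by auto
  have fC: "finite C" "C \<subseteq> {..<n}" "v \<notin> C" using C kid_setsD[OF C] by (auto simp: kid_sets_def)
  have "(\<Union>t\<in>set ts. names T t) \<subseteq> set (sorted_list_of_set C) \<union> ({..<n} - (insert v Z \<union> C))"
    by (rule names_forest[OF _ ts]) (rule names_tree)
  with fC have nts: "(\<Union>t\<in>set ts. names T t) \<subseteq> {..<n} - {v}" by auto
  then have [measurable]: "(\<lambda>\<omega>. msgs T \<omega> ts x) \<in> borel_measurable \<Omega>" by (intro measurable_msgs) auto
  have [measurable]: "v \<in> {..<n}" using Suc.prems by simp
  have m: "0 \<le> 1 + sg x * mag w" for w using mag_le[of w] by (auto simp: sg_def)
  have "(\<integral>\<^sup>+\<omega>. ennreal (lik (Suc T) \<omega> \<tau> x) \<partial>\<Omega>) =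
    (\<integral>\<^sup>+\<omega>. ennreal ((1 + sg x * mag (\<omega> v)) * exp (- d)) * ennreal (msgs T \<omega> ts x) \<partial>\<Omega>)"
    unfolding \<tau> lik_Suc using m by (intro nn_integral_cong) (simp add: ennreal_mult')
  also have "\<dots> = (\<integral>\<^sup>+\<omega>. ennreal ((1 + sg x * mag (\<omega> v)) * exp (- d)) \<partial>\<Omega>) * (\<integral>\<^sup>+\<omega>. ennreal (msgs T \<omega> ts x) \<partial>\<Omega>)"
  proof (rule nn_integral_PiM_indep_mult[where A = "{v}" and B = "{..<n} - {v}"])
    show "depends_on ({..<n} - {v}) (\<lambda>\<omega>. ennreal (msgs T \<omega> ts x))"
      using nts by (intro depends_onI arg_cong[where f = ennreal] msgs_cong) blast
  qed (auto intro: N depends_onI)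
  also have "(\<integral>\<^sup>+\<omega>. ennreal ((1 + sg x * mag (\<omega> v)) * exp (- d)) \<partial>\<Omega>) = ennreal (exp (- d))"
  proof -
    have "(\<integral>\<^sup>+\<omega>. ennreal ((1 + sg x * mag (\<omega> v)) * exp (- d)) \<partial>\<Omega>) = (\<integral>\<^sup>+w. ennreal ((1 + sg x * mag w) * exp (- d)) \<partial>N)"
      using Suc.prems by (intro nn_integral_PiM_component[where f = "\<lambda>w. ennreal ((1 + sg x * mag w) * exp (- d))"]) (auto intro: N)
    also have "\<dots> = (\<integral>\<^sup>+w. ennreal (1 + sg x * mag w) \<partial>N) * ennreal (exp (- d))"
      by (simp add: ennreal_mult'' nn_integral_multc)
    finally show ?thesis by (simp add: mlaw_integral_sign[OF mlaw_mag])
  qed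
  also have "(\<integral>\<^sup>+\<omega>. ennreal (msgs T \<omega> ts x) \<partial>\<Omega>) = ennreal (\<Prod>t\<leftarrow>ts. d / n * tree_weight d n T t)"
    using fC by (intro forest[OF ts]) auto
  finally show ?case unfolding \<tau> by (simp add: ennreal_mult')
qed

end

section \<open>Neighbourhoods and belief propagation\<close>

text \<open>A certificate for being a tree: levels that change by one along each edge, and a unique
  neighbour on the previous level. Distances, children and acyclicity follow from it, and the
  recursive trees supply it directly.\<close>

locale leveled_tree =
  fixes V :: "nat set" and E :: "nat set set" and v :: nat and D :: "nat \<Rightarrow> nat"
  assumes root: "v \<in> V" "D v = 0"
    and edge: "\<And>e. e \<in> E \<Longrightarrow> \<exists>u w. e = {u, w} \<and> u \<in> V \<and> w \<in> V \<and> D w = Suc (D u)"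
    and parent: "\<And>w. w \<in> V \<Longrightarrow> w \<noteq> v \<Longrightarrow> \<exists>!u. {u, w} \<in> E \<and> D w = Suc (D u)"
begin

lemma edgeD: "{u, w} \<in> E \<Longrightarrow> u \<in> V \<and> w \<in> V \<and> (D w = Suc (D u) \<or> D u = Suc (D w))"
  by (drule edge) (auto simp: doubleton_eq_iff)

lemma walk_level: "(v, w) \<in> adj E ^^ k \<Longrightarrow> w \<in> V \<and> D w \<le> k"
proof (induction k arbitrary: w)
  case (Suc k)
  then obtain u where "(v, u) \<in> adj E ^^ k" "{u, w} \<in> E" by (auto simp: adj_def)
  with Suc.IH[of u] edgeD[of u w] show ?case by auto
qed (simp add: root)

lemma walk_to: "w \<in> V \<Longrightarrow> (v, w) \<in> adj E ^^ D w"
proof (induction "D w" arbitrary: w)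
  case 0
  then have "w = v" using parent[of w] by auto
  then show ?case using root by simp
next
  case (Suc k)
  then have "w \<noteq> v" using root by auto
  with parent[OF Suc.prems] obtain u where u: "{u, w} \<in> E" "D w = Suc (D u)" by blast
  then have "(v, u) \<in> adj E ^^ D u" using Suc edgeD[of u w] by auto
  then show ?case unfolding u(2) using u(1) by (auto simp: adj_def)
qed

lemma graph_dist: "w \<in> V \<Longrightarrow> graph_dist E v w = D w"
  unfolding graph_dist_def using walk_to walk_level by (intro Least_equality) auto

lemma children_eq: "u \<in> V \<Longrightarrow> children E v u = {w. {u, w} \<in> E \<and> D w = Suc (D u)}"
  using edgeD graph_dist by (auto simp: children_def)

text \<open>A vertex of maximal level on a cycle would have two distinct neighbours on the previous
  level.\<close>

lemma no_cycle: "\<not> is_cycle E p"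
proof
  assume "is_cycle E p"
  then have len: "3 \<le> length p" and dist: "distinct p" and suc: "successively (\<lambda>u w. {u, w} \<in> E) p"
    and close: "{last p, hd p} \<in> E" by (auto simp: is_cycle_def)
  define L where "L = length p"
  define nx where "nx i = (if Suc i = L then 0 else Suc i)" for i
  have step: "{p ! i, p ! nx i} \<in> E" if "i < L" for i
  proof (cases "Suc i = L")
    case True
    have ne: "p \<noteq> []" and "length p - 1 = i" using len True by (auto simp: L_def)
    then have "p ! i = last p" "p ! nx i = hd p"
      using True by (simp_all add: nx_def last_conv_nth hd_conv_nth)
    then show ?thesis using close by simp
  next
    case False
    then show ?thesis using suc that by (auto simp: nx_def L_def successively_conv_nth)
  qed
  have "finite ((\<lambda>i. D (p ! i)) ` {..<L})" "(\<lambda>i. D (p ! i)) ` {..<L} \<noteq> {}"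
    using len by (auto simp: L_def lessThan_empty_iff)
  then obtain i where i: "i < L" and max: "\<And>j. j < L \<Longrightarrow> D (p ! j) \<le> D (p ! i)"
    using Max_in[of "(\<lambda>i. D (p ! i)) ` {..<L}"] Max_ge[of "(\<lambda>i. D (p ! i)) ` {..<L}"]
    by (smt (verit, best) imageE imageI lessThan_iff)
  \<comment> \<open>The predecessor of \<open>i\<close> on the cycle. It differs from the successor
    because a cycle has at least three vertices.\<close>
  define j where "j = (if i = 0 then L - 1 else i - 1)"
  have j: "j < L" "nx j = i" using i len by (auto simp: j_def nx_def L_def)
  have ni: "nx i < L" using i by (auto simp: nx_def)
  have "j \<noteq> nx i" using i len by (auto simp: j_def nx_def L_def)
  then have ne: "p ! j \<noteq> p ! nx i" using dist j(1) ni by (simp add: nth_eq_iff_index_eq L_def)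
  have e1: "{p ! j, p ! i} \<in> E" using step[OF j(1)] j(2) by simp
  have e2: "{p ! nx i, p ! i} \<in> E" using step[OF i] by (simp add: insert_commute)
  have "D (p ! i) = Suc (D (p ! j))" using edgeD[OF e1] max[OF j(1)] by auto
  moreover have "D (p ! i) = Suc (D (p ! nx i))" using edgeD[OF e2] max[OF ni] by auto
  moreover have "p ! i \<in> V" using edgeD[OF e1] by simp
  moreover have "p ! i \<noteq> v" using calculation(1) root by auto
  ultimately show False using parent[of "p ! i"] e1 e2 ne by blast
qed

lemma tree: "is_tree V E"
proof -
  have sym: "sym ((adj E)\<^sup>*)" by (intro sym_rtrancl) (auto simp: sym_def adj_def insert_commute)
  have "(v, u) \<in> (adj E)\<^sup>*" if "u \<in> V" for u
    using walk_to[OF that] by (rule relpow_imp_rtrancl)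
  then have "(u, w) \<in> (adj E)\<^sup>*" if "u \<in> V" "w \<in> V" for u w
    using that sym by (meson rtrancl_trans symD)
  then show ?thesis using root no_cycle by (auto simp: is_tree_def)
qed

context
  fixes G :: "nat set set" and T :: nat
  assumes inside: "\<And>e. e \<subseteq> V \<Longrightarrow> e \<in> G \<longleftrightarrow> e \<in> E"
    and outside: "\<And>u w. u \<in> V \<Longrightarrow> D u < T \<Longrightarrow> {u, w} \<in> G \<Longrightarrow> w \<in> V"
    and height: "\<And>u. u \<in> V \<Longrightarrow> D u \<le> T"
begin

text \<open>Edges of \<open>G\<close> leave \<open>V\<close> only from vertices of level
  \<open>T\<close>, and a walk of length at most \<open>T\<close> has no step left once it is
  there.\<close>

lemma G_walk: "(v, w) \<in> adj G ^^ k \<Longrightarrow> k \<le> T \<Longrightarrow> w \<in> V \<and> D w \<le> k"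
proof (induction k arbitrary: w)
  case (Suc k)
  then obtain u where u: "(v, u) \<in> adj G ^^ k" "{u, w} \<in> G" by (auto simp: adj_def)
  with Suc have uV: "u \<in> V" "D u \<le> k" by auto
  with outside[of u w] u Suc.prems have "w \<in> V" by auto
  with uV u inside[of "{u, w}"] edgeD[of u w] show ?case by auto
qed (simp add: root)

text \<open>\<open>nbhd\<close> asks for a distance strictly below its radius, so trees of depth
  \<open>T\<close> correspond to the radius \<open>Suc T\<close>.\<close>

lemma nbhd_eq: "nbhd (Suc T) G v = V"
proof
  show "nbhd (Suc T) G v \<subseteq> V"
  proof
    fix u assume "u \<in> nbhd (Suc T) G v"
    then obtain k where k: "(v, u) \<in> adj G ^^ k" and d: "graph_dist G v u \<le> T"
      by (auto simp: nbhd_def dest: rtrancl_imp_relpow)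
    from k have "(v, u) \<in> adj G ^^ graph_dist G v u" unfolding graph_dist_def by (rule LeastI)
    with G_walk d show "u \<in> V" by blast
  qed
  show "V \<subseteq> nbhd (Suc T) G v"
  proof
    fix u assume u: "u \<in> V"
    have "e \<subseteq> V" if "e \<in> E" for e using edge[OF that] by auto
    then have "E \<subseteq> G" using inside by auto
    then have "adj E \<subseteq> adj G" by (auto simp: adj_def)
    then have "adj E ^^ k \<subseteq> adj G ^^ k" for k by (induction k) auto
    then have "(v, u) \<in> adj G ^^ D u" using walk_to[OF u] by blast
    moreover from this have "graph_dist G v u \<le> D u" unfolding graph_dist_def by (rule Least_le)
    ultimately show "u \<in> nbhd (Suc T) G v" using height[OF u] by (auto simp: nbhd_def relpow_imp_rtrancl)
  qed
qed

lemma induced_edges_eq: "induced_edges V G = E"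
proof -
  have "e \<subseteq> V" if "e \<in> E" for e using edge[OF that] by auto
  then show ?thesis using inside by (auto simp: induced_edges_def)
qed

end

end

section \<open>The graph carried by a recursive tree\<close>

primrec inner :: "nat \<Rightarrow> ntree \<Rightarrow> nat set" where
  "inner 0 \<tau> = {}"
| "inner (Suc T) \<tau> = insert (root \<tau>) (\<Union>t\<in>set (kids \<tau>). inner T t)"

primrec tedges :: "nat \<Rightarrow> ntree \<Rightarrow> nat set set" where
  "tedges 0 \<tau> = {}"
| "tedges (Suc T) \<tau> = (\<Union>t\<in>set (kids \<tau>). insert {root \<tau>, root t} (tedges T t))"

primrec wf_tree :: "nat \<Rightarrow> ntree \<Rightarrow> bool" where
  "wf_tree 0 \<tau> \<longleftrightarrow> kids \<tau> = []"
| "wf_tree (Suc T) \<tau> \<longleftrightarrow> sorted (map root (kids \<tau>)) \<and> distinct (map root (kids \<tau>)) \<and>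
     (\<forall>t\<in>set (kids \<tau>). wf_tree T t \<and> root \<tau> \<notin> names T t \<and>
       (\<forall>t'\<in>set (kids \<tau>). t \<noteq> t' \<longrightarrow> names T t \<inter> names T t' = {}))"

text \<open>The choice is among disjoint subtrees, so in a well-formed tree exactly one child
  qualifies for a name other than the root.\<close>

primrec level :: "nat \<Rightarrow> ntree \<Rightarrow> nat \<Rightarrow> nat" where
  "level 0 \<tau> w = 0"
| "level (Suc T) \<tau> w = (if w = root \<tau> then 0
     else Suc (level T (SOME t. t \<in> set (kids \<tau>) \<and> w \<in> names T t) w))"

lemma wf_forest:
  assumes IH: "\<And>Z v \<tau>. \<tau> \<in> trees n k T Z v \<Longrightarrow> wf_tree T \<tau>"
    and "ts \<in> forests (trees n k T) (names T) Z ws" "distinct ws" "set ws \<subseteq> Z"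
  shows "\<forall>t\<in>set ts. wf_tree T t \<and> (\<forall>t'\<in>set ts. t \<noteq> t' \<longrightarrow> names T t \<inter> names T t' = {})"
  using assms(2-4)
proof (induction ws arbitrary: Z ts)
  case (Cons w ws)
  then obtain t ts' where ts: "ts = t # ts'" by auto
  note * = forest_ConsD[OF Cons.prems(1)[unfolded ts] Cons.prems(2,3)]
  have "\<forall>t\<in>set ts'. wf_tree T t \<and> (\<forall>t'\<in>set ts'. t \<noteq> t' \<longrightarrow> names T t \<inter> names T t' = {})"
    using Cons.prems by (intro Cons.IH[OF *(2)]) auto
  with * IH[OF *(1)] show ?case by (auto simp: ts)
qed simp

lemma wf_trees: "\<tau> \<in> trees n k T Z v \<Longrightarrow> wf_tree T \<tau>"
proof (induction T arbitrary: Z v \<tau>)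
  case (Suc T)
  then obtain C ts where C: "C \<in> kid_sets n k Z v" and \<tau>: "\<tau> = Node v ts"
    and ts: "ts \<in> forests (trees n k T) (names T) (insert v Z \<union> C) (sorted_list_of_set C)" by auto
  have fC: "finite C" "v \<notin> C" using C kid_setsD[OF C] by (auto simp: kid_sets_def)
  have roots: "map root ts = sorted_list_of_set C" by (rule roots_forest[OF ts])
  have nm: "(\<Union>t\<in>set ts. names T t) \<subseteq> set (sorted_list_of_set C) \<union> ({..<n} - (insert v Z \<union> C))"
    by (rule names_forest[OF _ ts]) (rule names_tree)
  have "\<forall>t\<in>set ts. wf_tree T t \<and> (\<forall>t'\<in>set ts. t \<noteq> t' \<longrightarrow> names T t \<inter> names T t' = {})"
    using fC by (intro wf_forest[OF _ ts] Suc.IH) auto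
  with nm roots fC show ?case by (auto simp: \<tau>)
qed simp

lemma tedges_subset: "e \<in> tedges T \<tau> \<Longrightarrow> e \<subseteq> names T \<tau>"
proof (induction T arbitrary: \<tau>)
  case (Suc T)
  then obtain t where t: "t \<in> set (kids \<tau>)" "e = {root \<tau>, root t} \<or> e \<in> tedges T t" by auto
  then show ?case using Suc.IH[of t] root_in_names[of t T] by auto
qed simp

lemma inner_subset: "inner T \<tau> \<subseteq> names T \<tau>"
  by (induction T arbitrary: \<tau>) auto

lemma tedges_kid:
  assumes "wf_tree (Suc T) \<tau>" "t \<in> set (kids \<tau>)" "u \<in> names T t"
  shows "{u, w} \<in> tedges (Suc T) \<tau> \<longleftrightarrow> {u, w} \<in> tedges T t \<or> u = root t \<and> w = root \<tau>"
proof
  assume "{u, w} \<in> tedges (Suc T) \<tau>"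
  then obtain t' where t': "t' \<in> set (kids \<tau>)" "{u, w} = {root \<tau>, root t'} \<or> {u, w} \<in> tedges T t'" by auto
  from t'(2) have "u \<in> names T t' \<or> u = root \<tau>"
    using tedges_subset[of "{u, w}" T t'] root_in_names[of t' T] by (auto simp: doubleton_eq_iff)
  with assms t'(1) have "t' = t" by auto
  with t' assms show "{u, w} \<in> tedges T t \<or> u = root t \<and> w = root \<tau>"
    by (auto simp: doubleton_eq_iff)
next
  assume "{u, w} \<in> tedges T t \<or> u = root t \<and> w = root \<tau>"
  then show "{u, w} \<in> tedges (Suc T) \<tau>" using assms(2) by (auto simp: insert_commute)
qed

lemma tedges_root:
  assumes "wf_tree (Suc T) \<tau>"
  shows "{root \<tau>, w} \<in> tedges (Suc T) \<tau> \<longleftrightarrow> w \<in> root ` set (kids \<tau>)"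
proof
  assume "{root \<tau>, w} \<in> tedges (Suc T) \<tau>"
  then obtain t where t: "t \<in> set (kids \<tau>)" "{root \<tau>, w} = {root \<tau>, root t} \<or> {root \<tau>, w} \<in> tedges T t" by auto
  then show "w \<in> root ` set (kids \<tau>)"
    using tedges_subset[of "{root \<tau>, w}" T t] assms by (auto simp: doubleton_eq_iff)
qed auto

lemma level_kid:
  assumes "wf_tree (Suc T) \<tau>" "t \<in> set (kids \<tau>)" "u \<in> names T t"
  shows "level (Suc T) \<tau> u = Suc (level T t u)"
proof -
  have "(SOME t. t \<in> set (kids \<tau>) \<and> u \<in> names T t) = t"
    by (rule some_equality) (use assms in auto)
  then show ?thesis using assms by auto
qed

lemma level_root: "level T \<tau> (root \<tau>) = 0"
  by (cases T) auto

lemma level_le: "level T \<tau> w \<le> T"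
  by (induction T arbitrary: \<tau>) auto

text \<open>The interior consists of the vertices whose whole neighbourhood lies in the ball;
  vertices of level \<open>T\<close> may have further neighbours outside.\<close>

lemma inner_eq: "wf_tree T \<tau> \<Longrightarrow> inner T \<tau> = {w \<in> names T \<tau>. level T \<tau> w < T}"
proof (induction T arbitrary: \<tau>)
  case (Suc T)
  have "inner T t = {w \<in> names T t. level (Suc T) \<tau> w < Suc T}" if t: "t \<in> set (kids \<tau>)" for t
    using Suc.IH[of t] Suc.prems t level_kid[OF Suc.prems t] by (auto simp del: level.simps)
  then show ?case by (auto simp del: level.simps simp: level_root)
qed simp

lemma leveled_tree: "wf_tree T \<tau> \<Longrightarrow> leveled_tree (names T \<tau>) (tedges T \<tau>) (root \<tau>) (level T \<tau>)"
proof (induction T arbitrary: \<tau>)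
  case 0
  then show ?case by unfold_locales auto
next
  case (Suc T)
  note wf = Suc.prems
  have sub: "leveled_tree (names T t) (tedges T t) (root t) (level T t)" if "t \<in> set (kids \<tau>)" for t
    using Suc.IH[of t] wf that by auto
  show ?case
  proof
    show "root \<tau> \<in> names (Suc T) \<tau>" "level (Suc T) \<tau> (root \<tau>) = 0" by auto
  next
    fix e assume "e \<in> tedges (Suc T) \<tau>"
    then obtain t where t: "t \<in> set (kids \<tau>)" "e = {root \<tau>, root t} \<or> e \<in> tedges T t" by auto
    show "\<exists>u w. e = {u, w} \<and> u \<in> names (Suc T) \<tau> \<and> w \<in> names (Suc T) \<tau> \<and> level (Suc T) \<tau> w = Suc (level (Suc T) \<tau> u)"
      using t(2)
    proof
      assume e: "e = {root \<tau>, root t}"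
      have "level (Suc T) \<tau> (root t) = Suc 0"
        using level_kid[OF wf t(1) root_in_names] by (simp add: level_root)
      with e t(1) show ?thesis
        by (intro exI[of _ "root \<tau>"] exI[of _ "root t"]) (auto intro: root_in_names)
    next
      assume "e \<in> tedges T t"
      then obtain u w where uw: "e = {u, w}" "u \<in> names T t" "w \<in> names T t" "level T t w = Suc (level T t u)"
        using leveled_tree.edge[OF sub[OF t(1)]] by blast
      then show ?thesis
        using level_kid[OF wf t(1)] t(1) by (intro exI[of _ u] exI[of _ w]) auto
    qed
  next
    fix w assume w: "w \<in> names (Suc T) \<tau>" "w \<noteq> root \<tau>"
    then obtain t where t: "t \<in> set (kids \<tau>)" "w \<in> names T t" by auto
    have lw: "level (Suc T) \<tau> w = Suc (level T t w)" by (rule level_kid[OF wf t])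
    have comm: "{u, w} \<in> tedges (Suc T) \<tau> \<longleftrightarrow> {u, w} \<in> tedges T t \<or> w = root t \<and> u = root \<tau>" for u
      using tedges_kid[OF wf t, of u] by (simp add: insert_commute)
    show "\<exists>!u. {u, w} \<in> tedges (Suc T) \<tau> \<and> level (Suc T) \<tau> w = Suc (level (Suc T) \<tau> u)"
    proof (cases "w = root t")
      case True
      have "u = root \<tau>" if "{u, w} \<in> tedges T t" "level (Suc T) \<tau> w = Suc (level (Suc T) \<tau> u)" for u
      proof -
        have "u \<in> names T t" using tedges_subset[OF that(1)] by simp
        then show ?thesis using that(2) lw True level_kid[OF wf t(1)] by (simp add: level_root)
      qed
      then show ?thesis using True lw comm by (intro ex1I[of _ "root \<tau>"]) (auto simp: level_root simp del: tedges.simps)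
    next
      case False
      then obtain u where u: "{u, w} \<in> tedges T t" "level T t w = Suc (level T t u)"
        and uniq: "\<And>u'. {u', w} \<in> tedges T t \<Longrightarrow> level T t w = Suc (level T t u') \<Longrightarrow> u' = u"
        using leveled_tree.parent[OF sub[OF t(1)] t(2)] by blast
      have lv: "level (Suc T) \<tau> u' = Suc (level T t u')" if "{u', w} \<in> tedges T t" for u'
        using level_kid[OF wf t(1)] tedges_subset[OF that] by simp
      show ?thesis
        using u uniq lw lv comm False
        by (intro ex1I[of _ u]) (auto simp del: tedges.simps level.simps)
    qed
  qed
qed

text \<open>Separates the recursion from distances: belief propagation is evaluated for any child
  function that matches the tree, and only afterwards is this function identified with
  \<open>children\<close>.\<close>

primrec kids_ok :: "nat \<Rightarrow> (nat \<Rightarrow> nat set) \<Rightarrow> ntree \<Rightarrow> bool" where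
  "kids_ok 0 ch \<tau> \<longleftrightarrow> ch (root \<tau>) = {}"
| "kids_ok (Suc T) ch \<tau> \<longleftrightarrow> ch (root \<tau>) = root ` set (kids \<tau>) \<and> (\<forall>t\<in>set (kids \<tau>). kids_ok T ch t)"

lemma kids_ok_cong: "(\<And>u. u \<in> names T \<tau> \<Longrightarrow> ch u = ch' u) \<Longrightarrow> kids_ok T ch \<tau> = kids_ok T ch' \<tau>"
proof (induction T arbitrary: \<tau>)
  case (Suc T)
  have "kids_ok T ch t = kids_ok T ch' t" if "t \<in> set (kids \<tau>)" for t
    using that by (intro Suc.IH Suc.prems) auto
  then show ?case using Suc.prems by simp
qed simp

lemma kids_ok_tree:
  "wf_tree T \<tau> \<Longrightarrow> kids_ok T (\<lambda>u. {w. {u, w} \<in> tedges T \<tau> \<and> level T \<tau> w = Suc (level T \<tau> u)}) \<tau>"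
proof (induction T arbitrary: \<tau>)
  case (Suc T)
  note wf = Suc.prems
  let ?ch = "\<lambda>u. {w. {u, w} \<in> tedges (Suc T) \<tau> \<and> level (Suc T) \<tau> w = Suc (level (Suc T) \<tau> u)}"
  have "?ch (root \<tau>) = root ` set (kids \<tau>)"
    using level_kid[OF wf _ root_in_names]
    by (auto simp: tedges_root[OF wf] level_root simp del: tedges.simps level.simps)
  moreover have "kids_ok T ?ch t" if t: "t \<in> set (kids \<tau>)" for t
  proof -
    have "kids_ok T ?ch t = kids_ok T (\<lambda>u. {w. {u, w} \<in> tedges T t \<and> level T t w = Suc (level T t u)}) t"
    proof (rule kids_ok_cong)
      fix u assume u: "u \<in> names T t"
      have "w \<in> names T t" if "{u, w} \<in> tedges T t" for w using tedges_subset[OF that] by simp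
      then show "?ch u = {w. {u, w} \<in> tedges T t \<and> level T t w = Suc (level T t u)}"
        using level_kid[OF wf t] u
        by (auto simp: tedges_kid[OF wf t u] level_root simp del: tedges.simps level.simps)
    qed
    then show ?thesis using Suc.IH[of t] wf t by auto
  qed
  ultimately show ?case by (simp only: kids_ok.simps) blast
qed simp

text \<open>Reads a tree off a graph, where \<open>p\<close> is the vertex from which
  \<open>v\<close> was entered. It serves to show that a graph determines the tree of its ball, so
  that the events for different trees are disjoint.\<close>

primrec explore :: "nat \<Rightarrow> nat set set \<Rightarrow> nat option \<Rightarrow> nat \<Rightarrow> ntree" where
  "explore 0 G p v = Node v []"
| "explore (Suc T) G p v = Node v (map (explore T G (Some v)) (sorted_list_of_set {w. {v, w} \<in> G \<and> Some w \<noteq> p}))"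

lemma explore_eq:
  assumes "wf_tree T \<tau>" "\<And>q. p = Some q \<Longrightarrow> q \<notin> names T \<tau>"
    and "\<And>u w. u \<in> inner T \<tau> \<Longrightarrow> {u, w} \<in> G \<longleftrightarrow> {u, w} \<in> tedges T \<tau> \<or> u = root \<tau> \<and> Some w = p"
  shows "explore T G p (root \<tau>) = \<tau>"
  using assms
proof (induction T arbitrary: \<tau> p)
  case 0
  then show ?case by (cases \<tau>) auto
next
  case (Suc T)
  note wf = Suc.prems(1)
  have "{w. {root \<tau>, w} \<in> G \<and> Some w \<noteq> p} = root ` set (kids \<tau>)"
  proof -
    have "Some w \<noteq> p" if "w \<in> root ` set (kids \<tau>)" for w
      using Suc.prems(2)[of w] that root_in_names by fastforce
    then show ?thesis using Suc.prems(3)[of "root \<tau>"] tedges_root[OF wf] by auto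
  qed
  then have "sorted_list_of_set {w. {root \<tau>, w} \<in> G \<and> Some w \<noteq> p} = map root (kids \<tau>)"
    using wf sorted_list_of_set.idem_if_sorted_distinct[of "map root (kids \<tau>)"] by simp
  moreover have "explore T G (Some (root \<tau>)) (root t) = t" if t: "t \<in> set (kids \<tau>)" for t
  proof (rule Suc.IH)
    show "wf_tree T t" using wf t by auto
    show "q \<notin> names T t" if "Some (root \<tau>) = Some q" for q using that wf t by auto
    fix u w assume u: "u \<in> inner T t"
    then have un: "u \<in> names T t" using inner_subset by blast
    then have "u \<noteq> root \<tau>" using wf t by auto
    with Suc.prems(3)[of u w] u t
    show "({u, w} \<in> G) = ({u, w} \<in> tedges T t \<or> u = root t \<and> Some w = Some (root \<tau>))"
      by (auto simp: tedges_kid[OF wf t un] simp del: tedges.simps)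
  qed
  then have "map (\<lambda>t. explore T G (Some (root \<tau>)) (root t)) (kids \<tau>) = kids \<tau>" by (simp add: map_idI)
  ultimately show ?case by (cases \<tau>) (simp add: comp_def)
qed

section \<open>Belief propagation computes likelihood ratios\<close>

definition llr :: "real \<Rightarrow> real \<Rightarrow> ereal" where
  "llr p q = (if q = 0 then \<infinity> else if p = 0 then -\<infinity> else ereal (ln (p / q)))"

lemma llr_eq: "0 < x \<Longrightarrow> 0 < y \<Longrightarrow> llr x y = ereal (ln (x / y))"
  by (simp add: llr_def)

text \<open>Likelihoods can vanish, for infinite side information or if \<open>a = 0\<close> or
  \<open>b = 0\<close>. The condition rules out the addition of opposite infinities: with
  \<open>p = 0\<close> and \<open>q' = 0\<close> both products would be 0.\<close>

lemma llr_mult: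
  assumes "0 \<le> p" "0 \<le> q" "0 \<le> p'" "0 \<le> q'" and "p * p' \<noteq> 0 \<or> q * q' \<noteq> 0"
  shows "llr (p * p') (q * q') = llr p q + llr p' q'"
  using assms by (auto simp: llr_def ln_mult ln_div)

lemma llr_scale: "0 < c \<Longrightarrow> llr (c * p) (c * q) = llr p q"
  by (auto simp: llr_def)

lemma llr_pos: "0 \<le> p \<Longrightarrow> 0 \<le> q \<Longrightarrow> q < p \<Longrightarrow> 0 < llr p q"
  and llr_neg: "0 \<le> p \<Longrightarrow> 0 \<le> q \<Longrightarrow> p < q \<Longrightarrow> llr p q < 0"
  by (auto simp: llr_def ln_less_zero_iff)

lemma bp_fun_infinity:
  "bp_fun \<delta> \<infinity> = (if \<delta> = 0 then \<infinity> else if \<delta> = 1 then -\<infinity> else ereal (ln ((1 - \<delta>) / \<delta>)))"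
  "bp_fun \<delta> (-\<infinity>) = (if \<delta> = 0 then -\<infinity> else if \<delta> = 1 then \<infinity> else ereal (ln (\<delta> / (1 - \<delta>))))"
  unfolding bp_fun_def infinity_ereal_def uminus_ereal.simps by (simp_all only: ereal.case)

text \<open>With \<open>\<delta> = b / (a + b)\<close>, the chance that the labels across an edge
  differ, the right side is the ratio after passing through the edge. For \<open>\<delta>\<close>
  equal to 0 or 1 an infinite argument gives an infinite ratio, in agreement with the values chosen
  in \<open>bp_fun\<close>.\<close>

lemma bp_fun_llr:
  assumes \<delta>: "0 \<le> \<delta>" "\<delta> \<le> 1" and pq: "0 \<le> p" "0 \<le> q" "p \<noteq> 0 \<or> q \<noteq> 0"
  shows "bp_fun \<delta> (llr p q) = llr ((1 - \<delta>) * p + \<delta> * q) (\<delta> * p + (1 - \<delta>) * q)"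
proof -
  consider "q = 0" | "p = 0" "q \<noteq> 0" | "0 < p" "0 < q" using pq by linarith
  then show ?thesis
  proof cases
    case 1
    then have p: "0 < p" using pq by simp
    show ?thesis using 1 p \<delta> by (auto simp: llr_def bp_fun_infinity)
  next
    case 2
    then have q: "0 < q" using pq by simp
    show ?thesis using 2 q \<delta> by (auto simp: llr_def bp_fun_infinity)
  next
    case 3
    have pos: "(1 - \<delta>) * p + \<delta> * q > 0" "\<delta> * p + (1 - \<delta>) * q > 0"
      using 3 \<delta> by (cases "\<delta> = 0"; cases "\<delta> = 1"; auto intro!: add_pos_pos)+
    have "((1 - \<delta>) * (p / q) + \<delta>) / (\<delta> * (p / q) + 1 - \<delta>) =
        (q * ((1 - \<delta>) * (p / q) + \<delta>)) / (q * (\<delta> * (p / q) + 1 - \<delta>))"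
      using 3 by simp
    also have "q * ((1 - \<delta>) * (p / q) + \<delta>) = (1 - \<delta>) * p + \<delta> * q"
      using 3 by (simp add: distrib_left)
    also have "q * (\<delta> * (p / q) + 1 - \<delta>) = \<delta> * p + (1 - \<delta>) * q"
      using 3 by (simp add: distrib_left right_diff_distrib left_diff_distrib)
    finally have eq: "((1 - \<delta>) * (p / q) + \<delta>) / (\<delta> * (p / q) + 1 - \<delta>) =
        ((1 - \<delta>) * p + \<delta> * q) / (\<delta> * p + (1 - \<delta>) * q)" .
    have ex: "exp (ln (p / q)) = p / q" using 3 by simp
    have "llr p q = ereal (ln (p / q))" using 3 by (intro llr_eq)
    then have "bp_fun \<delta> (llr p q) = ereal (ln (((1 - \<delta>) * (p / q) + \<delta>) / (\<delta> * (p / q) + 1 - \<delta>)))"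
      by (simp only: bp_fun_def ereal.case ex)
    also have "\<dots> = llr ((1 - \<delta>) * p + \<delta> * q) (\<delta> * p + (1 - \<delta>) * q)"
      unfolding eq by (rule llr_eq[OF pos, symmetric])
    finally show ?thesis .
  qed
qed

text \<open>The posterior mean for the log-likelihood ratio \<open>s\<close>: the likelihoods of the
  two labels are proportional to \<open>1 + emag s\<close> and \<open>1 - emag s\<close>, see
  \<open>llr_emag\<close>.\<close>

definition emag :: "ereal \<Rightarrow> real" where
  "emag s = (case s of ereal r \<Rightarrow> tanh (r / 2) | PInfty \<Rightarrow> 1 | MInfty \<Rightarrow> - 1)"

lemma emag_simps [simp]: "emag (ereal r) = tanh (r / 2)" "emag \<infinity> = 1" "emag (-\<infinity>) = - 1"
  unfolding emag_def infinity_ereal_def uminus_ereal.simps by (simp_all only: ereal.case)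

lemma
  fixes r :: real
  shows one_plus_tanh_half: "1 + tanh (r / 2) = 2 * exp r / (exp r + 1)"
  and one_minus_tanh_half: "1 - tanh (r / 2) = 2 / (exp r + 1)"
proof -
  have e: "tanh (r / 2) = (1 - exp (- r)) / (1 + exp (- r))" by (simp add: tanh_real_altdef)
  have m: "exp r * exp (- r) = 1" by (simp flip: exp_add)
  have "tanh (r / 2) = (exp r * (1 - exp (- r))) / (exp r * (1 + exp (- r)))" unfolding e by simp
  also have "\<dots> = (exp r - 1) / (exp r + 1)" by (simp only: right_diff_distrib distrib_left m) simp
  finally have t: "tanh (r / 2) = (exp r - 1) / (exp r + 1)" .
  have "exp r + 1 \<noteq> 0" using exp_gt_zero[of r] by linarith
  then show "1 + tanh (r / 2) = 2 * exp r / (exp r + 1)" "1 - tanh (r / 2) = 2 / (exp r + 1)"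
    unfolding t by (simp_all add: add_divide_eq_iff diff_divide_eq_iff)
qed

lemma abs_emag_le: "\<bar>emag s\<bar> \<le> 1"
proof (cases s)
  case (real r)
  have "0 \<le> 1 + tanh (r / 2)" "0 \<le> 1 - tanh (r / 2)"
    unfolding one_plus_tanh_half one_minus_tanh_half by (auto simp: add_pos_pos)
  then show ?thesis using real by auto
qed auto

lemma llr_emag: "llr (1 + emag s) (1 - emag s) = s"
proof (cases s)
  case (real r)
  have "0 < exp r + 1" by (simp add: add_pos_pos)
  then show ?thesis using real
    by (simp add: llr_def one_plus_tanh_half one_minus_tanh_half)
qed (auto simp: llr_def)

lemma measurable_emag [measurable]: "emag \<in> borel_measurable borel"
proof -
  have "emag = (\<lambda>s. if s = \<infinity> then 1 else if s = -\<infinity> then - 1 else tanh (real_of_ereal s / 2))"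
  proof
    fix s show "emag s = (if s = \<infinity> then 1 else if s = -\<infinity> then - 1 else tanh (real_of_ereal s / 2))"
      by (cases s) auto
  qed
  moreover have "(tanh :: real \<Rightarrow> real) \<in> borel_measurable borel"
    by (intro borel_measurable_continuous_onI continuous_intros) simp
  then have "(\<lambda>s. if s = \<infinity> then 1 else if s = -\<infinity> then - 1 else tanh (real_of_ereal s / 2)) \<in> borel_measurable borel"
    by measurable
  ultimately show ?thesis by simp
qed

locale ereal_tree_model = tree_model n a b N emag emag
  for n :: nat and a b :: real and N :: "ereal measure"
begin

text \<open>If the product of the messages is nonzero for some label, no child has two vanishing
  likelihoods, so every message is a genuine ratio. The factor common to both messages along an edge
  cancels.\<close>

lemma msgs_llr:
  assumes "distinct (map root ts)" "msgs T s ts False \<noteq> 0 \<or> msgs T s ts True \<noteq> 0"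
    and "\<And>t. t \<in> set ts \<Longrightarrow> lik T s t False \<noteq> 0 \<or> lik T s t True \<noteq> 0 \<Longrightarrow> l (root t) = llr (lik T s t False) (lik T s t True)"
  shows "llr (msgs T s ts False) (msgs T s ts True) = (\<Sum>w\<in>root ` set ts. bp_fun (b / (a + b)) (l w))"
  using assms
proof (induction ts)
  case Nil
  then show ?case by (simp add: llr_def)
next
  case (Cons t ts)
  let ?p = "lik T s t False" and ?q = "lik T s t True" and ?\<delta> = "b / (a + b)"
  have nz: "msg T s t False \<noteq> 0 \<or> msg T s t True \<noteq> 0" "msgs T s ts False \<noteq> 0 \<or> msgs T s ts True \<noteq> 0"
    using Cons.prems(2) by auto
  have pq: "?p \<noteq> 0 \<or> ?q \<noteq> 0" using nz(1) by (auto simp: msg_def UNIV_bool)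
  have c: "0 < (a + b) / n / 2" using ab n by simp
  have \<delta>: "0 \<le> ?\<delta>" "?\<delta> \<le> 1" using a b ab by auto
  have m: "msg T s t False = (a + b) / n / 2 * ((1 - ?\<delta>) * ?p + ?\<delta> * ?q)"
    "msg T s t True = (a + b) / n / 2 * (?\<delta> * ?p + (1 - ?\<delta>) * ?q)"
  proof -
    have "1 - ?\<delta> = a / (a + b)" using ab by (simp add: diff_divide_eq_iff)
    then have 1: "(a + b) / n / 2 * (1 - ?\<delta>) = a / n / 2" "(a + b) / n / 2 * ?\<delta> = b / n / 2"
      using ab by simp_all
    show "msg T s t False = (a + b) / n / 2 * ((1 - ?\<delta>) * ?p + ?\<delta> * ?q)"
      "msg T s t True = (a + b) / n / 2 * (?\<delta> * ?p + (1 - ?\<delta>) * ?q)"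
      unfolding distrib_left mult.assoc[symmetric] 1 by (auto simp: msg_def UNIV_bool conn_def)
  qed
  have "llr (msgs T s (t # ts) False) (msgs T s (t # ts) True) =
      llr (msg T s t False) (msg T s t True) + llr (msgs T s ts False) (msgs T s ts True)"
    using Cons.prems(2) unfolding msgs_Cons by (intro llr_mult msg_nonneg msgs_nonneg)
  also have "llr (msg T s t False) (msg T s t True) = bp_fun ?\<delta> (llr ?p ?q)"
    unfolding m llr_scale[OF c] by (rule bp_fun_llr[symmetric]) (use \<delta> pq in \<open>auto intro: lik_nonneg\<close>)
  also have "llr ?p ?q = l (root t)" using Cons.prems(3)[of t] pq by simp
  also have "llr (msgs T s ts False) (msgs T s ts True) = (\<Sum>w\<in>root ` set ts. bp_fun ?\<delta> (l w))"
    using Cons.prems nz by (intro Cons.IH) auto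
  also have "bp_fun ?\<delta> (l (root t)) + \<dots> = (\<Sum>w\<in>root ` set (t # ts). bp_fun ?\<delta> (l w))"
    using Cons.prems(1) by simp
  finally show ?case .
qed

text \<open>Observations that are impossible under both labels of the root are excluded. There
  opposite infinities may meet, but such observations contribute nothing to the integrals that
  follow.\<close>

lemma bp_eq_llr:
  assumes "wf_tree T \<tau>" "kids_ok T ch \<tau>"
    and "\<And>u. u \<in> names T \<tau> \<Longrightarrow> l u = s u + (\<Sum>w\<in>ch u. bp_fun (b / (a + b)) (l w))"
    and "lik T s \<tau> False \<noteq> 0 \<or> lik T s \<tau> True \<noteq> 0"
  shows "l (root \<tau>) = llr (lik T s \<tau> False) (lik T s \<tau> True)"
  using assms
proof (induction T arbitrary: \<tau>)
  case 0
  then show ?case by (simp add: sg_def llr_emag)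
next
  case (Suc T)
  obtain v ts where \<tau>: "\<tau> = Node v ts" by (cases \<tau>)
  let ?m = "emag (s v)"
  have e: "0 < exp (- d)" by simp
  have lik: "lik (Suc T) s \<tau> False = exp (- d) * ((1 + ?m) * msgs T s ts False)"
    "lik (Suc T) s \<tau> True = exp (- d) * ((1 - ?m) * msgs T s ts True)"
    unfolding \<tau> lik_Suc by (simp_all add: sg_def)
  have IH: "l (root t) = llr (lik T s t False) (lik T s t True)"
    if "t \<in> set ts" "lik T s t False \<noteq> 0 \<or> lik T s t True \<noteq> 0" for t
    using that Suc.prems by (intro Suc.IH) (auto simp: \<tau>)
  have m: "0 \<le> 1 + ?m" "0 \<le> 1 - ?m" using abs_emag_le[of "s v"] by auto
  have nz: "msgs T s ts False \<noteq> 0 \<or> msgs T s ts True \<noteq> 0"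
    "(1 + ?m) * msgs T s ts False \<noteq> 0 \<or> (1 - ?m) * msgs T s ts True \<noteq> 0"
    using Suc.prems(4) unfolding lik by auto
  have "l v = s v + (\<Sum>w\<in>root ` set ts. bp_fun (b / (a + b)) (l w))"
    using Suc.prems(2,3) by (simp add: \<tau>)
  also have "(\<Sum>w\<in>root ` set ts. bp_fun (b / (a + b)) (l w)) = llr (msgs T s ts False) (msgs T s ts True)"
    using Suc.prems nz by (intro msgs_llr[symmetric] IH) (auto simp: \<tau>)
  also have "s v = llr (1 + ?m) (1 - ?m)" by (simp add: llr_emag)
  also have "llr (1 + ?m) (1 - ?m) + llr (msgs T s ts False) (msgs T s ts True) =
     llr ((1 + ?m) * msgs T s ts False) ((1 - ?m) * msgs T s ts True)"
    using nz by (intro llr_mult[symmetric] m msgs_nonneg)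
  also have "\<dots> = llr (lik (Suc T) s \<tau> False) (lik (Suc T) s \<tau> True)"
    unfolding lik by (rule llr_scale[OF e, symmetric])
  finally show ?case by (simp add: \<tau>)
qed

end

section \<open>Events that prescribe the ball around a vertex\<close>

definition ball_pairs :: "nat \<Rightarrow> nat \<Rightarrow> ntree \<Rightarrow> (nat \<times> nat) set" where
  "ball_pairs n T \<tau> = {(i, j) \<in> vertex_pairs n. i \<in> names T \<tau> \<and> j \<in> names T \<tau> \<or> i \<in> inner T \<tau> \<or> j \<in> inner T \<tau>}"

text \<open>All pairs inside the ball and all pairs with an interior vertex are prescribed; pairs
  between the boundary and the outside stay free. So the event says that the ball is the given tree
  and nothing more.\<close>

definition ball_event :: "nat \<Rightarrow> nat \<Rightarrow> ntree \<Rightarrow> (nat \<times> nat \<Rightarrow> bool) set" where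
  "ball_event n T \<tau> = {g \<in> vertex_pairs n \<rightarrow>\<^sub>E UNIV. \<forall>(i, j)\<in>ball_pairs n T \<tau>. g (i, j) \<longleftrightarrow> {i, j} \<in> tedges T \<tau>}"

lemma edges_iff: "{u, w} \<in> edges n g \<longleftrightarrow> (u, w) \<in> vertex_pairs n \<and> g (u, w) \<or> (w, u) \<in> vertex_pairs n \<and> g (w, u)"
  by (auto simp: edges_def doubleton_eq_iff)

lemma edges_doubleton: "e \<in> edges n g \<Longrightarrow> \<exists>u w. e = {u, w} \<and> u \<noteq> w"
  by (auto simp: edges_def vertex_pairs_def)

lemma tedges_ne: "wf_tree T \<tau> \<Longrightarrow> {u, w} \<in> tedges T \<tau> \<Longrightarrow> u \<noteq> w"
  using leveled_tree.edge[OF leveled_tree, of T \<tau> "{u, w}"] by auto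

lemma ball_event_edges:
  assumes wf: "wf_tree T \<tau>" and names: "names T \<tau> \<subseteq> {..<n}" and g: "g \<in> ball_event n T \<tau>"
    and uw: "u \<in> names T \<tau> \<and> w \<in> names T \<tau> \<or> u \<in> inner T \<tau>"
  shows "{u, w} \<in> edges n g \<longleftrightarrow> {u, w} \<in> tedges T \<tau>"
proof
  assume "{u, w} \<in> edges n g"
  then consider "(u, w) \<in> vertex_pairs n" "g (u, w)" | "(w, u) \<in> vertex_pairs n" "g (w, u)"
    by (auto simp: edges_iff)
  then show "{u, w} \<in> tedges T \<tau>"
  proof cases
    case 1
    then have "(u, w) \<in> ball_pairs n T \<tau>" using uw by (auto simp: ball_pairs_def)
    with g 1 show ?thesis by (auto simp: ball_event_def)
  next
    case 2
    then have "(w, u) \<in> ball_pairs n T \<tau>" using uw by (auto simp: ball_pairs_def)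
    with g 2 show ?thesis by (auto simp: ball_event_def insert_commute)
  qed
next
  assume e: "{u, w} \<in> tedges T \<tau>"
  then have uw: "u \<in> names T \<tau>" "w \<in> names T \<tau>" "u \<noteq> w" using tedges_subset tedges_ne[OF wf] by blast+
  then have "u < n" "w < n" using names by auto
  with uw(3) consider "(u, w) \<in> vertex_pairs n" | "(w, u) \<in> vertex_pairs n"
    by (cases "u < w") (auto simp: vertex_pairs_def)
  then show "{u, w} \<in> edges n g"
  proof cases
    case 1
    then have "(u, w) \<in> ball_pairs n T \<tau>" using uw by (auto simp: ball_pairs_def)
    with g 1 e show ?thesis by (auto simp: ball_event_def edges_iff)
  next
    case 2
    then have "(w, u) \<in> ball_pairs n T \<tau>" using uw by (auto simp: ball_pairs_def)
    with g 2 e show ?thesis by (auto simp: ball_event_def edges_iff insert_commute)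
  qed
qed

lemma ball_event_nbhd:
  assumes wf: "wf_tree T \<tau>" and names: "names T \<tau> \<subseteq> {..<n}" and g: "g \<in> ball_event n T \<tau>"
  shows "nbhd (Suc T) (edges n g) (root \<tau>) = names T \<tau>"
    and "induced_edges (names T \<tau>) (edges n g) = tedges T \<tau>"
proof -
  interpret leveled_tree "names T \<tau>" "tedges T \<tau>" "root \<tau>" "level T \<tau>" by (rule leveled_tree[OF wf])
  have inside: "e \<in> edges n g \<longleftrightarrow> e \<in> tedges T \<tau>" if "e \<subseteq> names T \<tau>" for e
  proof
    assume e: "e \<in> edges n g"
    then obtain u w where "e = {u, w}" using edges_doubleton by blast
    with e that ball_event_edges[OF wf names g, of u w] show "e \<in> tedges T \<tau>" by simp
  next
    assume e: "e \<in> tedges T \<tau>"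
    then obtain u w where "e = {u, w}" using edge by blast
    with e that ball_event_edges[OF wf names g, of u w] show "e \<in> edges n g" by simp
  qed
  have outside: "w \<in> names T \<tau>" if "u \<in> names T \<tau>" "level T \<tau> u < T" "{u, w} \<in> edges n g" for u w
  proof -
    have "u \<in> inner T \<tau>" using that inner_eq[OF wf] by simp
    then have "{u, w} \<in> tedges T \<tau>" using that ball_event_edges[OF wf names g, of u w] by simp
    then show ?thesis using tedges_subset by blast
  qed
  show "nbhd (Suc T) (edges n g) (root \<tau>) = names T \<tau>"
    by (rule nbhd_eq[OF inside outside level_le])
  show "induced_edges (names T \<tau>) (edges n g) = tedges T \<tau>"
    by (rule induced_edges_eq[OF inside outside level_le])
qed

lemma ball_event_disjoint:
  assumes "wf_tree T \<tau>" "names T \<tau> \<subseteq> {..<n}" "g \<in> ball_event n T \<tau>"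
    and "wf_tree T \<tau>'" "names T \<tau>' \<subseteq> {..<n}" "g \<in> ball_event n T \<tau>'" and "root \<tau> = root \<tau>'"
  shows "\<tau> = \<tau>'"
proof -
  have *: "explore T (edges n g) None (root \<tau>) = \<tau>"
    if "wf_tree T \<tau>" "names T \<tau> \<subseteq> {..<n}" "g \<in> ball_event n T \<tau>" for \<tau>
  proof (rule explore_eq[OF that(1)])
    fix u w assume "u \<in> inner T \<tau>"
    then show "{u, w} \<in> edges n g \<longleftrightarrow> {u, w} \<in> tedges T \<tau> \<or> u = root \<tau> \<and> Some w = None"
      using ball_event_edges[OF that, of u w] by blast
  qed blast
  from *[OF assms(1-3)] *[OF assms(4-6)] assms(7) show ?thesis by metis
qed

text \<open>The answer at the root can be computed from any one graph of the event. For a given tree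
  and label, success thus becomes a function of the side information alone.\<close>

lemma bp_estimator_local:
  assumes wf: "wf_tree T \<tau>" and names: "names T \<tau> \<subseteq> {..<n}"
    and g: "g \<in> ball_event n T \<tau>" "g' \<in> ball_event n T \<tau>"
    and h: "bp_estimator n (Suc T) \<delta> R h" and r: "r \<in> space R"
    and s: "s \<in> space (\<Pi>\<^sub>M v\<in>{..<n}. borel)"
  shows "h r (g, s) (root \<tau>) = h r (g', s) (root \<tau>)"
proof -
  have v: "root \<tau> < n" using names root_in_names[of \<tau> T] by auto
  have sp: "(g, s) \<in> space (observation_space n)" "(g', s) \<in> space (observation_space n)"
    using g s by (auto simp: observation_space_def space_pair_measure space_PiM ball_event_def)
  have "local_at n (Suc T) (root \<tau>) (\<lambda>obs. h r obs (root \<tau>))"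
    using h r v by (auto simp: bp_estimator_def)
  from this[unfolded local_at_def, rule_format, OF sp(1), simplified, rule_format, OF sp(2)]
  show ?thesis
    using ball_event_nbhd[OF wf names g(1)] ball_event_nbhd[OF wf names g(2)] by (simp add: Let_def)
qed

context ereal_tree_model
begin

text \<open>A strict inequality between the likelihoods excludes ties as well as the case that both
  vanish, so the belief at the root has the sign of the true log-likelihood ratio.\<close>

lemma bp_estimator_sign:
  assumes wf: "wf_tree T \<tau>" and names: "names T \<tau> \<subseteq> {..<n}" and g: "g \<in> ball_event n T \<tau>"
    and h: "bp_estimator n (Suc T) (b / (a + b)) R h" and r: "r \<in> space R"
    and s: "s \<in> space (\<Pi>\<^sub>M v\<in>{..<n}. borel)"
  shows "lik T s \<tau> True < lik T s \<tau> False \<Longrightarrow> \<not> h r (g, s) (root \<tau>)"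
    and "lik T s \<tau> False < lik T s \<tau> True \<Longrightarrow> h r (g, s) (root \<tau>)"
proof -
  have v: "root \<tau> < n" using names root_in_names[of \<tau> T] by auto
  interpret leveled_tree "names T \<tau>" "tedges T \<tau>" "root \<tau>" "level T \<tau>" by (rule leveled_tree[OF wf])
  have sp: "(g, s) \<in> space (observation_space n)"
    using g s by (auto simp: observation_space_def space_pair_measure space_PiM ball_event_def)
  note nb = ball_event_nbhd[OF wf names g]
  have "finite (names T \<tau>)" "\<Union> (tedges T \<tau>) \<subseteq> names T \<tau>"
    using tedges_subset by (blast intro: finite_names)+
  from bp_recursion_exists[OF this, of "b / (a + b)" s "root \<tau>"]
  obtain l where l: "bp_recursion (b / (a + b)) (names T \<tau>) (tedges T \<tau>) s (root \<tau>) l" by blast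
  have key: "(l (root \<tau>) > 0 \<longrightarrow> \<not> h r (g, s) (root \<tau>)) \<and> (l (root \<tau>) < 0 \<longrightarrow> h r (g, s) (root \<tau>))"
  proof -
    have "\<forall>(g, s)\<in>space (observation_space n).
           let V = nbhd (Suc T) (edges n g) (root \<tau>); E = induced_edges V (edges n g) in
           is_tree V E \<longrightarrow>
           (\<forall>l. bp_recursion (b / (a + b)) V E s (root \<tau>) l \<longrightarrow>
              (l (root \<tau>) > 0 \<longrightarrow> h r (g, s) (root \<tau>) = False) \<and> (l (root \<tau>) < 0 \<longrightarrow> h r (g, s) (root \<tau>) = True))"
      using h r v by (auto simp: bp_estimator_def)
    from bspec[OF this sp] show ?thesis using tree l by (simp add: nb Let_def)
  qed
  have llr: "l (root \<tau>) = llr (lik T s \<tau> False) (lik T s \<tau> True)"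
    if "lik T s \<tau> False \<noteq> 0 \<or> lik T s \<tau> True \<noteq> 0"
  proof (rule bp_eq_llr[OF wf _ _ that])
    show "kids_ok T (children (tedges T \<tau>) (root \<tau>)) \<tau>"
    proof -
      have "kids_ok T (children (tedges T \<tau>) (root \<tau>)) \<tau> =
        kids_ok T (\<lambda>u. {w. {u, w} \<in> tedges T \<tau> \<and> level T \<tau> w = Suc (level T \<tau> u)}) \<tau>"
        by (rule kids_ok_cong) (rule children_eq)
      then show ?thesis using kids_ok_tree[OF wf] by simp
    qed
    show "l u = s u + (\<Sum>w\<in>children (tedges T \<tau>) (root \<tau>) u. bp_fun (b / (a + b)) (l w))"
      if "u \<in> names T \<tau>" for u
      using l that by (auto simp: bp_recursion_def)
  qed
  note nn = lik_nonneg[of T s \<tau>]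
  show "\<not> h r (g, s) (root \<tau>)" if "lik T s \<tau> True < lik T s \<tau> False"
  proof -
    have "0 < l (root \<tau>)" using llr llr_pos[OF nn nn that] that nn[of True] by auto
    then show ?thesis using key by simp
  qed
  show "h r (g, s) (root \<tau>)" if "lik T s \<tau> False < lik T s \<tau> True"
  proof -
    have "l (root \<tau>) < 0" using llr llr_neg[OF nn nn that] that nn[of False] by auto
    then show ?thesis using key by simp
  qed
qed

end

section \<open>Likelihoods in the block model\<close>

lemma measurable_label: "f \<in> borel_measurable (label_measure n)"
  by (simp add: measurable_def sets_labels space_label_measure)

text \<open>The space of labellings is finite and all its subsets are measurable, so only the
  sections have to be checked.\<close>

lemma measurable_label_pair:
  assumes "\<And>x. x \<in> space (label_measure n) \<Longrightarrow> f x \<in> borel_measurable S"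
  shows "case_prod f \<in> borel_measurable (label_measure n \<Otimes>\<^sub>M S)"
proof -
  have fin: "finite (space (label_measure n))"
    unfolding space_label_measure by (intro finite_PiE) auto
  have "case_prod f \<in> borel_measurable (count_space (space (label_measure n)) \<Otimes>\<^sub>M S)"
    using assms by (intro measurable_pair_measure_countable1 countable_finite fin) auto
  moreover have "sets (label_measure n \<Otimes>\<^sub>M S) = sets (count_space (space (label_measure n)) \<Otimes>\<^sub>M S)"
    by (intro sets_pair_measure_cong refl) (simp add: sets_labels space_label_measure)
  ultimately show ?thesis using measurable_cong_sets by blast
qed

lemma label_swap:
  assumes S: "sigma_finite_measure S" and f: "\<And>x. x \<in> space (label_measure n) \<Longrightarrow> f x \<in> borel_measurable S"
  shows "(\<integral>\<^sup>+x. (\<integral>\<^sup>+s. f x s \<partial>S) \<partial>label_measure n) = (\<integral>\<^sup>+s. (\<integral>\<^sup>+x. f x s \<partial>label_measure n) \<partial>S)"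
proof -
  interpret S: sigma_finite_measure S by fact
  interpret L: prob_space "label_measure n" by (rule prob_space_label_measure)
  interpret pair_sigma_finite "label_measure n" S ..
  show ?thesis by (rule Fubini'[symmetric]) (rule measurable_label_pair[OF f])
qed

lemma label_splice:
  "(\<integral>\<^sup>+x. H x \<partial>label_measure n) = (\<integral>\<^sup>+x. (\<integral>\<^sup>+y. H (splice_at A x y) \<partial>label_measure n) \<partial>label_measure n)"
  unfolding label_measure_def
  by (rule nn_integral_PiM_splice) (auto intro: prob_space_measure_pmf measurable_label[unfolded label_measure_def])

lemma label_indep_mult:
  assumes "depends_on A f" "depends_on B g" "A \<inter> B = {}"
  shows "(\<integral>\<^sup>+x. f x * g x \<partial>label_measure n) = (\<integral>\<^sup>+x. f x \<partial>label_measure n) * (\<integral>\<^sup>+x. g x \<partial>label_measure n)"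
  unfolding label_measure_def
  by (rule nn_integral_PiM_indep_mult[OF _ _ _ _ assms])
    (auto intro: prob_space_measure_pmf measurable_label[unfolded label_measure_def])

lemma nn_integral_fair_bit:
  "(\<integral>\<^sup>+y. f y \<partial>measure_pmf (bernoulli_pmf (1 / 2))) = (\<Sum>y\<in>UNIV. ennreal (1 / 2) * f y)"
  by (subst nn_integral_measure_pmf, subst nn_integral_count_space_finite) (auto simp: UNIV_bool)

text \<open>Conditions on the label of \<open>v\<close> by resampling this one coordinate, which
  leaves the other labels untouched and avoids conditional laws.\<close>

lemma label_root:
  assumes "v < n"
  shows "(\<integral>\<^sup>+x. H x \<partial>label_measure n) = (\<Sum>y\<in>UNIV. ennreal (1 / 2) * (\<integral>\<^sup>+x. H (x(v := y)) \<partial>label_measure n))"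
proof -
  have sp: "splice_at (- {v}) x z = x(v := z v)" for x z :: labelling
    by (auto simp: splice_at_def)
  have "(\<integral>\<^sup>+x. H x \<partial>label_measure n) = (\<integral>\<^sup>+x. (\<integral>\<^sup>+z. H (x(v := z v)) \<partial>label_measure n) \<partial>label_measure n)"
    by (subst label_splice[of _ _ "- {v}"]) (simp add: sp)
  also have "\<dots> = (\<integral>\<^sup>+x. (\<Sum>y\<in>UNIV. ennreal (1 / 2) * H (x(v := y))) \<partial>label_measure n)"
  proof (rule nn_integral_cong)
    fix x
    have "(\<integral>\<^sup>+z. H (x(v := z v)) \<partial>label_measure n) = (\<integral>\<^sup>+y. H (x(v := y)) \<partial>measure_pmf (bernoulli_pmf (1 / 2)))"
      unfolding label_measure_def using assms
      by (intro nn_integral_PiM_component[where f = "\<lambda>y. H (x(v := y))"]) (auto intro: prob_space_measure_pmf)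
    then show "(\<integral>\<^sup>+z. H (x(v := z v)) \<partial>label_measure n) = (\<Sum>y\<in>UNIV. ennreal (1 / 2) * H (x(v := y)))"
      by (simp only: nn_integral_fair_bit)
  qed
  also have "\<dots> = (\<Sum>y\<in>UNIV. ennreal (1 / 2) * (\<integral>\<^sup>+x. H (x(v := y)) \<partial>label_measure n))"
    by (subst nn_integral_sum) (auto intro: measurable_label simp: nn_integral_cmult measurable_label)
  finally show ?thesis .
qed

lemma prod_kids:
  assumes wf: "wf_tree (Suc T) \<tau>" and A: "\<And>t. A t \<subseteq> names T t"
  shows "prod f (\<Union>t\<in>set (kids \<tau>). A t) = (\<Prod>t\<leftarrow>kids \<tau>. prod f (A t))"
proof -
  have "prod f (\<Union>t\<in>set (kids \<tau>). A t) = (\<Prod>t\<in>set (kids \<tau>). prod f (A t))"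
  proof (rule prod.UNION_disjoint)
    show "\<forall>t\<in>set (kids \<tau>). finite (A t)" using A finite_names finite_subset by blast
    show "\<forall>t\<in>set (kids \<tau>). \<forall>t'\<in>set (kids \<tau>). t \<noteq> t' \<longrightarrow> A t \<inter> A t' = {}"
      using wf A by (simp only: wf_tree.simps) blast
  qed simp
  also have "\<dots> = (\<Prod>t\<leftarrow>kids \<tau>. prod f (A t))"
    using wf by (intro prod.distinct_set_conv_list) (auto simp: distinct_map)
  finally show ?thesis .
qed

lemma tedges_nonempty: "e \<in> tedges T \<tau> \<Longrightarrow> e \<noteq> {}"
  by (induction T arbitrary: \<tau>) auto

lemma prod_list_mult: "(\<Prod>t\<leftarrow>ts. f t * g t) = (\<Prod>t\<leftarrow>ts. f t) * (\<Prod>t\<leftarrow>ts. g t :: 'a :: comm_monoid_mult)"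
  by (induction ts) (auto simp: mult_ac)

section \<open>Summing out the labels of a tree\<close>

context tree_model
begin

text \<open>Edges are unordered; their smaller and larger endpoints serve as representatives, and
  \<open>conn\<close> is symmetric.\<close>

definition econn :: "labelling \<Rightarrow> nat set \<Rightarrow> real" where
  "econn x e = conn (x (Min e)) (x (Max e))"

lemma econn_doubleton: "econn x {u, w} = conn (x u) (x w)"
  by (cases "u \<le> w") (auto simp: econn_def conn_def min_def max_def)

text \<open>The likelihood of a labelling of the whole tree as a flat product over vertices and
  edges. This form appears in the probability of a graph; \<open>nn_integral_joint\<close>
  identifies its average with the recursive \<open>lik\<close>.\<close>

definition joint :: "nat \<Rightarrow> labelling \<Rightarrow> (nat \<Rightarrow> 'w) \<Rightarrow> ntree \<Rightarrow> real" where
  "joint T x \<omega> \<tau> = (\<Prod>u\<in>inner T \<tau>. exp (- d) * (1 + sg (x u) * mag (\<omega> u))) *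
     (\<Prod>u\<in>names T \<tau> - inner T \<tau>. 1 + sg (x u) * leaf (\<omega> u)) * (\<Prod>e\<in>tedges T \<tau>. econn x e)"

lemma conn_nonneg: "0 \<le> conn x z" using a b by (simp add: conn_def)
lemma econn_nonneg: "0 \<le> econn x e" by (simp add: econn_def conn_nonneg)
lemma mag_nonneg: "0 \<le> 1 + sg y * mag w" and leaf_nonneg: "0 \<le> 1 + sg y * leaf w"
  using mag_le[of w] leaf_le[of w] by (auto simp: sg_def)

lemma joint_nonneg: "0 \<le> joint T x \<omega> \<tau>"
  unfolding joint_def by (intro mult_nonneg_nonneg prod_nonneg ballI econn_nonneg mag_nonneg leaf_nonneg) simp

lemma joint_0: "wf_tree 0 \<tau> \<Longrightarrow> joint 0 x \<omega> \<tau> = 1 + sg (x (root \<tau>)) * leaf (\<omega> (root \<tau>))"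
  by (simp add: joint_def)

lemma joint_Suc:
  assumes wf: "wf_tree (Suc T) \<tau>"
  shows "joint (Suc T) x \<omega> \<tau> = (1 + sg (x (root \<tau>)) * mag (\<omega> (root \<tau>))) * exp (- d) *
    (\<Prod>t\<leftarrow>kids \<tau>. conn (x (root \<tau>)) (x (root t)) * joint T x \<omega> t)"
proof -
  let ?v = "root \<tau>"
  have v: "?v \<notin> names T t" if "t \<in> set (kids \<tau>)" for t using wf that by auto
  have "finite (inner T t)" for t by (rule finite_subset[OF inner_subset finite_names])
  then have "?v \<notin> (\<Union>t\<in>set (kids \<tau>). inner T t)" "finite (\<Union>t\<in>set (kids \<tau>). inner T t)"
    using v inner_subset by blast+
  then have 1: "(\<Prod>u\<in>inner (Suc T) \<tau>. exp (- d) * (1 + sg (x u) * mag (\<omega> u))) =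
    exp (- d) * (1 + sg (x ?v) * mag (\<omega> ?v)) *
    (\<Prod>t\<leftarrow>kids \<tau>. \<Prod>u\<in>inner T t. exp (- d) * (1 + sg (x u) * mag (\<omega> u)))"
    by (simp add: prod_kids[OF wf inner_subset])
  have disj: "names T t \<inter> names T t' = {}" if "t \<in> set (kids \<tau>)" "t' \<in> set (kids \<tau>)" "t \<noteq> t'" for t t'
    using wf that by auto
  have "names (Suc T) \<tau> - inner (Suc T) \<tau> = (\<Union>t\<in>set (kids \<tau>). names T t - inner T t)"
  proof
    show "names (Suc T) \<tau> - inner (Suc T) \<tau> \<subseteq> (\<Union>t\<in>set (kids \<tau>). names T t - inner T t)" by auto
    show "(\<Union>t\<in>set (kids \<tau>). names T t - inner T t) \<subseteq> names (Suc T) \<tau> - inner (Suc T) \<tau>"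
    proof
      fix u assume "u \<in> (\<Union>t\<in>set (kids \<tau>). names T t - inner T t)"
      then obtain t where t: "t \<in> set (kids \<tau>)" "u \<in> names T t" "u \<notin> inner T t" by auto
      have "u \<notin> inner T t'" if "t' \<in> set (kids \<tau>)" for t'
        using t that disj[of t t'] inner_subset[of T t'] by (cases "t = t'") auto
      with t v show "u \<in> names (Suc T) \<tau> - inner (Suc T) \<tau>" by auto
    qed
  qed
  then have 2: "(\<Prod>u\<in>names (Suc T) \<tau> - inner (Suc T) \<tau>. 1 + sg (x u) * leaf (\<omega> u)) =
    (\<Prod>t\<leftarrow>kids \<tau>. \<Prod>u\<in>names T t - inner T t. 1 + sg (x u) * leaf (\<omega> u))"
    by (simp add: prod_kids[OF wf Diff_subset])
  have 3: "(\<Prod>e\<in>tedges (Suc T) \<tau>. econn x e) =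
    (\<Prod>t\<leftarrow>kids \<tau>. conn (x ?v) (x (root t)) * (\<Prod>e\<in>tedges T t. econn x e))"
  proof -
    have fin: "finite (tedges T t)" for t
      by (rule finite_subset[of _ "Pow (names T t)"]) (use tedges_subset finite_names in auto)
    have "(\<Prod>e\<in>tedges (Suc T) \<tau>. econn x e) = (\<Prod>t\<in>set (kids \<tau>). \<Prod>e\<in>insert {?v, root t} (tedges T t). econn x e)"
      unfolding tedges.simps
    proof (rule prod.UNION_disjoint)
      \<comment> \<open>Every edge in the branch of \<open>t\<close> meets the names of
        \<open>t\<close> and reaches no other branch, so different branches have disjoint edge
        sets.\<close>
      have ne: "e \<inter> names T t \<noteq> {} \<and> e \<subseteq> insert ?v (names T t)" if "t \<in> set (kids \<tau>)" "e \<in> insert {?v, root t} (tedges T t)" for e t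
      proof -
        from that show ?thesis using tedges_nonempty[of e T t] tedges_subset[of e T t] root_in_names[of t T] by auto
      qed
      show "\<forall>t\<in>set (kids \<tau>). \<forall>t'\<in>set (kids \<tau>). t \<noteq> t' \<longrightarrow>
        insert {?v, root t} (tedges T t) \<inter> insert {?v, root t'} (tedges T t') = {}"
      proof (intro ballI impI)
        fix t t' assume t: "t \<in> set (kids \<tau>)" "t' \<in> set (kids \<tau>)" "t \<noteq> t'"
        show "insert {?v, root t} (tedges T t) \<inter> insert {?v, root t'} (tedges T t') = {}"
        proof (rule ccontr)
          assume "insert {?v, root t} (tedges T t) \<inter> insert {?v, root t'} (tedges T t') \<noteq> {}"
          then obtain e where e: "e \<in> insert {?v, root t} (tedges T t)" "e \<in> insert {?v, root t'} (tedges T t')" by blast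
          with ne[OF t(1) e(1)] ne[OF t(2) e(2)] disj[OF t] v[OF t(1)] v[OF t(2)] show False by blast
        qed
      qed
    qed (use fin in auto)
    also have "\<dots> = (\<Prod>t\<in>set (kids \<tau>). conn (x ?v) (x (root t)) * (\<Prod>e\<in>tedges T t. econn x e))"
    proof (rule prod.cong[OF refl])
      fix t assume t: "t \<in> set (kids \<tau>)"
      have "{?v, root t} \<notin> tedges T t" using tedges_subset[of "{?v, root t}" T t] v[OF t] by auto
      then show "(\<Prod>e\<in>insert {?v, root t} (tedges T t). econn x e) = conn (x ?v) (x (root t)) * (\<Prod>e\<in>tedges T t. econn x e)"
        using fin by (simp add: econn_doubleton)
    qed
    also have "\<dots> = (\<Prod>t\<leftarrow>kids \<tau>. conn (x ?v) (x (root t)) * (\<Prod>e\<in>tedges T t. econn x e))"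
      using wf by (intro prod.distinct_set_conv_list) (auto simp: distinct_map)
    finally show ?thesis .
  qed
  show ?thesis
    unfolding joint_def 1 2 3 by (simp add: prod_list_mult mult_ac)
qed

lemma depends_on_joint: "depends_on (names T \<tau>) (\<lambda>x. joint T x \<omega> \<tau>)"
proof (rule depends_onI)
  fix x y :: labelling assume eq: "\<And>i. i \<in> names T \<tau> \<Longrightarrow> x i = y i"
  have "econn x e = econn y e" if e: "e \<in> tedges T \<tau>" for e

  proof -
    have "finite e" using tedges_subset[OF e] finite_names finite_subset by blast
    then have "Min e \<in> e" "Max e \<in> e" using tedges_nonempty[OF e] by auto
    then have "x (Min e) = y (Min e)" "x (Max e) = y (Max e)" using tedges_subset[OF e] by (auto intro!: eq)
    then show ?thesis by (simp add: econn_def)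
  qed
  moreover have "x u = y u" if "u \<in> inner T \<tau>" for u using that inner_subset eq by blast
  ultimately show "joint T x \<omega> \<tau> = joint T y \<omega> \<tau>"
    unfolding joint_def by (intro arg_cong2[where f = "(*)"] prod.cong refl) (auto simp: eq)
qed

text \<open>Given the root label, the labels of different branches are independent; averaging over
  the fair label of a child produces the factor 1/2 of each edge in \<open>lik\<close>.\<close>

lemma nn_integral_joint:
  assumes "\<tau> \<in> trees n k T Z v" "v < n"
  shows "(\<integral>\<^sup>+x. ennreal (joint T (x(v := y)) \<omega> \<tau>) \<partial>label_measure n) = ennreal (lik T \<omega> \<tau> y)"
  using assms
proof (induction T arbitrary: Z v \<tau> y)
  case 0
  interpret L: prob_space "label_measure n" by (rule prob_space_label_measure)
  have "root \<tau> = v" "wf_tree 0 \<tau>" using 0 by auto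
  then show ?case by (simp add: joint_0 L.emeasure_space_1)
next
  case (Suc T)
  interpret L: prob_space "label_measure n" by (rule prob_space_label_measure)
  have msg: "(\<integral>\<^sup>+x. ennreal (conn y (x (root t)) * joint T x \<omega> t) \<partial>label_measure n) = ennreal (msg T \<omega> t y)"
    if t: "t \<in> trees n k T Z w" "w < n" for t Z w y
  proof -
    have r: "root t = w" using root_tree[OF t(1)] .
    have "(\<integral>\<^sup>+x. ennreal (conn y (x (root t)) * joint T x \<omega> t) \<partial>label_measure n) =
      (\<Sum>z\<in>UNIV. ennreal (1 / 2) * (\<integral>\<^sup>+x. ennreal (conn y z * joint T (x(w := z)) \<omega> t) \<partial>label_measure n))"
      by (subst label_root[OF t(2)]) (simp add: r)
    also have "\<dots> = (\<Sum>z\<in>UNIV. ennreal (1 / 2) * (ennreal (conn y z) * ennreal (lik T \<omega> t z)))"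
      by (simp add: ennreal_mult' conn_nonneg nn_integral_cmult measurable_label Suc.IH[OF t])
    also have "\<dots> = (\<Sum>z\<in>UNIV. ennreal (conn y z / 2 * lik T \<omega> t z))"
    proof (rule sum.cong[OF refl])
      fix z
      have "ennreal (conn y z / 2 * lik T \<omega> t z) = ennreal (1 / 2 * (conn y z * lik T \<omega> t z))" by simp
      also have "\<dots> = ennreal (1 / 2) * (ennreal (conn y z) * ennreal (lik T \<omega> t z))"
        by (subst ennreal_mult', simp, subst ennreal_mult', rule conn_nonneg, rule refl)
      finally show "ennreal (1 / 2) * (ennreal (conn y z) * ennreal (lik T \<omega> t z)) = ennreal (conn y z / 2 * lik T \<omega> t z)" ..
    qed
    also have "\<dots> = ennreal (msg T \<omega> t y)"
      unfolding msg_def by (rule sum_ennreal) (auto intro!: mult_nonneg_nonneg conn_nonneg lik_nonneg)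
    finally show ?thesis .
  qed
  have forest: "(\<integral>\<^sup>+x. ennreal (\<Prod>t\<leftarrow>ts. conn y (x (root t)) * joint T x \<omega> t) \<partial>label_measure n) = ennreal (msgs T \<omega> ts y)"
    if "ts \<in> forests (trees n k T) (names T) Z ws" "distinct ws" "set ws \<subseteq> Z" "set ws \<subseteq> {..<n}" for ts Z ws y
    using that
  proof (induction ws arbitrary: ts Z)
    case Nil
    then show ?case by (simp add: L.emeasure_space_1)
  next
    case (Cons w ws)
    then obtain t ts' where ts: "ts = t # ts'" by auto
    note * = forest_ConsD[OF Cons.prems(1)[unfolded ts] Cons.prems(2,3)]
    let ?f = "\<lambda>t x. conn y (x (root t)) * joint T x \<omega> t"
    have f: "?f t x = ?f t x'" if "\<And>i. i \<in> names T t \<Longrightarrow> x i = x' i" for t x x'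
      using that root_in_names[of t T] by (simp add: depends_onD[OF depends_on_joint that])
    have "(\<integral>\<^sup>+x. ennreal (\<Prod>t\<leftarrow>ts. ?f t x) \<partial>label_measure n) =
      (\<integral>\<^sup>+x. ennreal (?f t x) * ennreal (\<Prod>t\<leftarrow>ts'. ?f t x) \<partial>label_measure n)"
      unfolding ts by (simp add: ennreal_mult' conn_nonneg joint_nonneg)
    also have "\<dots> = (\<integral>\<^sup>+x. ennreal (?f t x) \<partial>label_measure n) * (\<integral>\<^sup>+x. ennreal (\<Prod>t\<leftarrow>ts'. ?f t x) \<partial>label_measure n)"
    proof (rule label_indep_mult[OF _ _ *(3)])
      show "depends_on (names T t) (\<lambda>x. ennreal (?f t x))"
        by (intro depends_onI arg_cong[where f = ennreal] f)
      show "depends_on (\<Union>t\<in>set ts'. names T t) (\<lambda>x. ennreal (\<Prod>t\<leftarrow>ts'. ?f t x))"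
        by (intro depends_onI arg_cong[where f = ennreal] arg_cong[where f = prod_list] map_cong refl f) blast
    qed
    also have "(\<integral>\<^sup>+x. ennreal (?f t x) \<partial>label_measure n) = ennreal (msg T \<omega> t y)"
      using Cons.prems by (intro msg[OF *(1)]) auto
    also have "(\<integral>\<^sup>+x. ennreal (\<Prod>t\<leftarrow>ts'. ?f t x) \<partial>label_measure n) = ennreal (msgs T \<omega> ts' y)"
      using Cons.prems by (intro Cons.IH[OF *(2)]) auto
    finally show ?case by (simp add: ts ennreal_mult' msg_nonneg)
  qed
  obtain C ts where C: "C \<in> kid_sets n k Z v" and \<tau>: "\<tau> = Node v ts"
    and ts: "ts \<in> forests (trees n k T) (names T) (insert v Z \<union> C) (sorted_list_of_set C)"
    using Suc.prems by auto
  have fC: "finite C" "C \<subseteq> {..<n}" "v \<notin> C" using C kid_setsD[OF C] by (auto simp: kid_sets_def)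
  have wf: "wf_tree (Suc T) \<tau>" by (rule wf_trees[OF Suc.prems(1)])
  have "joint (Suc T) (x(v := y)) \<omega> \<tau> = (1 + sg y * mag (\<omega> v)) * exp (- d) *
      (\<Prod>t\<leftarrow>ts. conn y (x (root t)) * joint T x \<omega> t)" for x
  proof -
    have "map (\<lambda>t. conn y ((x(v := y)) (root t)) * joint T (x(v := y)) \<omega> t) ts =
      map (\<lambda>t. conn y (x (root t)) * joint T x \<omega> t) ts"
    proof (rule map_cong[OF refl])
      fix t assume "t \<in> set ts"
      then have "v \<notin> names T t" using wf \<tau> by auto
      moreover from this have "joint T (x(v := y)) \<omega> t = joint T x \<omega> t"
        by (intro depends_onD[OF depends_on_joint]) auto
      ultimately show "conn y ((x(v := y)) (root t)) * joint T (x(v := y)) \<omega> t = conn y (x (root t)) * joint T x \<omega> t"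
        using root_in_names[of t T] by auto
    qed
    then show ?thesis unfolding joint_Suc[OF wf] by (simp only: \<tau> ntree.sel fun_upd_same)
  qed
  then have "(\<integral>\<^sup>+x. ennreal (joint (Suc T) (x(v := y)) \<omega> \<tau>) \<partial>label_measure n) =
    (\<integral>\<^sup>+x. ennreal ((1 + sg y * mag (\<omega> v)) * exp (- d)) * ennreal (\<Prod>t\<leftarrow>ts. conn y (x (root t)) * joint T x \<omega> t) \<partial>label_measure n)"
    by (simp add: ennreal_mult' mag_nonneg)
  also have "\<dots> = ennreal ((1 + sg y * mag (\<omega> v)) * exp (- d)) *
    (\<integral>\<^sup>+x. ennreal (\<Prod>t\<leftarrow>ts. conn y (x (root t)) * joint T x \<omega> t) \<partial>label_measure n)"
    by (rule nn_integral_cmult) (rule measurable_label)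
  also have "(\<integral>\<^sup>+x. ennreal (\<Prod>t\<leftarrow>ts. conn y (x (root t)) * joint T x \<omega> t) \<partial>label_measure n) = ennreal (msgs T \<omega> ts y)"
    using fC by (intro forest[OF ts]) auto
  also have "ennreal ((1 + sg y * mag (\<omega> v)) * exp (- d)) * ennreal (msgs T \<omega> ts y) = ennreal (lik (Suc T) \<omega> \<tau> y)"
    unfolding \<tau> lik_Suc by (rule ennreal_mult''[symmetric]) (rule msgs_nonneg)
  finally show ?case .
qed

end

section \<open>Side information as a density\<close>

text \<open>
  The law of the side information of a vertex without knowledge of its label. The channel has the
  density \<open>1 \<plusminus> emag s\<close> with respect to it, where \<open>emag s\<close> is the posterior mean.
\<close>

definition base_law :: "ereal measure \<Rightarrow> ereal measure" where
  "base_law \<mu> = measure_pmf (bernoulli_pmf (1 / 2)) \<bind> channel \<mu>"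

definition graph_prob :: "nat \<Rightarrow> real \<Rightarrow> real \<Rightarrow> labelling \<Rightarrow> (nat \<times> nat \<Rightarrow> bool) \<Rightarrow> real" where
  "graph_prob n a b x g = (\<Prod>e\<in>vertex_pairs n. pmf (bernoulli_pmf (if x (fst e) = x (snd e) then a / n else b / n)) (g e))"

lemma nn_integral_graph:
  "(\<integral>\<^sup>+g. f g \<partial>graph_measure n a b x) = (\<Sum>g\<in>vertex_pairs n \<rightarrow>\<^sub>E UNIV. ennreal (graph_prob n a b x g) * f g)"
proof -
  let ?P = "\<lambda>e. measure_pmf (bernoulli_pmf (if x (fst e) = x (snd e) then a / n else b / n))"
  let ?G = "vertex_pairs n \<rightarrow>\<^sub>E (UNIV :: bool set)"
  let ?M = "graph_measure n a b x"
  interpret product_prob_space ?P "vertex_pairs n"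
    by (simp add: product_prob_space_def product_sigma_finite_def product_prob_space_axioms_def
        prob_space_imp_sigma_finite prob_space_measure_pmf)
  have fin: "finite ?G" by (intro finite_PiE finite_vertex_pairs) auto
  have sp: "space ?M = ?G" by (simp add: graph_measure_def space_PiM)
  have em: "{g} \<in> sets ?M" "emeasure ?M {g} = ennreal (graph_prob n a b x g)" if g: "g \<in> ?G" for g
  proof -
    have eq: "{g} = (\<Pi>\<^sub>E e\<in>vertex_pairs n. {g e})"
      using g PiE_singleton[of g "vertex_pairs n"] unfolding PiE_def by blast
    show "{g} \<in> sets ?M" unfolding eq graph_measure_def
      by (intro sets_PiM_I_finite finite_vertex_pairs) auto
    have "emeasure ?M {g} = (\<Prod>e\<in>vertex_pairs n. emeasure (?P e) {g e})"
      unfolding eq graph_measure_def by (intro emeasure_PiM finite_vertex_pairs) auto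
    then show "emeasure ?M {g} = ennreal (graph_prob n a b x g)"
      by (simp add: emeasure_pmf_single prod_ennreal graph_prob_def)
  qed
  have "(\<integral>\<^sup>+g. f g \<partial>?M) = (\<integral>\<^sup>+g. (\<Sum>h\<in>?G. f h * indicator {h} g) \<partial>?M)"
  proof (rule nn_integral_cong)
    fix g assume "g \<in> space ?M"
    then have "g \<in> ?G" by (simp add: sp)
    then show "f g = (\<Sum>h\<in>?G. f h * indicator {h} g)"
      using fin by (simp add: indicator_def sum.delta if_distrib cong: if_cong)
  qed
  also have "\<dots> = (\<Sum>h\<in>?G. \<integral>\<^sup>+g. f h * indicator {h} g \<partial>?M)"
    by (rule nn_integral_sum) (use em in auto)
  also have "\<dots> = (\<Sum>h\<in>?G. ennreal (graph_prob n a b x h) * f h)"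
    using em by (intro sum.cong refl) (simp add: nn_integral_cmult_indicator mult.commute)
  finally show ?thesis .
qed

context
  fixes \<mu> :: "ereal measure"
  assumes sym: "symmetric_distribution \<mu>"
begin

lemma prob_mu: "prob_space \<mu>" and sets_mu [measurable_cong]: "sets \<mu> = sets borel"
  and mu_minf: "emeasure \<mu> {-\<infinity>} = 0"
  using sym by (auto simp: symmetric_distribution_def)

lemma sets_channel: "sets (channel \<mu> y) = sets borel"
  by (simp add: channel_def sets_mu)

lemma channel_kernel: "channel \<mu> \<in> measurable (measure_pmf (bernoulli_pmf (1 / 2))) (subprob_algebra borel)"
  using prob_space_channel[OF prob_mu sets_mu]
  by (auto simp: space_subprob_algebra sets_channel intro: prob_space_imp_subprob_space)

lemma sets_base_law [measurable_cong]: "sets (base_law \<mu>) = sets borel"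
  unfolding base_law_def by (rule sets_bind) (auto simp: channel_def sets_mu)

lemma prob_space_base_law: "prob_space (base_law \<mu>)"
  unfolding base_law_def
  by (rule prob_space.prob_space_bind[OF prob_space_measure_pmf _ channel_kernel])
    (simp add: prob_space_channel prob_mu sets_mu)

lemma nn_integral_base_law:
  assumes [measurable]: "f \<in> borel_measurable borel"
  shows "(\<integral>\<^sup>+s. f s \<partial>base_law \<mu>) = ennreal (1 / 2) * (\<integral>\<^sup>+s. f s \<partial>\<mu>) + ennreal (1 / 2) * (\<integral>\<^sup>+s. f (- s) \<partial>\<mu>)"
proof -
  have 1: "(\<integral>\<^sup>+s. f s \<partial>base_law \<mu>) = (\<Sum>y\<in>UNIV. ennreal (1 / 2) * (\<integral>\<^sup>+s. f s \<partial>channel \<mu> y))"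
    unfolding base_law_def by (subst nn_integral_bind[OF assms channel_kernel]) (rule nn_integral_fair_bit)
  have 2: "(\<integral>\<^sup>+s. f s \<partial>channel \<mu> True) = (\<integral>\<^sup>+s. f (- s) \<partial>\<mu>)"
    unfolding channel_def if_True by (rule nn_integral_distr) measurable
  have 3: "channel \<mu> False = \<mu>" by (simp add: channel_def)
  show ?thesis by (simp only: 1 UNIV_bool) (simp add: 2 3)
qed

lemma emag_uminus: "emag (- s) = - emag s"
  by (cases s) auto

text \<open>Symmetry is an identity of two measures on the finite values, so it extends to all
  nonnegative functions that vanish at both infinities.\<close>

lemma symmetric_nn_integral:
  assumes [measurable]: "f \<in> borel_measurable borel" and f: "f \<infinity> = 0" "f (-\<infinity>) = 0"
  shows "(\<integral>\<^sup>+s. f s \<partial>\<mu>) = (\<integral>\<^sup>+r. ennreal (exp (- real_of_ereal r)) * f (- r) \<partial>\<mu>)"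
proof -
  define F where "F = UNIV - {-\<infinity>, \<infinity> :: ereal}"
  have [measurable]: "F \<in> sets borel" unfolding F_def by auto
  define \<kappa> where "\<kappa> = distr (density \<mu> (\<lambda>r. ennreal (exp (- real_of_ereal r)))) borel uminus"
  have nk: "(\<integral>\<^sup>+s. h s \<partial>\<kappa>) = (\<integral>\<^sup>+r. ennreal (exp (- real_of_ereal r)) * h (- r) \<partial>\<mu>)"
    if [measurable]: "h \<in> borel_measurable borel" for h
    unfolding \<kappa>_def by (subst nn_integral_distr, measurable, subst nn_integral_density) auto
  have "density \<mu> (indicator F) = density \<kappa> (indicator F)"
  proof (rule measure_eqI)
    show "sets (density \<mu> (indicator F)) = sets (density \<kappa> (indicator F))" by (simp add: sets_mu \<kappa>_def)
    fix A assume "A \<in> sets (density \<mu> (indicator F))"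
    then have [measurable]: "A \<in> sets borel" by (simp add: sets_mu)
    have "emeasure (density \<mu> (indicator F)) A = (\<integral>\<^sup>+s. indicator (A \<inter> F) s \<partial>\<mu>)"
      by (subst emeasure_density; (simp add: sets_mu; fail)?) (rule nn_integral_cong, auto simp: indicator_def)
    also have "\<dots> = emeasure \<mu> (A \<inter> F)" by (rule nn_integral_indicator) (simp add: sets_mu)
    also have "\<dots> = (\<integral>\<^sup>+r. ennreal (exp (- real_of_ereal r)) * indicator (A \<inter> F) (- r) \<partial>\<mu>)"
    proof -
      have "A \<inter> F \<in> sets borel" "A \<inter> F \<subseteq> UNIV - {-\<infinity>, \<infinity>}" by (auto simp: F_def)
      with sym show ?thesis unfolding symmetric_distribution_def by blast
    qed
    also have "\<dots> = (\<integral>\<^sup>+s. indicator (A \<inter> F) s \<partial>\<kappa>)" by (rule nk[symmetric]) measurable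
    also have "\<dots> = emeasure (density \<kappa> (indicator F)) A"
      by (subst emeasure_density; (simp add: \<kappa>_def; fail)?) (rule nn_integral_cong, auto simp: indicator_def)
    finally show "emeasure (density \<mu> (indicator F)) A = emeasure (density \<kappa> (indicator F)) A" .
  qed
  then have "(\<integral>\<^sup>+s. f s \<partial>density \<mu> (indicator F)) = (\<integral>\<^sup>+s. f s \<partial>density \<kappa> (indicator F))" by simp
  moreover have "(\<integral>\<^sup>+s. f s \<partial>density \<mu> (indicator F)) = (\<integral>\<^sup>+s. f s \<partial>\<mu>)"
    by (subst nn_integral_density) (auto simp: F_def indicator_def f intro!: nn_integral_cong)
  moreover have "(\<integral>\<^sup>+s. f s \<partial>density \<kappa> (indicator F)) = (\<integral>\<^sup>+s. f s \<partial>\<kappa>)"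
    by (subst nn_integral_density) (auto simp: F_def indicator_def f \<kappa>_def intro!: nn_integral_cong)
  ultimately show ?thesis by (simp add: nk)
qed

text \<open>The reflected half of \<open>base_law\<close> is moved back to \<open>\<mu>\<close> by
  symmetry. Since \<open>exp (- r) * (1 + tanh (r / 2)) = 1 - tanh (r / 2)\<close>, the two halves
  carry the weights \<open>1 + emag\<close> and \<open>1 - emag\<close>, which add up to 2.\<close>

lemma nn_integral_base_law_plus:
  assumes [measurable]: "f \<in> borel_measurable borel"
  shows "(\<integral>\<^sup>+s. ennreal (1 + emag s) * f s \<partial>base_law \<mu>) = (\<integral>\<^sup>+s. f s \<partial>\<mu>)"
proof -
  \<comment> \<open>Cut off at both infinities for \<open>symmetric_nn_integral\<close>: the weight
    \<open>1 + emag (- s)\<close> vanishes at \<open>\<infinity>\<close>, and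
    \<open>-\<infinity>\<close> is a null set.\<close>
  define g where "g s = (if s = \<infinity> \<or> s = -\<infinity> then 0 else ennreal (1 - emag s) * f (- s))" for s
  have [measurable]: "g \<in> borel_measurable borel" unfolding g_def by measurable
  have "ennreal (1 + emag (- s)) * f (- s) = g s" if "s \<noteq> -\<infinity>" for s
    using that by (cases s) (auto simp: g_def emag_uminus)
  moreover have "AE s in \<mu>. s \<noteq> -\<infinity>" using mu_minf by (intro AE_I[where N = "{-\<infinity>}"]) (auto simp: sets_mu)
  ultimately have "(\<integral>\<^sup>+s. ennreal (1 + emag (- s)) * f (- s) \<partial>\<mu>) = (\<integral>\<^sup>+s. g s \<partial>\<mu>)"
    by (intro nn_integral_cong_AE) (auto elim: eventually_mono)
  also have "\<dots> = (\<integral>\<^sup>+r. ennreal (exp (- real_of_ereal r)) * g (- r) \<partial>\<mu>)"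
    by (rule symmetric_nn_integral) (auto simp: g_def)
  also have "\<dots> = (\<integral>\<^sup>+r. ennreal (1 - emag r) * f r \<partial>\<mu>)"
  proof (intro nn_integral_cong_AE, use \<open>AE s in \<mu>. s \<noteq> -\<infinity>\<close> in eventually_elim)
    case (elim s)
    show ?case
    proof (cases s)
      case (real r)
      have "exp (- r) * (1 + tanh (r / 2)) = 1 - tanh (r / 2)"
        unfolding one_plus_tanh_half one_minus_tanh_half by (simp add: exp_minus field_simps)
      then have "ennreal (exp (- r)) * ennreal (1 + tanh (r / 2)) = ennreal (1 - tanh (r / 2))"
        by (simp add: ennreal_mult'[symmetric])
      then show ?thesis using real by (simp add: g_def mult.assoc[symmetric])
    qed (use elim in \<open>auto simp: g_def\<close>)
  qed
  finally have *: "(\<integral>\<^sup>+s. ennreal (1 + emag (- s)) * f (- s) \<partial>\<mu>) = (\<integral>\<^sup>+r. ennreal (1 - emag r) * f r \<partial>\<mu>)" .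
  have "(\<integral>\<^sup>+s. ennreal (1 + emag s) * f s \<partial>base_law \<mu>) = ennreal (1 / 2) *
    ((\<integral>\<^sup>+s. ennreal (1 + emag s) * f s \<partial>\<mu>) + (\<integral>\<^sup>+r. ennreal (1 - emag r) * f r \<partial>\<mu>))"
    by (subst nn_integral_base_law) (measurable, simp only: * distrib_left)
  also have "(\<integral>\<^sup>+s. ennreal (1 + emag s) * f s \<partial>\<mu>) + (\<integral>\<^sup>+r. ennreal (1 - emag r) * f r \<partial>\<mu>) =
    (\<integral>\<^sup>+s. 2 * f s \<partial>\<mu>)"
  proof (subst nn_integral_add[symmetric])
    have "ennreal (1 + emag s) + ennreal (1 - emag s) = 2" for s
      using abs_emag_le[of s] by (subst ennreal_plus[symmetric]) auto
    then show "(\<integral>\<^sup>+s. ennreal (1 + emag s) * f s + ennreal (1 - emag s) * f s \<partial>\<mu>) = (\<integral>\<^sup>+s. 2 * f s \<partial>\<mu>)"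
      by (simp add: distrib_right[symmetric])
  qed measurable
  also have "ennreal (1 / 2) * (\<integral>\<^sup>+s. 2 * f s \<partial>\<mu>) = (\<integral>\<^sup>+s. f s \<partial>\<mu>)"
  proof -
    have "ennreal (1 / 2) * ennreal 2 = ennreal (1 / 2 * 2)" by (rule ennreal_mult'[symmetric]) simp
    also have "\<dots> = 1" by simp
    finally have "ennreal (1 / 2) * 2 = 1" by (simp only: ennreal_numeral)
    then show ?thesis by (subst nn_integral_cmult) (measurable, simp add: mult.assoc[symmetric])
  qed
  finally show ?thesis .
qed

lemma nn_integral_base_law_uminus:
  assumes [measurable]: "f \<in> borel_measurable borel"
  shows "(\<integral>\<^sup>+s. f (- s) \<partial>base_law \<mu>) = (\<integral>\<^sup>+s. f s \<partial>base_law \<mu>)"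
  by (subst (1 2) nn_integral_base_law) (auto simp: add.commute)

lemma channel_eq_density: "channel \<mu> y = density (base_law \<mu>) (\<lambda>s. ennreal (1 + sg y * emag s))"
proof (rule measure_eqI)
  show "sets (channel \<mu> y) = sets (density (base_law \<mu>) (\<lambda>s. ennreal (1 + sg y * emag s)))"
    by (simp add: channel_def sets_mu sets_base_law)
  fix A assume "A \<in> sets (channel \<mu> y)"
  then have [measurable]: "A \<in> sets borel" by (auto simp: channel_def sets_mu split: if_splits)
  have d: "emeasure (density (base_law \<mu>) (\<lambda>s. ennreal (1 + sg y * emag s))) A =
    (\<integral>\<^sup>+s. ennreal (1 + sg y * emag s) * indicator A s \<partial>base_law \<mu>)"
    by (rule emeasure_density) (auto simp: sets_base_law)
  show "emeasure (channel \<mu> y) A = emeasure (density (base_law \<mu>) (\<lambda>s. ennreal (1 + sg y * emag s))) A"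
  proof (cases y)
    case False
    then show ?thesis unfolding d by (simp add: sg_def nn_integral_base_law_plus channel_def sets_mu)
  next
    case True
    have "(\<integral>\<^sup>+s. ennreal (1 + sg y * emag s) * indicator A s \<partial>base_law \<mu>) =
      (\<integral>\<^sup>+s. ennreal (1 + emag s) * indicator A (- s) \<partial>base_law \<mu>)"
      using True nn_integral_base_law_uminus[of "\<lambda>s. ennreal (1 + sg y * emag s) * indicator A s"]
      by (simp add: sg_def emag_uminus)
    also have "\<dots> = (\<integral>\<^sup>+s. indicator A (- s) \<partial>\<mu>)"
      by (rule nn_integral_base_law_plus) measurable
    also have "\<dots> = (\<integral>\<^sup>+s. indicator A s \<partial>distr \<mu> borel uminus)"
      by (subst nn_integral_distr) auto
    also have "\<dots> = emeasure (channel \<mu> y) A" using True by (simp add: channel_def)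
    finally show ?thesis unfolding d ..
  qed
qed

lemma mlaw_base: "mlaw (distr (base_law \<mu>) borel emag)"
proof (rule mlawI)
  show "prob_space (distr (base_law \<mu>) borel emag)"
    by (rule prob_space.prob_space_distr[OF prob_space_base_law]) measurable
  show "AE x in distr (base_law \<mu>) borel emag. \<bar>x\<bar> \<le> 1"
    by (subst AE_distr_iff) (auto simp: abs_emag_le)
  fix A :: "real set" assume [measurable]: "A \<in> sets borel"
  show "(\<integral>\<^sup>+x. indicator A (- x) \<partial>distr (base_law \<mu>) borel emag) = (\<integral>\<^sup>+x. indicator A x \<partial>distr (base_law \<mu>) borel emag)"
    using nn_integral_base_law_uminus[of "\<lambda>s. indicator A (emag s)"]
    by (subst (1 2) nn_integral_distr) (measurable, simp add: emag_uminus)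
qed simp

text \<open>\<open>emag\<close> vanishes only at 0, so an excess of 0 would concentrate
  \<open>base_law\<close>, and with it \<open>\<mu>\<close>, at 0.\<close>

lemma base_law_nontrivial:
  assumes "\<mu> \<noteq> return borel 0"
  shows "excess (distr (base_law \<mu>) borel emag) 0 \<noteq> 0"
proof
  assume "excess (distr (base_law \<mu>) borel emag) 0 = 0"
  then have "(\<integral>\<^sup>+s. ennreal \<bar>emag s\<bar> \<partial>base_law \<mu>) = 0"
    unfolding excess_def by (subst (asm) nn_integral_distr) auto
  then have "AE s in base_law \<mu>. ennreal \<bar>emag s\<bar> = 0"
    by (subst (asm) nn_integral_0_iff_AE) auto
  moreover have "s = 0" if "ennreal \<bar>emag s\<bar> = 0" for s
    using that by (cases s) (auto simp: zero_ereal_def)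
  ultimately have "AE s in base_law \<mu>. s = 0" by (auto elim: eventually_mono)
  then have "(\<integral>\<^sup>+s. indicator (- {0}) s \<partial>base_law \<mu>) = 0"
    by (subst nn_integral_0_iff_AE) (auto simp: indicator_def elim: eventually_mono)
  then have "(\<integral>\<^sup>+s. indicator (- {0}) s \<partial>\<mu>) = 0"
    by (subst (asm) nn_integral_base_law) auto
  then have "emeasure \<mu> (- {0}) = 0" by (simp add: sets_mu)
  then have AE: "AE s in \<mu>. s = 0" by (intro AE_I[where N = "- {0}"]) (auto simp: sets_mu)
  have "\<mu> = return borel 0"
  proof (rule measure_eqI)
    fix A assume "A \<in> sets \<mu>"
    then have [measurable]: "A \<in> sets borel" by (simp add: sets_mu)
    interpret prob_space \<mu> by (rule prob_mu)
    have "emeasure \<mu> A = (\<integral>\<^sup>+s. indicator A s \<partial>\<mu>)" by (simp add: sets_mu)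
    also have "\<dots> = (\<integral>\<^sup>+s. indicator A 0 \<partial>\<mu>)"
      by (rule nn_integral_cong_AE) (use AE in \<open>auto elim: eventually_mono\<close>)
    also have "\<dots> = emeasure (return borel 0) A" by (simp add: emeasure_space_1)
    finally show "emeasure \<mu> A = emeasure (return borel 0) A" .
  qed (simp add: sets_mu)
  with assms show False by contradiction
qed

text \<open>A change of measure: the side information becomes independent of the labels, which enter
  only through an explicit weight. All later exchanges of integrals rest on this form.\<close>

lemma nn_integral_side:
  assumes f: "f \<in> borel_measurable (\<Pi>\<^sub>M v\<in>{..<n}. borel)"
  shows "(\<integral>\<^sup>+s. f s \<partial>side_measure n \<mu> x) =
    (\<integral>\<^sup>+s. (\<Prod>u<n. ennreal (1 + sg (x u) * emag (s u))) * f s \<partial>(\<Pi>\<^sub>M v\<in>{..<n}. base_law \<mu>))"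
proof -
  let ?S = "\<Pi>\<^sub>M v\<in>{..<n}. base_law \<mu>"
  let ?w = "\<lambda>s. \<Prod>u<n. ennreal (1 + sg (x u) * emag (s u))"
  interpret B: product_prob_space "\<lambda>_::nat. base_law \<mu>" "{..<n}"
    using prob_space_base_law by (simp add: product_prob_space_def product_sigma_finite_def product_prob_space_axioms_def prob_space_imp_sigma_finite)
  interpret C: product_prob_space "\<lambda>v. channel \<mu> (x v)" "{..<n}"
    using prob_space_channel[OF prob_mu sets_mu] by (simp add: product_prob_space_def product_sigma_finite_def product_prob_space_axioms_def prob_space_imp_sigma_finite)
  have sets: "sets ?S = sets (\<Pi>\<^sub>M v\<in>{..<n}. borel)" by (intro sets_PiM_cong refl sets_base_law)
  have w: "?w \<in> borel_measurable ?S" by measurable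
  have "density ?S ?w = side_measure n \<mu> x"
    unfolding side_measure_def
  proof (rule C.PiM_eqI)
    show "sets (density ?S ?w) = sets (\<Pi>\<^sub>M v\<in>{..<n}. channel \<mu> (x v))"
      unfolding sets_density by (intro sets_PiM_cong refl) (simp add: sets_base_law channel_def sets_mu)
    fix A assume "\<And>v. v \<in> {..<n} \<Longrightarrow> A v \<in> sets (channel \<mu> (x v))"
    then have A: "A v \<in> sets borel" if "v < n" for v using that by (auto simp: sets_channel)
    have PA: "Pi\<^sub>E {..<n} A \<in> sets ?S" using A by (intro sets_PiM_I_finite) (auto simp: sets_base_law)
    have "emeasure (density ?S ?w) (Pi\<^sub>E {..<n} A) = (\<integral>\<^sup>+s. ?w s * indicator (Pi\<^sub>E {..<n} A) s \<partial>?S)"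
      by (rule emeasure_density[OF w PA])
    also have "\<dots> = (\<integral>\<^sup>+s. (\<Prod>u<n. ennreal (1 + sg (x u) * emag (s u)) * indicator (A u) (s u)) \<partial>?S)"
    proof (rule nn_integral_cong)
      fix s assume "s \<in> space ?S"
      then have "indicator (Pi\<^sub>E {..<n} A) s = (\<Prod>u<n. indicator (A u) (s u) :: ennreal)"
        by (auto simp: space_PiM indicator_def PiE_iff prod_zero_iff)
      then show "?w s * indicator (Pi\<^sub>E {..<n} A) s = (\<Prod>u<n. ennreal (1 + sg (x u) * emag (s u)) * indicator (A u) (s u))"
        by (simp add: prod.distrib)
    qed
    also have "\<dots> = (\<Prod>u<n. \<integral>\<^sup>+s. ennreal (1 + sg (x u) * emag s) * indicator (A u) s \<partial>base_law \<mu>)"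
      using A by (intro B.product_nn_integral_prod) auto
    also have "\<dots> = (\<Prod>u<n. emeasure (channel \<mu> (x u)) (A u))"
      unfolding channel_eq_density using A
      by (intro prod.cong refl emeasure_density[symmetric]) (auto simp: sets_base_law)
    finally show "emeasure (density ?S ?w) (Pi\<^sub>E {..<n} A) = (\<Prod>u\<in>{..<n}. emeasure (channel \<mu> (x u)) (A u))" .
  qed simp
  then have "(\<integral>\<^sup>+s. f s \<partial>side_measure n \<mu> x) = (\<integral>\<^sup>+s. f s \<partial>density ?S ?w)" by simp
  also have "\<dots> = (\<integral>\<^sup>+s. ?w s * f s \<partial>?S)"
    using f measurable_cong_sets[OF sets refl] by (intro nn_integral_density w) auto
  finally show ?thesis .
qed

lemma nn_integral_sbm:
  assumes F: "F \<in> borel_measurable (label_measure n \<Otimes>\<^sub>M observation_space n)"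
  shows "(\<integral>\<^sup>+\<omega>. F \<omega> \<partial>sbm n a b \<mu>) = (\<integral>\<^sup>+x. (\<Sum>g\<in>vertex_pairs n \<rightarrow>\<^sub>E UNIV. ennreal (graph_prob n a b x g) *
     (\<integral>\<^sup>+s. (\<Prod>u<n. ennreal (1 + sg (x u) * emag (s u))) * F (x, (g, s)) \<partial>(\<Pi>\<^sub>M v\<in>{..<n}. base_law \<mu>))) \<partial>label_measure n)"
proof -
  have "(\<integral>\<^sup>+\<omega>. F \<omega> \<partial>sbm n a b \<mu>) = (\<integral>\<^sup>+x. (\<integral>\<^sup>+\<omega>. F \<omega> \<partial>sbm_kernel n a b \<mu> x) \<partial>label_measure n)"
    unfolding sbm_def by (rule nn_integral_bind[OF F measurable_sbm_kernel[OF prob_mu sets_mu]])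
  also have "\<dots> = (\<integral>\<^sup>+x. (\<Sum>g\<in>vertex_pairs n \<rightarrow>\<^sub>E UNIV. ennreal (graph_prob n a b x g) *
     (\<integral>\<^sup>+s. (\<Prod>u<n. ennreal (1 + sg (x u) * emag (s u))) * F (x, (g, s)) \<partial>(\<Pi>\<^sub>M v\<in>{..<n}. base_law \<mu>))) \<partial>label_measure n)"
  proof (rule nn_integral_cong)
    fix x assume x: "x \<in> space (label_measure n)"
    interpret S: prob_space "side_measure n \<mu> x"
      unfolding side_measure_def by (intro prob_space_PiM prob_space_channel prob_mu sets_mu)
    have Fx: "(\<lambda>obs. F (x, obs)) \<in> borel_measurable (observation_space n)"
      using F x by (rule measurable_Pair2)
    then have Fx': "(\<lambda>obs. F (x, obs)) \<in> borel_measurable (graph_measure n a b x \<Otimes>\<^sub>M side_measure n \<mu> x)"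
      by (subst measurable_cong_sets[OF sets_obs[OF sets_mu] refl])
    have "(\<integral>\<^sup>+\<omega>. F \<omega> \<partial>sbm_kernel n a b \<mu> x) = (\<integral>\<^sup>+obs. F (x, obs) \<partial>(graph_measure n a b x \<Otimes>\<^sub>M side_measure n \<mu> x))"
      unfolding sbm_kernel_def by (subst nn_integral_distr[OF Pair_measurable_label[OF x sets_mu]]) (use F in simp_all)
    also have "\<dots> = (\<integral>\<^sup>+g. (\<integral>\<^sup>+s. F (x, (g, s)) \<partial>side_measure n \<mu> x) \<partial>graph_measure n a b x)"
      by (rule S.nn_integral_fst[OF Fx', symmetric])
    also have "\<dots> = (\<Sum>g\<in>vertex_pairs n \<rightarrow>\<^sub>E UNIV. ennreal (graph_prob n a b x g) * (\<integral>\<^sup>+s. F (x, (g, s)) \<partial>side_measure n \<mu> x))"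
      by (rule nn_integral_graph)
    also have "\<dots> = (\<Sum>g\<in>vertex_pairs n \<rightarrow>\<^sub>E UNIV. ennreal (graph_prob n a b x g) *
     (\<integral>\<^sup>+s. (\<Prod>u<n. ennreal (1 + sg (x u) * emag (s u))) * F (x, (g, s)) \<partial>(\<Pi>\<^sub>M v\<in>{..<n}. base_law \<mu>)))"
    proof (intro sum.cong refl arg_cong2[where f = "(*)"] nn_integral_side)
      fix g :: "nat \<times> nat \<Rightarrow> bool" assume "g \<in> vertex_pairs n \<rightarrow>\<^sub>E UNIV"
      then have "g \<in> space (\<Pi>\<^sub>M e\<in>vertex_pairs n. count_space UNIV)" by (simp add: space_PiM)
      then show "(\<lambda>s. F (x, (g, s))) \<in> borel_measurable (\<Pi>\<^sub>M v\<in>{..<n}. borel)"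
        using Fx unfolding observation_space_def by (rule measurable_Pair2[rotated])
    qed
    finally show "(\<integral>\<^sup>+\<omega>. F \<omega> \<partial>sbm_kernel n a b \<mu> x) = (\<Sum>g\<in>vertex_pairs n \<rightarrow>\<^sub>E UNIV. ennreal (graph_prob n a b x g) *
     (\<integral>\<^sup>+s. (\<Prod>u<n. ennreal (1 + sg (x u) * emag (s u))) * F (x, (g, s)) \<partial>(\<Pi>\<^sub>M v\<in>{..<n}. base_law \<mu>)))" .
  qed
  finally show ?thesis .
qed

end

section \<open>The probability of a graph with a prescribed ball\<close>

lemma finite_ball_pairs: "finite (ball_pairs n T \<tau>)"
  by (rule finite_subset[OF _ finite_vertex_pairs[of n]]) (auto simp: ball_pairs_def)

text \<open>An upper bound on the number of outside vertices of each label gives a lower bound on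
  the probability that an interior vertex has no outside neighbour.\<close>

definition balanced :: "nat \<Rightarrow> nat set \<Rightarrow> nat \<Rightarrow> labelling \<Rightarrow> bool" where
  "balanced n V M x \<longleftrightarrow> (\<forall>y. card {w \<in> {..<n} - V. x w = y} \<le> M)"

definition rest_prob :: "nat \<Rightarrow> real \<Rightarrow> real \<Rightarrow> nat \<Rightarrow> ntree \<Rightarrow> labelling \<Rightarrow> (nat \<times> nat \<Rightarrow> bool) \<Rightarrow> real" where
  "rest_prob n a b T \<tau> x g = (\<Prod>e\<in>vertex_pairs n - ball_pairs n T \<tau>.
     pmf (bernoulli_pmf (if x (fst e) = x (snd e) then a / n else b / n)) (g e))"

lemma rest_prob_nonneg: "0 \<le> rest_prob n a b T \<tau> x g"
  unfolding rest_prob_def by (intro prod_nonneg) simp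

text \<open>The pairs outside \<open>ball_pairs\<close> are free in the event, so summing over the
  event is summing over all their states.\<close>

lemma sum_rest_prob: "(\<Sum>g\<in>ball_event n T \<tau>. rest_prob n a b T \<tau> x g) = 1"
proof -
  let ?B = "\<lambda>e. if e \<in> ball_pairs n T \<tau> then {{fst e, snd e} \<in> tedges T \<tau>} else UNIV"
  let ?f = "\<lambda>e c. if e \<in> ball_pairs n T \<tau> then 1 else pmf (bernoulli_pmf (if x (fst e) = x (snd e) then a / n else b / n)) c"
  have sub: "ball_pairs n T \<tau> \<subseteq> vertex_pairs n" by (auto simp: ball_pairs_def)
  have ev: "ball_event n T \<tau> = PiE (vertex_pairs n) ?B"
  proof
    show "ball_event n T \<tau> \<subseteq> PiE (vertex_pairs n) ?B"
    proof
      fix g assume g: "g \<in> ball_event n T \<tau>"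
      then have "g \<in> vertex_pairs n \<rightarrow>\<^sub>E UNIV" by (simp add: ball_event_def)
      moreover have "g (i, j) \<longleftrightarrow> {i, j} \<in> tedges T \<tau>" if "(i, j) \<in> ball_pairs n T \<tau>" for i j
        using g that by (auto simp: ball_event_def)
      ultimately show "g \<in> PiE (vertex_pairs n) ?B"
        by (intro PiE_I) (auto dest: PiE_arb)
    qed
    show "PiE (vertex_pairs n) ?B \<subseteq> ball_event n T \<tau>"
    proof
      fix g assume g: "g \<in> PiE (vertex_pairs n) ?B"
      have "g (i, j) \<longleftrightarrow> {i, j} \<in> tedges T \<tau>" if "(i, j) \<in> ball_pairs n T \<tau>" for i j
        using PiE_mem[OF g, of "(i, j)"] that sub by auto
      then show "g \<in> ball_event n T \<tau>" using g by (auto simp: ball_event_def PiE_iff)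
    qed
  qed
  have "(\<Sum>g\<in>ball_event n T \<tau>. rest_prob n a b T \<tau> x g) = (\<Sum>g\<in>ball_event n T \<tau>. \<Prod>e\<in>vertex_pairs n. ?f e (g e))"
    unfolding rest_prob_def
    by (intro sum.cong refl prod.mono_neutral_cong_left finite_vertex_pairs) auto
  also have "\<dots> = (\<Prod>e\<in>vertex_pairs n. \<Sum>c\<in>?B e. ?f e c)"
    unfolding ev by (rule prod_sum_PiE[symmetric]) (auto simp: finite_vertex_pairs)
  also have "\<dots> = 1"
  proof (rule prod.neutral, rule ballI)
    fix e
    show "(\<Sum>c\<in>?B e. ?f e c) = 1"
    proof (cases "e \<in> ball_pairs n T \<tau>")
      case False
      then show ?thesis by (simp add: sum_pmf_eq_1)
    qed simp
  qed
  finally show ?thesis .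
qed

text \<open>Every pair with an interior endpoint is prescribed by the ball. Hence the rest of the
  graph sees the tree only through the labels at its boundary.\<close>

lemma depends_on_rest_prob: "depends_on (- inner T \<tau>) (\<lambda>x. rest_prob n a b T \<tau> x g)"
proof (rule depends_onI)
  fix x y :: labelling assume eq: "\<And>i. i \<in> - inner T \<tau> \<Longrightarrow> x i = y i"
  have "x (fst e) = y (fst e)" "x (snd e) = y (snd e)" if "e \<in> vertex_pairs n - ball_pairs n T \<tau>" for e
    using that by (auto simp: ball_pairs_def split: prod.splits intro!: eq)
  then show "rest_prob n a b T \<tau> x g = rest_prob n a b T \<tau> y g"
    unfolding rest_prob_def by (intro prod.cong refl) simp
qed

lemma depends_on_balanced: "depends_on (- V) (balanced n V M)"
proof (rule depends_onI)
  fix x y :: labelling assume "\<And>i. i \<in> - V \<Longrightarrow> x i = y i"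
  then have "{w \<in> {..<n} - V. x w = c} = {w \<in> {..<n} - V. y w = c}" for c by auto
  then show "balanced n V M x = balanced n V M y" by (simp add: balanced_def)
qed

lemma balanced_mono: "balanced n {} M x \<Longrightarrow> balanced n V M x"
  unfolding balanced_def
proof (intro allI)
  fix y assume "\<forall>y. card {w \<in> {..<n} - {}. x w = y} \<le> M"
  then have "card {w \<in> {..<n} - {}. x w = y} \<le> M" by blast
  moreover have "card {w \<in> {..<n} - V. x w = y} \<le> card {w \<in> {..<n} - {}. x w = y}"
    by (intro card_mono) auto
  ultimately show "card {w \<in> {..<n} - V. x w = y} \<le> M" by simp
qed

context tree_model
begin

definition tree_prob :: "nat \<Rightarrow> labelling \<Rightarrow> ntree \<Rightarrow> real" where
  "tree_prob T x \<tau> = exp (- d) ^ card (inner T \<tau>) * (\<Prod>e\<in>tedges T \<tau>. econn x e)"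

lemma tree_prob_nonneg: "0 \<le> tree_prob T x \<tau>"
  unfolding tree_prob_def by (intro mult_nonneg_nonneg prod_nonneg ballI econn_nonneg) simp

lemma joint_tree_prob:
  "joint T x \<omega> \<tau> = tree_prob T x \<tau> * (\<Prod>u\<in>inner T \<tau>. 1 + sg (x u) * mag (\<omega> u)) *
     (\<Prod>u\<in>names T \<tau> - inner T \<tau>. 1 + sg (x u) * leaf (\<omega> u))"
  unfolding joint_def tree_prob_def by (simp add: prod.distrib mult_ac)

text \<open>Tree edges contribute exactly their factor. The absent pairs within the ball, at most
  \<open>K * K\<close>, and the absent pairs from the interior to the outside are bounded below, the
  latter by balance; for each interior vertex they are the finite version of the factor
  \<open>exp (- d)\<close>.\<close>

lemma graph_prob_ge:
  assumes abn: "a \<le> n" "b \<le> n" and wf: "wf_tree T \<tau>" and names: "names T \<tau> \<subseteq> {..<n}"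
    and g: "g \<in> ball_event n T \<tau>" and K: "card (names T \<tau>) \<le> K" and bal: "balanced n (names T \<tau>) M x"
  shows "(1 - max a b / n) ^ (K * K) * ((1 - a / n) ^ M * (1 - b / n) ^ M) ^ card (inner T \<tau>) *
    (\<Prod>e\<in>tedges T \<tau>. econn x e) * rest_prob n a b T \<tau> x g \<le> graph_prob n a b x g"
proof -
  let ?V = "names T \<tau>" and ?I = "inner T \<tau>" and ?E = "tedges T \<tau>"
  let ?B = "ball_pairs n T \<tau>"
  let ?c = "\<lambda>e. conn (x (fst e)) (x (snd e))"
  let ?p = "\<lambda>e. pmf (bernoulli_pmf (if x (fst e) = x (snd e) then a / n else b / n)) (g e)"
  define q where "q = 1 - max a b / n"
  have c01: "0 \<le> conn y z" "conn y z \<le> 1" "0 \<le> 1 - conn y z" "q \<le> 1 - conn y z" for y z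
    using abn a b n by (auto simp: conn_def q_def divide_right_mono max_def)
  have q: "0 \<le> q" "q \<le> 1" using abn a b n by (auto simp: q_def max_def)
  \<comment> \<open>The prescribed pairs fall into three classes: tree edges, absent pairs within
    the ball, and absent pairs from the interior to the outside.\<close>
  define TP where "TP = {e \<in> ?B. {fst e, snd e} \<in> ?E}"
  define A where "A = {e \<in> ?B. {fst e, snd e} \<notin> ?E \<and> fst e \<in> ?V \<and> snd e \<in> ?V}"
  define Cr where "Cr = {e \<in> ?B. {fst e, snd e} \<notin> ?E \<and> \<not> (fst e \<in> ?V \<and> snd e \<in> ?V)}"
  have fin: "finite TP" "finite A" "finite Cr" "finite ?B"
    using finite_ball_pairs by (auto simp: TP_def A_def Cr_def)
  have sub: "?B \<subseteq> vertex_pairs n" by (auto simp: ball_pairs_def)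
  have split: "?B = TP \<union> (A \<union> Cr)" "TP \<inter> (A \<union> Cr) = {}" "A \<inter> Cr = {}"
    by (auto simp: TP_def A_def Cr_def)
  have pT: "?p e = ?c e" if "e \<in> TP" for e
  proof -
    have "g e" using that g by (cases e) (auto simp: TP_def ball_event_def)
    then show ?thesis using abn a b n by (simp add: conn_def)
  qed
  have pF: "?p e = 1 - ?c e" if "e \<in> A \<union> Cr" for e
  proof -
    have "\<not> g e" using that g by (cases e) (auto simp: A_def Cr_def ball_event_def)
    then show ?thesis using abn a b n by (simp add: conn_def)
  qed
  have prodT: "(\<Prod>e\<in>TP. ?p e) = (\<Prod>e\<in>?E. econn x e)"
  proof -
    have "(\<Prod>e\<in>?E. econn x e) = (\<Prod>e\<in>TP. econn x {fst e, snd e})"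
    proof (rule prod.reindex_bij_betw[symmetric])
      show "bij_betw (\<lambda>e. {fst e, snd e}) TP ?E"
      proof (rule bij_betw_imageI)
        show "inj_on (\<lambda>e. {fst e, snd e}) TP"
          by (rule inj_onI) (auto simp: TP_def ball_pairs_def vertex_pairs_def doubleton_eq_iff)
        show "(\<lambda>e. {fst e, snd e}) ` TP = ?E"
        proof
          show "(\<lambda>e. {fst e, snd e}) ` TP \<subseteq> ?E" by (auto simp: TP_def)
          show "?E \<subseteq> (\<lambda>e. {fst e, snd e}) ` TP"
          proof
            fix e assume e: "e \<in> ?E"
            then obtain u w where uw: "e = {u, w}" using leveled_tree.edge[OF leveled_tree[OF wf]] by blast
            have "u \<noteq> w" "u \<in> ?V" "w \<in> ?V" using tedges_ne[OF wf] tedges_subset e uw by blast+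
            then have "(min u w, max u w) \<in> TP" using names e uw
              by (auto simp: TP_def ball_pairs_def vertex_pairs_def min_def max_def insert_commute)
            moreover have "e = {min u w, max u w}" using uw by (auto simp: min_def max_def)
            ultimately show "e \<in> (\<lambda>e. {fst e, snd e}) ` TP" by force
          qed
        qed
      qed
    qed
    also have "\<dots> = (\<Prod>e\<in>TP. ?p e)"
      by (intro prod.cong refl) (simp add: econn_doubleton pT)
    finally show ?thesis ..
  qed
  have prodA: "q ^ (K * K) \<le> (\<Prod>e\<in>A. ?p e)"
  proof -
    have "card A \<le> card (?V \<times> ?V)"
      by (intro card_mono finite_cartesian_product finite_names) (auto simp: A_def)
    also have "\<dots> \<le> K * K" using K by (simp add: card_cartesian_product mult_mono)
    finally have "q ^ (K * K) \<le> q ^ card A" using q by (intro power_decreasing)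
    also have "\<dots> = (\<Prod>e\<in>A. q)" by simp
    also have "\<dots> \<le> (\<Prod>e\<in>A. ?p e)" using q pF c01 by (intro prod_mono) auto
    finally show ?thesis .
  qed
  define \<gamma> where "\<gamma> = (1 - a / n) ^ M * (1 - b / n) ^ M"
  have prodC: "\<gamma> ^ card ?I \<le> (\<Prod>e\<in>Cr. ?p e)"
  proof -
    let ?O = "{..<n} - ?V"
    have bij: "bij_betw (\<lambda>(u, w). (min u w, max u w)) (?I \<times> ?O) Cr"
    proof (rule bij_betw_imageI)
      have I: "u \<in> ?V" if "u \<in> ?I" for u using that inner_subset by blast
      show "inj_on (\<lambda>(u, w). (min u w, max u w)) (?I \<times> ?O)"
        by (rule inj_onI) (auto simp: min_def max_def split: if_splits dest: I)
      show "(\<lambda>(u, w). (min u w, max u w)) ` (?I \<times> ?O) = Cr"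
      proof
        show "(\<lambda>(u, w). (min u w, max u w)) ` (?I \<times> ?O) \<subseteq> Cr"
        proof clarify
          fix u w assume uw: "u \<in> ?I" "w < n" "w \<notin> ?V"
          then have "u \<noteq> w" "u < n" using I names by auto
          moreover have "{u, w} \<notin> ?E" using uw tedges_subset by blast
          ultimately show "(min u w, max u w) \<in> Cr"
            using uw by (auto simp: Cr_def ball_pairs_def vertex_pairs_def min_def max_def insert_commute)
        qed
        show "Cr \<subseteq> (\<lambda>(u, w). (min u w, max u w)) ` (?I \<times> ?O)"
        proof
          fix e assume e: "e \<in> Cr"
          obtain i j where ij: "e = (i, j)" by (cases e)
          then have lt: "i < j" "j < n" and cr: "i \<in> ?I \<and> j \<notin> ?V \<or> j \<in> ?I \<and> i \<notin> ?V"
            using e I by (auto simp: Cr_def ball_pairs_def vertex_pairs_def)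
          from cr show "e \<in> (\<lambda>(u, w). (min u w, max u w)) ` (?I \<times> ?O)"
          proof
            assume "i \<in> ?I \<and> j \<notin> ?V"
            then show ?thesis using lt ij by (intro image_eqI[of _ _ "(i, j)"]) auto
          next
            assume "j \<in> ?I \<and> i \<notin> ?V"
            then show ?thesis using lt ij by (intro image_eqI[of _ _ "(j, i)"]) auto
          qed
        qed
      qed
    qed
    \<comment> \<open>The absent edges from \<open>u\<close> to the outside, split by whether the
      label agrees with that of \<open>u\<close>; balance allows at most \<open>M\<close> of each
      kind.\<close>
    have row: "\<gamma> \<le> (\<Prod>w\<in>?O. 1 - conn (x u) (x w))" for u
    proof -
      have a1: "0 \<le> 1 - a / n" "1 - a / n \<le> 1" "0 \<le> 1 - b / n" "1 - b / n \<le> 1" using abn a b n by auto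
      define S where "S = {w \<in> ?O. x w = x u}"
      define D where "D = {w \<in> ?O. x w = (\<not> x u)}"
      have SD: "?O = S \<union> D" "S \<inter> D = {}" "finite S" "finite D" by (auto simp: S_def D_def)
      have "card S \<le> M" "card D \<le> M" using bal unfolding balanced_def S_def D_def by blast+
      then have "\<gamma> \<le> (1 - a / n) ^ card S * (1 - b / n) ^ card D"
        unfolding \<gamma>_def using a1 by (intro mult_mono power_decreasing) auto
      also have "\<dots> = (\<Prod>w\<in>S. 1 - conn (x u) (x w)) * (\<Prod>w\<in>D. 1 - conn (x u) (x w))"
        by (auto simp: S_def D_def conn_def)
      also have "\<dots> = (\<Prod>w\<in>?O. 1 - conn (x u) (x w))"
        unfolding SD(1) using SD by (intro prod.union_disjoint[symmetric])
      finally show ?thesis .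
    qed
    have "0 \<le> \<gamma>" using abn a b n by (simp add: \<gamma>_def)
    then have "\<gamma> ^ card ?I \<le> (\<Prod>u\<in>?I. \<Prod>w\<in>?O. 1 - conn (x u) (x w))"
      unfolding prod_constant[symmetric] using row by (intro prod_mono) auto
    also have "\<dots> = (\<Prod>(u, w)\<in>?I \<times> ?O. 1 - conn (x u) (x w))"
      by (rule prod.cartesian_product)
    also have "\<dots> = (\<Prod>p\<in>?I \<times> ?O. 1 - ?c (case p of (u, w) \<Rightarrow> (min u w, max u w)))"
    proof (rule prod.cong[OF refl])
      fix p assume "p \<in> ?I \<times> ?O"
      obtain u w where p: "p = (u, w)" by (cases p)
      have "conn (x u) (x w) = conn (x (min u w)) (x (max u w))"
        by (cases "u \<le> w") (simp_all add: conn_def eq_commute)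
      then show "(case p of (u, w) \<Rightarrow> 1 - conn (x u) (x w)) = 1 - ?c (case p of (u, w) \<Rightarrow> (min u w, max u w))"
        by (simp only: p prod.case fst_conv snd_conv)
    qed
    also have "\<dots> = (\<Prod>e\<in>Cr. 1 - ?c e)"
      by (rule prod.reindex_bij_betw[OF bij])
    also have "\<dots> = (\<Prod>e\<in>Cr. ?p e)" by (intro prod.cong refl) (simp add: pF)
    finally show ?thesis .
  qed
  have "graph_prob n a b x g = (\<Prod>e\<in>?B. ?p e) * rest_prob n a b T \<tau> x g"
    unfolding graph_prob_def rest_prob_def
    using prod.subset_diff[OF sub finite_vertex_pairs, of ?p] by (simp add: mult.commute)
  also have "(\<Prod>e\<in>?B. ?p e) = (\<Prod>e\<in>TP. ?p e) * ((\<Prod>e\<in>A. ?p e) * (\<Prod>e\<in>Cr. ?p e))"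
  proof -
    have "(\<Prod>e\<in>?B. ?p e) = (\<Prod>e\<in>TP. ?p e) * (\<Prod>e\<in>A \<union> Cr. ?p e)"
      using fin split(2) by (subst split(1), intro prod.union_disjoint) auto
    then show ?thesis using fin split(3) by (simp add: prod.union_disjoint)
  qed
  finally have eq: "graph_prob n a b x g = (\<Prod>e\<in>?E. econn x e) * ((\<Prod>e\<in>A. ?p e) * (\<Prod>e\<in>Cr. ?p e)) * rest_prob n a b T \<tau> x g"
    unfolding prodT .
  have \<gamma>0: "0 \<le> \<gamma>" using abn a b n by (simp add: \<gamma>_def)
  have "q ^ (K * K) * \<gamma> ^ card ?I \<le> (\<Prod>e\<in>A. ?p e) * (\<Prod>e\<in>Cr. ?p e)"
    using prodA prodC q \<gamma>0 by (intro mult_mono) (auto intro: prod_nonneg)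
  then have "(\<Prod>e\<in>?E. econn x e) * (q ^ (K * K) * \<gamma> ^ card ?I) * rest_prob n a b T \<tau> x g \<le> graph_prob n a b x g"
    unfolding eq by (intro mult_right_mono mult_left_mono rest_prob_nonneg prod_nonneg ballI econn_nonneg)
  then show ?thesis unfolding q_def \<gamma>_def by (simp add: mult_ac)
qed

end

section \<open>Lower bounds for integrals over the block model\<close>

locale sbm_model =
  fixes n :: nat and a b :: real and \<mu> :: "ereal measure"
  assumes sym: "symmetric_distribution \<mu>" and a: "0 \<le> a" and b: "0 \<le> b" and ab: "0 < a + b"
    and an: "a \<le> n" and bn: "b \<le> n"
begin

abbreviation "N \<equiv> base_law \<mu>"
abbreviation "SM \<equiv> \<Pi>\<^sub>M v\<in>{..<n}. N"
abbreviation "LM \<equiv> label_measure n"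

lemma n: "0 < n" using a b ab an bn by (cases n) auto

lemma ereal_tree_model: "ereal_tree_model n a b N"
proof -
  interpret N: prob_space N by (rule prob_space_base_law[OF sym])
  have "emag \<in> borel_measurable N"
    by (subst measurable_cong_sets[OF sets_base_law[OF sym] refl]) measurable
  then show ?thesis
    unfolding ereal_tree_model_def
    by unfold_locales (simp_all add: n a b ab abs_emag_le prob_space_base_law[OF sym] mlaw_base[OF sym])
qed

sublocale hidden: ereal_tree_model n a b N by (rule ereal_tree_model)

text \<open>In the second model the labels at the boundary of the tree are revealed.\<close>

abbreviation "N2 \<equiv> N \<Otimes>\<^sub>M measure_pmf (bernoulli_pmf (1 / 2))"

lemma distr_revealed_mag: "distr N2 borel (\<lambda>w. emag (fst w)) = distr N borel emag"
proof -
  have [measurable_cong]: "sets N = sets borel" by (rule sets_base_law[OF sym])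
  interpret N: prob_space N by (rule prob_space_base_law[OF sym])
  have "distr N2 borel (\<lambda>w. emag (fst w)) = distr (distr N2 N fst) borel emag"
    by (subst distr_distr) (auto simp: comp_def)
  also have "distr N2 N fst = N"
    by (rule measure_pmf.distr_pair_fst)
  finally show ?thesis .
qed

lemma distr_revealed_leaf: "distr N2 borel (\<lambda>w. sg (snd w)) = perfect_law"
proof -
  have [measurable_cong]: "sets N = sets borel" by (rule sets_base_law[OF sym])
  interpret N: prob_space N by (rule prob_space_base_law[OF sym])
  have sgm [measurable]: "sg \<in> borel_measurable (measure_pmf (bernoulli_pmf (1 / 2)))" by simp
  have "distr N2 borel (\<lambda>w. sg (snd w)) =
      distr (distr N2 (measure_pmf (bernoulli_pmf (1 / 2))) snd) borel sg"
    by (subst distr_distr[OF sgm measurable_snd]) (simp add: comp_def)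
  also have "distr N2 (measure_pmf (bernoulli_pmf (1 / 2))) snd = measure_pmf (bernoulli_pmf (1 / 2))"
  proof (rule measure_eqI)
    fix A :: "bool set" assume "A \<in> sets (distr N2 (measure_pmf (bernoulli_pmf (1 / 2))) snd)"
    have "snd -` A \<inter> space N2 = space N \<times> A"
      by (rule set_eqI) (simp add: space_pair_measure mem_Times_iff conj_ac)
    moreover have "emeasure (distr N2 (measure_pmf (bernoulli_pmf (1 / 2))) snd) A = emeasure N2 (snd -` A \<inter> space N2)"
      by (rule emeasure_distr[OF measurable_snd]) simp
    moreover have "emeasure N2 (space N \<times> A) = emeasure N (space N) * emeasure (measure_pmf (bernoulli_pmf (1 / 2))) A"
      by (rule measure_pmf.emeasure_pair_measure_Times) simp_all
    ultimately show "emeasure (distr N2 (measure_pmf (bernoulli_pmf (1 / 2))) snd) A = emeasure (measure_pmf (bernoulli_pmf (1 / 2))) A"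
      by (simp only: N.emeasure_space_1 mult_1)
  qed simp
  finally show ?thesis by (simp add: perfect_law_def sg_def[abs_def])
qed

lemma tree_model_revealed: "tree_model n a b N2 (\<lambda>w. emag (fst w)) (\<lambda>w. sg (snd w))"
proof -
  have [measurable_cong]: "sets N = sets borel" by (rule sets_base_law[OF sym])
  interpret N: prob_space N by (rule prob_space_base_law[OF sym])
  interpret P: pair_prob_space N "measure_pmf (bernoulli_pmf (1 / 2))" ..
  have "(\<lambda>w. sg (snd w)) \<in> borel_measurable N2" by (rule measurable_compose[OF measurable_snd]) simp
  then show ?thesis
    by unfold_locales (simp_all add: n a b ab abs_emag_le P.P.emeasure_space_1 mlaw_base[OF sym] mlaw_perfect
      distr_revealed_mag distr_revealed_leaf)
qed

sublocale revealed: tree_model n a b N2 "\<lambda>w. emag (fst w)" "\<lambda>w. sg (snd w)"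
  by (rule tree_model_revealed)

lemma sets_SM: "sets SM = sets (\<Pi>\<^sub>M v\<in>{..<n}. borel)"
  by (intro sets_PiM_cong refl sets_base_law[OF sym])

lemma space_SM: "space SM = space (\<Pi>\<^sub>M v\<in>{..<n}. borel)"
  by (rule sets_eq_imp_space_eq[OF sets_SM])

lemma prob_SM: "prob_space SM" by (rule hidden.prob_space_Omega)

abbreviation "d \<equiv> hidden.d"
abbreviation "tree_prob \<equiv> hidden.tree_prob"

definition wgt :: "nat set \<Rightarrow> labelling \<Rightarrow> (nat \<Rightarrow> ereal) \<Rightarrow> ennreal" where
  "wgt U x s = (\<Prod>u\<in>U. ennreal (1 + sg (x u) * emag (s u)))"

lemma measurable_wgt: "U \<subseteq> {..<n} \<Longrightarrow> wgt U x \<in> borel_measurable SM"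
proof -
  assume U: "U \<subseteq> {..<n}"
  have [measurable_cong]: "sets N = sets borel" by (rule sets_base_law[OF sym])
  have "(\<lambda>s. ennreal (1 + sg (x u) * emag (s u))) \<in> borel_measurable SM" if "u \<in> U" for u
  proof -
    have [measurable]: "u \<in> {..<n}" using U that by auto
    show ?thesis by measurable
  qed
  then show ?thesis unfolding wgt_def[abs_def] by (intro borel_measurable_prod_ennreal)
qed

lemma wgt_Un: "finite U \<Longrightarrow> finite V \<Longrightarrow> U \<inter> V = {} \<Longrightarrow> wgt (U \<union> V) x s = wgt U x s * wgt V x s"
  unfolding wgt_def by (rule prod.union_disjoint)

lemma depends_on_wgt_s: "depends_on U (wgt U x)"
  and depends_on_wgt_x: "depends_on U (\<lambda>x. wgt U x s)"
  by (auto intro!: depends_onI prod.cong simp: wgt_def)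

lemma wgt_real: "wgt U x s = ennreal (\<Prod>u\<in>U. 1 + sg (x u) * emag (s u))"
  unfolding wgt_def by (rule prod_ennreal) (rule hidden.mag_nonneg)

lemma nn_integral_wgt:
  assumes U: "U \<subseteq> {..<n}"
  shows "(\<integral>\<^sup>+s. wgt U x s \<partial>SM) = 1"
proof -
  have [measurable_cong]: "sets N = sets borel" by (rule sets_base_law[OF sym])
  interpret N: prob_space N by (rule prob_space_base_law[OF sym])
  interpret product_prob_space "\<lambda>_::nat. N" "{..<n}"
    using prob_space_base_law[OF sym]
    by (simp add: product_prob_space_def product_sigma_finite_def product_prob_space_axioms_def prob_space_imp_sigma_finite)
  have "wgt U x s = (\<Prod>u<n. if u \<in> U then ennreal (1 + sg (x u) * emag (s u)) else 1)" for s
    unfolding wgt_def by (rule prod.mono_neutral_cong_left) (use U in auto)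
  then have "(\<integral>\<^sup>+s. wgt U x s \<partial>SM) = (\<Prod>u<n. \<integral>\<^sup>+w. (if u \<in> U then ennreal (1 + sg (x u) * emag w) else 1) \<partial>N)"
    by (simp only:) (rule product_nn_integral_prod, auto)
  also have "\<dots> = 1"
  proof (rule prod.neutral, rule ballI)
    fix u assume "u \<in> {..<n}"
    show "(\<integral>\<^sup>+w. (if u \<in> U then ennreal (1 + sg (x u) * emag w) else 1) \<partial>N) = 1"
      by (cases "u \<in> U")
        (simp_all add: hidden.mlaw_integral_sign[OF hidden.mlaw_mag hidden.mag_measurable] N.emeasure_space_1)
  qed
  finally show ?thesis .
qed

abbreviation "balb V M x \<equiv> (indicator {x. balanced n V M x} x :: ennreal)"

text \<open>Keeps only balanced labellings and graphs whose ball is one of the trees. The ball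
  events are disjoint, so their contributions add. The constant \<open>c\<close> collects the
  finite-size corrections and is taken close to 1 later.\<close>

lemma sbm_lower_bound:
  fixes K M k T :: nat and c :: real
  assumes v: "v < n" and K: "tree_size_bound k T \<le> K"
    and c: "0 \<le> c" "\<And>i. i \<le> K \<Longrightarrow> c * exp (- d) ^ i \<le> (1 - max a b / n) ^ (K * K) * ((1 - a / n) ^ M * (1 - b / n) ^ M) ^ i"
    and F: "F \<in> borel_measurable (LM \<Otimes>\<^sub>M observation_space n)"
  shows "(\<integral>\<^sup>+\<omega>. F \<omega> \<partial>sbm n a b \<mu>) \<ge> ennreal c * (\<Sum>\<tau>\<in>trees n k T {} v. \<integral>\<^sup>+x. balb (names T \<tau>) M x * ennreal (tree_prob T x \<tau>) *
     (\<Sum>g\<in>ball_event n T \<tau>. ennreal (rest_prob n a b T \<tau> x g) * (\<integral>\<^sup>+s. wgt {..<n} x s * F (x, (g, s)) \<partial>SM)) \<partial>LM)"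
proof -
  let ?G = "vertex_pairs n \<rightarrow>\<^sub>E (UNIV :: bool set)"
  let ?S = "\<lambda>x g. \<integral>\<^sup>+s. wgt {..<n} x s * F (x, (g, s)) \<partial>SM"
  have finG: "finite ?G" by (intro finite_PiE finite_vertex_pairs) auto
  have sub: "ball_event n T \<tau> \<subseteq> ?G" for \<tau> by (auto simp: ball_event_def)
  have wf: "wf_tree T \<tau>" "names T \<tau> \<subseteq> {..<n}" "root \<tau> = v" if "\<tau> \<in> trees n k T {} v" for \<tau>
    using wf_trees[OF that] names_tree[OF that] root_tree[OF that] v by auto
  have disj: "ball_event n T \<tau> \<inter> ball_event n T \<tau>' = {}"
    if "\<tau> \<in> trees n k T {} v" "\<tau>' \<in> trees n k T {} v" "\<tau> \<noteq> \<tau>'" for \<tau> \<tau>'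
    using ball_event_disjoint[OF wf(1,2)[OF that(1)] _ wf(1,2)[OF that(2)]] wf(3) that by blast
  have "ennreal c * (\<Sum>\<tau>\<in>trees n k T {} v. \<integral>\<^sup>+x. balb (names T \<tau>) M x * ennreal (tree_prob T x \<tau>) *
     (\<Sum>g\<in>ball_event n T \<tau>. ennreal (rest_prob n a b T \<tau> x g) * ?S x g) \<partial>LM) =
    (\<integral>\<^sup>+x. (\<Sum>\<tau>\<in>trees n k T {} v. \<Sum>g\<in>ball_event n T \<tau>.
       ennreal c * (balb (names T \<tau>) M x * ennreal (tree_prob T x \<tau>)) * ennreal (rest_prob n a b T \<tau> x g) * ?S x g) \<partial>LM)"
    by (simp add: nn_integral_sum nn_integral_cmult measurable_label sum_distrib_left mult.assoc)
  also have "\<dots> \<le> (\<integral>\<^sup>+x. (\<Sum>\<tau>\<in>trees n k T {} v. \<Sum>g\<in>ball_event n T \<tau>. ennreal (graph_prob n a b x g) * ?S x g) \<partial>LM)"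
  proof (intro nn_integral_mono sum_mono mult_right_mono)
    fix x \<tau> g assume \<tau>: "\<tau> \<in> trees n k T {} v" and g: "g \<in> ball_event n T \<tau>"
    show "ennreal c * (balb (names T \<tau>) M x * ennreal (tree_prob T x \<tau>)) * ennreal (rest_prob n a b T \<tau> x g) \<le> ennreal (graph_prob n a b x g)"
    proof (cases "balanced n (names T \<tau>) M x")
      case True
      have card: "card (names T \<tau>) \<le> K" using card_names_tree[OF \<tau>] K by simp
      have "card (inner T \<tau>) \<le> card (names T \<tau>)" by (rule card_mono[OF finite_names inner_subset])
      with card have ci: "card (inner T \<tau>) \<le> K" by simp
      have "c * tree_prob T x \<tau> * rest_prob n a b T \<tau> x g =
         c * exp (- d) ^ card (inner T \<tau>) * (\<Prod>e\<in>tedges T \<tau>. hidden.econn x e) * rest_prob n a b T \<tau> x g"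
        by (simp add: hidden.tree_prob_def)
      also have "\<dots> \<le> (1 - max a b / n) ^ (K * K) * ((1 - a / n) ^ M * (1 - b / n) ^ M) ^ card (inner T \<tau>) *
         (\<Prod>e\<in>tedges T \<tau>. hidden.econn x e) * rest_prob n a b T \<tau> x g"
        by (intro mult_right_mono c(2)[OF ci] rest_prob_nonneg prod_nonneg ballI hidden.econn_nonneg)
      also have "\<dots> \<le> graph_prob n a b x g"
        by (rule hidden.graph_prob_ge[OF an bn wf(1,2)[OF \<tau>] g card True])
      finally have "ennreal (c * tree_prob T x \<tau> * rest_prob n a b T \<tau> x g) \<le> ennreal (graph_prob n a b x g)"
        by (rule ennreal_leI)
      then show ?thesis
        using True c(1) hidden.tree_prob_nonneg rest_prob_nonneg by (simp add: ennreal_mult)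
    qed simp
  qed simp
  also have "\<dots> \<le> (\<integral>\<^sup>+x. (\<Sum>g\<in>?G. ennreal (graph_prob n a b x g) * ?S x g) \<partial>LM)"
  proof (intro nn_integral_mono)
    fix x
    have "(\<Sum>\<tau>\<in>trees n k T {} v. \<Sum>g\<in>ball_event n T \<tau>. ennreal (graph_prob n a b x g) * ?S x g) =
      (\<Sum>g\<in>(\<Union>\<tau>\<in>trees n k T {} v. ball_event n T \<tau>). ennreal (graph_prob n a b x g) * ?S x g)"
      using disj finite_subset[OF sub finG]
      by (intro sum.UNION_disjoint[symmetric] finite_trees) auto
    also have "\<dots> \<le> (\<Sum>g\<in>?G. ennreal (graph_prob n a b x g) * ?S x g)"
      using sub finG by (intro sum_mono2) auto
    finally show "(\<Sum>\<tau>\<in>trees n k T {} v. \<Sum>g\<in>ball_event n T \<tau>. ennreal (graph_prob n a b x g) * ?S x g) \<le>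
      (\<Sum>g\<in>?G. ennreal (graph_prob n a b x g) * ?S x g)" .
  qed
  also have "\<dots> = (\<integral>\<^sup>+\<omega>. F \<omega> \<partial>sbm n a b \<mu>)"
    unfolding wgt_def by (rule nn_integral_sbm[OF sym F, symmetric])
  finally show ?thesis .
qed

lemma wgt_split:
  assumes "names T \<tau> \<subseteq> {..<n}"
  shows "wgt {..<n} x s = wgt (inner T \<tau>) x s * wgt (names T \<tau> - inner T \<tau>) x s * wgt ({..<n} - names T \<tau>) x s"
proof -
  have fI: "finite (inner T \<tau>)" by (rule finite_subset[OF inner_subset finite_names])
  have "{..<n} = (inner T \<tau> \<union> (names T \<tau> - inner T \<tau>)) \<union> ({..<n} - names T \<tau>)"
    using assms inner_subset[of T \<tau>] by auto
  also have "wgt \<dots> x s = wgt (inner T \<tau> \<union> (names T \<tau> - inner T \<tau>)) x s * wgt ({..<n} - names T \<tau>) x s"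
    by (rule wgt_Un) (use fI finite_names inner_subset[of T \<tau>] in auto)
  also have "wgt (inner T \<tau> \<union> (names T \<tau> - inner T \<tau>)) x s = wgt (inner T \<tau>) x s * wgt (names T \<tau> - inner T \<tau>) x s"
    by (rule wgt_Un) (use fI finite_names in auto)
  finally show ?thesis .
qed

text \<open>For a local estimator \<open>f\<close> depends on the graph only through the tree. For
  fixed side information the labels inside and outside the ball then separate: the inside gives the
  likelihoods, the outside the probability of balance.\<close>

lemma local_lower_bound:
  fixes K M k T :: nat and c :: real and \<Phi> :: "real \<Rightarrow> real \<Rightarrow> ennreal"
  assumes v: "v < n" and K: "tree_size_bound k T \<le> K"
    and c: "0 \<le> c" "\<And>i. i \<le> K \<Longrightarrow> c * exp (- d) ^ i \<le> (1 - max a b / n) ^ (K * K) * ((1 - a / n) ^ M * (1 - b / n) ^ M) ^ i"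
    and F: "F \<in> borel_measurable (LM \<Otimes>\<^sub>M observation_space n)"
    and f: "\<And>\<tau> y. \<tau> \<in> trees n k T {} v \<Longrightarrow> (\<lambda>s. f \<tau> s y) \<in> borel_measurable SM"
    and Ff: "\<And>\<tau> g s x. \<tau> \<in> trees n k T {} v \<Longrightarrow> g \<in> ball_event n T \<tau> \<Longrightarrow> s \<in> space SM \<Longrightarrow> f \<tau> s (x v) \<le> F (x, (g, s))"
    and \<Phi>: "case_prod \<Phi> \<in> borel_measurable (borel \<Otimes>\<^sub>M borel)"
    and f\<Phi>: "\<And>\<tau> s. \<tau> \<in> trees n k T {} v \<Longrightarrow> s \<in> space SM \<Longrightarrow> \<Phi> (hidden.lik T s \<tau> False) (hidden.lik T s \<tau> True) \<le>
       (\<Sum>y\<in>UNIV. ennreal (1 / 2) * (ennreal (hidden.lik T s \<tau> y) * f \<tau> s y))"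
  shows "(\<integral>\<^sup>+\<omega>. F \<omega> \<partial>sbm n a b \<mu>) \<ge> ennreal c * (\<integral>\<^sup>+x. balb {} M x \<partial>LM) *
    (\<Sum>\<tau>\<in>trees n k T {} v. \<integral>\<^sup>+s. \<Phi> (hidden.lik T s \<tau> False) (hidden.lik T s \<tau> True) \<partial>SM)"
proof -
  interpret S: prob_space SM by (rule prob_SM)
  have "(\<integral>\<^sup>+x. balb {} M x \<partial>LM) * (\<integral>\<^sup>+s. \<Phi> (hidden.lik T s \<tau> False) (hidden.lik T s \<tau> True) \<partial>SM) \<le>
     (\<integral>\<^sup>+x. balb (names T \<tau>) M x * ennreal (tree_prob T x \<tau>) *
     (\<Sum>g\<in>ball_event n T \<tau>. ennreal (rest_prob n a b T \<tau> x g) * (\<integral>\<^sup>+s. wgt {..<n} x s * F (x, (g, s)) \<partial>SM)) \<partial>LM)"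
    if \<tau>: "\<tau> \<in> trees n k T {} v" for \<tau>
  proof -
    let ?V = "names T \<tau>" and ?O = "{..<n} - names T \<tau>"
    have nV: "?V \<subseteq> {..<n}" using names_tree[OF \<tau>] v by auto
    have vV: "v \<in> ?V" using root_in_names[of \<tau> T] root_tree[OF \<tau>] by simp
    note [measurable] = f[OF \<tau>] measurable_wgt[of "{..<n}"] measurable_wgt[of ?O] hidden.measurable_lik[OF nV] \<Phi>
    \<comment> \<open>The outside part: balanced labels, weighted by the density of the side
      information outside the ball. Its integral over \<open>s\<close> is the probability of balance
      outside the ball.\<close>
    define A where "A s = (\<integral>\<^sup>+x. balb ?V M x * wgt ?O x s \<partial>LM)" for s
    have Am [measurable]: "A \<in> borel_measurable SM"
    proof -
      have [measurable]: "case_prod (\<lambda>x s. balb ?V M x * wgt ?O x s) \<in> borel_measurable (LM \<Otimes>\<^sub>M SM)"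
        by (intro measurable_label_pair) measurable
      interpret L: prob_space LM by (rule prob_space_label_measure)
      have [measurable]: "(\<lambda>(s, x). balb ?V M x * wgt ?O x s) \<in> borel_measurable (SM \<Otimes>\<^sub>M LM)"
        using measurable_compose[OF measurable_pair_swap' \<open>case_prod (\<lambda>x s. balb ?V M x * wgt ?O x s) \<in> borel_measurable (LM \<Otimes>\<^sub>M SM)\<close>]
        by (simp add: case_prod_unfold)
      show ?thesis unfolding A_def[abs_def] by measurable
    qed
    have "(\<integral>\<^sup>+x. balb {} M x \<partial>LM) * (\<integral>\<^sup>+s. \<Phi> (hidden.lik T s \<tau> False) (hidden.lik T s \<tau> True) \<partial>SM) \<le>
      (\<integral>\<^sup>+s. A s \<partial>SM) * (\<integral>\<^sup>+s. \<Phi> (hidden.lik T s \<tau> False) (hidden.lik T s \<tau> True) \<partial>SM)"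
    proof (rule mult_right_mono)
      have "(\<integral>\<^sup>+s. A s \<partial>SM) = (\<integral>\<^sup>+x. (\<integral>\<^sup>+s. balb ?V M x * wgt ?O x s \<partial>SM) \<partial>LM)"
        unfolding A_def by (rule label_swap[symmetric]) (auto intro: S.sigma_finite_measure_axioms)
      also have "\<dots> = (\<integral>\<^sup>+x. balb ?V M x \<partial>LM)"
        by (simp add: nn_integral_cmult nn_integral_wgt)
      finally show "(\<integral>\<^sup>+x. balb {} M x \<partial>LM) \<le> (\<integral>\<^sup>+s. A s \<partial>SM)"
        using balanced_mono by (auto intro!: nn_integral_mono simp: indicator_def)
    qed simp
    also have "\<dots> = (\<integral>\<^sup>+s. A s * \<Phi> (hidden.lik T s \<tau> False) (hidden.lik T s \<tau> True) \<partial>SM)"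
    proof (rule nn_integral_PiM_indep_mult[symmetric, where A = ?O and B = ?V])
      show "depends_on ?O A" unfolding A_def
      proof (intro depends_onI nn_integral_cong)
        fix s s' :: "nat \<Rightarrow> ereal" and x assume "\<And>i. i \<in> ?O \<Longrightarrow> s i = s' i"
        then have "wgt ?O x s = wgt ?O x s'" by (rule depends_onD[OF depends_on_wgt_s])
        then show "balb ?V M x * wgt ?O x s = balb ?V M x * wgt ?O x s'" by simp
      qed
      show "depends_on ?V (\<lambda>s. \<Phi> (hidden.lik T s \<tau> False) (hidden.lik T s \<tau> True))"
        by (intro depends_onI arg_cong2[where f = \<Phi>] hidden.lik_cong)
    qed (auto intro: hidden.N)
    also have "\<dots> \<le> (\<integral>\<^sup>+s. (\<integral>\<^sup>+x. (balb ?V M x * wgt ?O x s) * (ennreal (hidden.joint T x s \<tau>) * f \<tau> s (x v)) \<partial>LM) \<partial>SM)"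
    proof (rule nn_integral_mono)
      fix s assume s: "s \<in> space SM"
      have "(\<integral>\<^sup>+x. ennreal (hidden.joint T x s \<tau>) * f \<tau> s (x v) \<partial>LM) =
        (\<Sum>y\<in>UNIV. ennreal (1 / 2) * (\<integral>\<^sup>+x. ennreal (hidden.joint T (x(v := y)) s \<tau>) * f \<tau> s y \<partial>LM))"
        by (subst label_root[OF v]) simp
      also have "\<dots> = (\<Sum>y\<in>UNIV. ennreal (1 / 2) * (ennreal (hidden.lik T s \<tau> y) * f \<tau> s y))"
        by (simp add: nn_integral_multc measurable_label hidden.nn_integral_joint[OF \<tau> v])
      finally have "\<Phi> (hidden.lik T s \<tau> False) (hidden.lik T s \<tau> True) \<le> (\<integral>\<^sup>+x. ennreal (hidden.joint T x s \<tau>) * f \<tau> s (x v) \<partial>LM)"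
        using f\<Phi>[OF \<tau> s] by simp
      then have "A s * \<Phi> (hidden.lik T s \<tau> False) (hidden.lik T s \<tau> True) \<le> A s * (\<integral>\<^sup>+x. ennreal (hidden.joint T x s \<tau>) * f \<tau> s (x v) \<partial>LM)"
        by (rule mult_left_mono) simp
      also have "\<dots> = (\<integral>\<^sup>+x. (balb ?V M x * wgt ?O x s) * (ennreal (hidden.joint T x s \<tau>) * f \<tau> s (x v)) \<partial>LM)"
        unfolding A_def
      proof (rule label_indep_mult[symmetric, where A = "- ?V" and B = ?V])
        show "depends_on (- ?V) (\<lambda>x. balb ?V M x * wgt ?O x s)"
        proof (rule depends_onI)
          fix x y :: labelling assume eq: "\<And>i. i \<in> - ?V \<Longrightarrow> x i = y i"
          have "balanced n ?V M x = balanced n ?V M y" by (rule depends_onD[OF depends_on_balanced eq])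
          moreover have "wgt ?O x s = wgt ?O y s" by (rule depends_onD[OF depends_on_wgt_x]) (rule eq, simp)
          ultimately show "balb ?V M x * wgt ?O x s = balb ?V M y * wgt ?O y s" by (simp add: indicator_def)
        qed
        show "depends_on ?V (\<lambda>x. ennreal (hidden.joint T x s \<tau>) * f \<tau> s (x v))"
        proof (rule depends_onI)
          fix x y :: labelling assume eq: "\<And>i. i \<in> ?V \<Longrightarrow> x i = y i"
          have "hidden.joint T x s \<tau> = hidden.joint T y s \<tau>" by (rule depends_onD[OF hidden.depends_on_joint eq])
          then show "ennreal (hidden.joint T x s \<tau>) * f \<tau> s (x v) = ennreal (hidden.joint T y s \<tau>) * f \<tau> s (y v)"
            using eq[OF vV] by simp
        qed
      qed auto
      finally show "A s * \<Phi> (hidden.lik T s \<tau> False) (hidden.lik T s \<tau> True) \<le>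
        (\<integral>\<^sup>+x. (balb ?V M x * wgt ?O x s) * (ennreal (hidden.joint T x s \<tau>) * f \<tau> s (x v)) \<partial>LM)" .
    qed
    also have "\<dots> = (\<integral>\<^sup>+s. (\<integral>\<^sup>+x. balb ?V M x * ennreal (tree_prob T x \<tau>) * (wgt {..<n} x s * f \<tau> s (x v)) \<partial>LM) \<partial>SM)"
    proof (intro nn_integral_cong)
      fix s x
      have "ennreal (hidden.joint T x s \<tau>) = ennreal (tree_prob T x \<tau>) * wgt (inner T \<tau>) x s * wgt (?V - inner T \<tau>) x s"
        unfolding hidden.joint_tree_prob wgt_real
        by (simp add: ennreal_mult hidden.tree_prob_nonneg prod_nonneg hidden.mag_nonneg)
      then show "(balb ?V M x * wgt ?O x s) * (ennreal (hidden.joint T x s \<tau>) * f \<tau> s (x v)) =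
         balb ?V M x * ennreal (tree_prob T x \<tau>) * (wgt {..<n} x s * f \<tau> s (x v))"
        by (simp add: wgt_split[OF nV] mult_ac)
    qed
    also have "\<dots> = (\<integral>\<^sup>+x. (\<integral>\<^sup>+s. balb ?V M x * ennreal (tree_prob T x \<tau>) * (wgt {..<n} x s * f \<tau> s (x v)) \<partial>SM) \<partial>LM)"
      by (rule label_swap[symmetric]) (auto intro: S.sigma_finite_measure_axioms)
    also have "\<dots> = (\<integral>\<^sup>+x. balb ?V M x * ennreal (tree_prob T x \<tau>) * (\<integral>\<^sup>+s. wgt {..<n} x s * f \<tau> s (x v) \<partial>SM) \<partial>LM)"
      by (intro nn_integral_cong nn_integral_cmult) measurable
    also have "\<dots> \<le> (\<integral>\<^sup>+x. balb (names T \<tau>) M x * ennreal (tree_prob T x \<tau>) *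
     (\<Sum>g\<in>ball_event n T \<tau>. ennreal (rest_prob n a b T \<tau> x g) * (\<integral>\<^sup>+s. wgt {..<n} x s * F (x, (g, s)) \<partial>SM)) \<partial>LM)"
    proof (intro nn_integral_mono mult_left_mono)
      fix x
      \<comment> \<open>Inserts the total mass 1 of the rest of the graph; then \<open>f\<close> can
        be replaced by \<open>F\<close> on each graph of the event.\<close>
      have "(\<integral>\<^sup>+s. wgt {..<n} x s * f \<tau> s (x v) \<partial>SM) =
        (\<Sum>g\<in>ball_event n T \<tau>. ennreal (rest_prob n a b T \<tau> x g) * (\<integral>\<^sup>+s. wgt {..<n} x s * f \<tau> s (x v) \<partial>SM))"
        by (simp add: sum_distrib_right[symmetric] sum_ennreal rest_prob_nonneg sum_rest_prob)
      also have "\<dots> \<le> (\<Sum>g\<in>ball_event n T \<tau>. ennreal (rest_prob n a b T \<tau> x g) * (\<integral>\<^sup>+s. wgt {..<n} x s * F (x, (g, s)) \<partial>SM))"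
        by (intro sum_mono mult_left_mono nn_integral_mono Ff \<tau>) auto
      finally show "(\<integral>\<^sup>+s. wgt {..<n} x s * f \<tau> s (x v) \<partial>SM) \<le>
        (\<Sum>g\<in>ball_event n T \<tau>. ennreal (rest_prob n a b T \<tau> x g) * (\<integral>\<^sup>+s. wgt {..<n} x s * F (x, (g, s)) \<partial>SM))" .
    qed simp
    finally show ?thesis .
  qed
  then have "ennreal c * ((\<integral>\<^sup>+x. balb {} M x \<partial>LM) *
    (\<Sum>\<tau>\<in>trees n k T {} v. \<integral>\<^sup>+s. \<Phi> (hidden.lik T s \<tau> False) (hidden.lik T s \<tau> True) \<partial>SM)) \<le>
    ennreal c * (\<Sum>\<tau>\<in>trees n k T {} v. \<integral>\<^sup>+x. balb (names T \<tau>) M x * ennreal (tree_prob T x \<tau>) *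
     (\<Sum>g\<in>ball_event n T \<tau>. ennreal (rest_prob n a b T \<tau> x g) * (\<integral>\<^sup>+s. wgt {..<n} x s * F (x, (g, s)) \<partial>SM)) \<partial>LM)"
    unfolding sum_distrib_left[of "\<integral>\<^sup>+x. balb {} M x \<partial>LM"] by (intro mult_left_mono sum_mono) auto
  also have "\<dots> \<le> (\<integral>\<^sup>+\<omega>. F \<omega> \<partial>sbm n a b \<mu>)" by (rule sbm_lower_bound[OF v K c F])
  finally show ?thesis by (simp add: mult.assoc)
qed

end

section \<open>Revealing the labels at the boundary\<close>

lemma nn_integral_matching_labels:
  assumes B: "B \<subseteq> {..<n}"
  shows "(\<integral>\<^sup>+z. (\<Prod>u\<in>B. ennreal (1 + sg (z u) * sg (y u))) \<partial>label_measure n) = 1"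
proof -
  interpret product_prob_space "\<lambda>_::nat. measure_pmf (bernoulli_pmf (1 / 2))" "{..<n}"
    by unfold_locales
  have "(\<Prod>u\<in>B. ennreal (1 + sg (z u) * sg (y u))) = (\<Prod>u<n. if u \<in> B then ennreal (1 + sg (z u) * sg (y u)) else 1)" for z
    by (rule prod.mono_neutral_cong_left) (use B in auto)
  then have "(\<integral>\<^sup>+z. (\<Prod>u\<in>B. ennreal (1 + sg (z u) * sg (y u))) \<partial>label_measure n) =
    (\<Prod>u<n. \<integral>\<^sup>+c. (if u \<in> B then ennreal (1 + sg c * sg (y u)) else 1) \<partial>measure_pmf (bernoulli_pmf (1 / 2)))"
    unfolding label_measure_def by (simp only:) (rule product_nn_integral_prod, auto)
  also have "\<dots> = 1"
  proof (rule prod.neutral, rule ballI)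
    fix u
    have h: "ennreal (1 / 2) * ennreal 2 = 1"
      by (subst ennreal_mult'[symmetric]) simp_all
    \<comment> \<open>A factor is 2 if the two labels agree and 0 otherwise, and a fair label agrees
      with probability 1/2.\<close>
    have sum: "(\<Sum>c\<in>UNIV. ennreal (1 / 2) * ennreal (1 + sg c * sg (y u))) = ennreal (1 / 2) * ennreal 2"
      by (cases "y u") (simp_all add: UNIV_bool sg_def)
    show "(\<integral>\<^sup>+c. (if u \<in> B then ennreal (1 + sg c * sg (y u)) else 1) \<partial>measure_pmf (bernoulli_pmf (1 / 2))) = 1"
    proof (cases "u \<in> B")
      case True
      then show ?thesis by (simp only: if_True h nn_integral_fair_bit sum)
    next
      case False
      then show ?thesis by (simp add: measure_pmf.emeasure_space_1)
    qed
  qed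
  finally show ?thesis .
qed

text \<open>Labels on \<open>B\<close> may be drawn twice and required to agree.\<close>

lemma label_reveal:
  assumes R: "depends_on (- I) R" and W: "depends_on (I \<union> B) W" and B: "B \<subseteq> {..<n}" "I \<inter> B = {}"
  shows "(\<integral>\<^sup>+x. R x * W x \<partial>label_measure n) = (\<integral>\<^sup>+y. R y *
    (\<integral>\<^sup>+x. W x * (\<Prod>u\<in>B. ennreal (1 + sg (x u) * sg (y u))) \<partial>label_measure n) \<partial>label_measure n)"
proof -
  let ?m = "\<lambda>x y. \<Prod>u\<in>B. ennreal (1 + sg (x u) * sg (y u))"
  have finB: "finite B" using B(1) finite_subset by blast
  have "(\<integral>\<^sup>+x. R x * W x \<partial>label_measure n) = (\<integral>\<^sup>+y. (\<integral>\<^sup>+x. R y * W (splice_at (- I) y x) \<partial>label_measure n) \<partial>label_measure n)"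
  proof (subst label_splice[of _ _ "- I"], intro nn_integral_cong arg_cong2[where f = "(*)"] refl)
    fix x y :: labelling
    show "R (splice_at (- I) x y) = R x" by (rule depends_onD[OF R]) (simp add: splice_at_def)
  qed
  also have "\<dots> = (\<integral>\<^sup>+y. R y * (\<integral>\<^sup>+x. W x * ?m x y \<partial>label_measure n) \<partial>label_measure n)"
  proof (rule nn_integral_cong)
    fix y :: labelling
    have "(\<integral>\<^sup>+x. W x * ?m x y \<partial>label_measure n) =
      (\<integral>\<^sup>+z. (\<integral>\<^sup>+x. W (splice_at B z x) * ?m (splice_at B z x) y \<partial>label_measure n) \<partial>label_measure n)"
      by (rule label_splice)
    also have "\<dots> = (\<integral>\<^sup>+z. (\<integral>\<^sup>+x. W (splice_at (- I) y x) * ?m z y \<partial>label_measure n) \<partial>label_measure n)"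
    proof (intro nn_integral_cong)
      fix z x :: labelling
      have m: "?m (splice_at B z x) y = ?m z y" by (intro prod.cong refl) (simp add: splice_at_def)
      show "W (splice_at B z x) * ?m (splice_at B z x) y = W (splice_at (- I) y x) * ?m z y"
      \<comment> \<open>If the two labellings disagree somewhere on \<open>B\<close>, both sides
        vanish. Otherwise both splices agree on \<open>I\<close> and on \<open>B\<close>, which is
        all that \<open>W\<close> reads.\<close>
      proof (cases "\<forall>u\<in>B. z u = y u")
        case True
        have "W (splice_at B z x) = W (splice_at (- I) y x)"
          by (rule depends_onD[OF W]) (use True B(2) in \<open>auto simp: splice_at_def\<close>)
        then show ?thesis using m by simp
      next
        case False
        then obtain u where u: "u \<in> B" "z u \<noteq> y u" by blast
        then have "ennreal (1 + sg (z u) * sg (y u)) = 0" by (cases "z u") (auto simp: sg_def)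
        then have zero: "?m z y = 0" using u(1) finB by (auto simp: prod_zero_iff)
        show ?thesis by (simp only: m zero mult_zero_right)
      qed
    qed
    also have "\<dots> = (\<integral>\<^sup>+x. W (splice_at (- I) y x) \<partial>label_measure n)"
      by (simp add: nn_integral_multc nn_integral_cmult measurable_label nn_integral_matching_labels[OF B(1)])
    finally show "(\<integral>\<^sup>+x. R y * W (splice_at (- I) y x) \<partial>label_measure n) = R y * (\<integral>\<^sup>+x. W x * ?m x y \<partial>label_measure n)"
      by (simp add: nn_integral_cmult measurable_label)
  qed
  finally show ?thesis .
qed

text \<open>Used for the revealed model: the side information at boundary vertices does not enter
  the likelihood, so its density can be treated as an independent weight.\<close>

lemma (in tree_model) lik_cong_parts:
  assumes "\<And>i. i \<in> inner T \<tau> \<Longrightarrow> mag (\<omega> i) = mag (\<omega>' i)" "\<And>i. i \<in> names T \<tau> \<Longrightarrow> leaf (\<omega> i) = leaf (\<omega>' i)"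
  shows "lik T \<omega> \<tau> x = lik T \<omega>' \<tau> x"
  using assms
proof (induction T arbitrary: \<tau> x)
  case (Suc T)
  have "map (\<lambda>t. \<Sum>z\<in>UNIV. conn x z / 2 * lik T \<omega> t z) (kids \<tau>) = map (\<lambda>t. \<Sum>z\<in>UNIV. conn x z / 2 * lik T \<omega>' t z) (kids \<tau>)"
  proof (rule map_cong[OF refl])
    fix t assume "t \<in> set (kids \<tau>)"
    then have "lik T \<omega> t z = lik T \<omega>' t z" for z by (intro Suc.IH Suc.prems) auto
    then show "(\<Sum>z\<in>UNIV. conn x z / 2 * lik T \<omega> t z) = (\<Sum>z\<in>UNIV. conn x z / 2 * lik T \<omega>' t z)" by simp
  qed
  then show ?case using Suc.prems(1)[of "root \<tau>"] by (simp only: lik.simps) simp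
qed simp

context sbm_model
begin

definition zip_at :: "(nat \<Rightarrow> ereal) \<Rightarrow> labelling \<Rightarrow> nat \<Rightarrow> ereal \<times> bool" where
  "zip_at s y = (\<lambda>i\<in>{..<n}. (s i, y i))"

lemma measurable_zip_at: "(\<lambda>(s, y). zip_at s y) \<in> SM \<Otimes>\<^sub>M LM \<rightarrow>\<^sub>M revealed.\<Omega>"
  unfolding zip_at_def case_prod_unfold
proof (rule measurable_restrict)
  fix i assume [measurable]: "i \<in> {..<n}"
  have "(\<lambda>p. fst p i) \<in> SM \<Otimes>\<^sub>M LM \<rightarrow>\<^sub>M N" by measurable
  moreover have "(\<lambda>p. snd p i) \<in> SM \<Otimes>\<^sub>M LM \<rightarrow>\<^sub>M measure_pmf (bernoulli_pmf (1 / 2))"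
    by (rule measurable_compose[OF measurable_snd]) (unfold label_measure_def, rule measurable_component_singleton, fact)
  ultimately show "(\<lambda>p. (fst p i, snd p i)) \<in> SM \<Otimes>\<^sub>M LM \<rightarrow>\<^sub>M N2" by (rule measurable_Pair)
qed

lemma nn_integral_zip:
  assumes H: "H \<in> borel_measurable revealed.\<Omega>"
  shows "(\<integral>\<^sup>+\<omega>. H \<omega> \<partial>revealed.\<Omega>) = (\<integral>\<^sup>+y. (\<integral>\<^sup>+s. H (zip_at s y) \<partial>SM) \<partial>LM)"
proof -
  interpret N: prob_space N by (rule prob_space_base_law[OF sym])
  interpret SP: product_prob_space "\<lambda>_::nat. N" "{..<n}"
    using prob_space_base_law[OF sym]
    by (simp add: product_prob_space_def product_sigma_finite_def product_prob_space_axioms_def prob_space_imp_sigma_finite)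
  interpret LP: product_prob_space "\<lambda>_::nat. measure_pmf (bernoulli_pmf (1 / 2))" "{..<n}" by unfold_locales
  interpret RP: product_prob_space "\<lambda>_::nat. N2" "{..<n}"
    using revealed.N
    by (simp add: product_prob_space_def product_sigma_finite_def product_prob_space_axioms_def prob_space_imp_sigma_finite)
  interpret S: prob_space SM by (rule prob_SM)
  interpret L: prob_space LM by (rule prob_space_label_measure)
  interpret SL: pair_sigma_finite SM LM ..
  let ?D = "distr (SM \<Otimes>\<^sub>M LM) revealed.\<Omega> (\<lambda>(s, y). zip_at s y)"
  have "?D = revealed.\<Omega>"
  proof (rule RP.PiM_eqI)
    fix A assume A: "\<And>i. i \<in> {..<n} \<Longrightarrow> A i \<in> sets N2"
    have PA: "Pi\<^sub>E {..<n} A \<in> sets revealed.\<Omega>" using A by (intro sets_PiM_I_finite) auto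
    have "emeasure ?D (Pi\<^sub>E {..<n} A) = (\<integral>\<^sup>+\<omega>. indicator (Pi\<^sub>E {..<n} A) \<omega> \<partial>?D)"
      using PA by simp
    also have "\<dots> = (\<integral>\<^sup>+p. indicator (Pi\<^sub>E {..<n} A) (case p of (s, y) \<Rightarrow> zip_at s y) \<partial>(SM \<Otimes>\<^sub>M LM))"
      using PA by (subst nn_integral_distr[OF measurable_zip_at]) auto
    also have "\<dots> = (\<integral>\<^sup>+p. (\<Prod>i<n. indicator (A i) (fst p i, snd p i)) \<partial>(SM \<Otimes>\<^sub>M LM))"
    proof (rule nn_integral_cong)
      fix p
      have "zip_at (fst p) (snd p) \<in> Pi\<^sub>E {..<n} A \<longleftrightarrow> (\<forall>i<n. (fst p i, snd p i) \<in> A i)"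
        by (auto simp: zip_at_def PiE_iff)
      then show "indicator (Pi\<^sub>E {..<n} A) (case p of (s, y) \<Rightarrow> zip_at s y) = (\<Prod>i<n. indicator (A i) (fst p i, snd p i) :: ennreal)"
        by (cases p) (auto simp: indicator_def prod_zero_iff)
    qed
    also have "\<dots> = (\<integral>\<^sup>+y. (\<integral>\<^sup>+s. (\<Prod>i<n. indicator (A i) (s i, y i)) \<partial>SM) \<partial>LM)"
    proof -
      have m: "case_prod (\<lambda>s y. \<Prod>i<n. indicator (A i) (s i, y i) :: ennreal) \<in> borel_measurable (SM \<Otimes>\<^sub>M LM)"
        unfolding case_prod_unfold
      proof (rule borel_measurable_prod_ennreal)
        fix i assume i: "i \<in> {..<n}"
        note [measurable] = i
        have "(\<lambda>p. fst p i) \<in> SM \<Otimes>\<^sub>M LM \<rightarrow>\<^sub>M N" by measurable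
        moreover have "(\<lambda>p. snd p i) \<in> SM \<Otimes>\<^sub>M LM \<rightarrow>\<^sub>M measure_pmf (bernoulli_pmf (1 / 2))"
          by (rule measurable_compose[OF measurable_snd]) (unfold label_measure_def, rule measurable_component_singleton, fact)
        ultimately have "(\<lambda>p. (fst p i, snd p i)) \<in> SM \<Otimes>\<^sub>M LM \<rightarrow>\<^sub>M N2" by (rule measurable_Pair)
        then show "(\<lambda>p. indicator (A i) (fst p i, snd p i) :: ennreal) \<in> borel_measurable (SM \<Otimes>\<^sub>M LM)"
          by (rule measurable_compose) (use A[OF i] in simp)
      qed
      show ?thesis
        using SL.nn_integral_snd[OF m] unfolding case_prod_unfold by simp
    qed
    also have "\<dots> = (\<integral>\<^sup>+y. (\<Prod>i<n. \<integral>\<^sup>+w. indicator (A i) (w, y i) \<partial>N) \<partial>LM)"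
    proof (rule nn_integral_cong)
      fix y
      show "(\<integral>\<^sup>+s. (\<Prod>i<n. indicator (A i) (s i, y i)) \<partial>SM) = (\<Prod>i<n. \<integral>\<^sup>+w. indicator (A i) (w, y i) \<partial>N)"
      proof (rule SP.product_nn_integral_prod[where f = "\<lambda>i w. indicator (A i) (w, y i)"])
        fix i assume i: "i \<in> {..<n}"
        have "(\<lambda>w. (w, y i)) \<in> N \<rightarrow>\<^sub>M N2" by (intro measurable_Pair2') simp
        then show "(\<lambda>w. indicator (A i) (w, y i) :: ennreal) \<in> borel_measurable N"
          by (rule measurable_compose) (use A[OF i] in simp)
      qed simp
    qed
    also have "\<dots> = (\<Prod>i<n. \<integral>\<^sup>+c. (\<integral>\<^sup>+w. indicator (A i) (w, c) \<partial>N) \<partial>measure_pmf (bernoulli_pmf (1 / 2)))"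
      unfolding label_measure_def by (rule LP.product_nn_integral_prod) auto
    also have "\<dots> = (\<Prod>i<n. emeasure N2 (A i))"
    proof (rule prod.cong[OF refl])
      fix i assume i: "i \<in> {..<n}"
      interpret NB: pair_sigma_finite N "measure_pmf (bernoulli_pmf (1 / 2))" ..
      have "(\<integral>\<^sup>+c. (\<integral>\<^sup>+w. indicator (A i) (w, c) \<partial>N) \<partial>measure_pmf (bernoulli_pmf (1 / 2))) = (\<integral>\<^sup>+p. indicator (A i) p \<partial>N2)"
        using NB.nn_integral_snd[of "indicator (A i)"] A[OF i] by simp
      also have "\<dots> = emeasure N2 (A i)" using A[OF i] by simp
      finally show "(\<integral>\<^sup>+c. (\<integral>\<^sup>+w. indicator (A i) (w, c) \<partial>N) \<partial>measure_pmf (bernoulli_pmf (1 / 2))) = emeasure N2 (A i)" .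
    qed
    finally show "emeasure ?D (Pi\<^sub>E {..<n} A) = (\<Prod>i\<in>{..<n}. emeasure N2 (A i))" .
  qed simp_all
  then have "(\<integral>\<^sup>+\<omega>. H \<omega> \<partial>revealed.\<Omega>) = (\<integral>\<^sup>+\<omega>. H \<omega> \<partial>?D)" by simp
  also have "\<dots> = (\<integral>\<^sup>+p. H (case p of (s, y) \<Rightarrow> zip_at s y) \<partial>(SM \<Otimes>\<^sub>M LM))"
    using H by (subst nn_integral_distr[OF measurable_zip_at]) auto
  also have "\<dots> = (\<integral>\<^sup>+y. (\<integral>\<^sup>+s. H (zip_at s y) \<partial>SM) \<partial>LM)"
    using SL.nn_integral_snd[of "\<lambda>p. H (case p of (s, y) \<Rightarrow> zip_at s y)"] measurable_compose[OF measurable_zip_at H]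
    by (simp add: case_prod_unfold)
  finally show ?thesis .
qed

lemma measurable_zip_s: "y \<in> space LM \<Longrightarrow> (\<lambda>s. zip_at s y) \<in> SM \<rightarrow>\<^sub>M revealed.\<Omega>"
  using measurable_compose[OF measurable_Pair2' measurable_zip_at] by simp

text \<open>
  Given the graph, the side information and all labels outside the interior
  of the ball, only the tree inside the ball matters.
\<close>

lemma revealed_lower_bound:
  fixes K M k T :: nat and c :: real and \<Phi> :: "real \<Rightarrow> real \<Rightarrow> ennreal"
  assumes v: "v < n" and K: "tree_size_bound k T \<le> K"
    and c: "0 \<le> c" "\<And>i. i \<le> K \<Longrightarrow> c * exp (- d) ^ i \<le> (1 - max a b / n) ^ (K * K) * ((1 - a / n) ^ M * (1 - b / n) ^ M) ^ i"
    and F: "F \<in> borel_measurable (LM \<Otimes>\<^sub>M observation_space n)"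
    and f: "\<And>g y. g \<in> vertex_pairs n \<rightarrow>\<^sub>E UNIV \<Longrightarrow> (\<lambda>s. f g s y) \<in> borel_measurable SM"
    and Ff: "\<And>g s x. g \<in> vertex_pairs n \<rightarrow>\<^sub>E UNIV \<Longrightarrow> s \<in> space SM \<Longrightarrow> f g s (x v) \<le> F (x, (g, s))"
    and \<Phi>: "case_prod \<Phi> \<in> borel_measurable (borel \<Otimes>\<^sub>M borel)"
    and f\<Phi>: "\<And>p q g s. 0 \<le> p \<Longrightarrow> 0 \<le> q \<Longrightarrow> g \<in> vertex_pairs n \<rightarrow>\<^sub>E UNIV \<Longrightarrow> s \<in> space SM \<Longrightarrow>
       \<Phi> p q \<le> ennreal (1 / 2) * (ennreal p * f g s False) + ennreal (1 / 2) * (ennreal q * f g s True)"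
  shows "(\<integral>\<^sup>+\<omega>. F \<omega> \<partial>sbm n a b \<mu>) \<ge> ennreal c * (\<integral>\<^sup>+x. balb {} M x \<partial>LM) *
    (\<Sum>\<tau>\<in>trees n k T {} v. \<integral>\<^sup>+\<omega>. \<Phi> (revealed.lik T \<omega> \<tau> False) (revealed.lik T \<omega> \<tau> True) \<partial>revealed.\<Omega>)"
proof -
  interpret S: prob_space SM by (rule prob_SM)
  interpret L: prob_space LM by (rule prob_space_label_measure)
  have "(\<integral>\<^sup>+x. balb {} M x \<partial>LM) * (\<integral>\<^sup>+\<omega>. \<Phi> (revealed.lik T \<omega> \<tau> False) (revealed.lik T \<omega> \<tau> True) \<partial>revealed.\<Omega>) \<le>
     (\<integral>\<^sup>+x. balb (names T \<tau>) M x * ennreal (tree_prob T x \<tau>) *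
     (\<Sum>g\<in>ball_event n T \<tau>. ennreal (rest_prob n a b T \<tau> x g) * (\<integral>\<^sup>+s. wgt {..<n} x s * F (x, (g, s)) \<partial>SM)) \<partial>LM)"
    if \<tau>: "\<tau> \<in> trees n k T {} v" for \<tau>
  proof -
    let ?V = "names T \<tau>" and ?I = "inner T \<tau>" and ?O = "{..<n} - names T \<tau>"
    let ?B = "?V - ?I"
    have nV: "?V \<subseteq> {..<n}" using names_tree[OF \<tau>] v by auto
    have IV: "?I \<subseteq> ?V" by (rule inner_subset)
    have vV: "v \<in> ?V" using root_in_names[of \<tau> T] root_tree[OF \<tau>] by simp
    have fI: "finite ?I" "finite ?V" using finite_subset[OF IV finite_names] finite_names by auto
    define \<Psi> where "\<Psi> s y = \<Phi> (revealed.lik T (zip_at s y) \<tau> False) (revealed.lik T (zip_at s y) \<tau> True)" for s y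
    have Hm: "(\<lambda>\<omega>. \<Phi> (revealed.lik T \<omega> \<tau> False) (revealed.lik T \<omega> \<tau> True)) \<in> borel_measurable revealed.\<Omega>"
    proof -
      note [measurable] = revealed.measurable_lik[OF nV] \<Phi>
      show ?thesis by measurable
    qed
    have \<Psi>m: "(\<lambda>s. \<Psi> s y) \<in> borel_measurable SM" if "y \<in> space LM" for y
      unfolding \<Psi>_def by (rule measurable_compose[OF measurable_zip_s[OF that] Hm])
    have \<Psi>s: "\<Psi> s y = \<Psi> s' y" if "\<And>i. i \<in> ?I \<Longrightarrow> s i = s' i" for s s' y
    proof -
      have "revealed.lik T (zip_at s y) \<tau> x = revealed.lik T (zip_at s' y) \<tau> x" for x
        by (rule revealed.lik_cong_parts) (use that IV nV in \<open>auto simp: zip_at_def\<close>)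
      then show ?thesis by (simp add: \<Psi>_def)
    qed
    have \<Psi>y: "\<Psi> s y = \<Psi> s y'" if "\<And>i. i \<in> ?V \<Longrightarrow> y i = y' i" for s y y'
    proof -
      have "revealed.lik T (zip_at s y) \<tau> x = revealed.lik T (zip_at s y') \<tau> x" for x
        by (rule revealed.lik_cong_parts) (use that nV in \<open>auto simp: zip_at_def\<close>)
      then show ?thesis by (simp add: \<Psi>_def)
    qed
    have wm: "wgt (?B \<union> ?O) y \<in> borel_measurable SM" for y
      using nV by (intro measurable_wgt) auto
    have wm': "wgt {..<n} y \<in> borel_measurable SM" for y by (intro measurable_wgt) auto
    have gG: "g \<in> vertex_pairs n \<rightarrow>\<^sub>E UNIV" if "g \<in> ball_event n T \<tau>" for g
      using that by (simp add: ball_event_def)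
    \<comment> \<open>The factors are sorted by the labels that they read: \<open>R\<close> only
      labels outside the interior, \<open>Q\<close> only labels in the ball. They overlap in the
      boundary, which is where \<open>label_reveal\<close> applies. The graph stays fixed, since a
      general estimator may use all of it.\<close>
    define R where "R g s x = balb ?V M x * ennreal (rest_prob n a b T \<tau> x g) * wgt (?B \<union> ?O) x s" for g s x
    define Q where "Q g s x = ennreal (tree_prob T x \<tau>) * wgt ?I x s * f g s (x v)" for g s x
    have "(\<integral>\<^sup>+x. balb {} M x \<partial>LM) * (\<integral>\<^sup>+\<omega>. \<Phi> (revealed.lik T \<omega> \<tau> False) (revealed.lik T \<omega> \<tau> True) \<partial>revealed.\<Omega>) =
      (\<integral>\<^sup>+x. balb {} M x \<partial>LM) * (\<integral>\<^sup>+y. (\<integral>\<^sup>+s. \<Psi> s y \<partial>SM) \<partial>LM)"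
      unfolding nn_integral_zip[OF Hm] \<Psi>_def ..
    also have "\<dots> \<le> (\<integral>\<^sup>+y. balb ?V M y \<partial>LM) * (\<integral>\<^sup>+y. (\<integral>\<^sup>+s. \<Psi> s y \<partial>SM) \<partial>LM)"
      using balanced_mono by (intro mult_right_mono nn_integral_mono) (auto simp: indicator_def)
    also have "\<dots> = (\<integral>\<^sup>+y. balb ?V M y * (\<integral>\<^sup>+s. \<Psi> s y \<partial>SM) \<partial>LM)"
    proof (rule label_indep_mult[symmetric, where A = "- ?V" and B = ?V])
      show "depends_on (- ?V) (\<lambda>y. balb ?V M y)"
      proof (rule depends_onI)
        fix x y :: labelling assume eq: "\<And>i. i \<in> - ?V \<Longrightarrow> x i = y i"
        have "balanced n ?V M x = balanced n ?V M y" by (rule depends_onD[OF depends_on_balanced eq])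
        then show "balb ?V M x = balb ?V M y" by (simp add: indicator_def)
      qed
      show "depends_on ?V (\<lambda>y. \<integral>\<^sup>+s. \<Psi> s y \<partial>SM)"
        by (intro depends_onI nn_integral_cong \<Psi>y)
    qed auto
    \<comment> \<open>\<open>\<Psi>\<close> reads the side information only in the interior, so the
      density of the remaining side information can be inserted at no cost.\<close>
    also have "\<dots> = (\<integral>\<^sup>+y. balb ?V M y * (\<integral>\<^sup>+s. wgt (?B \<union> ?O) y s * \<Psi> s y \<partial>SM) \<partial>LM)"
    proof (rule nn_integral_cong, rule arg_cong2[where f = "(*)"], rule refl)
      fix y assume y: "y \<in> space LM"
      have "(\<integral>\<^sup>+s. wgt (?B \<union> ?O) y s * \<Psi> s y \<partial>SM) = (\<integral>\<^sup>+s. wgt (?B \<union> ?O) y s \<partial>SM) * (\<integral>\<^sup>+s. \<Psi> s y \<partial>SM)"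
        by (rule nn_integral_PiM_indep_mult[OF _ _ wm \<Psi>m[OF y] depends_on_wgt_s, where B = ?I])
          (use IV in \<open>auto intro: hidden.N depends_onI \<Psi>s\<close>)
      also have "(\<integral>\<^sup>+s. wgt (?B \<union> ?O) y s \<partial>SM) = 1"
        using nV by (intro nn_integral_wgt) auto
      finally show "(\<integral>\<^sup>+s. \<Psi> s y \<partial>SM) = (\<integral>\<^sup>+s. wgt (?B \<union> ?O) y s * \<Psi> s y \<partial>SM)" by simp
    qed
    also have "\<dots> = (\<integral>\<^sup>+y. (\<Sum>g\<in>ball_event n T \<tau>. \<integral>\<^sup>+s. R g s y * \<Psi> s y \<partial>SM) \<partial>LM)"
    proof (intro nn_integral_cong)
      fix y assume y: "y \<in> space LM"
      have "(\<integral>\<^sup>+s. R g s y * \<Psi> s y \<partial>SM) = ennreal (rest_prob n a b T \<tau> y g) * (balb ?V M y * (\<integral>\<^sup>+s. wgt (?B \<union> ?O) y s * \<Psi> s y \<partial>SM))" for g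
      proof -
        note [measurable] = wm \<Psi>m[OF y]
        have "(\<integral>\<^sup>+s. R g s y * \<Psi> s y \<partial>SM) = (\<integral>\<^sup>+s. (ennreal (rest_prob n a b T \<tau> y g) * balb ?V M y) * (wgt (?B \<union> ?O) y s * \<Psi> s y) \<partial>SM)"
          unfolding R_def by (intro nn_integral_cong) (simp add: mult_ac)
        also have "\<dots> = (ennreal (rest_prob n a b T \<tau> y g) * balb ?V M y) * (\<integral>\<^sup>+s. wgt (?B \<union> ?O) y s * \<Psi> s y \<partial>SM)"
          by (rule nn_integral_cmult) measurable
        finally show ?thesis by (simp add: mult.assoc)
      qed
      then show "balb ?V M y * (\<integral>\<^sup>+s. wgt (?B \<union> ?O) y s * \<Psi> s y \<partial>SM) = (\<Sum>g\<in>ball_event n T \<tau>. \<integral>\<^sup>+s. R g s y * \<Psi> s y \<partial>SM)"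
        by (simp add: sum_distrib_right[symmetric] sum_ennreal rest_prob_nonneg sum_rest_prob)
    qed
    also have "\<dots> = (\<Sum>g\<in>ball_event n T \<tau>. \<integral>\<^sup>+y. (\<integral>\<^sup>+s. R g s y * \<Psi> s y \<partial>SM) \<partial>LM)"
      by (rule nn_integral_sum) (rule measurable_label)
    also have "\<dots> \<le> (\<Sum>g\<in>ball_event n T \<tau>. \<integral>\<^sup>+x. (\<integral>\<^sup>+s. R g s x * Q g s x \<partial>SM) \<partial>LM)"
    proof (rule sum_mono)
      fix g assume g: "g \<in> ball_event n T \<tau>"
      have Rm: "(\<lambda>s. R g s x) \<in> borel_measurable SM" for x
      proof -
        note [measurable] = wm
        show ?thesis unfolding R_def by measurable
      qed
      have Qm: "(\<lambda>s. Q g s x) \<in> borel_measurable SM" for x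
      proof -
        have [measurable]: "wgt ?I x \<in> borel_measurable SM" using IV nV by (intro measurable_wgt) auto
        note [measurable] = f[OF gG[OF g]]
        show ?thesis unfolding Q_def by measurable
      qed
      have "(\<integral>\<^sup>+y. (\<integral>\<^sup>+s. R g s y * \<Psi> s y \<partial>SM) \<partial>LM) = (\<integral>\<^sup>+s. (\<integral>\<^sup>+y. R g s y * \<Psi> s y \<partial>LM) \<partial>SM)"
        by (rule label_swap) (auto intro: S.sigma_finite_measure_axioms Rm \<Psi>m borel_measurable_times_ennreal)
      also have "\<dots> \<le> (\<integral>\<^sup>+s. (\<integral>\<^sup>+x. R g s x * Q g s x \<partial>LM) \<partial>SM)"
      proof (rule nn_integral_mono)
        fix s assume s: "s \<in> space SM"
        \<comment> \<open>The boundary part of \<open>y\<close> becomes the revealed labels: summing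
          \<open>Q\<close> over the labellings that match it gives the likelihoods of the revealed
          tree.\<close>
        have "(\<integral>\<^sup>+y. R g s y * \<Psi> s y \<partial>LM) \<le> (\<integral>\<^sup>+y. R g s y * (\<integral>\<^sup>+x. Q g s x * (\<Prod>u\<in>?B. ennreal (1 + sg (x u) * sg (y u))) \<partial>LM) \<partial>LM)"
        proof (intro nn_integral_mono mult_left_mono)
          fix y
          let ?z = "zip_at s y"
          have "Q g s x * (\<Prod>u\<in>?B. ennreal (1 + sg (x u) * sg (y u))) = ennreal (revealed.joint T x ?z \<tau>) * f g s (x v)" for x
          proof -
            have 1: "(\<Prod>u\<in>?I. 1 + sg (x u) * emag (fst (?z u))) = (\<Prod>u\<in>?I. 1 + sg (x u) * emag (s u))"
              using IV nV by (intro prod.cong refl) (auto simp: zip_at_def)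
            have 2: "(\<Prod>u\<in>?B. 1 + sg (x u) * sg (snd (?z u))) = (\<Prod>u\<in>?B. 1 + sg (x u) * sg (y u))"
              using nV by (intro prod.cong refl) (auto simp: zip_at_def)
            have nn: "0 \<le> 1 + sg c * sg c'" for c c' by (cases c; cases c') (auto simp: sg_def)
            show ?thesis
              unfolding Q_def revealed.joint_tree_prob 1 2 wgt_real prod_ennreal[OF nn]
              by (simp add: ennreal_mult hidden.tree_prob_nonneg prod_nonneg hidden.mag_nonneg nn, simp only: mult_ac)
          qed
          then have "(\<integral>\<^sup>+x. Q g s x * (\<Prod>u\<in>?B. ennreal (1 + sg (x u) * sg (y u))) \<partial>LM) =
            (\<integral>\<^sup>+x. ennreal (revealed.joint T x ?z \<tau>) * f g s (x v) \<partial>LM)" by simp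
          also have "\<dots> = (\<Sum>c\<in>UNIV. ennreal (1 / 2) * (\<integral>\<^sup>+x. ennreal (revealed.joint T (x(v := c)) ?z \<tau>) * f g s c \<partial>LM))"
            by (subst label_root[OF v]) simp
          also have "\<dots> = (\<Sum>c\<in>UNIV. ennreal (1 / 2) * (ennreal (revealed.lik T ?z \<tau> c) * f g s c))"
            by (simp add: nn_integral_multc measurable_label revealed.nn_integral_joint[OF \<tau> v])
          also have "\<dots> = ennreal (1 / 2) * (ennreal (revealed.lik T ?z \<tau> False) * f g s False) +
              ennreal (1 / 2) * (ennreal (revealed.lik T ?z \<tau> True) * f g s True)"
            by (simp add: UNIV_bool add.commute)
          finally show "\<Psi> s y \<le> (\<integral>\<^sup>+x. Q g s x * (\<Prod>u\<in>?B. ennreal (1 + sg (x u) * sg (y u))) \<partial>LM)"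
            unfolding \<Psi>_def by (simp only:) (rule f\<Phi>[OF revealed.lik_nonneg revealed.lik_nonneg gG[OF g] s])
        qed simp
        also have "\<dots> = (\<integral>\<^sup>+x. R g s x * Q g s x \<partial>LM)"
        proof (rule label_reveal[symmetric, where I = ?I])
          show "depends_on (- ?I) (R g s)"
          proof (rule depends_onI)
            fix x y :: labelling assume eq: "\<And>i. i \<in> - ?I \<Longrightarrow> x i = y i"
            have "balanced n ?V M x = balanced n ?V M y" by (rule depends_onD[OF depends_on_balanced]) (use IV eq in auto)
            moreover have "wgt (?B \<union> ?O) x s = wgt (?B \<union> ?O) y s"
              by (rule depends_onD[OF depends_on_wgt_x]) (rule eq, use IV in auto)
            moreover have "rest_prob n a b T \<tau> x g = rest_prob n a b T \<tau> y g"
              by (rule depends_onD[OF depends_on_rest_prob eq])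
            ultimately show "R g s x = R g s y" by (simp add: R_def indicator_def)
          qed
          show "depends_on (?I \<union> ?B) (Q g s)"
          proof (rule depends_onI)
            fix x y :: labelling assume "\<And>i. i \<in> ?I \<union> ?B \<Longrightarrow> x i = y i"
            then have eq: "\<And>i. i \<in> ?V \<Longrightarrow> x i = y i" by auto
            have "wgt ?I x s = wgt ?I y s"
              by (rule depends_onD[OF depends_on_wgt_x]) (rule eq, use IV in auto)
            moreover have "tree_prob T x \<tau> = tree_prob T y \<tau>"
            proof -
              have "hidden.econn x e = hidden.econn y e" if e: "e \<in> tedges T \<tau>" for e
              proof -
                have "finite e" using tedges_subset[OF e] finite_names finite_subset by blast
                then have "Min e \<in> e" "Max e \<in> e" using tedges_nonempty[OF e] by auto
                then have "x (Min e) = y (Min e)" "x (Max e) = y (Max e)" using tedges_subset[OF e] by (auto intro!: eq)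
                then show ?thesis by (simp add: hidden.econn_def)
              qed
              then show ?thesis by (simp add: hidden.tree_prob_def)
            qed
            ultimately show "Q g s x = Q g s y" using eq[OF vV] by (simp add: Q_def)
          qed
        qed (use nV in auto)
        finally show "(\<integral>\<^sup>+y. R g s y * \<Psi> s y \<partial>LM) \<le> (\<integral>\<^sup>+x. R g s x * Q g s x \<partial>LM)" .
      qed
      also have "\<dots> = (\<integral>\<^sup>+x. (\<integral>\<^sup>+s. R g s x * Q g s x \<partial>SM) \<partial>LM)"
        by (rule label_swap[symmetric]) (auto intro: S.sigma_finite_measure_axioms Rm Qm borel_measurable_times_ennreal)
      finally show "(\<integral>\<^sup>+y. (\<integral>\<^sup>+s. R g s y * \<Psi> s y \<partial>SM) \<partial>LM) \<le> (\<integral>\<^sup>+x. (\<integral>\<^sup>+s. R g s x * Q g s x \<partial>SM) \<partial>LM)" .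
    qed
    also have "\<dots> = (\<integral>\<^sup>+x. (\<Sum>g\<in>ball_event n T \<tau>. \<integral>\<^sup>+s. R g s x * Q g s x \<partial>SM) \<partial>LM)"
      by (rule nn_integral_sum[symmetric]) (rule measurable_label)
    also have "\<dots> \<le> (\<integral>\<^sup>+x. balb ?V M x * ennreal (tree_prob T x \<tau>) *
       (\<Sum>g\<in>ball_event n T \<tau>. ennreal (rest_prob n a b T \<tau> x g) * (\<integral>\<^sup>+s. wgt {..<n} x s * F (x, (g, s)) \<partial>SM)) \<partial>LM)"
    proof (rule nn_integral_mono)
      fix x
      have split: "wgt {..<n} x s = wgt ?I x s * wgt (?B \<union> ?O) x s" for s
      proof -
        have "wgt (?B \<union> ?O) x s = wgt ?B x s * wgt ?O x s" using fI by (intro wgt_Un) auto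
        then show ?thesis by (simp add: wgt_split[OF nV] mult.assoc)
      qed
      have "(\<integral>\<^sup>+s. R g s x * Q g s x \<partial>SM) \<le> balb ?V M x * ennreal (tree_prob T x \<tau>) *
         (ennreal (rest_prob n a b T \<tau> x g) * (\<integral>\<^sup>+s. wgt {..<n} x s * F (x, (g, s)) \<partial>SM))"
        if g: "g \<in> ball_event n T \<tau>" for g
      proof -
        note [measurable] = wm' f[OF gG[OF g]]
        have "(\<integral>\<^sup>+s. R g s x * Q g s x \<partial>SM) =
          (\<integral>\<^sup>+s. (balb ?V M x * ennreal (tree_prob T x \<tau>) * ennreal (rest_prob n a b T \<tau> x g)) * (wgt {..<n} x s * f g s (x v)) \<partial>SM)"
          unfolding R_def Q_def split by (intro nn_integral_cong) (simp add: mult_ac)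
        also have "\<dots> = (balb ?V M x * ennreal (tree_prob T x \<tau>) * ennreal (rest_prob n a b T \<tau> x g)) * (\<integral>\<^sup>+s. wgt {..<n} x s * f g s (x v) \<partial>SM)"
          by (rule nn_integral_cmult) measurable
        also have "\<dots> \<le> (balb ?V M x * ennreal (tree_prob T x \<tau>) * ennreal (rest_prob n a b T \<tau> x g)) * (\<integral>\<^sup>+s. wgt {..<n} x s * F (x, (g, s)) \<partial>SM)"
          by (intro mult_left_mono nn_integral_mono Ff gG g) auto
        finally show ?thesis by (simp add: mult.assoc)
      qed
      then show "(\<Sum>g\<in>ball_event n T \<tau>. \<integral>\<^sup>+s. R g s x * Q g s x \<partial>SM) \<le> balb ?V M x * ennreal (tree_prob T x \<tau>) *
       (\<Sum>g\<in>ball_event n T \<tau>. ennreal (rest_prob n a b T \<tau> x g) * (\<integral>\<^sup>+s. wgt {..<n} x s * F (x, (g, s)) \<partial>SM))"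
        unfolding sum_distrib_left by (intro sum_mono)
    qed
    finally show ?thesis .
  qed
  then have "ennreal c * ((\<integral>\<^sup>+x. balb {} M x \<partial>LM) *
    (\<Sum>\<tau>\<in>trees n k T {} v. \<integral>\<^sup>+\<omega>. \<Phi> (revealed.lik T \<omega> \<tau> False) (revealed.lik T \<omega> \<tau> True) \<partial>revealed.\<Omega>)) \<le>
    ennreal c * (\<Sum>\<tau>\<in>trees n k T {} v. \<integral>\<^sup>+x. balb (names T \<tau>) M x * ennreal (tree_prob T x \<tau>) *
     (\<Sum>g\<in>ball_event n T \<tau>. ennreal (rest_prob n a b T \<tau> x g) * (\<integral>\<^sup>+s. wgt {..<n} x s * F (x, (g, s)) \<partial>SM)) \<partial>LM)"
    unfolding sum_distrib_left[of "\<integral>\<^sup>+x. balb {} M x \<partial>LM"] by (intro mult_left_mono sum_mono) auto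
  also have "\<dots> \<le> (\<integral>\<^sup>+\<omega>. F \<omega> \<partial>sbm n a b \<mu>)" by (rule sbm_lower_bound[OF v K c F])
  finally show ?thesis by (simp add: mult.assoc)
qed

end

section \<open>The limit of large graphs\<close>

text \<open>The variance of a sum of independent signs; averaging over one more fair sign cancels
  the cross term.\<close>

lemma label_sum_square:
  "m \<le> n \<Longrightarrow> (\<integral>\<^sup>+x. ennreal ((\<Sum>w<m. sg (x w))\<^sup>2) \<partial>label_measure n) = ennreal (real m)"
proof (induction m)
  case (Suc m)
  interpret L: prob_space "label_measure n" by (rule prob_space_label_measure)
  let ?S = "\<lambda>x::labelling. \<Sum>w<m. sg (x w)"
  have S: "?S (x(m := y)) = ?S x" for x y by (intro sum.cong refl) auto
  have "(\<integral>\<^sup>+x. ennreal ((\<Sum>w<Suc m. sg (x w))\<^sup>2) \<partial>label_measure n) =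
    (\<Sum>y\<in>UNIV. ennreal (1 / 2) * (\<integral>\<^sup>+x. ennreal ((?S x + sg y)\<^sup>2) \<partial>label_measure n))"
    using Suc.prems by (subst label_root[of m]) (auto simp: S)
  also have "\<dots> = (\<integral>\<^sup>+x. (\<Sum>y\<in>UNIV. ennreal (1 / 2) * ennreal ((?S x + sg y)\<^sup>2)) \<partial>label_measure n)"
    by (simp add: nn_integral_sum nn_integral_cmult measurable_label)
  also have "\<dots> = (\<integral>\<^sup>+x. ennreal ((?S x)\<^sup>2) + 1 \<partial>label_measure n)"
  proof (rule nn_integral_cong)
    fix x :: labelling
    have half_sq: "0 \<le> 1 / 2 * (z::real)\<^sup>2" for z by simp
    have "(\<Sum>y\<in>UNIV. ennreal (1 / 2) * ennreal ((?S x + sg y)\<^sup>2)) = ennreal (\<Sum>y\<in>UNIV. 1 / 2 * (?S x + sg y)\<^sup>2)"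
      unfolding sum_ennreal[symmetric, OF half_sq] by (intro sum.cong refl ennreal_mult'[symmetric]) simp
    also have "(\<Sum>y\<in>UNIV. 1 / 2 * (?S x + sg y)\<^sup>2) = (?S x)\<^sup>2 + 1"
      by (simp add: UNIV_bool sg_def power2_eq_square algebra_simps)
    finally show "(\<Sum>y\<in>UNIV. ennreal (1 / 2) * ennreal ((?S x + sg y)\<^sup>2)) = ennreal ((?S x)\<^sup>2) + 1"
      by simp
  qed
  also have "\<dots> = ennreal (real m) + 1"
    using Suc by (simp add: nn_integral_add measurable_label L.emeasure_space_1)
  also have "\<dots> = ennreal (real (Suc m))" using ennreal_plus[of "real m" 1] by (simp add: add.commute)
  finally show ?case .
qed simp

text \<open>Chebyshev's inequality for the sum of the signs: if a label class exceeds
  \<open>M\<close>, the sum is at least \<open>2 * \<eta> * n\<close> in absolute value, while its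
  variance is \<open>n\<close>.\<close>

lemma balanced_prob:
  assumes n: "0 < n" and \<eta>: "0 < \<eta>" and M: "(1 / 2 + \<eta>) * n \<le> real M"
  shows "1 \<le> (\<integral>\<^sup>+x. indicator {x. balanced n {} M x} x \<partial>label_measure n) + ennreal (1 / (4 * \<eta>\<^sup>2 * n))"
proof -
  interpret L: prob_space "label_measure n" by (rule prob_space_label_measure)
  let ?S = "\<lambda>x::labelling. \<Sum>w<n. sg (x w)"
  have k: "0 < (2 * \<eta> * n)\<^sup>2" using n \<eta> by simp
  have "1 \<le> indicator {x. balanced n {} M x} x + ennreal (1 / (2 * \<eta> * n)\<^sup>2) * ennreal ((?S x)\<^sup>2)" for x
  proof (cases "balanced n {} M x")
    case False
    then obtain y where y: "M < card {w \<in> {..<n}. x w = y}" by (auto simp: balanced_def not_le)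
    have fin: "finite {w \<in> {..<n}. P w}" for P by auto
    have "?S x = (\<Sum>w\<in>{w \<in> {..<n}. x w = y} \<union> {w \<in> {..<n}. x w \<noteq> y}. sg (x w))"
      by (intro sum.cong refl) auto
    also have "\<dots> = (\<Sum>w\<in>{w \<in> {..<n}. x w = y}. sg (x w)) + (\<Sum>w\<in>{w \<in> {..<n}. x w \<noteq> y}. sg (x w))"
      by (rule sum.union_disjoint) auto
    also have "(\<Sum>w\<in>{w \<in> {..<n}. x w = y}. sg (x w)) = card {w \<in> {..<n}. x w = y} * sg y" by simp
    also have "(\<Sum>w\<in>{w \<in> {..<n}. x w \<noteq> y}. sg (x w)) = (\<Sum>w\<in>{w \<in> {..<n}. x w \<noteq> y}. - sg y)"
      by (intro sum.cong refl) (auto simp: sg_def)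
    also have "\<dots> = - (card {w \<in> {..<n}. x w \<noteq> y} * sg y)" by simp
    finally have S: "?S x = (real (card {w \<in> {..<n}. x w = y}) - card {w \<in> {..<n}. x w \<noteq> y}) * sg y"
      by (simp add: algebra_simps)
    have "card ({w \<in> {..<n}. x w = y} \<union> {w \<in> {..<n}. x w \<noteq> y}) = card {w \<in> {..<n}. x w = y} + card {w \<in> {..<n}. x w \<noteq> y}"
      by (rule card_Un_disjoint) auto
    moreover have "{w \<in> {..<n}. x w = y} \<union> {w \<in> {..<n}. x w \<noteq> y} = {..<n}" by auto
    ultimately have "real n = card {w \<in> {..<n}. x w = y} + card {w \<in> {..<n}. x w \<noteq> y}" by simp
    then have "2 * \<eta> * n \<le> real (card {w \<in> {..<n}. x w = y}) - card {w \<in> {..<n}. x w \<noteq> y}"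
      using y M by (simp add: algebra_simps)
    then have "(2 * \<eta> * n)\<^sup>2 \<le> (real (card {w \<in> {..<n}. x w = y}) - card {w \<in> {..<n}. x w \<noteq> y})\<^sup>2"
      using \<eta> by (intro power_mono) auto
    also have "\<dots> = (?S x)\<^sup>2" unfolding S by (simp add: power_mult_distrib sg_def)
    finally have "1 \<le> 1 / (2 * \<eta> * n)\<^sup>2 * (?S x)\<^sup>2" using k by (simp add: le_divide_eq)
    then have "ennreal 1 \<le> ennreal (1 / (2 * \<eta> * n)\<^sup>2 * (?S x)\<^sup>2)" by (rule ennreal_leI)
    also have "\<dots> = ennreal (1 / (2 * \<eta> * n)\<^sup>2) * ennreal ((?S x)\<^sup>2)" by (rule ennreal_mult') simp
    finally show ?thesis using False by simp
  qed simp
  then have "(\<integral>\<^sup>+x. 1 \<partial>label_measure n) \<le> (\<integral>\<^sup>+x. indicator {x. balanced n {} M x} x + ennreal (1 / (2 * \<eta> * n)\<^sup>2) * ennreal ((?S x)\<^sup>2) \<partial>label_measure n)"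
    by (intro nn_integral_mono)
  also have "\<dots> = (\<integral>\<^sup>+x. indicator {x. balanced n {} M x} x \<partial>label_measure n) + ennreal (1 / (2 * \<eta> * n)\<^sup>2) * ennreal (real n)"
    by (subst nn_integral_add) (auto intro: measurable_label simp: nn_integral_cmult measurable_label label_sum_square)
  also have "ennreal (1 / (2 * \<eta> * n)\<^sup>2) * ennreal (real n) = ennreal (1 / (4 * \<eta>\<^sup>2 * n))"
    using n \<eta> by (subst ennreal_mult'[symmetric]) (auto simp: power2_eq_square field_simps)
  finally show ?thesis by (simp add: L.emeasure_space_1)
qed

text \<open>Uses ln (1 - x) \<ge> - x - 2 x^2 for 0 \<le> x \<le> 1/2. The real \<open>m\<close>
  replaces the integer \<open>M\<close>, so that the limit can be computed without rounding.\<close>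

lemma power_one_minus_ge:
  fixes a m :: real
  assumes "0 \<le> a" "2 * a \<le> n" "0 < n" "real M \<le> m"
  shows "exp (- (m * (a / n + 2 * (a / n)\<^sup>2))) \<le> (1 - a / n) ^ M"
proof -
  have x: "0 \<le> a / n" "a / n \<le> 1 / 2" using assms by (auto simp: field_simps)
  have "- (a / n) - 2 * (a / n)\<^sup>2 \<le> ln (1 - a / n)" by (rule ln_one_minus_pos_lower_bound[OF x])
  then have "real M * (- (a / n) - 2 * (a / n)\<^sup>2) \<le> real M * ln (1 - a / n)" by (rule mult_left_mono) simp
  moreover have "real M * (a / n + 2 * (a / n)\<^sup>2) \<le> m * (a / n + 2 * (a / n)\<^sup>2)"
    using assms x by (intro mult_right_mono) auto
  ultimately have "- (m * (a / n + 2 * (a / n)\<^sup>2)) \<le> real M * ln (1 - a / n)" by (simp add: algebra_simps)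
  then have "exp (- (m * (a / n + 2 * (a / n)\<^sup>2))) \<le> exp (real M * ln (1 - a / n))" by simp
  also have "\<dots> = (1 - a / n) ^ M"
  proof -
    have "0 < 1 - a / n" using x by linarith
    then show ?thesis by (simp only: exp_of_nat_mult exp_ln)
  qed
  finally show ?thesis .
qed

text \<open>With \<open>M\<close> about \<open>(1 / 2 + \<eta>) * n\<close> the factor of an
  interior vertex tends to exp (- d - 2 d \<eta>). Balance thus costs only the slack
  \<open>\<eta>\<close>, which is chosen small relative to \<open>K\<close>.\<close>

lemma eventually_constants:
  fixes a b \<epsilon> :: real and K :: nat
  assumes a: "0 \<le> a" and b: "0 \<le> b" and ab: "0 < a + b" and \<epsilon>: "0 < \<epsilon>"
  shows "eventually (\<lambda>n. \<exists>M. (\<forall>i\<le>K. (1 - \<epsilon>) * exp (- ((a + b) / 2)) ^ i \<le>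
      (1 - max a b / n) ^ (K * K) * ((1 - a / n) ^ M * (1 - b / n) ^ M) ^ i) \<and>
      ennreal (1 - \<epsilon>) \<le> (\<integral>\<^sup>+x. indicator {x. balanced n {} M x} x \<partial>label_measure n)) sequentially"
proof -
  define d where "d = (a + b) / 2"
  have d: "0 < d" using ab by (simp add: d_def)
  \<comment> \<open>Makes \<open>2 * d * \<eta> * K\<close> less than \<open>\<epsilon>\<close>, so
    that up to \<open>K\<close> interior vertices together cost a factor above
    \<open>1 - \<epsilon>\<close>.\<close>
  define \<eta> where "\<eta> = \<epsilon> / (2 * d * K + 1)"
  have den: "0 < 2 * d * K + 1" using d by (simp add: add_nonneg_pos)
  have \<eta>: "0 < \<eta>" using \<epsilon> den by (simp add: \<eta>_def)
  have dK: "2 * d * \<eta> * K < \<epsilon>"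
    using \<epsilon> den by (simp add: \<eta>_def field_simps)
  \<comment> \<open>An upper bound for the ceiling \<open>M\<close> chosen below; the summand 1 is
    the rounding.\<close>
  define m where "m n = (1 / 2 + \<eta>) * real n + 1" for n
  define G where "G i n = (1 - max a b / real n) ^ (K * K) *
     (exp (- (m n * (a / n + 2 * (a / n)\<^sup>2))) * exp (- (m n * (b / n + 2 * (b / n)\<^sup>2)))) ^ i" for i n
  have lim: "(\<lambda>n. m n * (c / real n + 2 * (c / real n)\<^sup>2)) \<longlonglongrightarrow> c * (1 / 2 + \<eta>)" for c
  proof -
    have "(\<lambda>n. c * (1 / 2 + \<eta>) + (c + 2 * (1 / 2 + \<eta>) * c\<^sup>2) * inverse (real n) + 2 * c\<^sup>2 * (inverse (real n) * inverse (real n))) \<longlonglongrightarrow>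
      c * (1 / 2 + \<eta>) + (c + 2 * (1 / 2 + \<eta>) * c\<^sup>2) * 0 + 2 * c\<^sup>2 * (0 * 0)"
      by (intro tendsto_intros lim_inverse_n)
    moreover have "eventually (\<lambda>n. c * (1 / 2 + \<eta>) + (c + 2 * (1 / 2 + \<eta>) * c\<^sup>2) * inverse (real n) + 2 * c\<^sup>2 * (inverse (real n) * inverse (real n)) =
      m n * (c / real n + 2 * (c / real n)\<^sup>2)) sequentially"
      using eventually_gt_at_top[of 0]
      by eventually_elim (simp add: m_def field_simps power2_eq_square)
    ultimately show ?thesis by (simp add: tendsto_cong)
  qed
  have limq: "(\<lambda>n. 1 - max a b / real n) \<longlonglongrightarrow> 1 - 0"
    by (intro tendsto_intros lim_const_over_n)
  have "eventually (\<lambda>n. (1 - \<epsilon>) * exp (- d) ^ i < G i n) sequentially" if i: "i \<le> K" for i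
  proof (rule order_tendstoD(1))
    show "G i \<longlonglongrightarrow> (1 - 0) ^ (K * K) * (exp (- (a * (1 / 2 + \<eta>))) * exp (- (b * (1 / 2 + \<eta>)))) ^ i"
      unfolding G_def by (intro tendsto_intros lim limq)
    have "(exp (- (a * (1 / 2 + \<eta>))) * exp (- (b * (1 / 2 + \<eta>)))) ^ i = exp (- d) ^ i * exp (- (2 * d * \<eta> * i))"
      by (simp add: exp_add[symmetric] exp_of_nat_mult[symmetric] d_def algebra_simps add_divide_distrib)
    moreover have "1 - \<epsilon> < exp (- (2 * d * \<eta> * i))"
    proof -
      have "2 * d * \<eta> * i \<le> 2 * d * \<eta> * K" using i d \<eta> by (intro mult_left_mono) auto
      then have "1 - \<epsilon> < 1 + - (2 * d * \<eta> * i)" using dK by simp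
      also have "\<dots> \<le> exp (- (2 * d * \<eta> * i))" by (rule exp_ge_add_one_self)
      finally show ?thesis .
    qed
    ultimately show "(1 - \<epsilon>) * exp (- d) ^ i < (1 - 0) ^ (K * K) * (exp (- (a * (1 / 2 + \<eta>))) * exp (- (b * (1 / 2 + \<eta>)))) ^ i"
      by (simp add: mult.commute)
  qed
  then have ev1: "eventually (\<lambda>n. \<forall>i\<in>{..K}. (1 - \<epsilon>) * exp (- d) ^ i < G i n) sequentially"
    by (intro eventually_ball_finite) auto
  have "(\<lambda>n. 1 / (4 * \<eta>\<^sup>2) / real n) \<longlonglongrightarrow> 0" by (rule lim_const_over_n)
  then have ev2: "eventually (\<lambda>n. 1 / (4 * \<eta>\<^sup>2 * real n) < \<epsilon>) sequentially"
    using \<epsilon> by (intro order_tendstoD[of _ 0]) auto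
  have ev3: "eventually (\<lambda>n. 2 * (a + b) + 1 \<le> real n) sequentially"
    using eventually_ge_at_top[of "nat \<lceil>2 * (a + b) + 1\<rceil>"] by eventually_elim linarith
  from ev1 ev2 ev3 show ?thesis
  proof eventually_elim
    case (elim n)
    have n: "0 < n" "2 * a \<le> n" "2 * b \<le> n" using elim(3) a b by (auto intro!: Nat.gr0I)
    define M where "M = nat \<lceil>(1 / 2 + \<eta>) * n\<rceil>"
    have M: "(1 / 2 + \<eta>) * n \<le> real M" "real M \<le> m n"
      using \<eta> n by (auto simp: M_def m_def of_nat_nat)
    show ?case
    proof (intro exI[of _ M] conjI allI impI)
      fix i assume i: "i \<le> K"
      have "(1 - \<epsilon>) * exp (- d) ^ i \<le> G i n" using elim(1) i by (auto intro: less_imp_le)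
      also have "\<dots> \<le> (1 - max a b / n) ^ (K * K) * ((1 - a / n) ^ M * (1 - b / n) ^ M) ^ i"
        unfolding G_def using n a b M
        by (intro mult_left_mono power_mono mult_mono power_one_minus_ge) (auto simp: max_def)
      finally show "(1 - \<epsilon>) * exp (- ((a + b) / 2)) ^ i \<le>
        (1 - max a b / n) ^ (K * K) * ((1 - a / n) ^ M * (1 - b / n) ^ M) ^ i" by (simp add: d_def)
    next
      have "1 \<le> (\<integral>\<^sup>+x. indicator {x. balanced n {} M x} x \<partial>label_measure n) + ennreal (1 / (4 * \<eta>\<^sup>2 * n))"
        by (rule balanced_prob[OF n(1) \<eta> M(1)])
      also have "\<dots> \<le> (\<integral>\<^sup>+x. indicator {x. balanced n {} M x} x \<partial>label_measure n) + ennreal \<epsilon>"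
        using elim(2) by (intro add_left_mono ennreal_leI) simp
      finally have "1 - ennreal \<epsilon> \<le> (\<integral>\<^sup>+x. indicator {x. balanced n {} M x} x \<partial>label_measure n)"
        by (subst ennreal_minus_le_iff) (auto simp: add.commute)
      then show "ennreal (1 - \<epsilon>) \<le> (\<integral>\<^sup>+x. indicator {x. balanced n {} M x} x \<partial>label_measure n)"
        using \<epsilon> by (simp add: ennreal_minus[symmetric] ennreal_1[symmetric] del: ennreal_1)
    qed
  qed
qed

section \<open>Error probabilities from tree sums\<close>

context tree_model
begin

text \<open>Each of the two sums is bounded above by its value on the Poisson tree, and together
  they make up the total mass of at least \<open>1 - \<epsilon>\<close>. So each is also bounded
  below.\<close>

lemma tree_sums:
  assumes v: "v < n" and \<epsilon>: "1 - \<epsilon> \<le> (\<Sum>\<tau>\<in>trees n k T Z v. tree_weight d n T \<tau>)"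
    and r: "excess (bp_law W d th L0 T) 0 = ennreal r" "0 \<le> r" "r \<le> 1"
  shows "ennreal ((1 + r) / 2 - \<epsilon>) \<le> (\<Sum>\<tau>\<in>trees n k T Z v. \<integral>\<^sup>+\<omega>. ennreal (max (lik T \<omega> \<tau> False) (lik T \<omega> \<tau> True) / 2) \<partial>\<Omega>)"
    and "ennreal ((1 - r) / 2 - \<epsilon>) \<le> (\<Sum>\<tau>\<in>trees n k T Z v. \<integral>\<^sup>+\<omega>. ennreal (min (lik T \<omega> \<tau> False) (lik T \<omega> \<tau> True) / 2) \<partial>\<Omega>)"
proof -
  have half_nonneg: "0 \<le> (1 / 2 :: real)" by simp
  define \<rho> where "\<rho> = bp_law W d th L0 T"
  have mr: "mlaw \<rho>" unfolding \<rho>_def by (intro mlaw_bp_law mlaw_mag mlaw_leaf th_le)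
  note [measurable_cong] = mlaw_sets[OF mr]
  interpret R: prob_space \<rho> by (rule mlaw_prob[OF mr])
  let ?A = "\<Sum>\<tau>\<in>trees n k T Z v. \<integral>\<^sup>+\<omega>. ennreal (max (lik T \<omega> \<tau> False) (lik T \<omega> \<tau> True) / 2) \<partial>\<Omega>"
  let ?B = "\<Sum>\<tau>\<in>trees n k T Z v. \<integral>\<^sup>+\<omega>. ennreal (min (lik T \<omega> \<tau> False) (lik T \<omega> \<tau> True) / 2) \<partial>\<Omega>"
  have hmax: "homogeneous (\<lambda>p q. ennreal (max p q / 2))"
  proof -
    have "max (c * x) (c * y) / 2 = c * (max x y / 2)" if "0 \<le> c" for c x y :: real
      using that by (simp add: max_mult_distrib_left)
    then show ?thesis unfolding homogeneous_def by (auto simp: ennreal_mult' simp del: times_divide_eq_right)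
  qed
  have hmin: "homogeneous (\<lambda>p q. ennreal (min p q / 2))"
  proof -
    have "min (c * x) (c * y) / 2 = c * (min x y / 2)" if "0 \<le> c" for c x y :: real
      using that by (simp add: min_mult_distrib_left)
    then show ?thesis unfolding homogeneous_def by (auto simp: ennreal_mult' simp del: times_divide_eq_right)
  qed
  have ex: "(\<integral>\<^sup>+x. ennreal \<bar>x\<bar> \<partial>\<rho>) = ennreal r" using r(1) by (simp add: excess_def \<rho>_def)
  have half: "(\<integral>\<^sup>+x. ennreal (\<bar>x\<bar> / 2) \<partial>\<rho>) = ennreal (r / 2)"
  proof -
    have "(\<integral>\<^sup>+x. ennreal (1 / 2 * \<bar>x\<bar>) \<partial>\<rho>) = (\<integral>\<^sup>+x. ennreal (1 / 2) * ennreal \<bar>x\<bar> \<partial>\<rho>)"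
      by (intro nn_integral_cong ennreal_mult') simp
    also have "\<dots> = ennreal (1 / 2) * ennreal r" by (subst nn_integral_cmult) (measurable, simp add: ex)
    also have "\<dots> = ennreal (1 / 2 * r)" by (rule ennreal_mult'[symmetric]) simp
    finally show ?thesis by simp
  qed
  have "?A \<le> (\<integral>\<^sup>+x. ennreal (max (1 + x) (1 - x) / 2) \<partial>\<rho>)"
    unfolding \<rho>_def by (rule tree_sum_le[OF v hmax])
  also have "\<dots> = (\<integral>\<^sup>+x. ennreal (1 / 2) + ennreal (\<bar>x\<bar> / 2) \<partial>\<rho>)"
  proof (rule nn_integral_cong)
    fix x :: real
    have "max (1 + x) (1 - x) / 2 = 1 / 2 + \<bar>x\<bar> / 2" by (simp add: max_def abs_if field_simps)
    then show "ennreal (max (1 + x) (1 - x) / 2) = ennreal (1 / 2) + ennreal (\<bar>x\<bar> / 2)"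
      by (simp only:) (rule ennreal_plus; simp)
  qed
  also have "\<dots> = ennreal (1 / 2) + ennreal (r / 2)"
    by (subst nn_integral_add) (measurable, simp add: half R.emeasure_space_1)
  also have "\<dots> = ennreal ((1 + r) / 2)" using r by (subst ennreal_plus[symmetric]) (auto simp: add_divide_distrib)
  finally have A: "?A \<le> ennreal ((1 + r) / 2)" .
  have B: "?B \<le> ennreal ((1 - r) / 2)"
  proof -
    have le: "?B \<le> (\<integral>\<^sup>+x. ennreal (min (1 + x) (1 - x) / 2) \<partial>\<rho>)"
      unfolding \<rho>_def by (rule tree_sum_le[OF v hmin])
    have eq: "(\<integral>\<^sup>+x. ennreal (min (1 + x) (1 - x) / 2) \<partial>\<rho>) + ennreal (r / 2) = ennreal (1 / 2)"
    proof -
      have "(\<integral>\<^sup>+x. ennreal (min (1 + x) (1 - x) / 2) \<partial>\<rho>) + ennreal (r / 2) =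
        (\<integral>\<^sup>+x. ennreal (min (1 + x) (1 - x) / 2) + ennreal (\<bar>x\<bar> / 2) \<partial>\<rho>)"
        unfolding half[symmetric] by (rule nn_integral_add[symmetric]) measurable
      also have "\<dots> = (\<integral>\<^sup>+x. ennreal (1 / 2) \<partial>\<rho>)"
      proof (rule mlaw_nn_integral_cong[OF mr])
        fix x :: real assume x: "\<bar>x\<bar> \<le> 1"
        then have nn: "0 \<le> min (1 + x) (1 - x) / 2" by (simp add: min_def abs_if split: if_splits)
        have "ennreal (min (1 + x) (1 - x) / 2) + ennreal (\<bar>x\<bar> / 2) = ennreal (min (1 + x) (1 - x) / 2 + \<bar>x\<bar> / 2)"
          by (rule ennreal_plus[symmetric, OF nn]) simp
        also have "min (1 + x) (1 - x) / 2 + \<bar>x\<bar> / 2 = 1 / 2" by (simp add: min_def abs_if field_simps)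
        finally show "ennreal (min (1 + x) (1 - x) / 2) + ennreal (\<bar>x\<bar> / 2) = ennreal (1 / 2)" .
      qed
      finally show ?thesis by (simp add: R.emeasure_space_1)
    qed
    have "?B + ennreal (r / 2) \<le> ennreal (1 / 2)" unfolding eq[symmetric] by (rule add_right_mono[OF le])
    also have "ennreal (1 / 2) = ennreal ((1 - r) / 2) + ennreal (r / 2)"
      using r by (subst ennreal_plus[symmetric]) (auto simp: diff_divide_distrib)
    finally show ?thesis by (simp add: add.commute[of _ "ennreal (r / 2)"] ennreal_add_left_cancel_le del: ennreal_plus)
  qed
  have AB: "?A + ?B = ennreal (\<Sum>\<tau>\<in>trees n k T Z v. tree_weight d n T \<tau>)"
  proof -
    have "(\<integral>\<^sup>+\<omega>. ennreal (max (lik T \<omega> \<tau> False) (lik T \<omega> \<tau> True) / 2) \<partial>\<Omega>) +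
       (\<integral>\<^sup>+\<omega>. ennreal (min (lik T \<omega> \<tau> False) (lik T \<omega> \<tau> True) / 2) \<partial>\<Omega>) = ennreal (tree_weight d n T \<tau>)"
      if \<tau>: "\<tau> \<in> trees n k T Z v" for \<tau>
    proof -
      have nV: "names T \<tau> \<subseteq> {..<n}" using names_tree[OF \<tau>] v by auto
      note [measurable] = measurable_lik[OF nV]
      have "(\<integral>\<^sup>+\<omega>. ennreal (max (lik T \<omega> \<tau> False) (lik T \<omega> \<tau> True) / 2) \<partial>\<Omega>) +
         (\<integral>\<^sup>+\<omega>. ennreal (min (lik T \<omega> \<tau> False) (lik T \<omega> \<tau> True) / 2) \<partial>\<Omega>) =
         (\<integral>\<^sup>+\<omega>. ennreal (max (lik T \<omega> \<tau> False) (lik T \<omega> \<tau> True) / 2) + ennreal (min (lik T \<omega> \<tau> False) (lik T \<omega> \<tau> True) / 2) \<partial>\<Omega>)"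
        by (rule nn_integral_add[symmetric]) measurable
      also have "\<dots> = (\<integral>\<^sup>+\<omega>. ennreal (1 / 2) * ennreal (lik T \<omega> \<tau> False) + ennreal (1 / 2) * ennreal (lik T \<omega> \<tau> True) \<partial>\<Omega>)"
      proof (rule nn_integral_cong)
        fix \<omega>
        let ?p = "lik T \<omega> \<tau> False" and ?q = "lik T \<omega> \<tau> True"
        have nn: "0 \<le> ?p" "0 \<le> ?q" by (rule lik_nonneg)+
        have "ennreal (max ?p ?q / 2) + ennreal (min ?p ?q / 2) = ennreal (max ?p ?q / 2 + min ?p ?q / 2)"
          using nn by (intro ennreal_plus[symmetric]) auto
        also have "max ?p ?q / 2 + min ?p ?q / 2 = 1 / 2 * ?p + 1 / 2 * ?q" by (simp add: max_def min_def)
        also have "ennreal \<dots> = ennreal (1 / 2) * ennreal ?p + ennreal (1 / 2) * ennreal ?q"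
          unfolding ennreal_mult'[OF half_nonneg, symmetric] by (rule ennreal_plus) (use nn in auto)
        finally show "ennreal (max ?p ?q / 2) + ennreal (min ?p ?q / 2) = ennreal (1 / 2) * ennreal ?p + ennreal (1 / 2) * ennreal ?q" .
      qed
      also have "\<dots> = ennreal (1 / 2) * ennreal (tree_weight d n T \<tau>) + ennreal (1 / 2) * ennreal (tree_weight d n T \<tau>)"
        by (subst nn_integral_add) (measurable, simp add: nn_integral_cmult nn_integral_lik[OF \<tau> v])
      also have "\<dots> = ennreal (1 / 2 * tree_weight d n T \<tau> + 1 / 2 * tree_weight d n T \<tau>)"
        unfolding ennreal_mult'[OF half_nonneg, symmetric] using tree_weight_nonneg[of d n T \<tau>] d_pos
        by (intro ennreal_plus[symmetric]) auto
      finally show ?thesis by simp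
    qed
    then have "?A + ?B = (\<Sum>\<tau>\<in>trees n k T Z v. ennreal (tree_weight d n T \<tau>))"
      by (simp add: sum.distrib[symmetric])
    also have "\<dots> = ennreal (\<Sum>\<tau>\<in>trees n k T Z v. tree_weight d n T \<tau>)"
      using d_pos by (intro sum_ennreal tree_weight_nonneg) auto
    finally show ?thesis .
  qed
  have lower: "ennreal (1 - \<epsilon> - c) \<le> X" if "ennreal (1 - \<epsilon>) \<le> X + Y" "Y \<le> ennreal c" "0 \<le> c" for X Y c
  proof -
    have "ennreal (1 - \<epsilon>) \<le> ennreal c + X" using that by (metis add.commute add_left_mono order_trans)
    then have "ennreal (1 - \<epsilon>) - ennreal c \<le> X" by (subst ennreal_minus_le_iff) auto
    then show ?thesis using that(3) by (simp add: ennreal_minus)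
  qed
  have AB': "ennreal (1 - \<epsilon>) \<le> ?A + ?B" unfolding AB using \<epsilon> by (rule ennreal_leI)
  have "ennreal (1 - \<epsilon> - (1 - r) / 2) \<le> ?A" by (rule lower[OF AB' B]) (use r in simp)
  also have "1 - \<epsilon> - (1 - r) / 2 = (1 + r) / 2 - \<epsilon>" by (simp add: field_simps)
  finally show "ennreal ((1 + r) / 2 - \<epsilon>) \<le> ?A" .
  have "ennreal (1 - \<epsilon> - (1 + r) / 2) \<le> ?B" by (rule lower[OF AB'[unfolded add.commute[of ?A]] A]) (use r in simp)
  also have "1 - \<epsilon> - (1 + r) / 2 = (1 - r) / 2 - \<epsilon>" by (simp add: field_simps)
  finally show "ennreal ((1 - r) / 2 - \<epsilon>) \<le> ?B" .
qed

end

definition tree_approx :: "nat \<Rightarrow> real \<Rightarrow> real \<Rightarrow> real \<Rightarrow> nat \<Rightarrow> nat \<Rightarrow> nat \<Rightarrow> nat \<Rightarrow> bool" where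
  "tree_approx n a b \<epsilon> k K M T \<longleftrightarrow> tree_size_bound k T \<le> K \<and>
     (\<forall>i\<le>K. (1 - \<epsilon>) * exp (- ((a + b) / 2)) ^ i \<le>
        (1 - max a b / n) ^ (K * K) * ((1 - a / n) ^ M * (1 - b / n) ^ M) ^ i) \<and>
     ennreal (1 - \<epsilon>) \<le> (\<integral>\<^sup>+x. indicator {x. balanced n {} M x} x \<partial>label_measure n) \<and>
     (\<forall>v. 1 - \<epsilon> \<le> (\<Sum>\<tau>\<in>trees n k T {} v. tree_weight ((a + b) / 2) n T \<tau>))"

lemma eventually_tree_approx:
  assumes "0 \<le> a" "0 \<le> b" "0 < a + b" "0 < \<epsilon>"
  shows "eventually (\<lambda>n. \<exists>k K M. tree_approx n a b \<epsilon> k K M T) sequentially"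
proof -
  obtain k where k: "\<forall>M. \<exists>n0. \<forall>n\<ge>n0. \<forall>Z v. finite Z \<longrightarrow> card Z \<le> M \<longrightarrow>
      1 - \<epsilon> \<le> (\<Sum>\<tau>\<in>trees n k T Z v. tree_weight ((a + b) / 2) n T \<tau>)"
    using tree_mass[of "(a + b) / 2" \<epsilon> T] assms by auto
  then obtain n0 where n0: "\<And>n v. n0 \<le> n \<Longrightarrow> 1 - \<epsilon> \<le> (\<Sum>\<tau>\<in>trees n k T {} v. tree_weight ((a + b) / 2) n T \<tau>)"
    by (metis card.empty finite.emptyI le_refl)
  show ?thesis
    using eventually_constants[OF assms, of "tree_size_bound k T"] eventually_ge_at_top[of n0]
  proof eventually_elim
    case (elim n)
    then show ?case using n0[of n] unfolding tree_approx_def by blast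
  qed
qed

text \<open>One factor \<open>1 - \<epsilon>\<close> stems from the probability of a graph, the
  other from balance; the sign of \<open>z - \<epsilon>\<close> decides how they may be
  dropped.\<close>

lemma shrink_bound:
  fixes \<epsilon> z :: real
  assumes "0 < \<epsilon>" "\<epsilon> < 1" "0 \<le> z" "z \<le> 1"
  shows "z - 3 * \<epsilon> \<le> (1 - \<epsilon>)\<^sup>2 * (z - \<epsilon>)"
proof (cases "\<epsilon> \<le> z")
  case True
  have "z - 3 * \<epsilon> \<le> (1 - 2 * \<epsilon>) * (z - \<epsilon>)"
  proof -
    have "\<epsilon> * z \<le> \<epsilon> * 1" using assms by (intro mult_left_mono) auto
    moreover have "0 \<le> \<epsilon> * \<epsilon>" by simp
    moreover have "(1 - 2 * \<epsilon>) * (z - \<epsilon>) = z - \<epsilon> - 2 * (\<epsilon> * z) + 2 * (\<epsilon> * \<epsilon>)" by (simp add: algebra_simps)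
    ultimately show ?thesis by linarith
  qed
  also have "\<dots> \<le> (1 - \<epsilon>)\<^sup>2 * (z - \<epsilon>)"
    using True by (intro mult_right_mono) (auto simp: power2_eq_square algebra_simps)
  finally show ?thesis .
next
  case False
  have "(1 - \<epsilon>)\<^sup>2 \<le> 1" using assms by (simp add: power_le_one)
  then have "1 * (z - \<epsilon>) \<le> (1 - \<epsilon>)\<^sup>2 * (z - \<epsilon>)" using False by (intro mult_right_mono_neg) auto
  then show ?thesis using assms by simp
qed

context sbm_model
begin

lemma prob_sbm: "prob_space (sbm n a b \<mu>)"
  by (rule prob_space_sbm[OF prob_mu[OF sym] sets_mu[OF sym]])

text \<open>\<open>P\<close> is instantiated with the identity and with negation, which treats
  success and error at once.\<close>

lemma pred_agree:
  fixes P :: "bool \<Rightarrow> bool"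
  assumes h: "(\<lambda>obs. h obs v) \<in> observation_space n \<rightarrow>\<^sub>M count_space UNIV" and v: "v < n"
  shows "Measurable.pred (LM \<Otimes>\<^sub>M observation_space n) (\<lambda>\<omega>. P (fst \<omega> v = h (snd \<omega>) v))"
proof -
  have "(\<lambda>x. x v) \<in> LM \<rightarrow>\<^sub>M count_space UNIV" by (simp add: measurable_def sets_labels space_label_measure)
  from measurable_compose[OF measurable_fst this] measurable_compose[OF measurable_snd h]
  have "Measurable.pred (LM \<Otimes>\<^sub>M observation_space n) (\<lambda>\<omega>. fst \<omega> v)"
    "Measurable.pred (LM \<Otimes>\<^sub>M observation_space n) (\<lambda>\<omega>. h (snd \<omega>) v)" .
  moreover have "Measurable.pred N (\<lambda>\<omega>. P (A \<omega> = B \<omega>))"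
    if [measurable]: "Measurable.pred N A" "Measurable.pred N B" for N :: "(labelling \<times> observation) measure" and A B
    by measurable
  ultimately show ?thesis by blast
qed

lemma emeasure_agree:
  fixes P :: "bool \<Rightarrow> bool"
  assumes h: "(\<lambda>obs. h obs v) \<in> observation_space n \<rightarrow>\<^sub>M count_space UNIV" and v: "v < n"
  shows "emeasure (sbm n a b \<mu>) {\<omega> \<in> space (sbm n a b \<mu>). P (fst \<omega> v = h (snd \<omega>) v)} =
    (\<integral>\<^sup>+\<omega>. indicator {\<omega>. P (fst \<omega> v = h (snd \<omega>) v)} \<omega> \<partial>sbm n a b \<mu>)"
    and "indicator {\<omega>. P (fst \<omega> v = h (snd \<omega>) v)} \<in> borel_measurable (LM \<Otimes>\<^sub>M observation_space n)"
    and "{\<omega> \<in> space (sbm n a b \<mu>). P (fst \<omega> v = h (snd \<omega>) v)} \<in> sets (sbm n a b \<mu>)"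
proof -
  let ?A = "{\<omega> \<in> space (sbm n a b \<mu>). P (fst \<omega> v = h (snd \<omega>) v)}"
  note [measurable] = pred_agree[where h = h and v = v and P = P, OF h v]
  show A: "?A \<in> sets (sbm n a b \<mu>)"
    unfolding sets_sbm sets_eq_imp_space_eq[OF sets_sbm] by measurable
  then have "emeasure (sbm n a b \<mu>) ?A = (\<integral>\<^sup>+\<omega>. indicator ?A \<omega> \<partial>sbm n a b \<mu>)" by simp
  also have "\<dots> = (\<integral>\<^sup>+\<omega>. indicator {\<omega>. P (fst \<omega> v = h (snd \<omega>) v)} \<omega> \<partial>sbm n a b \<mu>)"
    by (intro nn_integral_cong) (simp add: indicator_def)
  finally show "emeasure (sbm n a b \<mu>) ?A = (\<integral>\<^sup>+\<omega>. indicator {\<omega>. P (fst \<omega> v = h (snd \<omega>) v)} \<omega> \<partial>sbm n a b \<mu>)" .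
  show "indicator {\<omega>. P (fst \<omega> v = h (snd \<omega>) v)} \<in> borel_measurable (LM \<Otimes>\<^sub>M observation_space n)" by measurable
qed

lemma obs_section:
  assumes h: "(\<lambda>obs. h obs v) \<in> observation_space n \<rightarrow>\<^sub>M count_space UNIV"
    and g: "g \<in> vertex_pairs n \<rightarrow>\<^sub>E UNIV"
  shows "(\<lambda>s. h (g, s) v) \<in> SM \<rightarrow>\<^sub>M count_space UNIV"
proof -
  have "(\<lambda>s. (g, s)) \<in> (\<Pi>\<^sub>M v\<in>{..<n}. borel) \<rightarrow>\<^sub>M observation_space n"
    unfolding observation_space_def using g by (intro measurable_Pair1') (simp add: space_PiM)
  then have "(\<lambda>s. h (g, s) v) \<in> (\<Pi>\<^sub>M v\<in>{..<n}. borel) \<rightarrow>\<^sub>M count_space UNIV"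
    by (rule measurable_compose) (rule h)
  then show ?thesis using measurable_cong_sets[OF sets_SM refl] by blast
qed

text \<open>Whatever label is announced, the weight of its being wrong is at least half the smaller
  of the two likelihoods.\<close>

lemma estimator_bound:
  assumes v: "v < n" and \<epsilon>: "0 < \<epsilon>" "\<epsilon> < 1" and approx: "tree_approx n a b \<epsilon> k K M T"
    and h: "(\<lambda>obs. h obs v) \<in> observation_space n \<rightarrow>\<^sub>M count_space UNIV"
    and r: "excess (bp_law (distr N borel emag) ((a + b) / 2) ((a - b) / (a + b)) perfect_law T) 0 = ennreal r" "0 \<le> r" "r \<le> 1"
  shows "ennreal ((1 - \<epsilon>)\<^sup>2 * ((1 - r) / 2 - \<epsilon>)) \<le> emeasure (sbm n a b \<mu>) {\<omega> \<in> space (sbm n a b \<mu>). fst \<omega> v \<noteq> h (snd \<omega>) v}"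
proof -
  let ?E = "{\<omega>. fst \<omega> v \<noteq> h (snd \<omega>) v}"
  let ?f = "\<lambda>g s y. indicator {y. y \<noteq> h (g, s) v} y :: ennreal"
  note ta = approx[unfolded tree_approx_def]
  have "ennreal (1 - \<epsilon>) * (\<integral>\<^sup>+x. balb {} M x \<partial>LM) *
    (\<Sum>\<tau>\<in>trees n k T {} v. \<integral>\<^sup>+\<omega>. ennreal (min (revealed.lik T \<omega> \<tau> False) (revealed.lik T \<omega> \<tau> True) / 2) \<partial>revealed.\<Omega>)
    \<le> (\<integral>\<^sup>+\<omega>. indicator ?E \<omega> \<partial>sbm n a b \<mu>)"
  proof (rule revealed_lower_bound[OF v])
    show "tree_size_bound k T \<le> K" using ta by blast
    show "(1 - \<epsilon>) * exp (- d) ^ i \<le> (1 - max a b / n) ^ (K * K) * ((1 - a / n) ^ M * (1 - b / n) ^ M) ^ i" if "i \<le> K" for i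
      using ta that by (simp add: hidden.d_def)
    show "indicator ?E \<in> borel_measurable (LM \<Otimes>\<^sub>M observation_space n)"
      by (rule emeasure_agree(2)[where P = Not and h = h, OF h v])
    show "(\<lambda>s. ?f g s y) \<in> borel_measurable SM" if g: "g \<in> vertex_pairs n \<rightarrow>\<^sub>E UNIV" for g y
    proof -
      note [measurable] = obs_section[where h = h and v = v, OF h g]
      show ?thesis by (simp add: indicator_def)
    qed
    show "?f g s (x v) \<le> indicator ?E (x, (g, s))" for g s x by (simp add: indicator_def)
    show "(\<lambda>(p, q). ennreal (min p q / 2)) \<in> borel_measurable (borel \<Otimes>\<^sub>M borel)" by measurable
    show "ennreal (min p q / 2) \<le> ennreal (1 / 2) * (ennreal p * ?f g s False) + ennreal (1 / 2) * (ennreal q * ?f g s True)" for p q g s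
    proof -
      have "ennreal (1 / 2) * ennreal z = ennreal (z / 2)" for z
        using ennreal_mult'[of "1 / 2" z] by simp
      then show ?thesis by (cases "h (g, s) v") (auto intro!: ennreal_leI)
    qed
  qed (use \<epsilon> in simp)
  moreover have "ennreal ((1 - \<epsilon>)\<^sup>2 * ((1 - r) / 2 - \<epsilon>)) = ennreal (1 - \<epsilon>) * ennreal (1 - \<epsilon>) * ennreal ((1 - r) / 2 - \<epsilon>)"
    using \<epsilon> by (simp add: power2_eq_square ennreal_mult' mult.assoc)
  moreover have "\<dots> \<le> ennreal (1 - \<epsilon>) * (\<integral>\<^sup>+x. balb {} M x \<partial>LM) *
    (\<Sum>\<tau>\<in>trees n k T {} v. \<integral>\<^sup>+\<omega>. ennreal (min (revealed.lik T \<omega> \<tau> False) (revealed.lik T \<omega> \<tau> True) / 2) \<partial>revealed.\<Omega>)"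
  proof (intro mult_mono order_refl)
    show "ennreal (1 - \<epsilon>) \<le> (\<integral>\<^sup>+x. balb {} M x \<partial>LM)" using ta by simp
    show "ennreal ((1 - r) / 2 - \<epsilon>) \<le> (\<Sum>\<tau>\<in>trees n k T {} v. \<integral>\<^sup>+\<omega>. ennreal (min (revealed.lik T \<omega> \<tau> False) (revealed.lik T \<omega> \<tau> True) / 2) \<partial>revealed.\<Omega>)"
    proof (rule revealed.tree_sums(2)[OF v])
      show "1 - \<epsilon> \<le> (\<Sum>\<tau>\<in>trees n k T {} v. tree_weight d n T \<tau>)" using ta by (simp add: hidden.d_def)
      show "excess (bp_law revealed.W d revealed.th revealed.L0 T) 0 = ennreal r"
        using r(1) by (simp add: distr_revealed_mag distr_revealed_leaf hidden.d_def hidden.th_def)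
    qed (use r in auto)
  qed auto
  moreover note emeasure_agree(1)[where P = Not and h = h, OF h v]
  ultimately show ?thesis by simp
qed

lemma bp_section:
  assumes h: "bp_estimator n t \<delta> R h" and \<rho>: "\<rho> \<in> space R" and v: "v < n"
  shows "(\<lambda>obs. h \<rho> obs v) \<in> observation_space n \<rightarrow>\<^sub>M count_space UNIV"
proof -
  have "(\<lambda>(r, obs). h r obs v) \<in> R \<Otimes>\<^sub>M observation_space n \<rightarrow>\<^sub>M count_space UNIV"
    using h v by (auto simp: bp_estimator_def randomised_estimator_def)
  from measurable_compose[OF measurable_Pair1'[OF \<rho>] this] show ?thesis by simp
qed

text \<open>Applied with \<open>max\<close> and the identity for success, and with
  \<open>min\<close> and negation for error. On ties both answers satisfy the condition on
  \<open>m\<close>, so an arbitrary rule is admissible there.\<close>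

lemma bp_estimator_bound:
  fixes P :: "bool \<Rightarrow> bool" and m :: "real \<Rightarrow> real \<Rightarrow> real"
  assumes v: "v < n" and \<epsilon>: "0 < \<epsilon>" "\<epsilon> < 1" and approx: "tree_approx n a b \<epsilon> k K M T"
    and h: "bp_estimator n (Suc T) (b / (a + b)) R h" and \<rho>: "\<rho> \<in> space R"
    and m: "case_prod m \<in> borel_measurable (borel \<Otimes>\<^sub>M borel)"
      "\<And>p q y. 0 \<le> p \<Longrightarrow> 0 \<le> q \<Longrightarrow> (p < q \<longrightarrow> y) \<Longrightarrow> (q < p \<longrightarrow> \<not> y) \<Longrightarrow>
        m p q \<le> (if P (False = y) then p else 0) + (if P (True = y) then q else 0)"
    and z: "ennreal z \<le> (\<Sum>\<tau>\<in>trees n k T {} v. \<integral>\<^sup>+s. ennreal (m (hidden.lik T s \<tau> False) (hidden.lik T s \<tau> True) / 2) \<partial>SM)"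
  shows "ennreal ((1 - \<epsilon>)\<^sup>2 * z) \<le> emeasure (sbm n a b \<mu>) {\<omega> \<in> space (sbm n a b \<mu>). P (fst \<omega> v = h \<rho> (snd \<omega>) v)}"
proof -
  let ?E = "{\<omega>. P (fst \<omega> v = h \<rho> (snd \<omega>) v)}"
  \<comment> \<open>A representative graph for each tree. By locality the announced label is the
    same on the whole event, which is nonempty because \<open>rest_prob\<close> sums to 1 over
    it.\<close>
  define G where "G \<tau> = (SOME g. g \<in> ball_event n T \<tau>)" for \<tau>
  let ?f = "\<lambda>\<tau> s y. indicator {y. P (y = h \<rho> (G \<tau>, s) v)} y :: ennreal"
  note ta = approx[unfolded tree_approx_def]
  note hm = bp_section[OF h \<rho> v]
  have G: "G \<tau> \<in> ball_event n T \<tau>" for \<tau>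
  proof -
    have "ball_event n T \<tau> \<noteq> {}" by (metis sum.empty sum_rest_prob zero_neq_one)
    then show ?thesis unfolding G_def by (simp add: some_in_eq)
  qed
  have Gv: "G \<tau> \<in> vertex_pairs n \<rightarrow>\<^sub>E UNIV" for \<tau> using G by (auto simp: ball_event_def)
  have "ennreal (1 - \<epsilon>) * (\<integral>\<^sup>+x. balb {} M x \<partial>LM) *
    (\<Sum>\<tau>\<in>trees n k T {} v. \<integral>\<^sup>+s. ennreal (m (hidden.lik T s \<tau> False) (hidden.lik T s \<tau> True) / 2) \<partial>SM)
    \<le> (\<integral>\<^sup>+\<omega>. indicator ?E \<omega> \<partial>sbm n a b \<mu>)"
  proof (rule local_lower_bound[OF v])
    show "tree_size_bound k T \<le> K" using ta by blast
    show "(1 - \<epsilon>) * exp (- d) ^ i \<le> (1 - max a b / n) ^ (K * K) * ((1 - a / n) ^ M * (1 - b / n) ^ M) ^ i" if "i \<le> K" for i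
      using ta that by (simp add: hidden.d_def)
    show "indicator ?E \<in> borel_measurable (LM \<Otimes>\<^sub>M observation_space n)"
      by (rule emeasure_agree(2)[where P = P and h = "h \<rho>", OF hm v])
    show "(\<lambda>s. ?f \<tau> s y) \<in> borel_measurable SM" for \<tau> y
    proof -
      note [measurable] = obs_section[where h = "h \<rho>" and v = v, OF hm Gv]
      show ?thesis by (simp add: indicator_def)
    qed
    fix \<tau> assume \<tau>: "\<tau> \<in> trees n k T {} v"
    have wf: "wf_tree T \<tau>" "names T \<tau> \<subseteq> {..<n}" "root \<tau> = v"
      using wf_trees[OF \<tau>] names_tree[OF \<tau>] root_tree[OF \<tau>] v by auto
    show "?f \<tau> s (x v) \<le> indicator ?E (x, (g, s))" if g: "g \<in> ball_event n T \<tau>" and s: "s \<in> space SM" for g s x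
      using bp_estimator_local[OF wf(1,2) g G h \<rho>] s by (simp add: space_SM wf(3) indicator_def)
    show "ennreal (m (hidden.lik T s \<tau> False) (hidden.lik T s \<tau> True) / 2) \<le>
       (\<Sum>y\<in>UNIV. ennreal (1 / 2) * (ennreal (hidden.lik T s \<tau> y) * ?f \<tau> s y))" if s: "s \<in> space SM" for s
    proof -
      let ?p = "hidden.lik T s \<tau> False" and ?q = "hidden.lik T s \<tau> True" and ?y = "h \<rho> (G \<tau>, s) v"
      have nn: "0 \<le> ?p" "0 \<le> ?q" by (rule hidden.lik_nonneg)+
      have "m ?p ?q \<le> (if P (False = ?y) then ?p else 0) + (if P (True = ?y) then ?q else 0)"
        using hidden.bp_estimator_sign[OF wf(1,2) G h \<rho>] s by (intro m(2) nn) (auto simp: space_SM wf(3))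
      then have "m ?p ?q / 2 \<le> 1 / 2 * ((if P (False = ?y) then ?p else 0) + (if P (True = ?y) then ?q else 0))" by simp
      then have "ennreal (m ?p ?q / 2) \<le> ennreal (1 / 2 * ((if P (False = ?y) then ?p else 0) + (if P (True = ?y) then ?q else 0)))"
        by (rule ennreal_leI)
      also have "\<dots> = ennreal (1 / 2) * ennreal ((if P (False = ?y) then ?p else 0) + (if P (True = ?y) then ?q else 0))"
        by (rule ennreal_mult') simp
      also have "ennreal ((if P (False = ?y) then ?p else 0) + (if P (True = ?y) then ?q else 0)) =
        (\<Sum>y\<in>UNIV. ennreal (hidden.lik T s \<tau> y) * ?f \<tau> s y)"
        using nn by (simp add: UNIV_bool indicator_def)
      finally show ?thesis by (simp only: sum_distrib_left)
    qed
  qed (use \<epsilon> m(1) in \<open>simp_all add: split_beta'\<close>)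
  moreover have "ennreal ((1 - \<epsilon>)\<^sup>2 * z) = ennreal (1 - \<epsilon>) * ennreal (1 - \<epsilon>) * ennreal z"
    using \<epsilon> by (simp add: power2_eq_square ennreal_mult' mult.assoc)
  moreover have "\<dots> \<le> ennreal (1 - \<epsilon>) * (\<integral>\<^sup>+x. balb {} M x \<partial>LM) *
    (\<Sum>\<tau>\<in>trees n k T {} v. \<integral>\<^sup>+s. ennreal (m (hidden.lik T s \<tau> False) (hidden.lik T s \<tau> True) / 2) \<partial>SM)"
    using ta by (intro mult_mono order_refl z) auto
  moreover note emeasure_agree(1)[where P = P and h = "h \<rho>", OF hm v]
  ultimately show ?thesis by simp
qed

lemma bp_estimator_bounds:
  assumes v: "v < n" and \<epsilon>: "0 < \<epsilon>" "\<epsilon> < 1" and approx: "tree_approx n a b \<epsilon> k K M T"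
    and h: "bp_estimator n (Suc T) (b / (a + b)) R h" and \<rho>: "\<rho> \<in> space R"
    and r: "excess (bp_law (distr N borel emag) ((a + b) / 2) ((a - b) / (a + b)) (distr N borel emag) T) 0 = ennreal r" "0 \<le> r" "r \<le> 1"
  shows "ennreal ((1 - \<epsilon>)\<^sup>2 * ((1 + r) / 2 - \<epsilon>)) \<le> emeasure (sbm n a b \<mu>) {\<omega> \<in> space (sbm n a b \<mu>). fst \<omega> v = h \<rho> (snd \<omega>) v}"
    and "ennreal ((1 - \<epsilon>)\<^sup>2 * ((1 - r) / 2 - \<epsilon>)) \<le> emeasure (sbm n a b \<mu>) {\<omega> \<in> space (sbm n a b \<mu>). fst \<omega> v \<noteq> h \<rho> (snd \<omega>) v}"
proof -
  have mass: "1 - \<epsilon> \<le> (\<Sum>\<tau>\<in>trees n k T {} v. tree_weight d n T \<tau>)"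
    using approx by (simp add: tree_approx_def hidden.d_def)
  have r': "excess (bp_law hidden.W d hidden.th hidden.L0 T) 0 = ennreal r"
    using r(1) by (simp add: hidden.d_def hidden.th_def)
  note sums = hidden.tree_sums[OF v mass r' r(2,3)]
  show "ennreal ((1 - \<epsilon>)\<^sup>2 * ((1 + r) / 2 - \<epsilon>)) \<le> emeasure (sbm n a b \<mu>) {\<omega> \<in> space (sbm n a b \<mu>). fst \<omega> v = h \<rho> (snd \<omega>) v}"
    by (rule bp_estimator_bound[where P = "\<lambda>x. x", OF v \<epsilon> approx h \<rho> _ _ sums(1)]) (auto simp: max_def)
  show "ennreal ((1 - \<epsilon>)\<^sup>2 * ((1 - r) / 2 - \<epsilon>)) \<le> emeasure (sbm n a b \<mu>) {\<omega> \<in> space (sbm n a b \<mu>). fst \<omega> v \<noteq> h \<rho> (snd \<omega>) v}"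
    by (rule bp_estimator_bound[where P = Not, OF v \<epsilon> approx h \<rho> _ _ sums(2)]) (auto simp: min_def)
qed

end

section \<open>Randomisation, the supremum and the limits\<close>

lemma pair_measure_section_bounds:
  assumes "prob_space P" "prob_space R" and A: "A \<in> sets (P \<Otimes>\<^sub>M R)"
    and sec: "\<And>r. r \<in> space R \<Longrightarrow> l \<le> measure P ((\<lambda>x. (x, r)) -` A)" "\<And>r. r \<in> space R \<Longrightarrow> measure P ((\<lambda>x. (x, r)) -` A) \<le> u"
  shows "l \<le> measure (P \<Otimes>\<^sub>M R) A" and "measure (P \<Otimes>\<^sub>M R) A \<le> u"
proof -
  interpret P: prob_space P by fact
  interpret R: prob_space R by fact
  interpret PR: pair_prob_space P R ..
  have eq: "ennreal (measure (P \<Otimes>\<^sub>M R) A) = (\<integral>\<^sup>+r. ennreal (measure P ((\<lambda>x. (x, r)) -` A)) \<partial>R)"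
    using PR.emeasure_pair_measure_alt2[OF A] by (simp add: PR.P.emeasure_eq_measure P.emeasure_eq_measure)
  have "ennreal l = (\<integral>\<^sup>+r. ennreal l \<partial>R)" by (simp add: R.emeasure_space_1)
  also have "\<dots> \<le> ennreal (measure (P \<Otimes>\<^sub>M R) A)"
    unfolding eq using sec(1) by (intro nn_integral_mono ennreal_leI)
  finally show "l \<le> measure (P \<Otimes>\<^sub>M R) A" by simp
  obtain r where "r \<in> space R" using R.not_empty by blast
  then have u: "0 \<le> u" using sec(2)[of r] measure_nonneg[of P] order_trans by blast
  have "ennreal (measure (P \<Otimes>\<^sub>M R) A) \<le> (\<integral>\<^sup>+r. ennreal u \<partial>R)"
    unfolding eq using sec(2) by (intro nn_integral_mono ennreal_leI)
  also have "\<dots> = ennreal u" by (simp add: R.emeasure_space_1)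
  finally show "measure (P \<Otimes>\<^sub>M R) A \<le> u" using u by simp
qed

lemma accuracy_bounds:
  assumes "0 < n"
  shows "(\<And>v. v < n \<Longrightarrow> l \<le> \<P>(\<omega> in P. X \<omega> v = Y \<omega> v)) \<Longrightarrow> l \<le> accuracy n P X Y"
    and "(\<And>v. v < n \<Longrightarrow> \<P>(\<omega> in P. X \<omega> v = Y \<omega> v) \<le> u) \<Longrightarrow> accuracy n P X Y \<le> u"
proof -
  show "l \<le> accuracy n P X Y" if "\<And>v. v < n \<Longrightarrow> l \<le> \<P>(\<omega> in P. X \<omega> v = Y \<omega> v)"
    using sum_mono[of "{..<n}" "\<lambda>_. l"] that assms by (simp add: accuracy_def le_divide_eq mult.commute)
  show "accuracy n P X Y \<le> u" if "\<And>v. v < n \<Longrightarrow> \<P>(\<omega> in P. X \<omega> v = Y \<omega> v) \<le> u"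
    using sum_mono[of "{..<n}" _ "\<lambda>_. u"] that assms by (simp add: accuracy_def divide_le_eq mult.commute)
qed

context sbm_model
begin

lemma prob_disagree:
  assumes "(\<lambda>obs. h obs v) \<in> observation_space n \<rightarrow>\<^sub>M count_space UNIV" and "v < n"
  shows "\<P>(\<omega> in sbm n a b \<mu>. fst \<omega> v \<noteq> h (snd \<omega>) v) = 1 - \<P>(\<omega> in sbm n a b \<mu>. fst \<omega> v = h (snd \<omega>) v)"
  by (rule prob_space.prob_neg[OF prob_sbm emeasure_agree(3)[where P = "\<lambda>x. x" and h = h, OF assms]])

lemma ennreal_le_prob:
  assumes "ennreal c \<le> emeasure (sbm n a b \<mu>) A"
  shows "c \<le> measure (sbm n a b \<mu>) A"
proof -
  interpret S: prob_space "sbm n a b \<mu>" by (rule prob_sbm)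
  show ?thesis using assms by (simp add: S.emeasure_eq_measure)
qed

lemma estimator_prob_le:
  assumes v: "v < n" and \<epsilon>: "0 < \<epsilon>" "\<epsilon> < 1" and approx: "tree_approx n a b \<epsilon> k K M T"
    and h: "(\<lambda>obs. h obs v) \<in> observation_space n \<rightarrow>\<^sub>M count_space UNIV"
    and r: "excess (bp_law (distr N borel emag) ((a + b) / 2) ((a - b) / (a + b)) perfect_law T) 0 = ennreal r" "0 \<le> r" "r \<le> 1"
  shows "\<P>(\<omega> in sbm n a b \<mu>. fst \<omega> v = h (snd \<omega>) v) \<le> (1 + r) / 2 + 3 * \<epsilon>"
proof -
  have "(1 - r) / 2 - 3 * \<epsilon> \<le> (1 - \<epsilon>)\<^sup>2 * ((1 - r) / 2 - \<epsilon>)"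
    using r \<epsilon> by (intro shrink_bound) auto
  also have "\<dots> \<le> \<P>(\<omega> in sbm n a b \<mu>. fst \<omega> v \<noteq> h (snd \<omega>) v)"
    by (rule ennreal_le_prob[OF estimator_bound[where h = h, OF v \<epsilon> approx h r]])
  finally show ?thesis unfolding prob_disagree[where h = h, OF h v] by (simp add: field_simps)
qed

lemma bp_prob_bounds:
  assumes v: "v < n" and \<epsilon>: "0 < \<epsilon>" "\<epsilon> < 1" and approx: "tree_approx n a b \<epsilon> k K M T"
    and h: "bp_estimator n (Suc T) (b / (a + b)) R h" and \<rho>: "\<rho> \<in> space R"
    and r: "excess (bp_law (distr N borel emag) ((a + b) / 2) ((a - b) / (a + b)) (distr N borel emag) T) 0 = ennreal r" "0 \<le> r" "r \<le> 1"
  shows "(1 + r) / 2 - 3 * \<epsilon> \<le> \<P>(\<omega> in sbm n a b \<mu>. fst \<omega> v = h \<rho> (snd \<omega>) v)"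
    and "\<P>(\<omega> in sbm n a b \<mu>. fst \<omega> v = h \<rho> (snd \<omega>) v) \<le> (1 + r) / 2 + 3 * \<epsilon>"
proof -
  note bounds = bp_estimator_bounds[OF v \<epsilon> approx h \<rho> r]
  have "(1 + r) / 2 - 3 * \<epsilon> \<le> (1 - \<epsilon>)\<^sup>2 * ((1 + r) / 2 - \<epsilon>)"
    using r \<epsilon> by (intro shrink_bound) auto
  also have "\<dots> \<le> \<P>(\<omega> in sbm n a b \<mu>. fst \<omega> v = h \<rho> (snd \<omega>) v)" by (rule ennreal_le_prob[OF bounds(1)])
  finally show "(1 + r) / 2 - 3 * \<epsilon> \<le> \<P>(\<omega> in sbm n a b \<mu>. fst \<omega> v = h \<rho> (snd \<omega>) v)" .
  have "(1 - r) / 2 - 3 * \<epsilon> \<le> (1 - \<epsilon>)\<^sup>2 * ((1 - r) / 2 - \<epsilon>)"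
    using r \<epsilon> by (intro shrink_bound) auto
  also have "\<dots> \<le> \<P>(\<omega> in sbm n a b \<mu>. fst \<omega> v \<noteq> h \<rho> (snd \<omega>) v)" by (rule ennreal_le_prob[OF bounds(2)])
  finally show "\<P>(\<omega> in sbm n a b \<mu>. fst \<omega> v = h \<rho> (snd \<omega>) v) \<le> (1 + r) / 2 + 3 * \<epsilon>"
    unfolding prob_disagree[where h = "h \<rho>", OF bp_section[OF h \<rho> v] v] by (simp add: field_simps)
qed

text \<open>The bounds hold for every value of the independent random element, so they survive
  averaging over it.\<close>

lemma randomised_prob_bounds:
  assumes h: "bp_estimator n t \<delta> R h" and v: "v < n"
    and sec: "\<And>\<rho>. \<rho> \<in> space R \<Longrightarrow> l \<le> \<P>(\<omega> in sbm n a b \<mu>. fst \<omega> v = h \<rho> (snd \<omega>) v)"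
      "\<And>\<rho>. \<rho> \<in> space R \<Longrightarrow> \<P>(\<omega> in sbm n a b \<mu>. fst \<omega> v = h \<rho> (snd \<omega>) v) \<le> u"
  shows "l \<le> \<P>(\<omega> in sbm n a b \<mu> \<Otimes>\<^sub>M R. fst (fst \<omega>) v = h (snd \<omega>) (snd (fst \<omega>)) v)"
    and "\<P>(\<omega> in sbm n a b \<mu> \<Otimes>\<^sub>M R. fst (fst \<omega>) v = h (snd \<omega>) (snd (fst \<omega>)) v) \<le> u"
proof -
  let ?A = "{\<omega> \<in> space (sbm n a b \<mu> \<Otimes>\<^sub>M R). fst (fst \<omega>) v = h (snd \<omega>) (snd (fst \<omega>)) v}"
  have R: "prob_space R" and hm: "(\<lambda>(r, obs). h r obs v) \<in> R \<Otimes>\<^sub>M observation_space n \<rightarrow>\<^sub>M count_space UNIV"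
    using h v by (auto simp: bp_estimator_def randomised_estimator_def)
  have A: "?A \<in> sets (sbm n a b \<mu> \<Otimes>\<^sub>M R)"
  proof -
    have [measurable_cong]: "sets (sbm n a b \<mu>) = sets (LM \<Otimes>\<^sub>M observation_space n)" by (rule sets_sbm)
    have "(\<lambda>\<omega>. (snd \<omega>, snd (fst \<omega>))) \<in> sbm n a b \<mu> \<Otimes>\<^sub>M R \<rightarrow>\<^sub>M R \<Otimes>\<^sub>M observation_space n" by measurable
    from measurable_compose[OF this hm]
    have 1: "Measurable.pred (sbm n a b \<mu> \<Otimes>\<^sub>M R) (\<lambda>\<omega>. h (snd \<omega>) (snd (fst \<omega>)) v)" by simp
    have "(\<lambda>x. x v) \<in> LM \<rightarrow>\<^sub>M count_space UNIV" by (simp add: measurable_def sets_labels space_label_measure)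
    moreover have "(\<lambda>\<omega>. fst (fst \<omega>)) \<in> sbm n a b \<mu> \<Otimes>\<^sub>M R \<rightarrow>\<^sub>M LM" by measurable
    ultimately have 2: "Measurable.pred (sbm n a b \<mu> \<Otimes>\<^sub>M R) (\<lambda>\<omega>. fst (fst \<omega>) v)"
      by (rule measurable_compose[rotated])
    have "Measurable.pred Z (\<lambda>\<omega>. A \<omega> = B \<omega>)" if [measurable]: "Measurable.pred Z A" "Measurable.pred Z B"
      for Z :: "((labelling \<times> observation) \<times> 'd) measure" and A B by measurable
    from this[OF 2 1] show ?thesis by (simp add: pred_def)
  qed
  have eq: "(\<lambda>x. (x, \<rho>)) -` ?A = {\<omega> \<in> space (sbm n a b \<mu>). fst \<omega> v = h \<rho> (snd \<omega>) v}" if "\<rho> \<in> space R" for \<rho>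
    using that by (auto simp: space_pair_measure)
  show "l \<le> measure (sbm n a b \<mu> \<Otimes>\<^sub>M R) ?A" "measure (sbm n a b \<mu> \<Otimes>\<^sub>M R) ?A \<le> u"
    by (rule pair_measure_section_bounds[OF prob_sbm R A, of l u]; simp only: eq sec)+
qed

lemma optimal_accuracy_le:
  assumes "\<And>h v. h \<in> estimators n \<Longrightarrow> v < n \<Longrightarrow> \<P>(\<omega> in sbm n a b \<mu>. fst \<omega> v = h (snd \<omega>) v) \<le> u"
  shows "optimal_accuracy n a b \<mu> \<le> u"
proof -
  have "(\<lambda>_ _. False) \<in> estimators n" by (simp add: estimators_def)
  then show ?thesis unfolding optimal_accuracy_def
    using assms n by (intro cSUP_least accuracy_bounds) auto
qed

lemma optimal_accuracy_ge:
  assumes h: "h \<in> estimators n" and "\<And>v. v < n \<Longrightarrow> l \<le> \<P>(\<omega> in sbm n a b \<mu>. fst \<omega> v = h (snd \<omega>) v)"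
  shows "l \<le> optimal_accuracy n a b \<mu>"
proof -
  interpret S: prob_space "sbm n a b \<mu>" by (rule prob_sbm)
  have "l \<le> accuracy n (sbm n a b \<mu>) fst (\<lambda>\<omega>. h (snd \<omega>))" using assms n by (intro accuracy_bounds) auto
  also have "\<dots> \<le> optimal_accuracy n a b \<mu>" unfolding optimal_accuracy_def
    using n by (intro cSUP_upper h bdd_aboveI2[where M = 1] accuracy_bounds) auto
  finally show ?thesis .
qed

end

lemma eventually_sbm_model:
  assumes "symmetric_distribution \<mu>" "0 \<le> a" "0 \<le> b" "0 < a + b"
  shows "eventually (\<lambda>n. sbm_model n a b \<mu>) sequentially"
  using eventually_ge_at_top[of "nat \<lceil>max a b\<rceil>"]
proof eventually_elim
  case (elim n)
  then have "max a b \<le> n" by linarith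
  then show ?case using assms by unfold_locales auto
qed

lemma eventually_bp_accuracy:
  assumes sym: "symmetric_distribution \<mu>" and ab: "0 \<le> a" "0 \<le> b" "0 < a + b"
    and h: "\<And>n. bp_estimator n (Suc T) (b / (a + b)) (R n) (h n)"
    and r: "excess (bp_law (distr (base_law \<mu>) borel emag) ((a + b) / 2) ((a - b) / (a + b)) (distr (base_law \<mu>) borel emag) T) 0 = ennreal r" "0 \<le> r" "r \<le> 1"
    and \<epsilon>: "0 < \<epsilon>" "\<epsilon> < 1"
  shows "eventually (\<lambda>n. \<bar>randomised_accuracy n a b \<mu> (R n) (h n) - (1 + r) / 2\<bar> \<le> 3 * \<epsilon> \<and>
    (1 + r) / 2 - 3 * \<epsilon> \<le> optimal_accuracy n a b \<mu>) sequentially"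
  using eventually_sbm_model[OF sym ab] eventually_tree_approx[OF ab \<epsilon>(1), of T]
proof eventually_elim
  case (elim n)
  then obtain k K M where approx: "tree_approx n a b \<epsilon> k K M T" by blast
  interpret sbm_model n a b \<mu> by fact
  note bounds = bp_prob_bounds[OF _ \<epsilon> approx h _ r]
  interpret R: prob_space "R n" using h[of n] by (simp add: bp_estimator_def randomised_estimator_def)
  \<comment> \<open>Freezing the random element at any value gives a deterministic estimator, which
    bounds the optimal accuracy from below by the same number.\<close>
  obtain \<rho> where \<rho>: "\<rho> \<in> space (R n)" using R.not_empty by blast
  have "h n \<rho> \<in> estimators n" using bp_section[OF h \<rho>] by (simp add: estimators_def)
  then have opt: "(1 + r) / 2 - 3 * \<epsilon> \<le> optimal_accuracy n a b \<mu>"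
    using bounds(1)[OF _ \<rho>] by (rule optimal_accuracy_ge)
  note rbounds = randomised_prob_bounds[OF h _ bounds]
  have "(1 + r) / 2 - 3 * \<epsilon> \<le> randomised_accuracy n a b \<mu> (R n) (h n)"
    unfolding randomised_accuracy_def by (intro accuracy_bounds n rbounds)
  moreover have "randomised_accuracy n a b \<mu> (R n) (h n) \<le> (1 + r) / 2 + 3 * \<epsilon>"
    unfolding randomised_accuracy_def by (intro accuracy_bounds n rbounds)
  ultimately show ?case using opt by (simp add: abs_le_iff)
qed

lemma eventually_optimal_accuracy:
  assumes sym: "symmetric_distribution \<mu>" and ab: "0 \<le> a" "0 \<le> b" "0 < a + b"
    and r: "excess (bp_law (distr (base_law \<mu>) borel emag) ((a + b) / 2) ((a - b) / (a + b)) perfect_law T) 0 = ennreal r" "0 \<le> r" "r \<le> 1"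
    and \<epsilon>: "0 < \<epsilon>" "\<epsilon> < 1"
  shows "eventually (\<lambda>n. optimal_accuracy n a b \<mu> \<le> (1 + r) / 2 + 3 * \<epsilon>) sequentially"
  using eventually_sbm_model[OF sym ab] eventually_tree_approx[OF ab \<epsilon>(1), of T]
proof eventually_elim
  case (elim n)
  then obtain k K M where approx: "tree_approx n a b \<epsilon> k K M T" by blast
  interpret sbm_model n a b \<mu> by fact
  show ?case
  proof (rule optimal_accuracy_le)
    fix h v assume h: "h \<in> estimators n" and v: "v < n"
    show "\<P>(\<omega> in sbm n a b \<mu>. fst \<omega> v = h (snd \<omega>) v) \<le> (1 + r) / 2 + 3 * \<epsilon>"
      by (rule estimator_prob_le[where h = h, OF v \<epsilon> approx _ r]) (use h v in \<open>simp add: estimators_def\<close>)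
  qed
qed

theorem theorem39:
  fixes a b :: real and \<mu> :: "ereal measure"
    and R :: "nat \<Rightarrow> nat \<Rightarrow> 'r measure"
    and Xhat :: "nat \<Rightarrow> nat \<Rightarrow> 'r \<Rightarrow> observation \<Rightarrow> labelling"
  assumes "a \<ge> 0" and "b \<ge> 0" and "\<not> (a = 0 \<and> b = 0)"
    and "symmetric_distribution \<mu>" and "\<mu> \<noteq> return borel 0"
    and "\<And>t n. t \<ge> 1 \<Longrightarrow> bp_estimator n t (b / (a + b)) (R t n) (Xhat t n)"
  shows "\<exists>q L. (\<forall>t\<ge>1. (\<lambda>n. randomised_accuracy n a b \<mu> (R t n) (Xhat t n)) \<longlonglongrightarrow> q t) \<and>
           q \<longlonglongrightarrow> L \<and> (\<lambda>n. optimal_accuracy n a b \<mu>) \<longlonglongrightarrow> L"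
proof -
  have ab: "0 \<le> a" "0 \<le> b" "0 < a + b" using assms(1-3) by auto
  note sym = assms(4)
  interpret B: bp_recursion_laws "distr (base_law \<mu>) borel emag" "(a + b) / 2" "(a - b) / (a + b)"
    using ab mlaw_base[OF sym] base_law_nontrivial[OF sym assms(5)]
    by unfold_locales (auto simp: abs_le_iff field_simps)
  obtain L where p: "B.p \<longlonglongrightarrow> L" and q: "B.q \<longlonglongrightarrow> L" using B.boundary_irrelevance by blast
  \<comment> \<open>The success probabilities of the best guess at the root of a Poisson tree with
    hidden and with revealed boundary. They squeeze the optimal accuracy.\<close>
  define x where "x k = (1 + B.p k) / 2" for k
  define y where "y k = (1 + B.q k) / 2" for k
  have x: "x \<longlonglongrightarrow> (1 + L) / 2" unfolding x_def by (intro tendsto_intros p) simp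
  have y: "y \<longlonglongrightarrow> (1 + L) / 2" unfolding y_def by (intro tendsto_intros q) simp
  have bp: "eventually (\<lambda>n. \<bar>randomised_accuracy n a b \<mu> (R (Suc T) n) (Xhat (Suc T) n) - x T\<bar> \<le> 3 * \<epsilon> \<and>
      x T - 3 * \<epsilon> \<le> optimal_accuracy n a b \<mu>) sequentially" if "0 < \<epsilon>" "\<epsilon> < 1" for T \<epsilon>
    unfolding x_def using B.pq_bounds that assms(6)
    by (intro eventually_bp_accuracy[OF sym ab _ B.excess_P]) auto
  have opt: "eventually (\<lambda>n. optimal_accuracy n a b \<mu> \<le> y T + 3 * \<epsilon>) sequentially" if "0 < \<epsilon>" "\<epsilon> < 1" for T \<epsilon>
    unfolding y_def using B.pq_bounds that
    by (intro eventually_optimal_accuracy[OF sym ab B.excess_Q]) auto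
  \<comment> \<open>Radius \<open>t\<close> means distance less than \<open>t\<close>, hence trees
    of depth \<open>t - 1\<close>.\<close>
  have "(\<lambda>n. randomised_accuracy n a b \<mu> (R t n) (Xhat t n)) \<longlonglongrightarrow> x (t - 1)" if t: "1 \<le> t" for t
  proof (rule tendstoI)
    fix e :: real assume e: "0 < e"
    define \<epsilon> where "\<epsilon> = min (e / 4) (1 / 2)"
    have \<epsilon>: "0 < \<epsilon>" "\<epsilon> < 1" "3 * \<epsilon> < e" using e by (auto simp: \<epsilon>_def)
    have T: "Suc (t - 1) = t" using t by simp
    show "eventually (\<lambda>n. dist (randomised_accuracy n a b \<mu> (R t n) (Xhat t n)) (x (t - 1)) < e) sequentially"
      using bp[OF \<epsilon>(1,2), of "t - 1"] unfolding T
      by eventually_elim (use \<epsilon>(3) in \<open>auto simp: dist_real_def\<close>)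
  qed
  moreover have "(\<lambda>t. x (t - 1)) \<longlonglongrightarrow> (1 + L) / 2" by (rule LIMSEQ_imp_Suc) (simp add: x)
  moreover have "(\<lambda>n. optimal_accuracy n a b \<mu>) \<longlonglongrightarrow> (1 + L) / 2"
  proof (rule tendstoI)
    fix e :: real assume e: "0 < e"
    \<comment> \<open>Half of the error is spent on the choice of the depth \<open>T\<close>, the
      other half on the loss \<open>3 * \<epsilon>\<close> as \<open>n\<close> grows at this fixed
      depth.\<close>
    define \<epsilon> where "\<epsilon> = min (e / 8) (1 / 2)"
    have \<epsilon>: "0 < \<epsilon>" "\<epsilon> < 1" "3 * \<epsilon> < e / 2" using e by (auto simp: \<epsilon>_def)
    have "eventually (\<lambda>T. dist (x T) ((1 + L) / 2) < e / 2 \<and> dist (y T) ((1 + L) / 2) < e / 2) sequentially"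
      using e by (intro eventually_conj tendstoD[OF x] tendstoD[OF y]) auto
    then obtain T where T: "dist (x T) ((1 + L) / 2) < e / 2" "dist (y T) ((1 + L) / 2) < e / 2"
      by (auto dest: eventually_happens)
    show "eventually (\<lambda>n. dist (optimal_accuracy n a b \<mu>) ((1 + L) / 2) < e) sequentially"
      using bp[OF \<epsilon>(1,2), of T] opt[OF \<epsilon>(1,2), of T]
    proof eventually_elim
      case (elim n)
      then show ?case using T \<epsilon>(3) unfolding dist_real_def abs_less_iff by linarith
    qed
  qed
  ultimately show ?thesis by (intro exI[of _ "\<lambda>t. x (t - 1)"] exI[of _ "(1 + L) / 2"]) blast
qed

end
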